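(* Let $(X,0)\subset(\mathbb{C}^N,0)$ be an ICMC2 singularity (isolated Cohen–Macaulay codimension $2$ singularity), i.e. of type $(t,t+1,t)$, with generic linear entries; that is, $(X,0)$ is defined by the $t$-minors of a $t\times(t+1)$ matrix $M$ whose entries are generic linear forms in $x_1,\dots,x_N$. Let $Y\subset\mathbb{C}^N\times\mathbb{P}^{t-1}$ be its Tjurina transform. 1. $Y$ is smooth if and only if $N\ge 2t$. 2. If $t+1\le N<2t$, then the singular locus of $Y$ is a determinantal variety of type $(t+1,N,t+1)$ of dimension $2t-N-1$ in $\mathbb{P}^{t-1}$ (identified with $\{0\}\times\mathbb{P}^{t-1}$).
   Context: "Generic" means: for all choices of coefficients of the linear forms in some non-empty Zariski open subset of the space of $t\times(t+1)$ matrices of linear forms in $N$ variables. A germ of type $(t,t+1,t)$ is one defined by the maximal minors of a $t\times(t+1)$ matrix and of codimension $2$; it is then Cohen–Macaulay of codimension $2$; ICMC2 means in addition that it has an isolated singularity at the origin. The Tjurina transform is $Y=\{(x,(s_1:\dots:s_t)) : (s_1,\dots,s_t)\cdot M(x)=0\}\subset\mathbb{C}^N\times\mathbb{P}^{t-1}$, with scheme structure given by these $t+1$ equations. A subset of a projective space is called a determinantal variety of type $(m,n,q)$ if it is the zero locus of the $q$-minors of an $m\times n$ matrix of homogeneous polynomials of the same degree and has codimension $(m-q+1)(n-q+1)$.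
   Formalization: Item 1 is stated except for N = 2 with t ≥ 2: there X is a fat point and, for generic entries, Y is the reduced {0} × P^{t-1}, which is smooth although N < 2t, so the equivalence fails as written. *)

theory Defs
  imports
    Complex_Main
    "HOL-Library.Poly_Mapping"
    "Jordan_Normal_Form.VS_Connect"
    "Jordan_Normal_Form.DL_Submatrix"
begin

section \<open>Polynomials over the complex numbers\<close>

text \<open>A polynomial is a finitely supported map from exponents to coefficients. Points of affine
  \<open>n\<close>-space are the elements of \<^term>\<open>carrier_vec n\<close>; the variable with index \<open>k\<close> is the
  coordinate function \<open>x \<mapsto> x $ k\<close>.\<close>

type_synonym cpoly = "(nat \<Rightarrow>\<^sub>0 nat) \<Rightarrow>\<^sub>0 complex"

definition Cst :: "complex \<Rightarrow> cpoly" where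
  "Cst c = Poly_Mapping.single 0 c"

definition Var :: "nat \<Rightarrow> cpoly" where
  "Var k = Poly_Mapping.single (Poly_Mapping.single k 1) 1"

definition in_vars :: "nat \<Rightarrow> cpoly \<Rightarrow> bool" where
  "in_vars n f \<longleftrightarrow> (\<forall>m\<in>Poly_Mapping.keys f. Poly_Mapping.keys m \<subseteq> {..<n})"

definition homogeneous :: "nat \<Rightarrow> nat \<Rightarrow> cpoly \<Rightarrow> bool" where
  "homogeneous n d f \<longleftrightarrow> in_vars n f \<and>
     (\<forall>m\<in>Poly_Mapping.keys f. (\<Sum>i\<in>Poly_Mapping.keys m. Poly_Mapping.lookup m i) = d)"

definition peval :: "cpoly \<Rightarrow> complex vec \<Rightarrow> complex" where
  "peval f x = (\<Sum>m\<in>Poly_Mapping.keys f. Poly_Mapping.lookup f m *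
     (\<Prod>i\<in>Poly_Mapping.keys m. (x $ i) ^ Poly_Mapping.lookup m i))"

definition pderivative :: "nat \<Rightarrow> cpoly \<Rightarrow> cpoly" where
  "pderivative k f = (\<Sum>m\<in>Poly_Mapping.keys f.
     Poly_Mapping.single (m - Poly_Mapping.single k 1)
       (of_nat (Poly_Mapping.lookup m k) * Poly_Mapping.lookup f m))"

definition minors :: "nat \<Rightarrow> cpoly mat \<Rightarrow> cpoly set" where
  "minors q F = {det (submatrix F I J) |I J.
     I \<subseteq> {..<dim_row F} \<and> J \<subseteq> {..<dim_col F} \<and> card I = q \<and> card J = q}"


section \<open>Zariski topology and dimension\<close>

definition zero_locus :: "nat \<Rightarrow> cpoly set \<Rightarrow> complex vec set" where
  "zero_locus n S = {x \<in> carrier_vec n. \<forall>f\<in>S. peval f x = 0}"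

definition affine_closed :: "nat \<Rightarrow> complex vec set set" where
  "affine_closed n = {zero_locus n S |S. \<forall>f\<in>S. in_vars n f}"

definition zariski_open :: "nat \<Rightarrow> complex vec set \<Rightarrow> bool" where
  "zariski_open n U \<longleftrightarrow> (\<exists>Z\<in>affine_closed n. U = carrier_vec n - Z)"

text \<open>A point of the projective space with \<open>n\<close> homogeneous coordinates (of dimension \<open>n - 1\<close>) is
  the set of all its homogeneous coordinate vectors.\<close>

definition proj_space :: "nat \<Rightarrow> complex vec set set" where
  "proj_space n = {{c \<cdot>\<^sub>v s |c. c \<noteq> 0} |s. s \<in> carrier_vec n \<and> s \<noteq> 0\<^sub>v n}"

definition proj_zero_locus :: "nat \<Rightarrow> cpoly set \<Rightarrow> complex vec set set" where
  "proj_zero_locus n S = {p \<in> proj_space n. \<forall>f\<in>S. \<forall>s\<in>p. peval f s = 0}"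

definition proj_closed :: "nat \<Rightarrow> complex vec set set set" where
  "proj_closed n = {proj_zero_locus n S |S. \<forall>f\<in>S. \<exists>d. homogeneous n d f}"

text \<open>In the following, \<open>\<C>\<close> is the family of closed sets of a topology.\<close>

definition irreducible_closed :: "'a set set \<Rightarrow> 'a set \<Rightarrow> bool" where
  "irreducible_closed \<C> Z \<longleftrightarrow> Z \<in> \<C> \<and> Z \<noteq> {} \<and>
     (\<forall>A\<in>\<C>. \<forall>B\<in>\<C>. Z \<subseteq> A \<union> B \<longrightarrow> Z \<subseteq> A \<or> Z \<subseteq> B)"

definition irreducible_chain :: "'a set set \<Rightarrow> nat \<Rightarrow> (nat \<Rightarrow> 'a set) \<Rightarrow> bool" where
  "irreducible_chain \<C> d Z \<longleftrightarrow>
     (\<forall>i\<le>d. irreducible_closed \<C> (Z i)) \<and> (\<forall>i<d. Z i \<subset> Z (Suc i))"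

text \<open>Krull dimension of a closed set \<open>V\<close>. It is a relation, so that the empty set has no
  dimension.\<close>

definition has_dim :: "'a set set \<Rightarrow> 'a set \<Rightarrow> nat \<Rightarrow> bool" where
  "has_dim \<C> V d \<longleftrightarrow>
     (\<exists>Z. irreducible_chain \<C> d Z \<and> Z d \<subseteq> V) \<and>
     \<not> (\<exists>Z. irreducible_chain \<C> (Suc d) Z \<and> Z (Suc d) \<subseteq> V)"

text \<open>Local dimension of \<open>V\<close> at the point \<open>p\<close>, i.e. the Krull dimension of the local ring at \<open>p\<close>: the
  prime ideals of that ring are the irreducible closed subsets of \<open>V\<close> through \<open>p\<close>.\<close>

definition has_local_dim :: "'a set set \<Rightarrow> 'a set \<Rightarrow> 'a \<Rightarrow> nat \<Rightarrow> bool" where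
  "has_local_dim \<C> V p d \<longleftrightarrow>
     (\<exists>Z. irreducible_chain \<C> d Z \<and> p \<in> Z 0 \<and> Z d \<subseteq> V) \<and>
     \<not> (\<exists>Z. irreducible_chain \<C> (Suc d) Z \<and> p \<in> Z 0 \<and> Z (Suc d) \<subseteq> V)"


section \<open>Smooth points of affine schemes\<close>

text \<open>A set \<open>S\<close> of polynomials in \<open>n\<close> variables stands for the (possibly non-reduced) affine scheme
  given by the ideal generated by \<open>S\<close>. A closed point is smooth iff the local ring
  there is regular, i.e. iff the Zariski tangent space has the dimension of the scheme at that
  point.\<close>

definition tangent_space :: "nat \<Rightarrow> cpoly set \<Rightarrow> complex vec \<Rightarrow> complex vec set" where
  "tangent_space n S p =
     {v \<in> carrier_vec n. \<forall>f\<in>S. (\<Sum>k<n. peval (pderivative k f) p * v $ k) = 0}"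

definition tangent_dim :: "nat \<Rightarrow> cpoly set \<Rightarrow> complex vec \<Rightarrow> nat" where
  "tangent_dim n S p = vectorspace.dim (class_ring :: complex ring)
     (module_vec TYPE(complex) n \<lparr>carrier := tangent_space n S p\<rparr>)"

definition smooth_at :: "nat \<Rightarrow> cpoly set \<Rightarrow> complex vec \<Rightarrow> bool" where
  "smooth_at n S p \<longleftrightarrow> p \<in> zero_locus n S \<and>
     has_local_dim (affine_closed n) (zero_locus n S) p (tangent_dim n S p)"


section \<open>Matrices of linear forms and determinantal singularities\<close>

text \<open>A \<open>t \<times> (t + 1)\<close> matrix of linear forms in \<open>N\<close> variables is given by the vector \<open>a\<close> of its
  \<open>t (t + 1) N\<close> coefficients.\<close>

definition linear_matrix :: "nat \<Rightarrow> nat \<Rightarrow> complex vec \<Rightarrow> cpoly mat" where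
  "linear_matrix t N a =
     mat t (t + 1) (\<lambda>(i, j). \<Sum>k<N. Cst (a $ ((i * (t + 1) + j) * N + k)) * Var k)"

text \<open>The germ at the origin of the scheme \<open>X\<close> in \<open>N\<close>-space defined by the \<open>t\<close>-minors of the
  \<open>t \<times> (t + 1)\<close> matrix \<open>M\<close> has codimension \<open>2\<close> and is smooth outside the origin
  in a (classical) neighbourhood of the origin.\<close>

definition ICMC2 :: "nat \<Rightarrow> nat \<Rightarrow> cpoly mat \<Rightarrow> bool" where
  "ICMC2 N t M \<longleftrightarrow> M \<in> carrier_mat t (t + 1) \<and>
     (\<exists>d. has_local_dim (affine_closed N) (zero_locus N (minors t M)) (0\<^sub>v N) d \<and> d + 2 = N) \<and>
     (\<exists>\<epsilon>>0. \<forall>x\<in>zero_locus N (minors t M).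
        x \<noteq> 0\<^sub>v N \<and> (\<forall>k<N. cmod (x $ k) < \<epsilon>) \<longrightarrow> smooth_at N (minors t M) x)"

text \<open>A determinantal variety of type \<open>(m, k, q)\<close> in the projective space with \<open>n\<close> homogeneous
  coordinates; the codimension is taken in dimension \<open>n - 1\<close>.\<close>

definition determinantal_variety ::
  "nat \<Rightarrow> nat \<Rightarrow> nat \<Rightarrow> nat \<Rightarrow> complex vec set set \<Rightarrow> bool" where
  "determinantal_variety n m k q V \<longleftrightarrow>
     (\<exists>F \<in> carrier_mat m k.
        (\<exists>\<delta>. \<forall>i<m. \<forall>j<k. homogeneous n \<delta> (F $$ (i, j))) \<and>
        V = proj_zero_locus n (minors q F)) \<and>
     (\<exists>e. has_dim (proj_closed n) V e \<and> e + (m - q + 1) * (k - q + 1) + 1 = n)"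


section \<open>The Tjurina transform\<close>

text \<open>The coordinates \<open>x\<^sub>1, \<dots>, x\<^sub>N\<close> have the indices \<open>0, \<dots>, N - 1\<close> and the homogeneous coordinates
  \<open>s\<^sub>1, \<dots>, s\<^sub>t\<close> the indices \<open>N, \<dots>, N + t - 1\<close>. The matrix \<open>M\<close> involves only the former.\<close>

definition tjurina_equations :: "nat \<Rightarrow> nat \<Rightarrow> cpoly mat \<Rightarrow> cpoly set" where
  "tjurina_equations N t M = {\<Sum>i<t. Var (N + i) * M $$ (i, j) |j. j < t + 1}"

definition tjurina_transform ::
  "nat \<Rightarrow> nat \<Rightarrow> cpoly mat \<Rightarrow> (complex vec \<times> complex vec set) set" where
  "tjurina_transform N t M = {(x, p). x \<in> carrier_vec N \<and> p \<in> proj_space t \<and>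
     (\<forall>f\<in>tjurina_equations N t M. \<forall>s\<in>p. peval f (x @\<^sub>v s) = 0)}"

text \<open>The affine chart \<open>s\<^sub>i \<noteq> 0\<close> of the transform, as the closed subscheme of affine
  \<open>(N + t)\<close>-space on which \<open>s\<^sub>i = 1\<close>.\<close>

definition tjurina_chart :: "nat \<Rightarrow> nat \<Rightarrow> cpoly mat \<Rightarrow> nat \<Rightarrow> cpoly set" where
  "tjurina_chart N t M i = insert (Var (N + i) - 1) (tjurina_equations N t M)"

definition tjurina_smooth_at ::
  "nat \<Rightarrow> nat \<Rightarrow> cpoly mat \<Rightarrow> complex vec \<times> complex vec set \<Rightarrow> bool" where
  "tjurina_smooth_at N t M y \<longleftrightarrow> (case y of (x, p) \<Rightarrow>
     \<forall>i<t. \<forall>s\<in>p. s $ i = 1 \<longrightarrow> smooth_at (N + t) (tjurina_chart N t M i) (x @\<^sub>v s))"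

definition tjurina_smooth :: "nat \<Rightarrow> nat \<Rightarrow> cpoly mat \<Rightarrow> bool" where
  "tjurina_smooth N t M \<longleftrightarrow> (\<forall>y\<in>tjurina_transform N t M. tjurina_smooth_at N t M y)"

definition tjurina_singular_locus ::
  "nat \<Rightarrow> nat \<Rightarrow> cpoly mat \<Rightarrow> (complex vec \<times> complex vec set) set" where
  "tjurina_singular_locus N t M =
     {y \<in> tjurina_transform N t M. \<not> tjurina_smooth_at N t M y}"

end

theory Submission
  imports Defs "HOL-Analysis.Continuum_Not_Denumerable"
    "HOL-Computational_Algebra.Fundamental_Theorem_Algebra" "Jordan_Normal_Form.DL_Rank"
begin

text \<open>Write the equations \<open>s M(x) = 0\<close> of the transform as a linear system \<open>B(s) x = 0\<close>, where
  \<open>B(s)\<close> is a \<open>(t + 1) \<times> N\<close> matrix of linear forms in \<open>s\<close>. At \<open>(x, s)\<close> the Jacobian of these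
  equations drops rank iff some \<open>y \<noteq> 0\<close> satisfies \<open>y B(s) = 0\<close> and \<open>M(x) y = 0\<close>. For \<open>x \<noteq> 0\<close> such a
  \<open>y\<close> makes the differentials of the maximal minors of \<open>M\<close> proportional at \<open>x\<close>, which an isolated
  singularity of codimension 2 excludes. So the singular points are the points \<open>(0, s)\<close> where
  \<open>B(s)\<close> has rank at most \<open>t\<close>.

  All dimensions reduce to two bilinear systems, \<open>s M(x) = 0\<close> and \<open>y B(s) = 0\<close>. Too
  few bilinear forms always have a nontrivial common zero, since otherwise the diagonal part of the
  bigraded polynomial ring would grow too slowly. Conversely, polynomial multiplication gives special systems without
  nontrivial zeros; by the Nullstellensatz these generate all forms of some bidegree, a condition that
  is open in the coefficients and bounds the growth of the coordinate rings for generic coefficients,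
  hence also the length of chains of irreducible closed sets. Chains are constructed by Krull's
  argument, from the growth of the polynomial ring modulo \<open>I\<close> and powers of a maximal ideal.\<close>


text \<open>The coefficients of M form one tensor with indices i (rows), j (columns) and k
  (variables). Contracting it with s and x gives t + 1 bilinear forms, \<open>qY\<close>;
  contracting it with s and y gives N of them, \<open>qV\<close>. On the products of projective
  spaces the expected dimensions of their zero sets are (N - 1) + (t - 1) - (t + 1) = N - 3 and (t -
  1) + t - N = 2t - N - 1. The second number is negative exactly for N \<ge> 2t: then B(s) has no
  left kernel for any s \<noteq> 0, which is where the threshold comes from. Dimension is defined by
  chains of irreducible sets, and a generic statement needs one nonzero polynomial in the
  coefficients. So nothing is argued by general position: an explicit tensor with the expected
  behaviour and one determinant provide the open set, and only a growth exponent is carried along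
  the family. The diagonal bidegrees (d, d) suffice because multiplication by powers of a coordinate
  that is nonzero at a given point moves every bihomogeneous form to the diagonal.\<close>

abbreviation lookup where "lookup \<equiv> Poly_Mapping.lookup"
abbreviation keys where "keys \<equiv> Poly_Mapping.keys"
abbreviation single where "single \<equiv> Poly_Mapping.single"

section \<open>Evaluation of polynomials\<close>

definition mdeg :: "(nat \<Rightarrow>\<^sub>0 nat) \<Rightarrow> nat" where
  "mdeg m = (\<Sum>i\<in>keys m. lookup m i)"

lemma mdeg_superset:
  assumes "finite A" "keys m \<subseteq> A"
  shows "mdeg m = sum (lookup m) A"
  unfolding mdeg_def by (rule sum.mono_neutral_left[OF assms]) (auto simp: in_keys_iff)

lemma keys_nat_add: "keys (m + m') = keys m \<union> keys (m' :: nat \<Rightarrow>\<^sub>0 nat)"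
  by (auto simp: in_keys_iff lookup_add)

lemma mdeg_add: "mdeg (m + m') = mdeg m + mdeg m'"
proof -
  have "finite (keys m \<union> keys m')" by simp
  then show ?thesis
    by (simp add: mdeg_superset[of "keys m \<union> keys m'"] keys_nat_add lookup_add sum.distrib)
qed

lemma mdeg_zero [simp]: "mdeg 0 = 0"
  by (simp add: mdeg_def)

lemma mdeg_single [simp]: "mdeg (single i k) = k"
  by (simp add: mdeg_def)

lemma mdeg_eq_0: "mdeg m = 0 \<Longrightarrow> m = 0"
proof -
  assume "mdeg m = 0"
  then have "\<forall>i\<in>keys m. lookup m i = 0" by (simp add: mdeg_def)
  then have "lookup m i = 0" for i by (cases "i \<in> keys m") (auto simp: in_keys_iff)
  then show "m = 0" by (intro poly_mapping_eqI) simp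
qed

lemma exponent_split:
  assumes "0 < lookup m i"
  shows "m = single i 1 + (m - single i (1::nat))"
  using assms by (intro poly_mapping_eqI) (auto simp: lookup_add lookup_minus lookup_single when_def)

lemma sum_singles: "f = (\<Sum>m\<in>keys f. single m (lookup f m))"
proof (rule poly_mapping_eqI)
  fix k
  have "lookup (\<Sum>m\<in>keys f. single m (lookup f m)) k = (\<Sum>m\<in>keys f. if m = k then lookup f k else 0)"
    by (auto simp: lookup_sum lookup_single when_def intro!: sum.cong)
  also have "\<dots> = lookup f k"
    by (auto simp: in_keys_iff)
  finally show "lookup f k = lookup (\<Sum>m\<in>keys f. single m (lookup f m)) k" by simp
qed

text \<open>Maps out of the polynomial ring are compared on constants and variables only; identities
  for translation, for restriction to lines and for reduction modulo a maximal ideal all go through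
  this rule.\<close>

lemma cpoly_induct [case_names Cst Var add mult]:
  assumes C: "\<And>c. P (Cst c)" and V: "\<And>k. P (Var k)"
    and A: "\<And>f g. P f \<Longrightarrow> P g \<Longrightarrow> P (f + g)"
    and M: "\<And>f g. P f \<Longrightarrow> P g \<Longrightarrow> P (f * g)"
  shows "P f"
proof -
  have S: "P (single m c)" for m :: "nat \<Rightarrow>\<^sub>0 nat" and c
  proof (induction "mdeg m" arbitrary: m)
    case 0
    then show ?case using C mdeg_eq_0[of m] by (simp add: Cst_def)
  next
    case (Suc n)
    then obtain i where i: "0 < lookup m i"
      by (metis mdeg_def sum.neutral neq0_conv nat.distinct(1))
    define m' where "m' = m - single i 1"
    have m: "m = single i 1 + m'"
      using exponent_split[OF i] by (simp add: m'_def)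
    have "mdeg m' = n" using Suc.hyps(2) by (simp add: m mdeg_add)
    then have "P (single m' c)" using Suc by simp
    then have "P (Var i * single m' c)" using M V by blast
    moreover have "single m c = Var i * single m' c"
      by (simp add: m Var_def mult_single)
    ultimately show ?case by simp
  qed
  have "P (\<Sum>m\<in>A. single m (lookup f m))" if "finite A" for A
    using that
  proof (induction A)
    case empty
    then show ?case using C[of 0] by (simp add: Cst_def)
  next
    case (insert a A)
    then show ?case using A S by simp
  qed
  then show ?thesis using sum_singles[of f] by (metis finite_keys)
qed

definition monev :: "(nat \<Rightarrow> 'a) \<Rightarrow> (nat \<Rightarrow>\<^sub>0 nat) \<Rightarrow> 'a :: comm_ring_1" where
  "monev x m = (\<Prod>i\<in>keys m. x i ^ lookup m i)"

text \<open>A coefficient map \<open>h\<close> into an arbitrary ring is allowed so that evaluation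
  at a point, translation of the origin (\<open>shift\<close>) and restriction to a line
  (\<open>along\<close>) are instances of one homomorphism.\<close>

definition evg :: "(complex \<Rightarrow> 'a) \<Rightarrow> (nat \<Rightarrow> 'a) \<Rightarrow> cpoly \<Rightarrow> 'a :: comm_ring_1" where
  "evg h x f = (\<Sum>m\<in>keys f. h (lookup f m) * monev x m)"

text \<open>Points have coordinates for all indices, because ideals live in the ring with infinitely
  many variables; the variables beyond n are put into the ideals where n matters.\<close>

abbreviation ev :: "(nat \<Rightarrow> complex) \<Rightarrow> cpoly \<Rightarrow> complex" where
  "ev \<equiv> evg (\<lambda>c. c)"

lemma peval_ev: "peval f v = ev (($) v) f"
  by (simp add: peval_def evg_def monev_def)

lemma monev_superset:
  assumes "finite A" "keys m \<subseteq> A"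
  shows "monev x m = (\<Prod>i\<in>A. x i ^ lookup m i)"
  unfolding monev_def by (rule prod.mono_neutral_left[OF assms]) (auto simp: in_keys_iff)

lemma monev_add: "monev x (m + m') = monev x m * monev x m'"
proof -
  have "finite (keys m \<union> keys m')" by simp
  then show ?thesis
    by (simp add: monev_superset[of "keys m \<union> keys m'"] keys_nat_add lookup_add prod.distrib power_add)
qed

lemma monev_0 [simp]: "monev x 0 = 1"
  by (simp add: monev_def)

context
  fixes h :: "complex \<Rightarrow> 'a :: comm_ring_1"
  assumes h: "comm_ring_hom h"
begin

interpretation h: comm_ring_hom h by (rule h)

lemma evg_superset:
  assumes "finite A" "keys f \<subseteq> A"
  shows "evg h x f = (\<Sum>m\<in>A. h (lookup f m) * monev x m)"
  unfolding evg_def by (rule sum.mono_neutral_left[OF assms]) (auto simp: in_keys_iff)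

lemma evg_add: "evg h x (f + g) = evg h x f + evg h x g"
proof -
  have "finite (keys f \<union> keys g)" by simp
  moreover have "keys (f + g) \<subseteq> keys f \<union> keys g" by (rule keys_add)
  ultimately show ?thesis
    by (simp add: evg_superset[of "keys f \<union> keys g"] lookup_add h.hom_add ring_distribs sum.distrib)
qed

lemma evg_0: "evg h x 0 = 0"
  by (simp add: evg_def)

lemma evg_sum: "evg h x (sum g A) = (\<Sum>a\<in>A. evg h x (g a))"
  by (induction A rule: infinite_finite_induct) (auto simp: evg_add evg_0)

lemma evg_single: "evg h x (single m c) = h c * monev x m"
  by (cases "c = 0") (auto simp: evg_def)

lemma evg_mult: "evg h x (f * g) = evg h x f * evg h x g"
proof -
  have "f * g = (\<Sum>m\<in>keys f. \<Sum>m'\<in>keys g. single (m + m') (lookup f m * lookup g m'))"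
    by (subst sum_singles[of f], subst sum_singles[of g]) (simp add: sum_product mult_single)
  then have "evg h x (f * g)
      = (\<Sum>m\<in>keys f. \<Sum>m'\<in>keys g. (h (lookup f m) * monev x m) * (h (lookup g m') * monev x m'))"
    by (simp add: evg_sum evg_single h.hom_mult monev_add algebra_simps)
  then show ?thesis by (simp add: evg_def sum_product)
qed

lemma evg_hom: "comm_ring_hom (evg h x)"
proof
  show "evg h x 1 = 1" using evg_single[of x 0 1] by simp
qed (simp_all add: evg_add evg_mult evg_0)

lemma evg_Cst: "evg h x (Cst c) = h c"
  by (simp add: Cst_def evg_single)

lemma evg_Var: "evg h x (Var k) = x k"
  by (simp add: Var_def evg_single monev_def)

end

lemma id_comm_ring_hom: "comm_ring_hom (\<lambda>c::complex. c)"
  by unfold_locales auto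

interpretation ev: comm_ring_hom "ev x" for x
  by (rule evg_hom[OF id_comm_ring_hom])

lemma ev_Cst [simp]: "ev x (Cst c) = c"
  by (rule evg_Cst[OF id_comm_ring_hom])

lemma ev_Var [simp]: "ev x (Var k) = x k"
  by (rule evg_Var[OF id_comm_ring_hom])

lemma ev_single: "ev x (single m c) = c * monev x m"
  by (rule evg_single[OF id_comm_ring_hom])

lemma Cst_hom: "comm_ring_hom Cst"
  by unfold_locales (auto simp: Cst_def single_add mult_single)

interpretation Cst: comm_ring_hom Cst
  by (rule Cst_hom)

lemma lookup_single_mult: "lookup (single m c * f) (m + k) = c * lookup (f :: cpoly) k"
proof -
  have "single m c * f = (\<Sum>l\<in>keys f. single (m + l) (c * lookup f l))"
    by (subst sum_singles[of f]) (simp add: sum_distrib_left mult_single)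
  then have "lookup (single m c * f) (m + k) = (\<Sum>l\<in>keys f. if l = k then c * lookup f k else 0)"
    by (auto simp: lookup_sum lookup_single when_def intro!: sum.cong)
  also have "\<dots> = c * lookup f k"
    by (auto simp: in_keys_iff)
  finally show ?thesis .
qed

lemma lookup_Cst_mult [simp]: "lookup (Cst c * f) k = c * lookup f k"
  using lookup_single_mult[of 0 c f k] by (simp add: Cst_def)

lemma keys_Cst_mult: "keys (Cst c * f) \<subseteq> keys f"
  by (auto simp: in_keys_iff)

lemma keys_mult_cpoly:
  fixes f g :: cpoly
  assumes "k \<in> keys (f * g)"
  obtains a b where "a \<in> keys f" "b \<in> keys g" "k = a + b"
  using keys_mult[of f g] assms by blast

section \<open>Number of variables and total degree\<close>

lemma in_vars_Cst [simp]: "in_vars n (Cst c)"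
  by (auto simp: in_vars_def Cst_def)

lemma in_vars_0 [simp]: "in_vars n 0"
  by (auto simp: in_vars_def)

lemma in_vars_1 [simp]: "in_vars n 1"
  by (auto simp: in_vars_def)

lemma in_vars_Var [simp]: "k < n \<Longrightarrow> in_vars n (Var k)"
  by (auto simp: in_vars_def Var_def)

lemma in_vars_add: "in_vars n f \<Longrightarrow> in_vars n g \<Longrightarrow> in_vars n (f + g)"
  unfolding in_vars_def using keys_add[of f g] by blast

lemma in_vars_uminus: "in_vars n f \<Longrightarrow> in_vars n (- f)"
  by (auto simp: in_vars_def in_keys_iff)

lemma in_vars_minus: "in_vars n f \<Longrightarrow> in_vars n g \<Longrightarrow> in_vars n (f - g)"
  using in_vars_add[of n f "- g"] in_vars_uminus[of n g] by simp

lemma in_vars_mult: "in_vars n f \<Longrightarrow> in_vars n g \<Longrightarrow> in_vars n (f * g)"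
  unfolding in_vars_def by (metis Un_subset_iff keys_mult_cpoly keys_nat_add)

lemma in_vars_sum: "(\<And>a. a \<in> A \<Longrightarrow> in_vars n (g a)) \<Longrightarrow> in_vars n (sum g A)"
  by (induction A rule: infinite_finite_induct) (auto intro: in_vars_add)

lemma in_vars_prod: "(\<And>a. a \<in> A \<Longrightarrow> in_vars n (g a)) \<Longrightarrow> in_vars n (prod g A)"
  by (induction A rule: infinite_finite_induct) (auto intro: in_vars_mult)

lemma in_vars_power: "in_vars n f \<Longrightarrow> in_vars n (f ^ k)"
  by (induction k) (auto intro: in_vars_mult)

lemma in_vars_single: "keys m \<subseteq> {..<n} \<Longrightarrow> in_vars n (single m c)"
  by (cases "c = 0") (auto simp: in_vars_def)

lemma in_vars_det:
  assumes "A \<in> carrier_mat k k" "\<And>i j. i < k \<Longrightarrow> j < k \<Longrightarrow> in_vars n (A $$ (i, j))"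
  shows "in_vars n (det A)"
proof -
  have "in_vars n (signof p :: cpoly)" for p
    by (cases "sign p = 1") (auto simp: sign_def intro: in_vars_uminus)
  then show ?thesis
    unfolding det_def'[OF assms(1)]
    by (intro in_vars_sum in_vars_mult in_vars_prod) (auto intro!: assms(2) simp: permutes_in_image)
qed

lemma monev_cong:
  assumes "keys m \<subseteq> A" "\<And>i. i \<in> A \<Longrightarrow> x i = y i"
  shows "monev x m = monev y m"
  unfolding monev_def using assms by (intro prod.cong) auto

lemma evg_cong:
  assumes "in_vars n f" "\<And>i. i < n \<Longrightarrow> x i = y i"
  shows "evg h x f = evg h y f"
  unfolding evg_def using assms
  by (intro sum.cong refl arg_cong2[of _ _ _ _ "(*)"] monev_cong[of _ "{..<n}"]) (auto simp: in_vars_def)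

definition tdeg_le :: "nat \<Rightarrow> cpoly \<Rightarrow> bool" where
  "tdeg_le D f \<longleftrightarrow> (\<forall>m\<in>keys f. mdeg m \<le> D)"

lemma tdeg_le_mono: "tdeg_le D f \<Longrightarrow> D \<le> D' \<Longrightarrow> tdeg_le D' f"
  unfolding tdeg_le_def by force

lemma tdeg_le_0 [simp]: "tdeg_le D 0"
  by (auto simp: tdeg_le_def)

lemma tdeg_le_1 [simp]: "tdeg_le D 1"
  by (auto simp: tdeg_le_def)

lemma tdeg_le_add: "tdeg_le D f \<Longrightarrow> tdeg_le D g \<Longrightarrow> tdeg_le D (f + g)"
  unfolding tdeg_le_def using keys_add[of f g] by blast

lemma tdeg_le_sum: "(\<And>a. a \<in> A \<Longrightarrow> tdeg_le D (g a)) \<Longrightarrow> tdeg_le D (sum g A)"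
  by (induction A rule: infinite_finite_induct) (auto intro: tdeg_le_add)

lemma tdeg_le_mult: "tdeg_le D f \<Longrightarrow> tdeg_le E g \<Longrightarrow> tdeg_le (D + E) (f * g)"
  unfolding tdeg_le_def by (metis add_mono keys_mult_cpoly mdeg_add)

lemma tdeg_le_power: "tdeg_le D f \<Longrightarrow> tdeg_le (k * D) (f ^ k)"
  by (induction k) (auto intro: tdeg_le_mult)

lemma tdeg_le_Cst_mult: "tdeg_le D f \<Longrightarrow> tdeg_le D (Cst c * f)"
  unfolding tdeg_le_def using keys_Cst_mult by blast

lemma tdeg_le_ex: "\<exists>D. tdeg_le D f"
proof
  show "tdeg_le (Max (mdeg ` keys f)) f" by (auto simp: tdeg_le_def)
qed


section \<open>Counting monomials\<close>

definition exps :: "nat set \<Rightarrow> (nat \<Rightarrow> nat) \<Rightarrow> nat \<Rightarrow>\<^sub>0 nat" where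
  "exps A \<phi> = Abs_poly_mapping (\<lambda>i. if i \<in> A then \<phi> i else 0)"

lemma lookup_exps: "finite A \<Longrightarrow> lookup (exps A \<phi>) i = (if i \<in> A then \<phi> i else 0)"
  unfolding exps_def by (subst lookup_Abs_poly_mapping) (auto elim: rev_finite_subset)

lemma inj_on_exps: "finite A \<Longrightarrow> inj_on (exps A) (PiE A B)"
proof (rule inj_onI)
  fix \<phi> \<psi>
  assume A: "finite A" and "\<phi> \<in> PiE A B" "\<psi> \<in> PiE A B" "exps A \<phi> = exps A \<psi>"
  then have "\<phi> i = \<psi> i" if "i \<in> A" for i
    using lookup_exps[OF A, of \<phi> i] lookup_exps[OF A, of \<psi> i] that by simp
  then show "\<phi> = \<psi>" using \<open>\<phi> \<in> PiE A B\<close> \<open>\<psi> \<in> PiE A B\<close> by (rule PiE_ext[rotated 2])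
qed

definition exps_eq :: "nat \<Rightarrow> nat \<Rightarrow> (nat \<Rightarrow>\<^sub>0 nat) set" where
  "exps_eq n d = {m. keys m \<subseteq> {..<n} \<and> mdeg m = d}"

definition exps_le :: "nat \<Rightarrow> nat \<Rightarrow> (nat \<Rightarrow>\<^sub>0 nat) set" where
  "exps_le n d = {m. keys m \<subseteq> {..<n} \<and> mdeg m \<le> d}"

lemma lookup_le_mdeg: "lookup m i \<le> mdeg m"
  by (cases "i \<in> keys m") (auto simp: mdeg_def in_keys_iff intro: member_le_sum)

lemma restrict_eq_lookup_eq:
  assumes "restrict (lookup m) A = restrict (lookup m') A" "keys m \<subseteq> A" "keys m' \<subseteq> A"
  shows "m = m'"
proof (rule poly_mapping_eqI)
  fix k
  show "lookup m k = lookup m' k"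
  proof (cases "k \<in> A")
    case True
    then show ?thesis using fun_cong[OF assms(1), of k] by simp
  next
    case False
    then show ?thesis using assms(2,3) by (metis in_keys_iff subsetD)
  qed
qed

lemma exps_le_inj:
  "inj_on (\<lambda>m. restrict (lookup m) {..<n}) (exps_le n d)"
  "(\<lambda>m. restrict (lookup m) {..<n}) ` exps_le n d \<subseteq> PiE {..<n} (\<lambda>_. {..d})"
proof -
  show "inj_on (\<lambda>m. restrict (lookup m) {..<n}) (exps_le n d)"
    by (rule inj_onI, erule restrict_eq_lookup_eq) (auto simp: exps_le_def)
  show "(\<lambda>m. restrict (lookup m) {..<n}) ` exps_le n d \<subseteq> PiE {..<n} (\<lambda>_. {..d})"
    by (rule image_subsetI, unfold restrict_PiE_iff) (auto simp: exps_le_def intro: le_trans[OF lookup_le_mdeg])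
qed

lemma finite_PiE_atMost: "finite (PiE {..<n::nat} (\<lambda>_. {..d::nat}))"
  by (simp add: finite_PiE)

lemma finite_exps_le [simp]: "finite (exps_le n d)"
  using finite_imageD[OF finite_subset[OF exps_le_inj(2) finite_PiE_atMost] exps_le_inj(1)] .

lemma finite_exps_eq [simp]: "finite (exps_eq n d)"
  by (rule finite_subset[OF _ finite_exps_le[of n d]]) (auto simp: exps_eq_def exps_le_def)

text \<open>The last exponent is determined by the others, so n - 1 exponents between 0 and d
  remain. The factor d + 1 on the left replaces the exponent n - 1 and keeps the case n = 0
  true.\<close>

lemma card_exps_eq: "card (exps_eq n d) * (d + 1) \<le> (d + 1) ^ n"
proof (cases n)
  case 0
  have "exps_eq 0 d \<subseteq> (if d = 0 then {0} else {})"
    by (auto simp: exps_eq_def)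
  then have "card (exps_eq 0 d) \<le> card (if d = 0 then {0 :: nat \<Rightarrow>\<^sub>0 nat} else {})"
    by (rule card_mono[rotated]) simp
  then show ?thesis
    by (cases "d = 0") (auto simp: 0)
next
  case (Suc n')
  let ?r = "\<lambda>m. restrict (lookup m) {..<n'}"
  have "inj_on ?r (exps_eq n d)"
  proof (rule inj_onI)
    fix m m'
    assume a: "m \<in> exps_eq n d" "m' \<in> exps_eq n d" "?r m = ?r m'"
    have 1: "lookup m i = lookup m' i" if "i < n'" for i
      using fun_cong[OF a(3), of i] that by simp
    have 2: "mdeg l = sum (lookup l) {..<n'} + lookup l n'" if "l \<in> exps_eq n d" for l
      using that mdeg_superset[of "{..<Suc n'}" l] by (simp add: exps_eq_def Suc)
    have "lookup m n' = lookup m' n'"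
      using a(1,2) 2[of m] 2[of m'] 1 by (simp add: exps_eq_def)
    then have "lookup m i = lookup m' i" if "i < n" for i
      using 1 that by (cases "i = n'") (auto simp: Suc less_Suc_eq)
    then have "restrict (lookup m) {..<n} = restrict (lookup m') {..<n}"
      by (auto simp: restrict_def)
    then show "m = m'"
      by (rule restrict_eq_lookup_eq) (use a in \<open>auto simp: exps_eq_def\<close>)
  qed
  moreover have "?r ` exps_eq n d \<subseteq> PiE {..<n'} (\<lambda>_. {..d})"
    by (rule image_subsetI, unfold restrict_PiE_iff) (auto simp: exps_eq_def lookup_le_mdeg)
  ultimately have "card (exps_eq n d) \<le> (d + 1) ^ n'"
    using card_inj_on_le[OF _ _ finite_PiE_atMost[of n' d]] by (simp add: card_PiE)
  then have "card (exps_eq n d) * (d + 1) \<le> (d + 1) ^ n' * (d + 1)"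
    by (rule mult_le_mono1)
  then show ?thesis
    by (simp add: Suc mult.commute)
qed

text \<open>A cube of side u fits below total degree n * u; this crude count already has the right
  order.\<close>

lemma card_exps_le_ge: "(u + 1) ^ n \<le> card (exps_le n (n * u))"
proof -
  have "exps {..<n} ` PiE {..<n} (\<lambda>_. {..u}) \<subseteq> exps_le n (n * u)"
  proof clarify
    fix \<phi> :: "nat \<Rightarrow> nat"
    assume "\<phi> \<in> PiE {..<n} (\<lambda>_. {..u})"
    then have le: "\<phi> i \<le> u" if "i < n" for i
      using that by auto
    have k: "keys (exps {..<n} \<phi>) \<subseteq> {..<n}"
      by (auto simp: in_keys_iff lookup_exps split: if_splits)
    have "mdeg (exps {..<n} \<phi>) = (\<Sum>i<n. \<phi> i)"
      using mdeg_superset[OF _ k] by (simp add: lookup_exps)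
    also have "\<dots> \<le> n * u"
      using sum_bounded_above[of "{..<n}" \<phi> u] le by simp
    finally show "exps {..<n} \<phi> \<in> exps_le n (n * u)"
      using k by (simp add: exps_le_def)
  qed
  then have "card (exps {..<n} ` PiE {..<n} (\<lambda>_. {..u})) \<le> card (exps_le n (n * u))"
    by (rule card_mono[OF finite_exps_le])
  then show ?thesis
    by (simp add: card_image inj_on_exps card_PiE)
qed


section \<open>Underdetermined linear systems\<close>

text \<open>Elimination of one unknown with a pivot in the new equation. Arbitrary index sets are
  used because the equations will be indexed by exponents, functionals or polynomials, and the
  unknowns by complex numbers, exponents or lists.\<close>

lemma underdetermined:
  fixes c :: "'a \<Rightarrow> 'b \<Rightarrow> 'c :: field"
  assumes "finite A" "finite B" "card A < card B"
  shows "\<exists>z. (\<exists>b\<in>B. z b \<noteq> 0) \<and> (\<forall>a\<in>A. (\<Sum>b\<in>B. c a b * z b) = 0)"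
  using assms
proof (induction A arbitrary: B c rule: finite_induct)
  case empty
  then obtain b where "b \<in> B" by fastforce
  then show ?case by (intro exI[of _ "\<lambda>_. 1"]) auto
next
  case (insert a A)
  show ?case
  proof (cases "\<exists>b\<in>B. c a b \<noteq> 0")
    case False
    have "card A < card B" using insert by simp
    then obtain z where "\<exists>b\<in>B. z b \<noteq> 0" "\<forall>a\<in>A. (\<Sum>b\<in>B. c a b * z b) = 0"
      using insert.IH[OF insert.prems(1)] by blast
    then show ?thesis using False by (intro exI[of _ z]) auto
  next
    case True
    then obtain p where p: "p \<in> B" "c a p \<noteq> 0" by blast
    \<comment> \<open>Row a', cleared of the unknown p by means of row a; afterwards the value at p
      is the one that row a forces.\<close>
    define c' where "c' = (\<lambda>a' b. c a' b - c a' p * c a b / c a p)"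
    have "card A < card (B - {p})" using insert p by simp
    then obtain z where z: "\<exists>b\<in>B - {p}. z b \<noteq> 0" "\<forall>a'\<in>A. (\<Sum>b\<in>B - {p}. c' a' b * z b) = 0"
      using insert.IH[OF finite_Diff[OF insert.prems(1)], of "{p}" c'] by blast
    define w where "w = z(p := - (\<Sum>b\<in>B - {p}. c a b * z b) / c a p)"
    have split: "(\<Sum>b\<in>B. c a' b * w b) = c a' p * w p + (\<Sum>b\<in>B - {p}. c a' b * z b)" for a'
      using sum.remove[OF insert.prems(1) p(1), of "\<lambda>b. c a' b * w b"]
      by (simp add: w_def)
    have wp: "w p = - (\<Sum>b\<in>B - {p}. c a b * z b) / c a p"
      by (simp add: w_def)
    have "(\<Sum>b\<in>B. c a b * w b) = 0"
      unfolding split wp using p by simp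
    moreover have "(\<Sum>b\<in>B. c a' b * w b) = 0" if "a' \<in> A" for a'
    proof -
      have "(\<Sum>b\<in>B - {p}. c' a' b * z b)
          = (\<Sum>b\<in>B - {p}. c a' b * z b) - (\<Sum>b\<in>B - {p}. (c a' p / c a p) * (c a b * z b))"
        by (simp add: c'_def algebra_simps sum_subtractf)
      also have "\<dots> = (\<Sum>b\<in>B. c a' b * w b)"
        unfolding split wp sum_distrib_left[symmetric] by simp
      finally show ?thesis using z(2) that by simp
    qed
    moreover have "\<exists>b\<in>B. w b \<noteq> 0"
      using z(1) by (auto simp: w_def)
    ultimately show ?thesis by (intro exI[of _ w]) auto
  qed
qed

section \<open>Ideals and the Nullstellensatz\<close>

definition pideal :: "cpoly set \<Rightarrow> bool" where
  "pideal I \<longleftrightarrow> 0 \<in> I \<and> (\<forall>f\<in>I. \<forall>g\<in>I. f + g \<in> I) \<and> (\<forall>f\<in>I. \<forall>g. g * f \<in> I)"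

lemma pidealD:
  assumes "pideal I"
  shows "0 \<in> I" "f \<in> I \<Longrightarrow> g \<in> I \<Longrightarrow> f + g \<in> I" "f \<in> I \<Longrightarrow> g * f \<in> I" "f \<in> I \<Longrightarrow> f * g \<in> I"
    "f \<in> I \<Longrightarrow> - f \<in> I" "f \<in> I \<Longrightarrow> g \<in> I \<Longrightarrow> f - g \<in> I"
proof -
  note I = assms[unfolded pideal_def]
  show "0 \<in> I" using I by blast
  show add: "f + g \<in> I" if "f \<in> I" "g \<in> I" for f g using I that by blast
  show mult: "g * f \<in> I" if "f \<in> I" for f g using I that by blast
  then show "f * g \<in> I" if "f \<in> I" using that by (metis mult.commute)
  show um: "- f \<in> I" if "f \<in> I" for f using mult[OF that, of "- 1"] by simp
  show "f - g \<in> I" if "f \<in> I" "g \<in> I" using add[of f "- g"] um that by simp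
qed

lemma pideal_sum:
  assumes "pideal I" "\<And>a. a \<in> A \<Longrightarrow> g a \<in> I"
  shows "sum g A \<in> I"
  using assms(2) by (induction A rule: infinite_finite_induct) (auto intro: pidealD[OF assms(1)])

lemma pideal_cong_iff:
  assumes "pideal I" "f - g \<in> I"
  shows "f \<in> I \<longleftrightarrow> g \<in> I"
  using pidealD(2)[OF assms(1) assms(2), of g] pidealD(6)[OF assms(1) _ assms(2), of f] by auto

text \<open>Inductive, so that membership in the generated ideal comes with an induction rule;
  explicit coefficients are recovered in \<open>pgen_image_sum\<close>.\<close>

inductive_set pgen :: "cpoly set \<Rightarrow> cpoly set" for S where
  zero: "0 \<in> pgen S"
| step: "f \<in> pgen S \<Longrightarrow> s \<in> S \<Longrightarrow> f + g * s \<in> pgen S"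

lemma pideal_pgen: "pideal (pgen S)"
  unfolding pideal_def
proof (intro conjI ballI allI)
  show "f + g \<in> pgen S" if "f \<in> pgen S" "g \<in> pgen S" for f g
    using that(2) by induction (use that(1) in \<open>auto simp: add.assoc[symmetric] intro: pgen.step\<close>)
  show "g * f \<in> pgen S" if "f \<in> pgen S" for f g
    using that
    by induction (auto simp: ring_distribs mult.assoc[symmetric] intro: pgen.intros)
qed (rule pgen.zero)

lemma pgen_superset: "s \<in> S \<Longrightarrow> s \<in> pgen S"
  using pgen.step[OF pgen.zero, of s S 1] by simp

lemma pgen_minimal:
  assumes "pideal I" "S \<subseteq> I"
  shows "pgen S \<subseteq> I"
proof
  fix f assume "f \<in> pgen S"
  then show "f \<in> I"
    by induction (use assms in \<open>auto intro: pidealD[OF assms(1)]\<close>)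
qed

lemma pgen_image_sum:
  assumes "f \<in> pgen (q ` {..<c::nat})"
  obtains g where "f = (\<Sum>k<c. g k * q k)"
proof -
  have "\<exists>g. f = (\<Sum>k<c. g k * q k)"
    using assms
  proof induction
    case zero
    show ?case by (intro exI[of _ "\<lambda>_. 0"]) simp
  next
    case (step f s h)
    then obtain g l where g: "f = (\<Sum>k<c. g k * q k)" and l: "l < c" "s = q l" by auto
    have "(\<Sum>k<c. (g(l := g l + h)) k * q k) = (\<Sum>k<c. g k * q k + (if k = l then h * q l else 0))"
      by (intro sum.cong) (auto simp: algebra_simps)
    also have "\<dots> = f + h * s"
      using l g by (simp add: sum.distrib)
    finally show ?case by metis
  qed
  then show ?thesis using that by blast
qed

lemma ev_pgen:
  assumes "f \<in> pgen S" "\<And>s. s \<in> S \<Longrightarrow> ev x s = 0"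
  shows "ev x f = 0"
  using assms(1) by induction (auto simp: ev.hom_add ev.hom_mult assms(2))

definition padj :: "cpoly set \<Rightarrow> cpoly \<Rightarrow> cpoly set" where
  "padj I f = {p + h * f |p h. p \<in> I}"

lemma padj:
  assumes "pideal I"
  shows "pideal (padj I f)" "I \<subseteq> padj I f" "f \<in> padj I f"
proof -
  show "I \<subseteq> padj I f"
  proof
    fix p assume "p \<in> I"
    then have "p + 0 * f \<in> padj I f" unfolding padj_def by blast
    then show "p \<in> padj I f" by simp
  qed
  have "0 + 1 * f \<in> padj I f" unfolding padj_def using pidealD(1)[OF assms] by blast
  then show "f \<in> padj I f" by simp
  show "pideal (padj I f)"
    unfolding pideal_def
  proof (intro conjI ballI allI)
    show "0 \<in> padj I f"
      using \<open>I \<subseteq> padj I f\<close> pidealD(1)[OF assms] by blast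
    fix a assume "a \<in> padj I f"
    then obtain p h where a: "a = p + h * f" "p \<in> I" by (auto simp: padj_def)
    show "a + b \<in> padj I f" if bI: "b \<in> padj I f" for b
    proof -
      obtain p' h' where b: "b = p' + h' * f" "p' \<in> I" using bI unfolding padj_def by blast
      have "a + b = (p + p') + (h + h') * f" by (simp add: a b algebra_simps)
      then show ?thesis unfolding padj_def using pidealD(2)[OF assms a(2) b(2)] by blast
    qed
    show "g * a \<in> padj I f" for g
    proof -
      have "g * a = g * p + (g * h) * f" by (simp add: a algebra_simps)
      then show ?thesis unfolding padj_def using pidealD(3)[OF assms a(2)] by blast
    qed
  qed
qed

section \<open>Prime ideals and the uncountability argument\<close>

definition pprime :: "cpoly set \<Rightarrow> bool" where
  "pprime P \<longleftrightarrow> pideal P \<and> 1 \<notin> P \<and> (\<forall>f g. f * g \<in> P \<longrightarrow> f \<in> P \<or> g \<in> P)"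

lemma pprime_power: "pprime P \<Longrightarrow> f ^ k \<in> P \<Longrightarrow> f \<in> P"
  by (induction k) (auto simp: pprime_def)

lemma countable_exponents: "countable (UNIV :: (nat \<Rightarrow>\<^sub>0 nat) set)"
proof -
  have "m \<in> range (\<lambda>xs. exps {..<length xs} ((!) xs))" for m :: "nat \<Rightarrow>\<^sub>0 nat"
  proof -
    obtain n where n: "\<forall>i\<in>keys m. i < n"
      using finite_nat_set_iff_bounded[of "keys m"] by auto
    have "m = exps {..<length (map (lookup m) [0..<n])} ((!) (map (lookup m) [0..<n]))"
      using n by (intro poly_mapping_eqI) (auto simp: lookup_exps in_keys_iff)
    then show ?thesis by blast
  qed
  then have "UNIV = range (\<lambda>xs :: nat list. exps {..<length xs} ((!) xs))" by blast
  then show ?thesis by (metis countable_image countableI_type)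
qed

lemma uncountable_complex: "\<not> countable (UNIV :: complex set)"
proof
  assume "countable (UNIV :: complex set)"
  then have "countable (range complex_of_real)" by (rule countable_subset[rotated]) simp
  then have "countable (UNIV :: real set)" by (rule countable_image_inj_on) (simp add: inj_on_def)
  then show False using uncountable_UNIV_real by blast
qed

definition usubst :: "cpoly \<Rightarrow> complex poly \<Rightarrow> cpoly" where
  "usubst X p = poly (map_poly Cst p) X"

lemma usubst_pCons: "usubst X (pCons a p) = Cst a + X * usubst X p"
  by (simp add: usubst_def map_poly_pCons)

lemma usubst_0: "usubst X 0 = 0"
  by (simp add: usubst_def)

lemma usubst_add: "usubst X (p + q) = usubst X p + usubst X q"
  by (induction p q rule: poly_induct2) (auto simp: usubst_pCons usubst_0 Cst.hom_add algebra_simps)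

lemma usubst_smult: "usubst X (smult c p) = Cst c * usubst X p"
  by (induction p) (auto simp: usubst_pCons usubst_0 Cst.hom_mult algebra_simps)

lemma usubst_mult: "usubst X (p * q) = usubst X p * usubst X q"
  by (induction p) (auto simp: usubst_pCons usubst_0 usubst_add usubst_smult algebra_simps)

lemma usubst_sum: "usubst X (sum g A) = (\<Sum>a\<in>A. usubst X (g a))"
  by (induction A rule: infinite_finite_induct) (auto simp: usubst_0 usubst_add)

text \<open>By the fundamental theorem of algebra \<open>r\<close> splits into linear factors, and a
  prime that contains the product contains a factor; it cannot be the constant one, which is a
  unit.\<close>

lemma prime_contains_root:
  assumes "pprime P" "r \<noteq> 0" "usubst X r \<in> P"
  shows "\<exists>c. X - Cst c \<in> P"
  using assms(2,3)
proof (induction "degree r" arbitrary: r)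
  case 0
  then obtain a where r: "r = [:a:]" "a \<noteq> 0" by (metis degree_eq_zeroE pCons_0_0)
  have "Cst (1 / a) * usubst X r \<in> P"
    using 0 assms(1) by (auto simp: pprime_def intro: pidealD)
  then have "1 \<in> P"
    using r by (simp add: usubst_pCons usubst_0 Cst.hom_mult[symmetric])
  then show ?case using assms(1) by (simp add: pprime_def)
next
  case (Suc n)
  then have "\<not> constant (poly r)"
    by (simp add: constant_degree)
  then obtain c where "poly r c = 0"
    using fundamental_theorem_of_algebra by blast
  then obtain q where q: "r = [:- c, 1:] * q"
    by (metis dvdE poly_eq_0_iff_dvd)
  then have "(X - Cst c) * usubst X q \<in> P"
    using Suc.prems(2)
    by (simp only: usubst_mult) (simp add: usubst_pCons usubst_0 Cst.hom_uminus)
  then have "X - Cst c \<in> P \<or> usubst X q \<in> P"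
    using assms(1) by (simp add: pprime_def)
  moreover have "q \<noteq> 0" using q Suc.prems(1) by auto
  moreover have "degree q = n"
    using Suc.hyps(2) \<open>q \<noteq> 0\<close> q degree_mult_eq[of "[:- c, 1:]" q] by simp
  ultimately show ?case using Suc.hyps(1)[of q] by blast
qed

text \<open>The residue field of \<open>P\<close> after inverting \<open>f\<close> has countable dimension over the uncountable
  field of complex numbers, so the inverses of \<open>Var i - c\<close> cannot be linearly independent.\<close>

lemma coordinate_mod_prime:
  assumes P: "pprime P" and f: "f \<notin> P"
    and max: "\<And>h. h \<notin> P \<Longrightarrow> \<exists>k g. f ^ k - g * h \<in> P"
  shows "\<exists>c. Var i - Cst c \<in> P"
proof (rule ccontr)
  assume no: "\<not> ?thesis"
  define X where "X = Var i"
  have id: "pideal P" using P by (simp add: pprime_def)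
  \<comment> \<open>After inverting \<open>f\<close>, the quotient of \<open>G c\<close> by
    \<open>f ^ \<kappa> c\<close> is an inverse of X - c modulo P.\<close>
  have "\<forall>c. \<exists>k g. f ^ k - g * (X - Cst c) \<in> P"
    using no max by (auto simp: X_def)
  then obtain \<kappa> G where G: "\<And>c. f ^ \<kappa> c - G c * (X - Cst c) \<in> P"
    by metis
  define T where "T = (UNIV :: nat set) \<times> {F :: (nat \<Rightarrow>\<^sub>0 nat) set. finite F \<and> F \<subseteq> UNIV}"
  have "countable T"
    unfolding T_def
    by (intro countable_SIGMA countableI_type countable_Collect_finite_subset countable_exponents)
  \<comment> \<open>Uncountably many c stand against countably many pairs of an exponent and a
    finite support, so some pair occurs infinitely often.\<close>
  have "\<exists>\<tau>\<in>T. infinite {c. (\<kappa> c, keys (G c)) = \<tau>}"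
  proof (rule ccontr)
    assume "\<not> ?thesis"
    then have "countable (\<Union>\<tau>\<in>T. {c. (\<kappa> c, keys (G c)) = \<tau>})"
      using \<open>countable T\<close> by (auto intro: countable_finite)
    moreover have "(\<Union>\<tau>\<in>T. {c. (\<kappa> c, keys (G c)) = \<tau>}) = UNIV"
      by (auto simp: T_def)
    ultimately show False using uncountable_complex by simp
  qed
  then obtain k F where F: "finite F" "infinite {c. \<kappa> c = k \<and> keys (G c) = F}"
    by (auto simp: T_def)
  \<comment> \<open>One more polynomial than there are monomials in the common support: the
    \<open>G c\<close> with c in B are linearly dependent.\<close>
  then obtain B where B: "finite B" "card B = Suc (card F)" "B \<subseteq> {c. \<kappa> c = k \<and> keys (G c) = F}"
    using infinite_arbitrarily_large[OF F(2)] by blast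
  then obtain z where z: "\<exists>c\<in>B. z c \<noteq> 0" "\<forall>m\<in>F. (\<Sum>c\<in>B. lookup (G c) m * z c) = 0"
    using underdetermined[OF F(1) B(1), of "\<lambda>m c. lookup (G c) m"] by auto
  have G0: "(\<Sum>c\<in>B. Cst (z c) * G c) = 0"
  proof (rule poly_mapping_eqI)
    fix m
    have "(\<Sum>c\<in>B. lookup (G c) m * z c) = 0"
    proof (cases "m \<in> F")
      case False
      then have "lookup (G c) m = 0" if "c \<in> B" for c
        using B(3) that by (auto simp: in_keys_iff)
      then show ?thesis by simp
    qed (use z in blast)
    then show "lookup (\<Sum>c\<in>B. Cst (z c) * G c) m = lookup 0 m"
      by (simp add: lookup_sum mult.commute[of "lookup _ _"])
  qed
  \<comment> \<open>Multiplying the dependence by all factors X - b with b in B clears the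
    denominators and leaves a polynomial \<open>r\<close> in X alone that lies in P.\<close>
  define q where "q = (\<lambda>c. \<Prod>b\<in>B - {c}. [:- b, 1 :: complex:])"
  define r where "r = (\<Sum>c\<in>B. smult (z c) (q c))"
  define Q where "Q = usubst X (\<Prod>b\<in>B. [:- b, 1:])"
  have Q: "Q = (X - Cst c) * usubst X (q c)" if "c \<in> B" for c
    unfolding Q_def q_def prod.remove[OF B(1) that]
    by (simp only: usubst_mult) (simp add: usubst_pCons usubst_0 Cst.hom_uminus)
  have "f ^ k * usubst X r
      = (\<Sum>c\<in>B. Cst (z c) * usubst X (q c) * (f ^ k - G c * (X - Cst c)))
        + (\<Sum>c\<in>B. Cst (z c) * usubst X (q c) * (G c * (X - Cst c)))"
    by (simp add: r_def usubst_sum usubst_smult sum_distrib_left sum.distrib[symmetric] algebra_simps)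
  also have "(\<Sum>c\<in>B. Cst (z c) * usubst X (q c) * (G c * (X - Cst c))) = Q * (\<Sum>c\<in>B. Cst (z c) * G c)"
    unfolding sum_distrib_left by (intro sum.cong refl) (simp add: Q algebra_simps)
  finally have "f ^ k * usubst X r = (\<Sum>c\<in>B. Cst (z c) * usubst X (q c) * (f ^ k - G c * (X - Cst c)))"
    by (simp add: G0)
  also have "\<dots> \<in> P"
  proof (intro pideal_sum[OF id] pidealD(3)[OF id])
    fix c assume "c \<in> B"
    then have "\<kappa> c = k" using B(3) by auto
    then show "f ^ k - G c * (X - Cst c) \<in> P" using G[of c] by simp
  qed
  finally have "usubst X r \<in> P"
    using P f pprime_power[OF P, of f k] by (auto simp: pprime_def)
  \<comment> \<open>At the point c only the summand belonging to c survives.\<close>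
  moreover have "r \<noteq> 0"
  proof
    assume "r = 0"
    obtain c where c: "c \<in> B" "z c \<noteq> 0" using z(1) by blast
    have "poly (q b) c = 0" if "b \<in> B" "b \<noteq> c" for b
      using that c B(1) by (auto simp: q_def poly_prod)
    then have "poly r c = z c * poly (q c) c"
      using B(1) c(1) by (simp add: r_def poly_sum sum.remove[OF B(1) c(1)])
    moreover have "poly (q c) c \<noteq> 0"
      using B(1) by (auto simp: q_def poly_prod)
    ultimately show False using \<open>r = 0\<close> c(2) by simp
  qed
  ultimately show False using prime_contains_root[OF P] no X_def by blast
qed

text \<open>An ideal maximal among those over I without a power of \<open>f\<close> is prime, and
  everything outside it becomes invertible once \<open>f\<close> is; this replaces the extra
  variable of Rabinowitsch. Every variable is then congruent to a number, and these numbers form a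
  zero of I at which \<open>f\<close> does not vanish.\<close>

theorem nullstellensatz:
  assumes I: "pideal I" and f: "\<And>x. (\<forall>g\<in>I. ev x g = 0) \<Longrightarrow> ev x f = 0"
  shows "\<exists>k. f ^ k \<in> I"
proof (rule ccontr)
  assume no: "\<nexists>k. f ^ k \<in> I"
  define \<A> where "\<A> = {J. pideal J \<and> I \<subseteq> J \<and> (\<forall>k. f ^ k \<notin> J)}"
  have "\<exists>M\<in>\<A>. \<forall>X\<in>\<A>. M \<subseteq> X \<longrightarrow> X = M"
  proof (rule subset_Zorn_nonempty)
    show "\<A> \<noteq> {}" using no I by (auto simp: \<A>_def)
    fix \<C> assume \<C>: "\<C> \<noteq> {}" "subset.chain \<A> \<C>"
    have mem: "J \<in> \<A>" if "J \<in> \<C>" for J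
      using \<C>(2) that by (auto simp: subset.chain_def)
    have lin: "J \<subseteq> K \<or> K \<subseteq> J" if "J \<in> \<C>" "K \<in> \<C>" for J K
      using \<C>(2) that by (auto simp: subset.chain_def)
    have "pideal (\<Union>\<C>)"
      unfolding pideal_def
    proof (intro conjI ballI allI)
      obtain J where "J \<in> \<C>" using \<C>(1) by blast
      then show "0 \<in> \<Union>\<C>" using mem[of J] pidealD(1)[of J] by (auto simp: \<A>_def)
      fix a assume "a \<in> \<Union>\<C>"
      then obtain J where J: "a \<in> J" "J \<in> \<C>" by blast
      then have idJ: "pideal J" using mem by (simp add: \<A>_def)
      show "g * a \<in> \<Union>\<C>" for g using J pidealD(3)[OF idJ] by blast
      show "a + b \<in> \<Union>\<C>" if bC: "b \<in> \<Union>\<C>" for b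
      proof -
        obtain K where K: "b \<in> K" "K \<in> \<C>" using bC by blast
        then have idK: "pideal K" using mem by (simp add: \<A>_def)
        show ?thesis
          using lin[OF J(2) K(2)] J K pidealD(2)[OF idJ] pidealD(2)[OF idK] by blast
      qed
    qed
    then show "\<Union>\<C> \<in> \<A>"
      using \<C>(1) mem by (auto simp: \<A>_def)
  qed
  then obtain P where "P \<in> \<A>" and max: "\<And>X. X \<in> \<A> \<Longrightarrow> P \<subseteq> X \<Longrightarrow> X = P"
    by blast
  then have P: "pideal P" "I \<subseteq> P" "\<And>k. f ^ k \<notin> P" by (auto simp: \<A>_def)
  have inv: "\<exists>k g. f ^ k - g * h \<in> P" if h: "h \<notin> P" for h
  proof -
    have "padj P h \<notin> \<A>"
      using max[OF _ padj(2)[OF P(1)]] padj(3)[OF P(1), of h] h by blast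
    then obtain k where "f ^ k \<in> padj P h"
      using padj[OF P(1), of h] P(2) by (auto simp: \<A>_def)
    then obtain p g where "f ^ k = p + g * h" "p \<in> P" by (auto simp: padj_def)
    then show ?thesis by (intro exI[of _ k] exI[of _ g]) simp
  qed
  have "pprime P"
    unfolding pprime_def
  proof (intro conjI allI impI)
    show "1 \<notin> P" using P(3)[of 0] by simp
    fix a b assume ab: "a * b \<in> P"
    show "a \<in> P \<or> b \<in> P"
    proof (rule ccontr)
      assume "\<not> ?thesis"
      then obtain k g l h where 1: "f ^ k - g * a \<in> P" "f ^ l - h * b \<in> P"
        using inv by blast
      \<comment> \<open>The inverses of a and b, multiplied, invert a * b, which lies in P; so a
        power of \<open>f\<close> would lie in P.\<close>
      have "f ^ (k + l) = f ^ k * (f ^ l - h * b) + h * b * (f ^ k - g * a) + g * h * (a * b)"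
        by (simp add: power_add algebra_simps)
      also have "\<dots> \<in> P"
        by (intro pidealD(2)[OF P(1)] pidealD(3)[OF P(1) 1(1)] pidealD(3)[OF P(1) 1(2)] pidealD(3)[OF P(1) ab])
      finally show False using P(3) by blast
    qed
  qed (rule P(1))
  moreover have "f \<notin> P" using P(3)[of 1] by simp
  ultimately have "\<forall>i. \<exists>c. Var i - Cst c \<in> P"
    using coordinate_mod_prime inv by blast
  then obtain x where x: "\<And>i. Var i - Cst (x i) \<in> P" by metis
  have congr: "g - Cst (ev x g) \<in> P" for g
  proof (induction g rule: cpoly_induct)
    case (add g h)
    have "g + h - Cst (ev x (g + h)) = (g - Cst (ev x g)) + (h - Cst (ev x h))"
      by (simp add: ev.hom_add Cst.hom_add)
    then show ?case using pidealD(2)[OF P(1) add] by metis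
  next
    case (mult g h)
    have "g * h - Cst (ev x (g * h)) = h * (g - Cst (ev x g)) + Cst (ev x g) * (h - Cst (ev x h))"
      by (simp add: ev.hom_mult Cst.hom_mult algebra_simps)
    then show ?case using pidealD(2,3)[OF P(1)] mult by simp
  qed (use x pidealD(1)[OF P(1)] in auto)
  have unit: "c = 0" if "Cst c \<in> P" for c
  proof (rule ccontr)
    assume "c \<noteq> 0"
    then have "Cst (1 / c) * Cst c = 1" by (simp add: Cst.hom_mult[symmetric])
    then have "1 \<in> P" using pidealD(3)[OF P(1) that] by metis
    then show False using P(3)[of 0] by simp
  qed
  have "ev x g = 0" if "g \<in> P" for g
    using unit pideal_cong_iff[OF P(1) congr[of g]] that by blast
  then have "ev x f = 0" using f[of x] P(2) by blast
  then have "f \<in> P" using congr[of f] by simp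
  then show False using \<open>f \<notin> P\<close> by blast
qed

corollary prime_zero:
  assumes "pprime P" "f \<notin> P"
  obtains x where "\<And>g. g \<in> P \<Longrightarrow> ev x g = 0" "ev x f \<noteq> 0"
proof -
  have "\<not> (\<forall>x. (\<forall>g\<in>P. ev x g = 0) \<longrightarrow> ev x f = 0)"
    using nullstellensatz[of P f] pprime_power[OF assms(1)] assms by (auto simp: pprime_def)
  then show ?thesis using that by blast
qed

section \<open>The Hilbert basis theorem\<close>

lemma nat_mono_subseq:
  fixes s :: "nat \<Rightarrow> nat"
  obtains \<phi> :: "nat \<Rightarrow> nat" where "strict_mono \<phi>" "mono (\<lambda>i. s (\<phi> i))"
proof -
  obtain f where f: "strict_mono f" "monoseq (\<lambda>n. s (f n))"
    using seq_monosub[of s] by blast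
  consider "\<forall>m n. m \<le> n \<longrightarrow> s (f m) \<le> s (f n)" | "\<forall>m n. m \<le> n \<longrightarrow> s (f n) \<le> s (f m)"
    using f(2) by (auto simp: monoseq_def)
  then show ?thesis
  proof cases
    case 1
    then show ?thesis using that[of f] f(1) by (auto simp: mono_def)
  next
    case 2
    obtain n0 where n0: "\<And>n. s (f n0) \<le> s (f n)"
      using ex_has_least_nat[of "\<lambda>_. True" 0 "\<lambda>n. s (f n)"] by auto
    have "s (f (n0 + i)) = s (f n0)" for i
      using 2 n0 by (metis le_add1 le_antisym)
    moreover have "strict_mono (\<lambda>i. f (n0 + i))"
      using f(1) by (auto simp: strict_mono_def)
    ultimately show ?thesis using that[of "\<lambda>i. f (n0 + i)"] by (simp add: mono_def)
  qed
qed

lemma dickson_subseq: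
  fixes m :: "nat \<Rightarrow> nat \<Rightarrow>\<^sub>0 nat"
  shows "\<exists>\<phi>::nat \<Rightarrow> nat. strict_mono \<phi> \<and> (\<forall>k<n. mono (\<lambda>i. lookup (m (\<phi> i)) k))"
proof (induction n)
  case 0
  show ?case by (intro exI[of _ "\<lambda>i. i"]) (auto simp: strict_mono_def)
next
  case (Suc n)
  then obtain \<phi> :: "nat \<Rightarrow> nat" where \<phi>: "strict_mono \<phi>" "\<And>k. k < n \<Longrightarrow> mono (\<lambda>i. lookup (m (\<phi> i)) k)"
    by blast
  obtain \<psi> :: "nat \<Rightarrow> nat" where \<psi>: "strict_mono \<psi>" "mono (\<lambda>i. lookup (m (\<phi> (\<psi> i))) n)"
    using nat_mono_subseq[of "\<lambda>i. lookup (m (\<phi> i)) n"] by blast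
  have "strict_mono (\<lambda>i. \<phi> (\<psi> i))"
    using \<phi>(1) \<psi>(1) by (auto simp: strict_mono_def)
  moreover have "mono (\<lambda>i. lookup (m (\<phi> (\<psi> i))) k)" if "k < Suc n" for k
  proof (cases "k = n")
    case False
    have "mono \<psi>" using \<psi>(1) by (rule strict_mono_mono)
    then show ?thesis using \<phi>(2)[of k] that False by (auto simp: mono_def)
  qed (use \<psi> in simp)
  ultimately show ?case by (intro exI[of _ "\<lambda>i. \<phi> (\<psi> i)"]) auto
qed

text \<open>Subtraction of exponents is truncated, so the equation says that the monomial
  \<open>m i\<close> divides \<open>m j\<close>.\<close>

lemma dickson:
  fixes m :: "nat \<Rightarrow> nat \<Rightarrow>\<^sub>0 nat"
  assumes "\<And>i. keys (m i) \<subseteq> {..<n}"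
  obtains i j where "i < j" "m j = m i + (m j - m i)"
proof -
  obtain \<phi> :: "nat \<Rightarrow> nat" where \<phi>: "strict_mono \<phi>" "\<forall>k<n. mono (\<lambda>i. lookup (m (\<phi> i)) k)"
    using dickson_subseq by blast
  have "lookup (m (\<phi> 0)) k \<le> lookup (m (\<phi> 1)) k" for k
  proof (cases "k < n")
    case True
    then show ?thesis using \<phi>(2) by (auto simp: mono_def)
  next
    case False
    then have "k \<notin> keys (m (\<phi> 0))" using assms[of "\<phi> 0"] by auto
    then show ?thesis by (simp add: in_keys_iff)
  qed
  then have "m (\<phi> 1) = m (\<phi> 0) + (m (\<phi> 1) - m (\<phi> 0))"
    by (intro poly_mapping_eqI) (auto simp: lookup_add lookup_minus)
  moreover have "\<phi> 0 < \<phi> 1" using \<phi>(1) by (auto simp: strict_mono_def)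
  ultimately show ?thesis using that by blast
qed

text \<open>The order on exponents is the lexicographic one on finitely supported functions. It is a
  monomial order and is implied by divisibility, which connects Dickson's lemma with leading
  exponents.\<close>

lemma exponent_le_add: "m \<le> m + (k :: nat \<Rightarrow>\<^sub>0 nat)"
proof -
  have "0 \<le> k"
  proof (cases "k = 0")
    case False
    then have "\<exists>i. lookup k i \<noteq> 0" by (metis lookup_zero poly_mapping_eqI)
    then obtain i where "lookup k i \<noteq> 0" "\<forall>j<i. lookup k j = 0"
      using exists_least_iff[of "\<lambda>i. lookup k i \<noteq> 0"] by auto
    then have "less_fun (lookup 0) (lookup k)"
      unfolding less_fun_def by (intro exI[of _ i]) auto
    then show ?thesis by (simp add: less_eq_poly_mapping.rep_eq)
  qed simp
  then show ?thesis by (metis add.right_neutral add_left_mono)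
qed

section \<open>Leading exponents and the ascending chain condition\<close>

definition lead :: "cpoly \<Rightarrow> nat \<Rightarrow>\<^sub>0 nat" where
  "lead f = Max (keys f)"

lemma lead_in_keys: "f \<noteq> 0 \<Longrightarrow> lead f \<in> keys f"
  unfolding lead_def by (rule Max_in) auto

lemma le_lead: "m \<in> keys f \<Longrightarrow> m \<le> lead f"
  unfolding lead_def by simp

lemma lead_single_mult:
  assumes "f \<noteq> 0" "c \<noteq> 0"
  shows "lead (single m c * f) = m + lead f"
  unfolding lead_def[of "single m c * f"]
proof (rule Max_eqI)
  fix k assume "k \<in> keys (single m c * f)"
  then obtain a b where "a \<in> keys (single m c)" "b \<in> keys f" "k = a + b"
    by (rule keys_mult_cpoly)
  then show "k \<le> m + lead f"
    using le_lead[of b f] assms by (auto intro: add_left_mono)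
next
  show "m + lead f \<in> keys (single m c * f)"
    using lead_in_keys[OF assms(1)] assms(2) by (simp add: in_keys_iff lookup_single_mult)
qed simp

definition trunc :: "nat \<Rightarrow> cpoly \<Rightarrow> cpoly" where
  "trunc n f = (\<Sum>m | m \<in> keys f \<and> keys m \<subseteq> {..<n}. single m (lookup f m))"

lemma in_vars_trunc: "in_vars n (trunc n f)"
  unfolding trunc_def by (auto intro!: in_vars_sum in_vars_single)

lemma trunc_cong:
  assumes I: "pideal I" "\<And>k. k \<ge> n \<Longrightarrow> Var k \<in> I"
  shows "f - trunc n f \<in> I"
proof -
  have "f = (\<Sum>m\<in>keys f. single m (lookup f m))" by (rule sum_singles)
  also have "\<dots> = trunc n f + (\<Sum>m | m \<in> keys f \<and> \<not> keys m \<subseteq> {..<n}. single m (lookup f m))"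
    unfolding trunc_def by (subst sum.union_disjoint[symmetric]) (auto intro!: sum.cong)
  finally have "f - trunc n f = (\<Sum>m | m \<in> keys f \<and> \<not> keys m \<subseteq> {..<n}. single m (lookup f m))"
    by (subst diff_eq_eq, subst add.commute)
  also have "\<dots> \<in> I"
  proof (rule pideal_sum[OF I(1)])
    fix m assume "m \<in> {m. m \<in> keys f \<and> \<not> keys m \<subseteq> {..<n}}"
    then obtain k where k: "k \<in> keys m" "k \<ge> n" by force
    then have "m = single k 1 + (m - single k 1)"
      by (intro exponent_split) (auto simp: in_keys_iff)
    then have "single m (lookup f m) = single (m - single k 1) (lookup f m) * Var k"
      by (metis Var_def add.commute mult.right_neutral mult_single)
    then show "single m (lookup f m) \<in> I"
      using pidealD(3)[OF I(1) I(2)[OF k(2)]] by metis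
  qed
  finally show ?thesis .
qed

text \<open>Take \<open>f\<close> in J - I with the smallest leading exponent. An element of I with
  the same leading exponent could be scaled and subtracted, which would leave a smaller one in J -
  I.\<close>

lemma new_leading_exponent:
  assumes I: "pideal I" "\<And>k. k \<ge> n \<Longrightarrow> Var k \<in> I" and J: "pideal J" "I \<subset> J"
  obtains f where "f \<in> J" "f \<noteq> 0" "in_vars n f"
    "\<And>g. g \<in> I \<Longrightarrow> g \<noteq> 0 \<Longrightarrow> lead g \<noteq> lead f"
proof -
  define S where "S = {f \<in> J - I. in_vars n f}"
  have "S \<noteq> {}"
  proof -
    obtain f where f: "f \<in> J" "f \<notin> I" using J(2) by blast
    have "f - trunc n f \<in> I" by (rule trunc_cong[OF I])
    then have "trunc n f \<in> J - I"
      using f J pideal_cong_iff[OF I(1)] pideal_cong_iff[OF J(1)] by blast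
    then show ?thesis using in_vars_trunc by (auto simp: S_def)
  qed
  have nz: "f \<noteq> 0" if "f \<in> S" for f using that pidealD(1)[OF I(1)] by (auto simp: S_def)
  \<comment> \<open>A smallest leading exponent exists because, by Dickson's lemma, exponents in n
    variables cannot decrease forever.\<close>
  have "\<exists>f\<in>S. \<forall>g\<in>S. \<not> lead g < lead f"
  proof (rule ccontr)
    assume "\<not> ?thesis"
    then obtain nxt where nxt: "\<And>f. f \<in> S \<Longrightarrow> nxt f \<in> S \<and> lead (nxt f) < lead f"
      by metis
    obtain f0 where "f0 \<in> S" using \<open>S \<noteq> {}\<close> by blast
    define s where "s = (\<lambda>i::nat. (nxt ^^ i) f0)"
    have sS: "s i \<in> S" for i
      by (induction i) (use \<open>f0 \<in> S\<close> nxt in \<open>auto simp: s_def\<close>)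
    have dec: "lead (s (Suc i)) < lead (s i)" for i
      using nxt[OF sS[of i]] by (simp add: s_def)
    have keys: "keys (lead (s i)) \<subseteq> {..<n}" for i
      using lead_in_keys[OF nz[OF sS[of i]]] sS[of i] by (auto simp: S_def in_vars_def)
    obtain i j where "i < j" "lead (s j) = lead (s i) + (lead (s j) - lead (s i))"
      using dickson[of "\<lambda>i. lead (s i)" n] keys by blast
    then have "lead (s i) \<le> lead (s j)" by (metis exponent_le_add)
    moreover have "lead (s j) < lead (s i)"
    proof -
      have "lead (s (i + Suc d)) < lead (s i)" for d
        by (induction d) (use dec in \<open>auto intro: less_trans\<close>)
      then show ?thesis using \<open>i < j\<close> by (metis less_iff_Suc_add add_Suc_right)
    qed
    ultimately show False by simp
  qed
  then obtain f where f: "f \<in> S" "\<And>g. g \<in> S \<Longrightarrow> \<not> lead g < lead f" by blast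
  have "lead g \<noteq> lead f" if g: "g \<in> I" "g \<noteq> 0" for g
  proof
    assume eq: "lead g = lead f"
    \<comment> \<open>The element \<open>g\<close> may involve variables beyond n; its truncation
      stays in I and keeps the leading coefficient, since the leading exponent is that of
      \<open>f\<close>.\<close>
    define g' where "g' = trunc n g"
    have "g - g' \<in> I" unfolding g'_def by (rule trunc_cong[OF I])
    then have g'I: "g' \<in> I" using g(1) pideal_cong_iff[OF I(1)] by blast
    have fv: "in_vars n f" using f(1) by (simp add: S_def)
    have lk: "lookup g' m = (if keys m \<subseteq> {..<n} then lookup g m else 0)" for m
    proof -
      have "lookup g' m = (\<Sum>k | k \<in> keys g \<and> keys k \<subseteq> {..<n}. if k = m then lookup g m else 0)"
        unfolding g'_def trunc_def by (auto simp: lookup_sum lookup_single when_def intro!: sum.cong)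
      then show ?thesis by (auto simp: in_keys_iff)
    qed
    have kl: "keys (lead f) \<subseteq> {..<n}"
      using lead_in_keys[OF nz[OF f(1)]] fv by (auto simp: in_vars_def)
    define c where "c = lookup f (lead f) / lookup g (lead f)"
    define h where "h = f - Cst c * g'"
    have "lookup g (lead f) \<noteq> 0"
      using lead_in_keys[OF g(2)] eq by (simp add: in_keys_iff)
    then have hl: "lookup h (lead f) = 0"
      using kl by (simp add: h_def lookup_minus lk c_def)
    have "h \<in> J" "h \<notin> I"
      using f(1) g'I J pidealD[OF I(1)] pidealD[OF J(1)] pideal_cong_iff[OF I(1), of f h]
      by (auto simp: S_def h_def)
    moreover have "in_vars n h"
      unfolding h_def g'_def using fv in_vars_trunc by (intro in_vars_minus in_vars_mult) auto
    ultimately have hS: "h \<in> S" by (simp add: S_def)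
    have "lead h \<in> keys h" using lead_in_keys[OF nz[OF hS]] .
    then have "lead h \<in> keys f \<or> lead h \<in> keys g"
      by (auto simp: h_def in_keys_iff lookup_minus lk split: if_splits)
    then have "lead h \<le> lead f" using le_lead eq by metis
    moreover have "lead h \<noteq> lead f"
      using hl \<open>lead h \<in> keys h\<close> by (auto simp: in_keys_iff)
    ultimately have "lead h < lead f" by simp
    then show False using f(2) hS by blast
  qed
  then show ?thesis using that[of f] f(1) nz by (auto simp: S_def)
qed

text \<open>Each step contributes a new leading exponent. By Dickson's lemma one of them is a
  multiple of an earlier one, so a monomial multiple of the earlier polynomial realizes it although
  it already lies in the smaller ideal.\<close>

theorem pideal_acc:
  assumes "\<And>j. pideal (I j)" "\<And>j k. k \<ge> n \<Longrightarrow> Var k \<in> I j" "\<And>j::nat. I j \<subset> I (Suc j)"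
  shows False
proof -
  have "\<exists>f. f \<in> I (Suc j) \<and> f \<noteq> 0 \<and> in_vars n f \<and> (\<forall>g\<in>I j. g \<noteq> 0 \<longrightarrow> lead g \<noteq> lead f)" for j
    using new_leading_exponent[OF assms(1,2,1,3)] by metis
  then obtain f where f: "\<And>j. f j \<in> I (Suc j)" "\<And>j. f j \<noteq> 0" "\<And>j. in_vars n (f j)"
    "\<And>j g. g \<in> I j \<Longrightarrow> g \<noteq> 0 \<Longrightarrow> lead g \<noteq> lead (f j)"
    by metis
  have "keys (lead (f j)) \<subseteq> {..<n}" for j
    using lead_in_keys[OF f(2)] f(3)[of j] by (auto simp: in_vars_def)
  then obtain i j where ij: "i < j" "lead (f j) = lead (f i) + (lead (f j) - lead (f i))"
    using dickson[of "\<lambda>j. lead (f j)" n] by blast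
  define g where "g = single (lead (f j) - lead (f i)) 1 * f i"
  have "I (Suc i) \<subseteq> I j"
    by (rule lift_Suc_mono_le) (use assms(3) ij(1) in auto)
  then have "g \<in> I j"
    unfolding g_def using f(1)[of i] by (intro pidealD(3)[OF assms(1)]) blast
  moreover have "lead g = lead (f j)"
    unfolding g_def using lead_single_mult[OF f(2)[of i]] ij(2) by (metis add.commute zero_neq_one)
  moreover have "g \<noteq> 0"
    unfolding g_def using f(2)
    by (metis insert_not_empty keys_single keys_zero mult_eq_0_iff zero_neq_one)
  ultimately show False using f(4) by blast
qed

corollary pideal_maximal:
  assumes "I \<in> \<F>" "\<And>I. I \<in> \<F> \<Longrightarrow> pideal I" "\<And>I k. I \<in> \<F> \<Longrightarrow> k \<ge> n \<Longrightarrow> Var k \<in> I"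
  obtains M where "M \<in> \<F>" "I \<subseteq> M" "\<And>J. J \<in> \<F> \<Longrightarrow> \<not> M \<subset> J"
proof -
  have "\<exists>M\<in>\<F>. I \<subseteq> M \<and> (\<forall>J\<in>\<F>. \<not> M \<subset> J)"
  proof (rule ccontr)
    assume no: "\<not> ?thesis"
    then have "\<forall>M. \<exists>J. M \<in> \<F> \<and> I \<subseteq> M \<longrightarrow> J \<in> \<F> \<and> M \<subset> J" by blast
    then obtain nxt where nxt: "\<And>M. M \<in> \<F> \<Longrightarrow> I \<subseteq> M \<Longrightarrow> nxt M \<in> \<F> \<and> M \<subset> nxt M"
      by metis
    define s where "s = (\<lambda>i::nat. (nxt ^^ i) I)"
    have s: "s i \<in> \<F> \<and> I \<subseteq> s i" for i
    proof (induction i)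
      case (Suc i)
      then show ?case using nxt[of "s i"] by (auto simp: s_def)
    qed (simp add: s_def assms(1))
    moreover have "s i \<subset> s (Suc i)" for i
      using nxt[of "s i"] s[of i] by (simp add: s_def)
    ultimately show False using pideal_acc[of s n] assms(2,3) by blast
  qed
  then obtain M where "M \<in> \<F>" "I \<subseteq> M" "\<forall>J\<in>\<F>. \<not> M \<subset> J" by auto
  then show ?thesis by (intro that[of M]) auto
qed

section \<open>Upper bounds for the dimension\<close>

definition clin :: "(cpoly \<Rightarrow> complex) \<Rightarrow> bool" where
  "clin l \<longleftrightarrow> (\<forall>f g. l (f + g) = l f + l g) \<and> (\<forall>c f. l (Cst c * f) = c * l f)"

lemma clin_add: "clin l \<Longrightarrow> l (f + g) = l f + l g"
  by (simp add: clin_def)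

lemma clin_Cst_mult: "clin l \<Longrightarrow> l (Cst c * f) = c * l f"
  by (simp add: clin_def)

lemma clin_0: "clin l \<Longrightarrow> l 0 = 0"
  using clin_Cst_mult[of l 0 0] by simp

lemma clin_sum: "clin l \<Longrightarrow> l (sum g A) = (\<Sum>a\<in>A. l (g a))"
  by (induction A rule: infinite_finite_induct) (auto simp: clin_add clin_0)

text \<open>\<open>sep n V d\<close>: the polynomials of degree at most \<open>D\<close>, restricted to \<open>V\<close>, span a space
  of dimension \<open>O(D^d)\<close>.\<close>

definition sep :: "nat \<Rightarrow> complex vec set \<Rightarrow> nat \<Rightarrow> bool" where
  "sep n V d \<longleftrightarrow> (\<exists>C. \<forall>D. \<exists>L. finite L \<and> card L \<le> C * (D + 1) ^ d \<and> (\<forall>l\<in>L. clin l) \<and>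
     (\<forall>f. in_vars n f \<longrightarrow> tdeg_le D f \<longrightarrow> (\<forall>l\<in>L. l f = 0) \<longrightarrow> (\<forall>z\<in>V. peval f z = 0)))"

lemma zero_locus_closed: "(\<And>f. f \<in> S \<Longrightarrow> in_vars n f) \<Longrightarrow> zero_locus n S \<in> affine_closed n"
  unfolding affine_closed_def by blast

text \<open>This is primality of the vanishing ideal of an irreducible set, in the form in which
  chains use it.\<close>

lemma irreducible_closed_mult:
  assumes Z: "irreducible_closed (affine_closed n) Z" and f: "in_vars n f" and g: "in_vars n g"
    and fg: "\<And>z. z \<in> Z \<Longrightarrow> peval (f * g) z = 0"
  shows "(\<forall>z\<in>Z. peval f z = 0) \<or> (\<forall>z\<in>Z. peval g z = 0)"
proof -
  have sub: "Z \<subseteq> carrier_vec n"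
    using Z by (auto simp: irreducible_closed_def affine_closed_def zero_locus_def)
  have "Z \<subseteq> zero_locus n {f} \<union> zero_locus n {g}"
    using sub fg by (auto simp: zero_locus_def peval_ev ev.hom_mult)
  moreover have "zero_locus n {f} \<in> affine_closed n" "zero_locus n {g} \<in> affine_closed n"
    using f g by (auto intro: zero_locus_closed)
  ultimately have "Z \<subseteq> zero_locus n {f} \<or> Z \<subseteq> zero_locus n {g}"
    using Z unfolding irreducible_closed_def by blast
  then show ?thesis by (auto simp: zero_locus_def)
qed

text \<open>The head of the list is the exponent of the last polynomial, so that peeling off the
  list matches peeling off the top of a chain.\<close>

fun listmon :: "(nat \<Rightarrow> cpoly) \<Rightarrow> nat list \<Rightarrow> cpoly" where
  "listmon f [] = 1"
| "listmon f (j # js) = f (length js) ^ j * listmon f js"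

lemma in_vars_listmon: "(\<And>i. i < length js \<Longrightarrow> in_vars n (f i)) \<Longrightarrow> in_vars n (listmon f js)"
  by (induction js) (auto intro: in_vars_mult in_vars_power)

lemma tdeg_le_listmon:
  "(\<And>i. i < length js \<Longrightarrow> tdeg_le \<delta> (f i)) \<Longrightarrow> set js \<subseteq> {..D} \<Longrightarrow> tdeg_le (\<delta> * D * length js) (listmon f js)"
proof (induction js)
  case (Cons j js)
  have "tdeg_le (j * \<delta>) (f (length js) ^ j)" using Cons.prems by (intro tdeg_le_power) simp
  then have "tdeg_le (D * \<delta>) (f (length js) ^ j)"
    by (rule tdeg_le_mono) (use Cons.prems in simp)
  then have "tdeg_le (D * \<delta> + \<delta> * D * length js) (listmon f (j # js))"
    using Cons by (auto intro: tdeg_le_mult)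
  then show ?case by (simp add: algebra_simps)
qed simp

abbreviation lists_of :: "nat \<Rightarrow> nat \<Rightarrow> nat list set" where
  "lists_of D k \<equiv> {js. set js \<subseteq> {..D} \<and> length js = k}"

lemma sum_lists_of_Suc:
  "(\<Sum>js\<in>lists_of D (Suc k). g js) = (\<Sum>j\<le>D. \<Sum>js\<in>lists_of D k. g (j # js))"
proof -
  have eq: "lists_of D (Suc k) = (\<lambda>(j, js). j # js) ` ({..D} \<times> lists_of D k)"
    by (auto simp: length_Suc_conv)
  show ?thesis
    unfolding eq by (subst sum.reindex) (auto simp: inj_on_def sum.cartesian_product case_prod_unfold)
qed

text \<open>Functions \<open>f i\<close> that vanish on \<open>Z i\<close> but not on
  \<open>Z (Suc i)\<close> are algebraically independent on the top set. A relation is expanded in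
  powers of the last function: on the smaller set only the constant term remains, and it is trivial
  by induction; on the irreducible larger set the last function can then be cancelled.\<close>

lemma chain_monomials_independent:
  assumes irr: "\<And>i. i \<le> k \<Longrightarrow> irreducible_closed (affine_closed n) (Z i)"
    and f: "\<And>i. i < k \<Longrightarrow> in_vars n (f i)"
    and van: "\<And>i z. i < k \<Longrightarrow> z \<in> Z i \<Longrightarrow> peval (f i) z = 0"
    and sub: "\<And>i. i < k \<Longrightarrow> Z i \<subseteq> Z (Suc i)"
    and nvan: "\<And>i. i < k \<Longrightarrow> \<exists>z\<in>Z (Suc i). peval (f i) z \<noteq> 0"
    and zero: "\<And>z. z \<in> Z k \<Longrightarrow> peval (\<Sum>js\<in>lists_of D k. Cst (c js) * listmon f js) z = 0"
    and js: "js \<in> lists_of D k"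
  shows "c js = 0"
  using assms
proof (induction k arbitrary: c js)
  case 0
  obtain z where z: "z \<in> Z 0" using 0(1) by (auto simp: irreducible_closed_def)
  have "{js. set js \<subseteq> {..D} \<and> js = []} = {[]}" by auto
  then have "c [] = 0" using 0(6)[OF z] by (simp add: peval_ev)
  then show ?case using 0 by simp
next
  case (Suc k)
  note IH = Suc.IH
  define G where "G = (\<lambda>b. \<Sum>js\<in>lists_of D k. Cst (b js) * listmon f js)"
  have inG: "in_vars n (G b)" for b
    unfolding G_def using Suc.prems(2)
    by (intro in_vars_sum in_vars_mult in_vars_Cst in_vars_listmon) auto
  have step: "\<forall>j<e. \<forall>js\<in>lists_of D k. b j js = 0"
    if "\<And>z. z \<in> Z (Suc k) \<Longrightarrow> peval (\<Sum>j<e. f k ^ j * G (b j)) z = 0" for e and b :: "nat \<Rightarrow> nat list \<Rightarrow> complex"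
    using that
  proof (induction e arbitrary: b)
    case (Suc e)
    define R where "R = (\<Sum>j<e. f k ^ j * G (b (Suc j)))"
    have split: "(\<Sum>j<Suc e. f k ^ j * G (b j)) = G (b 0) + f k * R"
      unfolding R_def sum.lessThan_Suc_shift sum_distrib_left by (simp add: algebra_simps)
    have "peval (G (b 0)) z = 0" if "z \<in> Z k" for z
    proof -
      have "z \<in> Z (Suc k)" using Suc.prems that \<open>\<And>i. i < Suc k \<Longrightarrow> Z i \<subseteq> Z (Suc i)\<close> by blast
      moreover have "peval (f k) z = 0" using that \<open>\<And>i z. i < Suc k \<Longrightarrow> z \<in> Z i \<Longrightarrow> peval (f i) z = 0\<close> by simp
      ultimately show ?thesis
        using Suc.prems[of z] unfolding split by (simp add: peval_ev ev.hom_add ev.hom_mult)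
    qed
    then have b0: "b 0 js = 0" if "js \<in> lists_of D k" for js
      using IH[of "b 0" js] Suc(2-) that \<open>\<And>i. i \<le> Suc k \<Longrightarrow> irreducible_closed (affine_closed n) (Z i)\<close>
        \<open>\<And>i. i < Suc k \<Longrightarrow> in_vars n (f i)\<close> \<open>\<And>i z. i < Suc k \<Longrightarrow> z \<in> Z i \<Longrightarrow> peval (f i) z = 0\<close>
        \<open>\<And>i. i < Suc k \<Longrightarrow> Z i \<subseteq> Z (Suc i)\<close> \<open>\<And>i. i < Suc k \<Longrightarrow> \<exists>z\<in>Z (Suc i). peval (f i) z \<noteq> 0\<close>
      unfolding G_def by simp
    then have "G (b 0) = 0" unfolding G_def by (intro sum.neutral) auto
    then have "peval (f k * R) z = 0" if "z \<in> Z (Suc k)" for z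
      using Suc.prems[OF that] unfolding split by simp
    moreover have "in_vars n R"
      unfolding R_def using inG \<open>\<And>i. i < Suc k \<Longrightarrow> in_vars n (f i)\<close>
      by (intro in_vars_sum in_vars_mult in_vars_power) auto
    ultimately have "\<forall>z\<in>Z (Suc k). peval R z = 0"
      using irreducible_closed_mult[of n "Z (Suc k)" "f k" R]
        \<open>\<And>i. i \<le> Suc k \<Longrightarrow> irreducible_closed (affine_closed n) (Z i)\<close>
        \<open>\<And>i. i < Suc k \<Longrightarrow> in_vars n (f i)\<close> \<open>\<And>i. i < Suc k \<Longrightarrow> \<exists>z\<in>Z (Suc i). peval (f i) z \<noteq> 0\<close>
      by blast
    then have "\<forall>j<e. \<forall>js\<in>lists_of D k. b (Suc j) js = 0"
      using Suc.IH[of "\<lambda>j. b (Suc j)"] by (simp add: R_def)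
    then show ?case using b0 by (auto simp: less_Suc_eq_0_disj)
  qed simp
  have "(\<Sum>js\<in>lists_of D (Suc k). Cst (c js) * listmon f js)
      = (\<Sum>j\<le>D. \<Sum>js\<in>lists_of D k. Cst (c (j # js)) * (f k ^ j * listmon f js))"
    unfolding sum_lists_of_Suc by (intro sum.cong refl) simp
  also have "\<dots> = (\<Sum>j<Suc D. f k ^ j * G (\<lambda>js. c (j # js)))"
    unfolding G_def sum_distrib_left lessThan_Suc_atMost by (intro sum.cong refl) (simp add: algebra_simps)
  finally have eq: "(\<Sum>js\<in>lists_of D (Suc k). Cst (c js) * listmon f js)
      = (\<Sum>j<Suc D. f k ^ j * G (\<lambda>js. c (j # js)))" .
  have "peval (\<Sum>j<Suc D. f k ^ j * G (\<lambda>js. c (j # js))) z = 0" if "z \<in> Z (Suc k)" for z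
    using Suc.prems(6)[OF that] unfolding eq .
  then have *: "\<forall>j<Suc D. \<forall>js\<in>lists_of D k. c (j # js) = 0"
    by (rule step)
  obtain j js' where "js = j # js'" "j \<le> D" "js' \<in> lists_of D k"
    using Suc.prems(7) by (cases js) auto
  then show ?case using * by simp
qed

text \<open>A chain of length d + 1 would yield d + 1 algebraically independent functions, hence (D
  + 1)^(d + 1) independent monomials of degree O(D), too many to be separated by O(D^d)
  functionals.\<close>

theorem no_chain_if_sep:
  assumes sep: "sep n V d" and ch: "irreducible_chain (affine_closed n) (Suc d) Z" and top: "Z (Suc d) \<subseteq> V"
  shows False
proof -
  have irr: "\<And>i. i \<le> Suc d \<Longrightarrow> irreducible_closed (affine_closed n) (Z i)"
    and psub: "\<And>i. i < Suc d \<Longrightarrow> Z i \<subset> Z (Suc i)"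
    using ch by (auto simp: irreducible_chain_def)
  have "\<exists>f. in_vars n f \<and> (\<forall>z\<in>Z i. peval f z = 0) \<and> (\<exists>z\<in>Z (Suc i). peval f z \<noteq> 0)" if i: "i < Suc d" for i
  proof -
    obtain S where S: "Z i = zero_locus n S" "\<forall>f\<in>S. in_vars n f"
      using irr[of i] i by (auto simp: irreducible_closed_def affine_closed_def)
    obtain z where z: "z \<in> Z (Suc i)" "z \<notin> Z i" using psub[OF i] by blast
    have "z \<in> carrier_vec n"
      using irr[of "Suc i"] i z(1) by (auto simp: irreducible_closed_def affine_closed_def zero_locus_def)
    then obtain f where "f \<in> S" "peval f z \<noteq> 0" using z(2) S(1) by (auto simp: zero_locus_def)
    then show ?thesis using S z(1) by (auto simp: zero_locus_def)
  qed
  then have "\<forall>i. \<exists>f. i < Suc d \<longrightarrow> in_vars n f \<and> (\<forall>z\<in>Z i. peval f z = 0) \<and> (\<exists>z\<in>Z (Suc i). peval f z \<noteq> 0)"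
    by blast
  then obtain f where f: "\<And>i. i < Suc d \<Longrightarrow> in_vars n (f i)"
    "\<And>i z. i < Suc d \<Longrightarrow> z \<in> Z i \<Longrightarrow> peval (f i) z = 0"
    "\<And>i. i < Suc d \<Longrightarrow> \<exists>z\<in>Z (Suc i). peval (f i) z \<noteq> 0"
    by metis
  obtain \<delta>' where \<delta>': "\<And>i. tdeg_le (\<delta>' i) (f i)"
    using choice[of "\<lambda>i D. tdeg_le D (f i)"] tdeg_le_ex by blast
  define \<delta> where "\<delta> = Max (\<delta>' ` {..d})"
  have \<delta>: "tdeg_le \<delta> (f i)" if "i < Suc d" for i
    by (rule tdeg_le_mono[OF \<delta>']) (use that in \<open>simp add: \<delta>_def\<close>)
  obtain C where C: "\<And>D. \<exists>L. finite L \<and> card L \<le> C * (D + 1) ^ d \<and> (\<forall>l\<in>L. clin l) \<and>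
     (\<forall>f. in_vars n f \<longrightarrow> tdeg_le D f \<longrightarrow> (\<forall>l\<in>L. l f = 0) \<longrightarrow> (\<forall>z\<in>V. peval f z = 0))"
    using sep by (auto simp: sep_def)
  define a where "a = \<delta> * Suc d + 1"
  \<comment> \<open>With this D the bound C * (a * (D + 1))^d for the functionals equals D * (D +
    1)^d, just below the number (D + 1)^(d + 1) of monomials.\<close>
  define D where "D = C * a ^ d"
  define B where "B = lists_of D (Suc d)"
  obtain L where L: "finite L" "card L \<le> C * (\<delta> * D * Suc d + 1) ^ d" "\<And>l. l \<in> L \<Longrightarrow> clin l"
     "\<And>f z. in_vars n f \<Longrightarrow> tdeg_le (\<delta> * D * Suc d) f \<Longrightarrow> (\<And>l. l \<in> L \<Longrightarrow> l f = 0) \<Longrightarrow> z \<in> V \<Longrightarrow> peval f z = 0"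
    using C[of "\<delta> * D * Suc d"] by auto
  have "\<delta> * D * Suc d + 1 \<le> a * (D + 1)" by (simp add: a_def algebra_simps)
  then have "card L \<le> C * (a * (D + 1)) ^ d"
    using L(2) by (meson le_trans mult_le_mono2 power_mono zero_le)
  also have "\<dots> = D * (D + 1) ^ d"
    unfolding power_mult_distrib by (simp only: D_def mult.assoc)
  also have "\<dots> < (D + 1) * (D + 1) ^ d"
    by simp
  also have "\<dots> = card B"
    using card_lists_length_eq[of "{..D}" "Suc d"] by (simp add: B_def)
  finally have "card L < card B" .
  moreover have finB: "finite B"
    unfolding B_def using finite_lists_length_eq[of "{..D}" "Suc d"] by simp
  ultimately obtain z where z: "\<exists>b\<in>B. z b \<noteq> 0" "\<forall>l\<in>L. (\<Sum>b\<in>B. l (listmon f b) * z b) = 0"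
    using underdetermined[OF L(1), of B "\<lambda>l b. l (listmon f b)"] by blast
  define F where "F = (\<Sum>js\<in>B. Cst (z js) * listmon f js)"
  have "peval F v = 0" if v: "v \<in> Z (Suc d)" for v
  proof (rule L(4))
    show "in_vars n F"
      unfolding F_def by (intro in_vars_sum in_vars_mult in_vars_listmon in_vars_Cst) (auto simp: B_def f)
    show "tdeg_le (\<delta> * D * Suc d) F"
      unfolding F_def
    proof (intro tdeg_le_sum tdeg_le_Cst_mult)
      fix js assume "js \<in> B"
      then show "tdeg_le (\<delta> * D * Suc d) (listmon f js)"
        using tdeg_le_listmon[of js \<delta> f D] \<delta> by (auto simp: B_def)
    qed
    show "l F = 0" if "l \<in> L" for l
      using z(2) that by (simp add: F_def clin_sum clin_Cst_mult L(3) mult.commute)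
    show "v \<in> V" using v top by blast
  qed
  then have F0: "peval (\<Sum>js\<in>lists_of D (Suc d). Cst (z js) * listmon f js) v = 0" if "v \<in> Z (Suc d)" for v
    using that unfolding F_def B_def .
  have "z js = 0" if "js \<in> B" for js
    by (rule chain_monomials_independent[OF irr f(1,2) _ f(3) F0])
      (use psub that in \<open>auto simp: B_def\<close>)
  then show False using z(1) by blast
qed

section \<open>Lower bounds for the local dimension\<close>

interpretation cv: vector_space "\<lambda>c f. Cst c * f"
  by unfold_locales (auto simp: Cst.hom_add Cst.hom_mult algebra_simps)

definition isum :: "cpoly set \<Rightarrow> cpoly set \<Rightarrow> cpoly set" where
  "isum I J = {a + b |a b. a \<in> I \<and> b \<in> J}"

lemma isumI: "a \<in> I \<Longrightarrow> b \<in> J \<Longrightarrow> a + b \<in> isum I J"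
  unfolding isum_def by blast

lemma pideal_isum:
  assumes "pideal I" "pideal J"
  shows "pideal (isum I J)"
  unfolding pideal_def
proof (intro conjI ballI allI)
  show "0 \<in> isum I J"
    using isumI[OF pidealD(1)[OF assms(1)] pidealD(1)[OF assms(2)]] by simp
  fix x assume "x \<in> isum I J"
  then obtain a b where x: "x = a + b" "a \<in> I" "b \<in> J" by (auto simp: isum_def)
  show "g * x \<in> isum I J" for g
    unfolding x(1) ring_distribs
    by (rule isumI[OF pidealD(3)[OF assms(1) x(2)] pidealD(3)[OF assms(2) x(3)]])
  show "x + y \<in> isum I J" if y: "y \<in> isum I J" for y
  proof -
    obtain a' b' where y': "y = a' + b'" "a' \<in> I" "b' \<in> J" using y by (auto simp: isum_def)
    have "(a + a') + (b + b') \<in> isum I J"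
      by (rule isumI[OF pidealD(2)[OF assms(1) x(2) y'(2)] pidealD(2)[OF assms(2) x(3) y'(3)]])
    then show ?thesis by (simp add: x y' algebra_simps)
  qed
qed

text \<open>The classes of F span the quotient by J; dimensions of quotients are bounded in this way
  without forming quotient spaces.\<close>

definition spanmod :: "cpoly set \<Rightarrow> cpoly set \<Rightarrow> bool" where
  "spanmod J F \<longleftrightarrow> (\<forall>r. \<exists>s\<in>cv.span F. r - s \<in> J)"

lemma span_mult_image:
  assumes "s \<in> cv.span G"
  shows "f * s \<in> cv.span ((*) f ` G)"
  using assms
proof (induction rule: cv.span_induct_alt)
  case base
  show ?case by (simp add: cv.span_zero)
next
  case (step c x y)
  have "f * (Cst c * x + y) = Cst c * (f * x) + f * y" by (simp add: algebra_simps)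
  then show ?case using step by (auto intro: cv.span_add cv.span_scale cv.span_base)
qed

locale maximal_powers =
  fixes n :: nat and p :: "complex vec"
begin

text \<open>The point p, continued by zeros so that the variables beyond n belong to its maximal
  ideal.\<close>

definition q :: "nat \<Rightarrow> complex" where
  "q k = (if k < n then p $ k else 0)"

definition shift :: "cpoly \<Rightarrow> cpoly" where
  "shift = evg Cst (\<lambda>k. Var k + Cst (q k))"

definition unshift :: "cpoly \<Rightarrow> cpoly" where
  "unshift = evg Cst (\<lambda>k. Var k - Cst (q k))"

sublocale shift: comm_ring_hom shift
  unfolding shift_def by (rule evg_hom[OF Cst_hom])

sublocale unshift: comm_ring_hom unshift
  unfolding unshift_def by (rule evg_hom[OF Cst_hom])

lemma shift_Cst [simp]: "shift (Cst c) = Cst c" and shift_Var: "shift (Var k) = Var k + Cst (q k)"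
  unfolding shift_def by (simp_all add: evg_Cst[OF Cst_hom] evg_Var[OF Cst_hom])

lemma unshift_Cst [simp]: "unshift (Cst c) = Cst c" and unshift_Var: "unshift (Var k) = Var k - Cst (q k)"
  unfolding unshift_def by (simp_all add: evg_Cst[OF Cst_hom] evg_Var[OF Cst_hom])

lemma shift_unshift: "shift (unshift f) = f"
  by (induction f rule: cpoly_induct)
    (auto simp: shift_Var unshift_Var shift.hom_minus shift.hom_add unshift.hom_add shift.hom_mult unshift.hom_mult)

text \<open>The \<open>k\<close>-th power of the maximal ideal of the point \<open>p\<close>.\<close>

definition M :: "nat \<Rightarrow> cpoly set" where
  "M k = {f. \<forall>m\<in>keys (shift f). k \<le> mdeg m}"

lemma pideal_M: "pideal (M k)"
  unfolding pideal_def
proof (intro conjI ballI allI)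
  show "0 \<in> M k" by (simp add: M_def)
  show "f + g \<in> M k" if "f \<in> M k" "g \<in> M k" for f g
    using that keys_add[of "shift f" "shift g"] by (auto simp: M_def shift.hom_add)
  show "g * f \<in> M k" if "f \<in> M k" for f g
    using that by (auto simp: M_def shift.hom_mult mdeg_add trans_le_add2 elim!: keys_mult_cpoly)
qed

lemma M_0: "M 0 = UNIV"
  by (simp add: M_def)

lemma M_mult: "f \<in> M (Suc 0) \<Longrightarrow> g \<in> M k \<Longrightarrow> f * g \<in> M (Suc k)"
  by (auto simp: M_def shift.hom_mult mdeg_add elim!: keys_mult_cpoly) fastforce

lemma M_power: "f \<in> M (Suc 0) \<Longrightarrow> f ^ k \<in> M k"
  by (induction k) (auto simp: M_0 intro: M_mult)

lemma ev_zero: "ev (\<lambda>_. 0) f = lookup f 0"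
proof -
  have "monev (\<lambda>_. 0 :: complex) m = (if m = 0 then 1 else 0)" for m
  proof (cases "m = 0")
    case False
    then obtain i where "lookup m i \<noteq> 0" by (metis lookup_zero poly_mapping_eqI)
    then show ?thesis using False by (auto simp: monev_def in_keys_iff intro!: bexI[of _ i])
  qed simp
  then have "ev (\<lambda>_. 0) f = (\<Sum>m\<in>keys f. if m = 0 then lookup f 0 else 0)"
    unfolding evg_def by (intro sum.cong) auto
  then show ?thesis by (auto simp: in_keys_iff)
qed

lemma ev_shift: "ev (\<lambda>_. 0) (shift f) = ev q f"
  by (induction f rule: cpoly_induct)
    (auto simp: shift_Var shift.hom_add shift.hom_mult ev.hom_add ev.hom_mult)

lemma M_1_iff: "f \<in> M (Suc 0) \<longleftrightarrow> ev q f = 0"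
proof -
  have "ev q f = lookup (shift f) 0" by (metis ev_shift ev_zero)
  moreover have "f \<in> M (Suc 0) \<longleftrightarrow> 0 \<notin> keys (shift f)"
    unfolding M_def using mdeg_eq_0 by (auto simp: Suc_le_eq)
  ultimately show ?thesis by (simp add: in_keys_iff)
qed

lemma pprime_M: "pprime (M (Suc 0))"
  unfolding pprime_def using pideal_M M_1_iff by (auto simp: ev.hom_mult)

text \<open>\<open>growth e I\<close>: the dimension of the quotient by \<open>I + M k\<close> is \<open>O(k^e)\<close>.\<close>

definition growth :: "nat \<Rightarrow> cpoly set \<Rightarrow> bool" where
  "growth e I \<longleftrightarrow> (\<exists>C. \<forall>k\<ge>1. \<exists>F. finite F \<and> card F \<le> C * k ^ e \<and> spanmod (isum I (M k)) F)"

text \<open>Modulo I some element \<open>w\<close> of the maximal ideal equals 1. Then 1 lies in I +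
  M k for every k, and all quotients are zero.\<close>

lemma growth_not_subset:
  assumes I: "pideal I" and u: "u \<in> I" "u \<notin> M (Suc 0)"
  shows "growth e I"
proof -
  define w where "w = 1 - Cst (1 / ev q u) * u"
  have "w \<in> M (Suc 0)" using u(2) by (simp add: M_1_iff w_def ev.hom_mult ev.hom_minus)
  have "spanmod (isum I (M k)) {}" for k
  proof -
    have "1 - w ^ k \<in> I"
    proof (induction k)
      case 0
      show ?case by (simp add: pidealD(1)[OF I])
    next
      case (Suc k)
      have "1 - w ^ Suc k = (1 - w ^ k) + w ^ k * (Cst (1 / ev q u) * u)"
        by (simp add: w_def algebra_simps)
      then show ?case
        using pidealD(2)[OF I Suc pidealD(3)[OF I pidealD(3)[OF I u(1)]]] by metis
    qed
    then have "r * (1 - w ^ k) + r * w ^ k \<in> isum I (M k)" for r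
      by (intro isumI pidealD(3)[OF I] pidealD(3)[OF pideal_M] M_power[OF \<open>w \<in> M (Suc 0)\<close>])
    then have "r \<in> isum I (M k)" for r by (simp add: algebra_simps)
    then show ?thesis unfolding spanmod_def using cv.span_zero by blast
  qed
  then show ?thesis unfolding growth_def by (intro exI[of _ 0]) (auto intro!: exI[of _ "{}"])
qed

lemma growth_M: "growth 0 (M (Suc 0))"
proof -
  have "spanmod (isum (M (Suc 0)) (M k)) {1}" for k
    unfolding spanmod_def
  proof
    fix r
    have "Cst (ev q r) * 1 \<in> cv.span {1}" by (intro cv.span_scale cv.span_base) simp
    moreover have "r - Cst (ev q r) * 1 \<in> M (Suc 0)" by (simp add: M_1_iff ev.hom_minus)
    then have "(r - Cst (ev q r) * 1) + 0 \<in> isum (M (Suc 0)) (M k)"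
      by (rule isumI) (rule pidealD(1)[OF pideal_M])
    ultimately show "\<exists>s\<in>cv.span {1}. r - s \<in> isum (M (Suc 0)) (M k)" by (intro bexI) auto
  qed
  then show ?thesis unfolding growth_def by (intro exI[of _ 1]) (auto intro!: exI[of _ "{1}"])
qed

text \<open>With M k adjoined to all ideals, multiplication by \<open>f\<close> maps the quotient by
  (I, g) onto the kernel of the map from the quotient by I to the quotient by (I, f), because f * g
  lies in I.\<close>

lemma spanmod_mult:
  assumes I: "pideal I" and fg: "f * g \<in> I"
    and F: "spanmod (isum (padj I f) (M k)) F" and G: "spanmod (isum (padj I g) (M k)) G"
  shows "spanmod (isum I (M k)) (F \<union> (*) f ` G)"
  unfolding spanmod_def
proof
  fix r
  obtain s where s: "s \<in> cv.span F" "r - s \<in> isum (padj I f) (M k)"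
    using F by (auto simp: spanmod_def)
  then obtain i h m where 1: "r - s = (i + h * f) + m" "i \<in> I" "m \<in> M k"
    by (auto simp: isum_def padj_def)
  obtain s' where s': "s' \<in> cv.span G" "h - s' \<in> isum (padj I g) (M k)"
    using G by (auto simp: spanmod_def)
  then obtain i' h' m' where 2: "h - s' = (i' + h' * g) + m'" "i' \<in> I" "m' \<in> M k"
    by (auto simp: isum_def padj_def)
  have "r - (s + f * s') = (r - s) - h * f + f * (h - s')" by (simp add: algebra_simps)
  also have "\<dots> = (i + f * i' + h' * (f * g)) + (m + f * m')"
    unfolding 1 2 by (simp add: algebra_simps)
  also have "\<dots> \<in> isum I (M k)"
    by (intro isumI pidealD(2)[OF I] pidealD(2)[OF pideal_M] 1(2,3) pidealD(3)[OF I 2(2)]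
        pidealD(3)[OF I fg] pidealD(3)[OF pideal_M 2(3)])
  finally have "r - (s + f * s') \<in> isum I (M k)" .
  moreover have "s + f * s' \<in> cv.span (F \<union> (*) f ` G)"
    using s(1) span_mult_image[OF s'(1), of f]
    by (intro cv.span_add) (auto intro: cv.span_mono[THEN subsetD, rotated])
  ultimately show "\<exists>s\<in>cv.span (F \<union> (*) f ` G). r - s \<in> isum I (M k)" by blast
qed

lemma growth_mult:
  assumes I: "pideal I" "f * g \<in> I" and F: "growth e (padj I f)" and G: "growth e (padj I g)"
  shows "growth e I"
proof -
  obtain C where C: "\<And>k. k \<ge> 1 \<Longrightarrow> \<exists>F. finite F \<and> card F \<le> C * k ^ e \<and> spanmod (isum (padj I f) (M k)) F"
    using F by (auto simp: growth_def)
  obtain C' where C': "\<And>k. k \<ge> 1 \<Longrightarrow> \<exists>F. finite F \<and> card F \<le> C' * k ^ e \<and> spanmod (isum (padj I g) (M k)) F"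
    using G by (auto simp: growth_def)
  have "\<exists>F. finite F \<and> card F \<le> (C + C') * k ^ e \<and> spanmod (isum I (M k)) F" if k: "k \<ge> 1" for k
  proof -
    obtain F where F: "finite F" "card F \<le> C * k ^ e" "spanmod (isum (padj I f) (M k)) F"
      using C[OF k] by blast
    obtain G where G: "finite G" "card G \<le> C' * k ^ e" "spanmod (isum (padj I g) (M k)) G"
      using C'[OF k] by blast
    have "card (F \<union> (*) f ` G) \<le> card F + card G"
      using card_Un_le[of F "(*) f ` G"] card_image_le[OF G(1), of "(*) f"] by simp
    also have "\<dots> \<le> (C + C') * k ^ e" using F(2) G(2) by (simp add: algebra_simps)
    finally show ?thesis
      using spanmod_mult[OF I F(3) G(3)] F(1) G(1) by (intro exI[of _ "F \<union> (*) f ` G"]) auto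
  qed
  then show ?thesis unfolding growth_def by blast
qed

text \<open>Multiplication by \<open>f\<close> maps M K into M (Suc K). Passing from K to Suc K
  therefore costs only the dimension of the quotient by (I, f) + M (Suc K), and these costs add
  up.\<close>

lemma spanmod_padj:
  assumes I: "pideal I" and f: "f \<in> M (Suc 0)"
    and F: "\<And>k. k \<ge> 1 \<Longrightarrow> finite (F k) \<and> spanmod (isum (padj I f) (M k)) (F k)"
  shows "\<exists>G. finite G \<and> card G \<le> (\<Sum>k=1..K. card (F k)) \<and> spanmod (isum I (M K)) G"
proof (induction K)
  case 0
  have "r \<in> isum I (M 0)" for r
    using isumI[OF pidealD(1)[OF I], of r "M 0"] by (simp add: M_0)
  then have "spanmod (isum I (M 0)) {}" unfolding spanmod_def using cv.span_zero by blast
  then show ?case by (intro exI[of _ "{}"]) simp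
next
  case (Suc K)
  then obtain G where G: "finite G" "card G \<le> (\<Sum>k=1..K. card (F k))" "spanmod (isum I (M K)) G"
    by blast
  have F': "finite (F (Suc K))" "spanmod (isum (padj I f) (M (Suc K))) (F (Suc K))"
    using F[of "Suc K"] by auto
  have "spanmod (isum I (M (Suc K))) (F (Suc K) \<union> (*) f ` G)"
    unfolding spanmod_def
  proof
    fix r
    obtain s where s: "s \<in> cv.span (F (Suc K))" "r - s \<in> isum (padj I f) (M (Suc K))"
      using F'(2) by (auto simp: spanmod_def)
    then obtain i h m where 1: "r - s = (i + h * f) + m" "i \<in> I" "m \<in> M (Suc K)"
      by (auto simp: isum_def padj_def)
    obtain s' where s': "s' \<in> cv.span G" "h - s' \<in> isum I (M K)"
      using G(3) by (auto simp: spanmod_def)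
    then obtain i' m' where 2: "h - s' = i' + m'" "i' \<in> I" "m' \<in> M K"
      by (auto simp: isum_def)
    have "r - (s + f * s') = (r - s) - h * f + f * (h - s')" by (simp add: algebra_simps)
    also have "\<dots> = (i + f * i') + (m + f * m')"
      unfolding 1 2 by (simp add: algebra_simps)
    also have "\<dots> \<in> isum I (M (Suc K))"
      by (intro isumI pidealD(2)[OF I] pidealD(2)[OF pideal_M] 1(2,3) pidealD(3)[OF I 2(2)]
          M_mult[OF f 2(3)])
    finally have "r - (s + f * s') \<in> isum I (M (Suc K))" .
    moreover have "s + f * s' \<in> cv.span (F (Suc K) \<union> (*) f ` G)"
      using s(1) span_mult_image[OF s'(1), of f]
      by (intro cv.span_add) (auto intro: cv.span_mono[THEN subsetD, rotated])
    ultimately show "\<exists>s\<in>cv.span (F (Suc K) \<union> (*) f ` G). r - s \<in> isum I (M (Suc K))" by blast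
  qed
  moreover have "card (F (Suc K) \<union> (*) f ` G) \<le> (\<Sum>k=1..Suc K. card (F k))"
    using card_Un_le[of "F (Suc K)" "(*) f ` G"] card_image_le[OF G(1), of "(*) f"] G(2) by simp
  ultimately show ?case using F'(1) G(1) by (intro exI[of _ "F (Suc K) \<union> (*) f ` G"]) auto
qed

text \<open>Adding up K bounds of order at most K^e gives order K^(e + 1): one more equation lowers
  the growth exponent by at most one. This is the core of Krull's principal ideal theorem.\<close>

lemma growth_padj:
  assumes I: "pideal I" and f: "f \<in> M (Suc 0)" and g: "growth e (padj I f)"
  shows "growth (Suc e) I"
proof -
  obtain C where C: "\<And>k. k \<ge> 1 \<Longrightarrow> \<exists>F. finite F \<and> card F \<le> C * k ^ e \<and> spanmod (isum (padj I f) (M k)) F"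
    using g by (auto simp: growth_def)
  then obtain F where F: "\<And>k. k \<ge> 1 \<Longrightarrow> finite (F k) \<and> card (F k) \<le> C * k ^ e \<and> spanmod (isum (padj I f) (M k)) (F k)"
    by metis
  have "\<exists>G. finite G \<and> card G \<le> C * K ^ Suc e \<and> spanmod (isum I (M K)) G" for K
  proof -
    obtain G where G: "finite G" "card G \<le> (\<Sum>k=1..K. card (F k))" "spanmod (isum I (M K)) G"
      using spanmod_padj[OF I f, of F K] F by blast
    have "(\<Sum>k=1..K. card (F k)) \<le> (\<Sum>k=1..K. C * K ^ e)"
    proof (rule sum_mono)
      fix k assume k: "k \<in> {1..K}"
      then have "card (F k) \<le> C * k ^ e" using F by simp
      also have "\<dots> \<le> C * K ^ e" using k by (simp add: power_mono)
      finally show "card (F k) \<le> C * K ^ e" .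
    qed
    then show ?thesis using G by (intro exI[of _ G]) (auto simp: mult.left_commute)
  qed
  then show ?thesis unfolding growth_def by blast
qed

section \<open>Growth of the polynomial ring and chains of zero sets\<close>

abbreviation tail_vars :: "cpoly set" where
  "tail_vars \<equiv> Var ` {n..}"

text \<open>Modulo the variables beyond n, the monomials of degree below k around p are independent,
  and there are about k^(e + 1) of them.\<close>

lemma not_growth_tail_vars:
  assumes "n = Suc e"
  shows "\<not> growth e (pgen tail_vars)"
proof
  assume "growth e (pgen tail_vars)"
  then obtain C where C: "\<And>k. k \<ge> 1 \<Longrightarrow> \<exists>F. finite F \<and> card F \<le> C * k ^ e \<and> spanmod (isum (pgen tail_vars) (M k)) F"
    by (auto simp: growth_def)
  \<comment> \<open>Chosen so that C * k^e \<le> u * (u + 1)^e, while at least (u + 1)^(e + 1)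
    exponents are available.\<close>
  define u where "u = C * n ^ e"
  define k where "k = n * u + 1"
  define B where "B = exps_le n (n * u)"
  obtain F where F: "finite F" "card F \<le> C * k ^ e" "spanmod (isum (pgen tail_vars) (M k)) F"
    using C[of k] by (auto simp: k_def)
  have "k \<le> n * (u + 1)" using assms by (simp add: k_def)
  then have "C * k ^ e \<le> C * (n * (u + 1)) ^ e" by (simp add: power_mono)
  also have "\<dots> = u * (u + 1) ^ e"
    unfolding power_mult_distrib by (simp only: u_def mult.assoc)
  also have "\<dots> < (u + 1) * (u + 1) ^ e"
    by simp
  also have "\<dots> \<le> card B" using card_exps_le_ge[of u n] assms by (simp add: B_def)
  finally have "card F < card B" using F(2) by simp
  have "\<forall>m. \<exists>s\<in>cv.span F. unshift (single m 1) - s \<in> isum (pgen tail_vars) (M k)"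
    using F(3) by (auto simp: spanmod_def)
  then obtain s where s: "\<And>m. s m \<in> cv.span F" "\<And>m. unshift (single m 1) - s m \<in> isum (pgen tail_vars) (M k)"
    by metis
  have "\<forall>m. \<exists>c. s m = (\<Sum>\<phi>\<in>F. Cst (c \<phi>) * \<phi>)"
    using s(1) cv.span_finite[OF F(1)] by (auto simp: image_iff)
  then obtain c where c: "\<And>m. s m = (\<Sum>\<phi>\<in>F. Cst (c m \<phi>) * \<phi>)" by metis
  obtain z where z: "\<exists>m\<in>B. z m \<noteq> 0" "\<forall>\<phi>\<in>F. (\<Sum>m\<in>B. c m \<phi> * z m) = 0"
    using underdetermined[OF F(1) _ \<open>card F < card B\<close>, of "\<lambda>\<phi> m. c m \<phi>"] by (auto simp: B_def)
  have "(\<Sum>m\<in>B. Cst (z m) * s m) = (\<Sum>\<phi>\<in>F. Cst (\<Sum>m\<in>B. c m \<phi> * z m) * \<phi>)"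
    unfolding c sum_distrib_left sum_distrib_right Cst.hom_sum
    by (subst sum.swap) (simp add: Cst.hom_mult mult_ac)
  also have "\<dots> = 0" using z(2) by simp
  finally have "(\<Sum>m\<in>B. Cst (z m) * unshift (single m 1))
      = (\<Sum>m\<in>B. Cst (z m) * (unshift (single m 1) - s m))"
    by (simp add: right_diff_distrib sum_subtractf)
  also have "\<dots> \<in> isum (pgen tail_vars) (M k)"
    by (intro pideal_sum pidealD(3) pideal_isum pideal_pgen pideal_M s(2))
  finally obtain a b where ab: "(\<Sum>m\<in>B. Cst (z m) * unshift (single m 1)) = a + b"
    "a \<in> pgen tail_vars" "b \<in> M k"
    by (auto simp: isum_def)
  have "shift (\<Sum>m\<in>B. Cst (z m) * unshift (single m 1)) = (\<Sum>m\<in>B. single m (z m))"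
    by (simp add: shift.hom_sum shift.hom_mult shift_unshift) (simp add: Cst_def mult_single)
  then have eq: "(\<Sum>m\<in>B. single m (z m)) = shift a + shift b"
    using ab(1) by (simp add: shift.hom_add)
  \<comment> \<open>The translation fixes the variables beyond n, because \<open>q\<close> is zero
    there; so every monomial of \<open>shift a\<close> contains one of them.\<close>
  have sa: "\<forall>m\<in>keys (shift a). \<not> keys m \<subseteq> {..<n}"
    using ab(2)
  proof induction
    case (step f s g)
    then obtain l where l: "l \<ge> n" "s = Var l" by auto
    then have "shift s = Var l" by (simp add: shift_Var q_def)
    have "\<not> keys m \<subseteq> {..<n}" if "m \<in> keys (shift g * Var l)" for m
      using that l(1) by (auto simp: Var_def keys_nat_add elim!: keys_mult_cpoly)
    then show ?case
      using step.IH keys_add[of "shift f" "shift g * Var l"] \<open>shift s = Var l\<close>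
      by (auto simp: shift.hom_add shift.hom_mult)
  qed simp
  have "z m = 0" if m: "m \<in> B" for m
  proof -
    have "lookup (\<Sum>m\<in>B. single m (z m)) m = (\<Sum>l\<in>B. if l = m then z m else 0)"
      by (auto simp: lookup_sum lookup_single when_def intro!: sum.cong)
    then have "z m = lookup (shift a) m + lookup (shift b) m"
      using m eq by (simp add: lookup_add B_def)
    moreover have "m \<notin> keys (shift a)" using sa m by (auto simp: B_def exps_le_def)
    moreover have "m \<notin> keys (shift b)" using ab(3) m by (auto simp: B_def exps_le_def M_def k_def)
    ultimately show ?thesis by (simp add: in_keys_iff)
  qed
  then show False using z(1) by blast
qed

text \<open>Ideals live in all variables but points in n-space: the missing coordinates are filled
  with 0, in accordance with \<open>tail_vars\<close> lying in the ideal.\<close>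

definition VV :: "cpoly set \<Rightarrow> complex vec set" where
  "VV I = {z \<in> carrier_vec n. \<forall>f\<in>I. ev (\<lambda>i. if i < n then z $ i else 0) f = 0}"

lemma VV_eq_zero_locus:
  assumes I: "pideal I" "tail_vars \<subseteq> I"
  shows "VV I = zero_locus n {f \<in> I. in_vars n f}"
proof -
  have tr: "trunc n f \<in> I \<and> ev (\<lambda>i. if i < n then z $ i else 0) f = peval (trunc n f) z"
    if "f \<in> I" for f and z :: "complex vec"
  proof
    have d: "f - trunc n f \<in> pgen tail_vars"
      by (rule trunc_cong[OF pideal_pgen]) (auto intro: pgen_superset)
    then have "f - trunc n f \<in> I" using pgen_minimal[OF I] by blast
    then show "trunc n f \<in> I" using pideal_cong_iff[OF I(1)] that by blast
    have "ev (\<lambda>i. if i < n then z $ i else 0) (f - trunc n f) = 0"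
      by (rule ev_pgen[OF d]) auto
    moreover have "ev (\<lambda>i. if i < n then z $ i else 0) (trunc n f) = ev (($) z) (trunc n f)"
      by (rule evg_cong[OF in_vars_trunc]) simp
    ultimately show "ev (\<lambda>i. if i < n then z $ i else 0) f = peval (trunc n f) z"
      by (simp add: ev.hom_minus peval_ev)
  qed
  have same: "ev (\<lambda>i. if i < n then z $ i else 0) f = peval f z" if "in_vars n f" for f and z :: "complex vec"
    unfolding peval_ev by (rule evg_cong[OF that]) simp
  show ?thesis
  proof (intro equalityI subsetI)
    fix z assume "z \<in> VV I"
    then show "z \<in> zero_locus n {f \<in> I. in_vars n f}"
      unfolding VV_def zero_locus_def using same[of _ z] by force
  next
    fix z assume z: "z \<in> zero_locus n {f \<in> I. in_vars n f}"
    have "ev (\<lambda>i. if i < n then z $ i else 0) f = 0" if "f \<in> I" for f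
      using z tr[OF that, of z] in_vars_trunc[of n f] by (simp add: zero_locus_def)
    then show "z \<in> VV I" using z by (simp add: VV_def zero_locus_def)
  qed
qed

text \<open>By the Nullstellensatz a polynomial outside P is nonzero at some zero of P. Products of
  such polynomials stay outside P, so two closed sets cannot cover the zeros of P unless one of them
  does.\<close>

lemma VV_irreducible:
  assumes P: "pprime P" "tail_vars \<subseteq> P"
  shows "irreducible_closed (affine_closed n) (VV P)"
proof -
  have id: "pideal P" using P(1) by (simp add: pprime_def)
  have point: "\<exists>z\<in>VV P. peval f z \<noteq> 0" if f: "f \<notin> P" "in_vars n f" for f
  proof -
    obtain x where x: "\<And>g. g \<in> P \<Longrightarrow> ev x g = 0" "ev x f \<noteq> 0"
      using prime_zero[OF P(1) f(1)] by blast
    have "x i = 0" if "i \<ge> n" for i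
      using x(1)[of "Var i"] P(2) that by auto
    then have x': "(\<lambda>i. if i < n then vec n x $ i else 0) = x" by (auto simp: fun_eq_iff)
    have "vec n x \<in> VV P"
    unfolding VV_def mem_Collect_eq x' using x(1) by simp
    moreover have "peval f (vec n x) = ev x f"
      unfolding peval_ev by (rule evg_cong[OF f(2)]) simp
    ultimately show ?thesis using x(2) by metis
  qed
  show ?thesis
    unfolding irreducible_closed_def
  proof (intro conjI ballI impI)
    show "VV P \<in> affine_closed n"
      unfolding VV_eq_zero_locus[OF id P(2)] by (rule zero_locus_closed) simp
    show "VV P \<noteq> {}" using point[of 1] P(1) by (auto simp: pprime_def)
    fix A B assume AB: "A \<in> affine_closed n" "B \<in> affine_closed n" "VV P \<subseteq> A \<union> B"
    obtain S T where A: "A = zero_locus n S" "\<forall>f\<in>S. in_vars n f"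
      and B: "B = zero_locus n T" "\<forall>f\<in>T. in_vars n f"
      using AB by (auto simp: affine_closed_def)
    have inP: "VV P \<subseteq> zero_locus n S" if "S \<subseteq> P" "\<forall>f\<in>S. in_vars n f" for S
      unfolding VV_eq_zero_locus[OF id P(2)] using that by (auto simp: zero_locus_def)
    show "VV P \<subseteq> A \<or> VV P \<subseteq> B"
    proof (rule ccontr)
      assume "\<not> ?thesis"
      then have "\<not> S \<subseteq> P" "\<not> T \<subseteq> P"
        using inP[OF _ A(2)] inP[OF _ B(2)] A(1) B(1) by auto
      then obtain f g where fg: "f \<in> S" "f \<notin> P" "g \<in> T" "g \<notin> P"
        by blast
      then have "f * g \<notin> P" "in_vars n (f * g)"
        using P(1) A(2) B(2) by (auto simp: pprime_def intro: in_vars_mult)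
      then obtain z where z: "z \<in> VV P" "peval (f * g) z \<noteq> 0" using point by blast
      then show False
        using AB(3) A(1) B(1) fg by (auto simp: zero_locus_def peval_ev ev.hom_mult)
    qed
  qed
qed

lemma VV_strict:
  assumes P: "pprime P" "tail_vars \<subseteq> P" and f: "f \<notin> P"
  shows "\<exists>z\<in>VV P. ev (\<lambda>i. if i < n then z $ i else 0) f \<noteq> 0"
proof -
  obtain x where x: "\<And>g. g \<in> P \<Longrightarrow> ev x g = 0" "ev x f \<noteq> 0"
    using prime_zero[OF P(1) f] by blast
  have "x i = 0" if "i \<ge> n" for i
    using x(1)[of "Var i"] P(2) that by auto
  then have x': "(\<lambda>i. if i < n then vec n x $ i else 0) = x" by (auto simp: fun_eq_iff)
  have "vec n x \<in> VV P"
    unfolding VV_def mem_Collect_eq x' using x(1) by simp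
  then show ?thesis using x(2) x' by metis
qed

lemma VV_antimono: "I \<subseteq> J \<Longrightarrow> VV J \<subseteq> VV I"
  unfolding VV_def by blast

lemma tail_vars_M: "tail_vars \<subseteq> M (Suc 0)"
  by (auto simp: M_1_iff q_def)

lemma point_in_VV_M: "p \<in> carrier_vec n \<Longrightarrow> p \<in> VV (M (Suc 0))"
proof -
  have "(\<lambda>i. if i < n then p $ i else 0) = q" by (auto simp: q_def)
  then show "p \<in> carrier_vec n \<Longrightarrow> p \<in> VV (M (Suc 0))"
    by (auto simp: VV_def M_1_iff)
qed

text \<open>An ideal maximal among those of large growth is prime by \<open>growth_mult\<close>; it
  exists by the ascending chain condition, and \<open>growth_not_subset\<close> places it inside the
  maximal ideal of p.\<close>

lemma prime_of_growth:
  assumes I: "pideal I" "tail_vars \<subseteq> I" "\<not> growth e I"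
  obtains P where "pprime P" "I \<subseteq> P" "\<not> growth e P" "P \<subseteq> M (Suc 0)"
proof -
  define \<F> where "\<F> = {J. pideal J \<and> tail_vars \<subseteq> J \<and> \<not> growth e J}"
  have F: "I \<in> \<F>" "\<And>J. J \<in> \<F> \<Longrightarrow> pideal J" "\<And>J k. J \<in> \<F> \<Longrightarrow> k \<ge> n \<Longrightarrow> Var k \<in> J"
    using I unfolding \<F>_def by auto
  have "\<exists>P\<in>\<F>. I \<subseteq> P \<and> (\<forall>J\<in>\<F>. \<not> P \<subset> J)"
  proof (rule pideal_maximal[OF F])
    fix X assume "X \<in> \<F>" "I \<subseteq> X" "\<And>J. J \<in> \<F> \<Longrightarrow> \<not> X \<subset> J"
    then show ?thesis by (intro bexI[of _ X] conjI ballI)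
  qed
  then obtain P where P: "P \<in> \<F>" "I \<subseteq> P" "\<forall>J\<in>\<F>. \<not> P \<subset> J"
    by auto
  have id: "pideal P" and ng: "\<not> growth e P" using P(1) by (auto simp: \<F>_def)
  have "P \<subseteq> M (Suc 0)" using growth_not_subset[OF id] ng by blast
  have "pprime P"
    unfolding pprime_def
  proof (intro conjI allI impI)
    have "(1::cpoly) \<notin> M (Suc 0)" by (simp add: M_1_iff)
    then show "1 \<notin> P" using \<open>P \<subseteq> M (Suc 0)\<close> by blast
    fix f g assume fg: "f * g \<in> P"
    have gr: "growth e (padj P h)" if "h \<notin> P" for h
    proof -
      have "P \<subset> padj P h" using padj(2,3)[OF id, of h] that by blast
      then have "padj P h \<notin> \<F>" using P(3) by blast
      moreover have "tail_vars \<subseteq> padj P h" using padj(2)[OF id, of h] P(1) unfolding \<F>_def by blast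
      ultimately show ?thesis using padj(1)[OF id, of h] unfolding \<F>_def by blast
    qed
    show "f \<in> P \<or> g \<in> P" using growth_mult[OF id fg] gr ng by blast
  qed (rule id)
  then show ?thesis using that P(2) ng \<open>P \<subseteq> M (Suc 0)\<close> by blast
qed

text \<open>A prime P over I still has large growth and so differs from the maximal ideal of p.
  Adjoining an \<open>f\<close> of that ideal outside P lowers the growth by at most one; a chain
  inside the smaller zero set is then extended by \<open>VV P\<close>.\<close>

lemma chain_of_growth:
  assumes "p \<in> carrier_vec n" "pideal I" "tail_vars \<subseteq> I" "\<not> growth e I"
  shows "\<exists>Z. irreducible_chain (affine_closed n) (Suc e) Z \<and> p \<in> Z 0 \<and> Z (Suc e) \<subseteq> VV I"
  using assms(2-4)
proof (induction e arbitrary: I)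
  case 0
  obtain P where P: "pprime P" "I \<subseteq> P" "\<not> growth 0 P" "P \<subseteq> M (Suc 0)"
    using prime_of_growth[OF 0] by blast
  then have tv: "tail_vars \<subseteq> P" using 0 by blast
  have "P \<noteq> M (Suc 0)" using P(3) growth_M by blast
  then obtain f where f: "f \<in> M (Suc 0)" "f \<notin> P" using P(4) by blast
  have "VV (M (Suc 0)) \<subset> VV P"
    using VV_antimono[OF P(4)] VV_strict[OF P(1) tv f(2)] f(1) by (auto simp: VV_def)
  then show ?case
    using VV_irreducible[OF P(1) tv] VV_irreducible[OF pprime_M tail_vars_M] point_in_VV_M[OF assms(1)]
      VV_antimono[OF P(2)]
    by (intro exI[of _ "\<lambda>i. if i = 0 then VV (M (Suc 0)) else VV P"]) (auto simp: irreducible_chain_def)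
next
  case (Suc e)
  obtain P where P: "pprime P" "I \<subseteq> P" "\<not> growth (Suc e) P" "P \<subseteq> M (Suc 0)"
    using prime_of_growth[OF Suc.prems] by blast
  then have tv: "tail_vars \<subseteq> P" and id: "pideal P" using Suc by (auto simp: pprime_def)
  have "growth (Suc e) (M (Suc 0))"
  proof -
    have "growth 0 (M (Suc 0))" by (rule growth_M)
    then obtain C where C: "\<And>k. k \<ge> 1 \<Longrightarrow> \<exists>F. finite F \<and> card F \<le> C \<and> spanmod (isum (M (Suc 0)) (M k)) F"
      by (auto simp: growth_def)
    have "\<exists>F. finite F \<and> card F \<le> C * k ^ Suc e \<and> spanmod (isum (M (Suc 0)) (M k)) F" if "k \<ge> 1" for k
    proof -
      have "C \<le> C * k ^ Suc e" using that by simp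
      then show ?thesis using C[OF that] le_trans by blast
    qed
    then show ?thesis unfolding growth_def by blast
  qed
  then have "P \<noteq> M (Suc 0)" using P(3) by blast
  then obtain f where f: "f \<in> M (Suc 0)" "f \<notin> P" using P(4) by blast
  have "\<not> growth e (padj P f)" using growth_padj[OF id f(1)] P(3) by blast
  then obtain Z where Z: "irreducible_chain (affine_closed n) (Suc e) Z" "p \<in> Z 0" "Z (Suc e) \<subseteq> VV (padj P f)"
    using Suc.IH[of "padj P f"] padj[OF id, of f] tv by blast
  have "VV (padj P f) \<subset> VV P"
    using VV_antimono[OF padj(2)[OF id]] VV_strict[OF P(1) tv f(2)] padj(3)[OF id, of f]
    by (auto simp: VV_def)
  then have "Z (Suc e) \<subset> VV P" using Z(3) by blast
  then show ?case
    using Z(1,2) VV_irreducible[OF P(1) tv] VV_antimono[OF P(2)]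
    by (intro exI[of _ "\<lambda>i. if i \<le> Suc e then Z i else VV P"])
      (auto simp: irreducible_chain_def le_Suc_eq less_Suc_eq)
qed

text \<open>Each of the c equations lowers the growth exponent by at most one, starting from the
  polynomial ring in n variables. Large growth is a negated bound of exponent n - 1 - c, which
  leaves no room for c = n; there the chain consists of p alone.\<close>

theorem krull_chain:
  assumes p: "p \<in> carrier_vec n" and f: "\<And>l. l < c \<Longrightarrow> in_vars n (f l)" "\<And>l. l < c \<Longrightarrow> peval (f l) p = 0"
    and "c \<le> n"
  shows "\<exists>Z. irreducible_chain (affine_closed n) (n - c) Z \<and> p \<in> Z 0 \<and> Z (n - c) \<subseteq> zero_locus n (f ` {..<c})"
proof (cases "c = n")
  case True
  have "p \<in> VV (M (Suc 0))" by (rule point_in_VV_M[OF p])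
  moreover have "z = p" if "z \<in> VV (M (Suc 0))" for z
  proof (rule eq_vecI)
    have "z \<in> carrier_vec n" using that by (simp add: VV_def)
    then show "dim_vec z = dim_vec p" using p by simp
    fix i assume "i < dim_vec p"
    then have "i < n" using p by simp
    have "Var i - Cst (q i) \<in> M (Suc 0)" by (simp add: M_1_iff ev.hom_minus)
    then have "ev (\<lambda>i. if i < n then z $ i else 0) (Var i - Cst (q i)) = 0"
      using that by (simp add: VV_def)
    then show "z $ i = p $ i" using \<open>i < n\<close> by (simp add: ev.hom_minus q_def)
  qed
  ultimately have "VV (M (Suc 0)) = {p}" by blast
  then show ?thesis
    using VV_irreducible[OF pprime_M tail_vars_M] True f(2) p
    by (intro exI[of _ "\<lambda>_. {p}"]) (auto simp: irreducible_chain_def zero_locus_def)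
next
  case False
  define I where "I = (\<lambda>c. rec_nat (pgen tail_vars) (\<lambda>l J. padj J (f l)) c)"
  have I0: "I 0 = pgen tail_vars" and IS: "I (Suc l) = padj (I l) (f l)" for l
    by (auto simp: I_def)
  have M1: "f l \<in> M (Suc 0)" if "l < c" for l
  proof -
    have "ev q (f l) = peval (f l) p"
      unfolding peval_ev by (rule evg_cong[OF f(1)[OF that]]) (simp add: q_def)
    then show ?thesis using f(2)[OF that] by (simp add: M_1_iff)
  qed
  have *: "pideal (I l) \<and> tail_vars \<subseteq> I l \<and> f ` {..<l} \<subseteq> I l \<and> \<not> growth (n - 1 - l) (I l)" if "l \<le> c" for l
    using that
  proof (induction l)
    case 0
    then show ?case
      using not_growth_tail_vars[of "n - 1"] False \<open>c \<le> n\<close> pideal_pgen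
      by (auto simp: I0 intro: pgen_superset)
  next
    case (Suc l)
    then have IH: "pideal (I l)" "tail_vars \<subseteq> I l" "f ` {..<l} \<subseteq> I l" "\<not> growth (n - 1 - l) (I l)" by auto
    have "n - 1 - l = Suc (n - 1 - Suc l)" using Suc.prems False \<open>c \<le> n\<close> by simp
    then have "\<not> growth (n - 1 - Suc l) (I (Suc l))"
      using growth_padj[OF IH(1) M1[of l]] Suc.prems IH(4) by (auto simp: IS)
    then show ?case
      using padj[OF IH(1), of "f l"] IH by (auto simp: IS lessThan_Suc)
  qed
  then obtain Z where Z: "irreducible_chain (affine_closed n) (Suc (n - 1 - c)) Z" "p \<in> Z 0"
      "Z (Suc (n - 1 - c)) \<subseteq> VV (I c)"
    using chain_of_growth[OF p, of "I c" "n - 1 - c"] by auto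
  have "VV (I c) \<subseteq> zero_locus n (f ` {..<c})"
    using *[of c] f(1) by (subst VV_eq_zero_locus) (auto simp: zero_locus_def)
  moreover have "Suc (n - 1 - c) = n - c" using False \<open>c \<le> n\<close> by simp
  ultimately show ?thesis using Z by (intro exI[of _ Z]) auto
qed

end

section \<open>Systems of bilinear equations\<close>

text \<open>The variables with indices below \<open>n1\<close> form the first block, the next \<open>n2\<close> variables the
  second one.\<close>

definition Mon :: "nat \<Rightarrow> nat \<Rightarrow> nat \<Rightarrow> nat \<Rightarrow> (nat \<Rightarrow>\<^sub>0 nat) set" where
  "Mon n1 n2 d e = {m. keys m \<subseteq> {..<n1 + n2} \<and> (\<Sum>i<n1. lookup m i) = d \<and> (\<Sum>j<n2. lookup m (n1 + j)) = e}"

definition bihom :: "nat \<Rightarrow> nat \<Rightarrow> nat \<Rightarrow> nat \<Rightarrow> cpoly \<Rightarrow> bool" where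
  "bihom n1 n2 d e f \<longleftrightarrow> keys f \<subseteq> Mon n1 n2 d e"

definition bil :: "nat \<Rightarrow> nat \<Rightarrow> (nat \<Rightarrow> nat \<Rightarrow> complex) \<Rightarrow> cpoly" where
  "bil n1 n2 b = (\<Sum>i<n1. \<Sum>j<n2. Cst (b i j) * (Var i * Var (n1 + j)))"

lemma sum_lessThan_add: "sum f {..<n1 + n2} = sum f {..<n1} + (\<Sum>j<n2. f (n1 + j :: nat))"
  by (induction n2) (auto simp: add.assoc)

lemma Mon_add: "a \<in> Mon n1 n2 d e \<Longrightarrow> b \<in> Mon n1 n2 d' e' \<Longrightarrow> a + b \<in> Mon n1 n2 (d + d') (e + e')"
  by (auto simp: Mon_def keys_nat_add lookup_add sum.distrib)

lemma Mon_add_cancel: "a + b \<in> Mon n1 n2 (d + d') (e + e') \<Longrightarrow> b \<in> Mon n1 n2 d' e' \<Longrightarrow> a \<in> Mon n1 n2 d e"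
  by (auto simp: Mon_def keys_nat_add lookup_add sum.distrib)

lemma finite_Mon [simp]: "finite (Mon n1 n2 d e)"
proof (rule finite_subset)
  show "Mon n1 n2 d e \<subseteq> exps_le (n1 + n2) (d + e)"
    by (auto simp: Mon_def exps_le_def mdeg_superset[of "{..<n1 + n2}"] sum_lessThan_add)
qed simp

lemma bihom_add: "bihom n1 n2 d e f \<Longrightarrow> bihom n1 n2 d e g \<Longrightarrow> bihom n1 n2 d e (f + g)"
  unfolding bihom_def using keys_add[of f g] by blast

lemma bihom_0 [simp]: "bihom n1 n2 d e 0"
  by (simp add: bihom_def)

lemma bihom_sum: "(\<And>a. a \<in> A \<Longrightarrow> bihom n1 n2 d e (g a)) \<Longrightarrow> bihom n1 n2 d e (sum g A)"
  by (induction A rule: infinite_finite_induct) (auto intro: bihom_add)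

lemma bihom_mult: "bihom n1 n2 d e f \<Longrightarrow> bihom n1 n2 d' e' g \<Longrightarrow> bihom n1 n2 (d + d') (e + e') (f * g)"
  unfolding bihom_def by (auto elim!: keys_mult_cpoly intro: Mon_add)

lemma bihom_Cst_mult: "bihom n1 n2 d e f \<Longrightarrow> bihom n1 n2 d e (Cst c * f)"
  unfolding bihom_def using keys_Cst_mult by blast

lemma bihom_single: "m \<in> Mon n1 n2 d e \<Longrightarrow> bihom n1 n2 d e (single m c)"
  by (cases "c = 0") (auto simp: bihom_def)

lemma bihom_Var1: "i < n1 \<Longrightarrow> bihom n1 n2 1 0 (Var i)"
  unfolding Var_def by (rule bihom_single) (auto simp: Mon_def lookup_single when_def)

lemma bihom_Var2: "j < n2 \<Longrightarrow> bihom n1 n2 0 1 (Var (n1 + j))"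
  unfolding Var_def by (rule bihom_single) (auto simp: Mon_def lookup_single when_def)

lemma bihom_Var_Var: "i < n1 \<Longrightarrow> j < n2 \<Longrightarrow> bihom n1 n2 1 1 (Var i * Var (n1 + j))"
  using bihom_mult[OF bihom_Var1 bihom_Var2, of i n1 j n2] by simp

lemma bihom_bil: "bihom n1 n2 1 1 (bil n1 n2 b)"
  unfolding bil_def by (intro bihom_sum bihom_Cst_mult bihom_Var_Var) auto

lemma ev_bil: "ev x (bil n1 n2 b) = (\<Sum>i<n1. \<Sum>j<n2. b i j * x i * x (n1 + j))"
  by (simp add: bil_def ev.hom_sum ev.hom_mult mult.assoc)

section \<open>Bihomogeneous components and generation in large bidegrees\<close>

definition bicomp :: "nat \<Rightarrow> nat \<Rightarrow> nat \<Rightarrow> nat \<Rightarrow> cpoly \<Rightarrow> cpoly" where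
  "bicomp n1 n2 d e f = (\<Sum>m\<in>keys f \<inter> Mon n1 n2 d e. single m (lookup f m))"

lemma lookup_bicomp: "lookup (bicomp n1 n2 d e f) m = (if m \<in> Mon n1 n2 d e then lookup f m else 0)"
proof -
  have "lookup (bicomp n1 n2 d e f) m = (\<Sum>k\<in>keys f \<inter> Mon n1 n2 d e. if k = m then lookup f m else 0)"
    unfolding bicomp_def by (auto simp: lookup_sum lookup_single when_def intro!: sum.cong)
  then show ?thesis by (auto simp: in_keys_iff)
qed

lemma bihom_bicomp: "bihom n1 n2 d e (bicomp n1 n2 d e f)"
  by (auto simp: bihom_def in_keys_iff lookup_bicomp split: if_splits)

lemma bicomp_id: "bihom n1 n2 d e f \<Longrightarrow> bicomp n1 n2 d e f = f"
  by (intro poly_mapping_eqI) (auto simp: lookup_bicomp bihom_def in_keys_iff)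

lemma bicomp_sum: "bicomp n1 n2 d e (sum g A) = (\<Sum>a\<in>A. bicomp n1 n2 d e (g a))"
  by (intro poly_mapping_eqI) (simp add: lookup_bicomp lookup_sum)

lemma bicomp_mult:
  assumes "bihom n1 n2 1 1 q"
  shows "bicomp n1 n2 (Suc d) (Suc e) (g * q) = bicomp n1 n2 d e g * q"
proof (rule poly_mapping_eqI)
  fix m
  let ?g = "bicomp n1 n2 d e g"
  have b: "bihom n1 n2 (Suc d) (Suc e) (?g * q)"
    using bihom_mult[OF bihom_bicomp[of n1 n2 d e g] assms] by simp
  show "lookup (bicomp n1 n2 (Suc d) (Suc e) (g * q)) m = lookup (?g * q) m"
  proof (cases "m \<in> Mon n1 n2 (Suc d) (Suc e)")
    case False
    then have "m \<notin> keys (?g * q)" using b by (auto simp: bihom_def)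
    then show ?thesis using False by (simp add: lookup_bicomp in_keys_iff)
  next
    case True
    have "m \<notin> keys ((g - ?g) * q)"
    proof
      assume "m \<in> keys ((g - ?g) * q)"
      then obtain a k where ak: "a \<in> keys (g - ?g)" "k \<in> keys q" "m = a + k"
        by (rule keys_mult_cpoly)
      have "a \<notin> Mon n1 n2 d e" using ak(1) by (auto simp: in_keys_iff lookup_minus lookup_bicomp)
      moreover have "k \<in> Mon n1 n2 1 1" using assms ak(2) by (auto simp: bihom_def)
      ultimately show False using Mon_add_cancel[of a k n1 n2 d 1 e 1] True ak(3) by simp
    qed
    then have "lookup (g * q) m = lookup (?g * q) m"
      by (simp add: in_keys_iff left_diff_distrib lookup_minus)
    then show ?thesis using True by (simp add: lookup_bicomp)
  qed
qed

text \<open>Only the component of bidegree (d, e) of each coefficient contributes, since the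
  generators have bidegree (1, 1).\<close>

lemma bihom_pgen:
  fixes q :: "nat \<Rightarrow> cpoly"
  assumes f: "f \<in> pgen (q ` {..<c})" "bihom n1 n2 (Suc d) (Suc e) f"
    and q: "\<And>k. k < c \<Longrightarrow> bihom n1 n2 1 1 (q k)"
  shows "\<exists>g. f = (\<Sum>k<c. g k * q k) \<and> (\<forall>k. bihom n1 n2 d e (g k))"
proof -
  obtain g where g: "f = (\<Sum>k<c. g k * q k)" using pgen_image_sum[OF f(1)] .
  have "f = bicomp n1 n2 (Suc d) (Suc e) f" using bicomp_id[OF f(2)] by simp
  also have "\<dots> = (\<Sum>k<c. bicomp n1 n2 d e (g k) * q k)"
    unfolding g bicomp_sum by (intro sum.cong refl bicomp_mult q) simp
  finally show ?thesis using bihom_bicomp by (intro exI[of _ "\<lambda>k. bicomp n1 n2 d e (g k)"]) simp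
qed

lemma Var_power: "Var i ^ k = single (single i k) 1"
proof (induction k)
  case (Suc k)
  have "single i 1 + single i k = single i (Suc k)" by (simp add: single_add[symmetric])
  then show ?case using Suc by (simp add: Var_def mult_single)
qed simp

text \<open>Without nontrivial zeros, each product of a variable of the first block with one of the
  second vanishes on the zero set, so a power of it lies in the ideal. By the pigeonhole principle a
  monomial of large bidegree contains such a power.\<close>

lemma no_zeros_imp_pgen:
  fixes q :: "nat \<Rightarrow> cpoly"
  assumes nz: "\<And>x. (\<And>k. k < c \<Longrightarrow> ev x (q k) = 0) \<Longrightarrow> (\<forall>i<n1. x i = 0) \<or> (\<forall>j<n2. x (n1 + j) = 0)"
  shows "\<exists>D\<ge>1. \<forall>m\<in>Mon n1 n2 D D. single m 1 \<in> pgen (q ` {..<c})"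
proof -
  define I where "I = pgen (q ` {..<c})"
  have idl: "pideal I" unfolding I_def by (rule pideal_pgen)
  have "\<exists>k. (Var i * Var (n1 + j)) ^ k \<in> I" if ij: "i < n1" "j < n2" for i j
  proof (rule nullstellensatz[OF idl])
    fix x assume "\<forall>g\<in>I. ev x g = 0"
    then have "ev x (q k) = 0" if "k < c" for k using that by (auto simp: I_def intro: pgen_superset)
    then show "ev x (Var i * Var (n1 + j)) = 0" using nz[of x] ij by (auto simp: ev.hom_mult)
  qed
  then have "\<forall>i j. \<exists>k. i < n1 \<longrightarrow> j < n2 \<longrightarrow> (Var i * Var (n1 + j)) ^ k \<in> I" by blast
  then obtain \<kappa> where \<kappa>: "\<And>i j. i < n1 \<Longrightarrow> j < n2 \<Longrightarrow> (Var i * Var (n1 + j)) ^ \<kappa> i j \<in> I"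
    by metis
  define K where "K = (\<Sum>i<n1. \<Sum>j<n2. \<kappa> i j)"
  have \<kappa>K: "\<kappa> i j \<le> K" if "i < n1" "j < n2" for i j
  proof -
    have "\<kappa> i j \<le> (\<Sum>j<n2. \<kappa> i j)" using that by (intro member_le_sum) auto
    also have "\<dots> \<le> K" unfolding K_def using that by (intro member_le_sum[of i _ "\<lambda>i. \<Sum>j<n2. \<kappa> i j"]) auto
    finally show ?thesis .
  qed
  \<comment> \<open>Larger than n1 * K and n2 * K, so that in each block some exponent reaches
    K.\<close>
  define D where "D = (n1 + n2) * K + 1"
  have "single m 1 \<in> I" if m: "m \<in> Mon n1 n2 D D" for m
  proof -
    have "\<exists>i<n1. K \<le> lookup m i"
    proof (rule ccontr)
      assume "\<not> ?thesis"
      then have "(\<Sum>i<n1. lookup m i) \<le> n1 * K"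
        using sum_bounded_above[of "{..<n1}" "lookup m" K] by (force simp: not_le)
      then show False using m by (simp add: Mon_def D_def add_mult_distrib)
    qed
    then obtain i where i: "i < n1" "K \<le> lookup m i" by blast
    have "\<exists>j<n2. K \<le> lookup m (n1 + j)"
    proof (rule ccontr)
      assume "\<not> ?thesis"
      then have "(\<Sum>j<n2. lookup m (n1 + j)) \<le> n2 * K"
        using sum_bounded_above[of "{..<n2}" "\<lambda>j. lookup m (n1 + j)" K] by (force simp: not_le)
      then show False using m by (simp add: Mon_def D_def add_mult_distrib)
    qed
    then obtain j where j: "j < n2" "K \<le> lookup m (n1 + j)" by blast
    define l where "l = single i K + single (n1 + j) K"
    have "m = (m - l) + l"
      using i j by (intro poly_mapping_eqI) (auto simp: l_def lookup_add lookup_minus lookup_single when_def)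
    then have "single m 1 = single (m - l) 1 * single l (1::complex)"
      by (metis mult_single mult_1)
    also have "single l (1::complex) = (Var i * Var (n1 + j)) ^ K"
      by (simp add: l_def power_mult_distrib Var_power mult_single)
    also have "\<dots> = (Var i * Var (n1 + j)) ^ (K - \<kappa> i j) * (Var i * Var (n1 + j)) ^ \<kappa> i j"
      using \<kappa>K[OF i(1) j(1)] by (simp add: power_add[symmetric])
    finally show ?thesis using pidealD(3)[OF idl pidealD(3)[OF idl \<kappa>[OF i(1) j(1)]]] by metis
  qed
  then show ?thesis unfolding I_def by (intro exI[of _ D]) (auto simp: D_def)
qed

lemma pgen_bidegree_Suc:
  assumes "\<forall>m\<in>Mon n1 n2 d d. single m 1 \<in> pgen S" and m: "m \<in> Mon n1 n2 (Suc d) (Suc d)"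
  shows "single m 1 \<in> pgen S"
proof -
  have "\<exists>i<n1. 0 < lookup m i" "\<exists>j<n2. 0 < lookup m (n1 + j)"
    using m by (auto simp: Mon_def) (metis lessThan_iff neq0_conv nat.distinct(1) sum.neutral)+
  then obtain i j where ij: "i < n1" "0 < lookup m i" "j < n2" "0 < lookup m (n1 + j)" by blast
  define l where "l = single i 1 + single (n1 + j) (1::nat)"
  have eq: "m = (m - l) + l"
    using ij by (intro poly_mapping_eqI) (auto simp: l_def lookup_add lookup_minus lookup_single when_def)
  have "l \<in> Mon n1 n2 1 1"
    using ij by (auto simp: l_def Mon_def keys_nat_add lookup_add lookup_single when_def sum.distrib)
  then have "m - l \<in> Mon n1 n2 d d"
    using Mon_add_cancel[of "m - l" l n1 n2 d 1 d 1] m eq by simp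
  then have "single l 1 * single (m - l) 1 \<in> pgen S"
    using assms(1) by (intro pidealD(3)[OF pideal_pgen]) blast
  moreover have "single l 1 * single (m - l) (1::complex) = single m 1"
    using eq by (metis add.commute mult_1 mult_single)
  ultimately show ?thesis by simp
qed

lemma pgen_bidegree_ge:
  assumes "\<forall>m\<in>Mon n1 n2 D D. single m 1 \<in> pgen S" "D \<le> d"
  shows "\<forall>m\<in>Mon n1 n2 d d. single m 1 \<in> pgen S"
  using assms(2)
proof (induction d rule: dec_induct)
  case base
  show ?case by (rule assms(1))
next
  case (step d)
  then show ?case using pgen_bidegree_Suc by blast
qed

text \<open>The determinant of the coefficient matrix of fixed combinations of the forms detects that they
  still span.\<close>

lemma pgen_open:
  fixes \<beta> :: "nat \<Rightarrow> nat \<Rightarrow> nat \<Rightarrow> cpoly" and Q :: "complex vec \<Rightarrow> nat \<Rightarrow> cpoly"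
  assumes \<beta>: "\<And>k i j. k < c \<Longrightarrow> i < n1 \<Longrightarrow> j < n2 \<Longrightarrow> in_vars A (\<beta> k i j)"
    and Q: "\<And>a k. Q a k = bil n1 n2 (\<lambda>i j. peval (\<beta> k i j) a)"
    and D: "1 \<le> D" "\<forall>m\<in>Mon n1 n2 D D. single m 1 \<in> pgen (Q a0 ` {..<c})"
  shows "\<exists>h. in_vars A h \<and> peval h a0 \<noteq> 0 \<and>
    (\<forall>a. peval h a \<noteq> 0 \<longrightarrow> (\<forall>m\<in>Mon n1 n2 D D. single m 1 \<in> pgen (Q a ` {..<c})))"
proof -
  define L where "L = card (Mon n1 n2 D D)"
  obtain e where e: "bij_betw e {0..<L} (Mon n1 n2 D D)"
    using ex_bij_betw_nat_finite[of "Mon n1 n2 D D"] by (auto simp: L_def)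
  have eM: "e r \<in> Mon n1 n2 D D" if "r < L" for r using e that by (auto simp: bij_betw_def)
  have e_inj: "e r = e s \<longleftrightarrow> r = s" if "r < L" "s < L" for r s
    using e that by (auto simp: bij_betw_def inj_on_def)
  have e_surj: "\<exists>r<L. m = e r" if "m \<in> Mon n1 n2 D D" for m
    using e that by (force simp: bij_betw_def)
  have Q11: "bihom n1 n2 1 1 (Q a k)" for a k unfolding Q by (rule bihom_bil)
  have D': "D = Suc (D - 1)" using D(1) by simp
  have "\<exists>g. single (e r) 1 = (\<Sum>k<c. g k * Q a0 k) \<and> (\<forall>k. bihom n1 n2 (D - 1) (D - 1) (g k))" if "r < L" for r
  proof -
    have "bihom n1 n2 (Suc (D - 1)) (Suc (D - 1)) (single (e r) 1)"
      using bihom_single[OF eM[OF that]] D' by simp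
    then show ?thesis
      using bihom_pgen[of "single (e r) 1" "Q a0" c n1 n2 "D - 1" "D - 1"] D(2) eM[OF that] Q11 by metis
  qed
  then have "\<forall>r. \<exists>g. r < L \<longrightarrow> single (e r) 1 = (\<Sum>k<c. g k * Q a0 k) \<and> (\<forall>k. bihom n1 n2 (D - 1) (D - 1) (g k))"
    by blast
  then obtain g where g: "\<And>r. r < L \<Longrightarrow> single (e r) 1 = (\<Sum>k<c. g r k * Q a0 k)"
    "\<And>r k. r < L \<Longrightarrow> bihom n1 n2 (D - 1) (D - 1) (g r k)"
    by metis
  \<comment> \<open>The coefficients found at a0 are kept while the forms move with the parameter
    a.\<close>
  define G where "G = (\<lambda>a r. \<Sum>k<c. g r k * Q a k)"
  have Gb: "bihom n1 n2 D D (G a r)" if "r < L" for a r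
    unfolding G_def
  proof (rule bihom_sum)
    fix k
    show "bihom n1 n2 D D (g r k * Q a k)"
      using bihom_mult[OF g(2)[OF that] Q11, of k a k] D' by simp
  qed
  have GI: "G a r \<in> pgen (Q a ` {..<c})" for a r
    unfolding G_def by (intro pideal_sum[OF pideal_pgen] pidealD(3)[OF pideal_pgen] pgen_superset) auto
  define \<epsilon> where "\<epsilon> = (\<lambda>r' r. \<Sum>k<c. \<Sum>i<n1. \<Sum>j<n2. Cst (lookup (g r k * (Var i * Var (n1 + j))) (e r')) * \<beta> k i j)"
  define E where "E = mat L L (\<lambda>(r', r). \<epsilon> r' r)"
  have lk: "lookup (G a r) (e r') = peval (\<epsilon> r' r) a" for a r r'
  proof -
    have "G a r = (\<Sum>k<c. \<Sum>i<n1. \<Sum>j<n2. Cst (peval (\<beta> k i j) a) * (g r k * (Var i * Var (n1 + j))))"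
      unfolding G_def Q bil_def sum_distrib_left by (simp add: mult.left_commute)
    then show ?thesis
      by (simp add: \<epsilon>_def lookup_sum peval_ev ev.hom_sum ev.hom_mult mult.commute)
  qed
  define Ea where "Ea = (\<lambda>a. mat L L (\<lambda>(r', r). lookup (G a r) (e r')))"
  have detE: "peval (det E) a = det (Ea a)" for a
  proof -
    have "map_mat (ev (($) a)) E = Ea a"
      by (rule eq_matI) (auto simp: E_def Ea_def lk peval_ev)
    then show ?thesis by (simp add: peval_ev ev.hom_det[symmetric])
  qed
  have "Ea a0 = 1\<^sub>m L"
  proof (rule eq_matI)
    fix r' r assume "r' < dim_row (1\<^sub>m L)" "r < dim_col (1\<^sub>m L)"
    then have r: "r' < L" "r < L" by auto
    have "G a0 r = single (e r) 1" using g(1)[OF r(2)] by (simp add: G_def)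
    then show "Ea a0 $$ (r', r) = 1\<^sub>m L $$ (r', r)"
      using r e_inj[OF r(2) r(1)] by (auto simp: Ea_def lookup_single when_def)
  qed (auto simp: Ea_def)
  then have "peval (det E) a0 \<noteq> 0" by (simp add: detE)
  moreover have "in_vars A (det E)"
  proof (rule in_vars_det)
    show "E \<in> carrier_mat L L" by (simp add: E_def)
    fix i j assume "i < L" "j < L"
    then show "in_vars A (E $$ (i, j))"
      unfolding E_def \<epsilon>_def using \<beta>
      by (auto intro!: in_vars_sum in_vars_mult)
  qed
  moreover have "\<forall>m\<in>Mon n1 n2 D D. single m 1 \<in> pgen (Q a ` {..<c})" if "peval (det E) a \<noteq> 0" for a
  proof
    fix m assume "m \<in> Mon n1 n2 D D"
    then obtain s where s: "s < L" "m = e s" using e_surj by blast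
    define \<delta> where "\<delta> = det (Ea a)"
    have \<delta>: "\<delta> \<noteq> 0" using that by (simp add: detE \<delta>_def)
    have Ec: "Ea a \<in> carrier_mat L L" by (simp add: Ea_def)
    define B where "B = adj_mat (Ea a)"
    have B: "B \<in> carrier_mat L L" "Ea a * B = \<delta> \<cdot>\<^sub>m 1\<^sub>m L"
      using adj_mat[OF Ec] by (auto simp: B_def \<delta>_def)
    \<comment> \<open>Column s of the adjugate combines the \<open>G a r\<close> into \<delta> times
      the monomial.\<close>
    have "(\<Sum>r<L. Cst (B $$ (r, s)) * G a r) = Cst \<delta> * single m 1"
    proof (rule poly_mapping_eqI)
      fix l
      show "lookup (\<Sum>r<L. Cst (B $$ (r, s)) * G a r) l = lookup (Cst \<delta> * single m 1) l"
      proof (cases "l \<in> Mon n1 n2 D D")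
        case True
        then obtain r' where r': "r' < L" "l = e r'" using e_surj by blast
        have "(\<Sum>r<L. B $$ (r, s) * lookup (G a r) (e r')) = (Ea a * B) $$ (r', s)"
          using r' s B(1) by (simp add: scalar_prod_def Ea_def mult.commute atLeast0LessThan)
        also have "\<dots> = (if r' = s then \<delta> else 0)" using r' s by (simp add: B(2))
        finally show ?thesis
          using r' s e_inj[OF s(1) r'(1)] by (auto simp: lookup_sum lookup_single when_def)
      next
        case False
        then have "lookup (G a r) l = 0" if "r < L" for r
          using Gb[OF that, of a] by (auto simp: bihom_def in_keys_iff)
        moreover have "l \<noteq> m" using False s eM by blast
        ultimately show ?thesis by (simp add: lookup_sum lookup_single when_def)
      qed
    qed
    then have "Cst \<delta> * single m 1 \<in> pgen (Q a ` {..<c})"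
      by (metis (no_types, lifting) GI pideal_sum[OF pideal_pgen] pidealD(3)[OF pideal_pgen])
    then have "Cst (1 / \<delta>) * (Cst \<delta> * single m 1) \<in> pgen (Q a ` {..<c})"
      by (rule pidealD(3)[OF pideal_pgen])
    then show "single m 1 \<in> pgen (Q a ` {..<c})"
      using \<delta> by (simp add: mult.assoc[symmetric] Cst.hom_mult[symmetric])
  qed
  ultimately show ?thesis by blast
qed

lemma span_mod_closed:
  assumes I: "pideal I"
  shows "(\<And>a. a \<in> A \<Longrightarrow> \<exists>s\<in>cv.span F. g a - s \<in> I) \<Longrightarrow> \<exists>s\<in>cv.span F. sum g A - s \<in> I"
    and "\<exists>s\<in>cv.span F. f - s \<in> I \<Longrightarrow> \<exists>s\<in>cv.span F. Cst c * f - s \<in> I"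
proof -
  show "\<exists>s\<in>cv.span F. Cst c * f - s \<in> I" if ex: "\<exists>s\<in>cv.span F. f - s \<in> I" for f c
  proof -
    obtain s where s: "s \<in> cv.span F" "f - s \<in> I" using ex by blast
    have "Cst c * f - Cst c * s \<in> I"
      using pidealD(3)[OF I s(2), of "Cst c"] by (simp add: algebra_simps)
    then show ?thesis using cv.span_scale[OF s(1), of c] by blast
  qed
  show "\<exists>s\<in>cv.span F. sum g A - s \<in> I" if "\<And>a. a \<in> A \<Longrightarrow> \<exists>s\<in>cv.span F. g a - s \<in> I"
    using that
  proof (induction A rule: infinite_finite_induct)
    case (insert a A)
    then obtain s s' where s: "s \<in> cv.span F" "g a - s \<in> I" "s' \<in> cv.span F" "sum g A - s' \<in> I"
      by (metis insertI1 insertI2)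
    have "(g a - s) + (sum g A - s') \<in> I" using pidealD(2)[OF I s(2,4)] .
    then have "sum g (insert a A) - (s + s') \<in> I" using insert.hyps by (simp add: algebra_simps)
    then show ?case using cv.span_add[OF s(1,3)] by blast
  qed (auto intro!: bexI[of _ 0] cv.span_zero pidealD(1)[OF I])
qed

text \<open>Modulo the first \<open>c\<close> forms, the diagonal part of the bigraded ring is finite over the
  polynomials in the remaining \<open>m\<close> forms. (The factor \<open>d + 1\<close> on the left covers \<open>m = 0\<close>.)\<close>

lemma diagonal_growth:
  fixes w :: "nat \<Rightarrow> cpoly"
  assumes w: "\<And>k. k < c + m \<Longrightarrow> bihom n1 n2 1 1 (w k)"
    and D: "1 \<le> D" "\<forall>\<mu>\<in>Mon n1 n2 D D. single \<mu> 1 \<in> pgen (w ` {..<c + m})"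
  shows "\<exists>K. \<forall>d. \<exists>F. finite F \<and> card F * (d + 1) \<le> K * (d + 1) ^ m \<and>
    (\<forall>\<mu>\<in>Mon n1 n2 d d. \<exists>s\<in>cv.span F. single \<mu> 1 - s \<in> pgen (w ` {..<c}))"
proof -
  define I where "I = pgen (w ` {..<c})"
  have idl: "pideal I" unfolding I_def by (rule pideal_pgen)
  define r where "r = (\<lambda>l. w (c + l))"
  define ks where "ks = (\<lambda>d. {..<D} \<inter> {..d})"
  \<comment> \<open>Generators in bidegree (d, d): a monomial of degree d - k in the last m forms
    times a monomial of bidegree (k, k) with k < D.\<close>
  define F where "F = (\<lambda>d. \<Union>k\<in>ks d. (\<lambda>(\<gamma>, \<mu>). monev r \<gamma> * single \<mu> (1::complex)) ` (exps_eq m (d - k) \<times> Mon n1 n2 k k))"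
  have finF: "finite (F d)" for d by (auto simp: F_def ks_def)
  define K where "K = (\<Sum>k<D. (k + 1) * card (Mon n1 n2 k k))"
  have cardF: "card (F d) * (d + 1) \<le> K * (d + 1) ^ m" for d
  proof -
    have "card (F d) \<le> (\<Sum>k\<in>ks d. card ((\<lambda>(\<gamma>, \<mu>). monev r \<gamma> * single \<mu> (1::complex)) ` (exps_eq m (d - k) \<times> Mon n1 n2 k k)))"
      unfolding F_def by (rule card_UN_le) (simp add: ks_def)
    also have "\<dots> \<le> (\<Sum>k\<in>ks d. card (exps_eq m (d - k)) * card (Mon n1 n2 k k))"
      by (intro sum_mono order.trans[OF card_image_le]) (auto simp: card_cartesian_product)
    finally have "card (F d) * (d + 1) \<le> (\<Sum>k\<in>ks d. card (exps_eq m (d - k)) * card (Mon n1 n2 k k)) * (d + 1)"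
      by (rule mult_le_mono1)
    also have "\<dots> \<le> (\<Sum>k\<in>ks d. ((k + 1) * card (Mon n1 n2 k k)) * (d + 1) ^ m)"
      unfolding sum_distrib_right
    proof (rule sum_mono)
      fix k assume k: "k \<in> ks d"
      then obtain l where "d = k + l" by (auto simp: ks_def dest: le_Suc_ex)
      \<comment> \<open>Trades the factor d + 1 for d - k + 1, as \<open>card_exps_eq\<close> needs
        it, at the cost of the constant k + 1.\<close>
      then have "d + 1 \<le> (d - k + 1) * (k + 1)" by simp
      then have "card (exps_eq m (d - k)) * card (Mon n1 n2 k k) * (d + 1)
          \<le> card (exps_eq m (d - k)) * card (Mon n1 n2 k k) * ((d - k + 1) * (k + 1))"
        by (rule mult_le_mono2)
      also have "\<dots> = ((k + 1) * card (Mon n1 n2 k k)) * (card (exps_eq m (d - k)) * (d - k + 1))"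
        by (simp only: mult_ac)
      also have "\<dots> \<le> ((k + 1) * card (Mon n1 n2 k k)) * (d + 1) ^ m"
        by (intro mult_le_mono2 order.trans[OF card_exps_eq] power_mono) auto
      finally show "card (exps_eq m (d - k)) * card (Mon n1 n2 k k) * (d + 1)
          \<le> ((k + 1) * card (Mon n1 n2 k k)) * (d + 1) ^ m" .
    qed
    also have "\<dots> \<le> K * (d + 1) ^ m"
      unfolding K_def sum_distrib_right[symmetric]
      by (intro mult_le_mono1 sum_mono2) (auto simp: ks_def)
    finally show ?thesis .
  qed
  have FI: "monev r \<gamma> * single \<mu> 1 \<in> F d"
    if "k \<in> ks d" "\<gamma> \<in> exps_eq m (d - k)" "\<mu> \<in> Mon n1 n2 k k" for k d \<gamma> \<mu>
    unfolding F_def by (rule UN_I[OF that(1)], rule image_eqI[of _ _ "(\<gamma>, \<mu>)"]) (use that in auto)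
  have FI0: "single \<mu> 1 \<in> F d" if "d < D" "\<mu> \<in> Mon n1 n2 d d" for d \<mu>
    using FI[of d d 0 \<mu>] that by (simp add: ks_def exps_eq_def)
  have rF: "r l * \<phi> \<in> F (Suc d)" if l: "l < m" and \<phi>: "\<phi> \<in> F d" for l d \<phi>
  proof -
    obtain k \<gamma> \<mu> where k: "k \<in> ks d" "\<gamma> \<in> exps_eq m (d - k)" "\<mu> \<in> Mon n1 n2 k k"
      and \<phi>': "\<phi> = monev r \<gamma> * single \<mu> 1"
      using \<phi> by (auto simp: F_def)
    have eq: "r l * \<phi> = monev r (single l 1 + \<gamma>) * single \<mu> 1"
      by (simp add: \<phi>' monev_add mult.assoc) (simp add: monev_def)
    have "single l 1 + \<gamma> \<in> exps_eq m (Suc d - k)"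
      using k l by (auto simp: exps_eq_def keys_nat_add mdeg_add ks_def)
    moreover have "k \<in> ks (Suc d)" using k by (auto simp: ks_def)
    ultimately show ?thesis unfolding eq using FI k(3) by blast
  qed
  have main: "\<exists>s\<in>cv.span (F d). f - s \<in> I" if "bihom n1 n2 d d f" for d f
    using that
  proof (induction d arbitrary: f)
    case (0 f)
    have "single \<mu> 1 \<in> F 0" if "\<mu> \<in> Mon n1 n2 0 0" for \<mu>
      using FI0[of 0 \<mu>] that D(1) by simp
    then have "\<exists>s\<in>cv.span (F 0). single \<mu> 1 - s \<in> I" if "\<mu> \<in> keys f" for \<mu>
      using that 0 pidealD(1)[OF idl] cv.span_base[of "single \<mu> 1" "F 0"] by (force simp: bihom_def)
    then have "\<exists>s\<in>cv.span (F 0). (\<Sum>\<mu>\<in>keys f. Cst (lookup f \<mu>) * single \<mu> 1) - s \<in> I"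
      by (intro span_mod_closed[OF idl]) auto
    then show ?case using sum_singles[of f] by (simp add: Cst_def mult_single)
  next
    case (Suc d f)
    have "\<exists>s\<in>cv.span (F (Suc d)). single \<mu> 1 - s \<in> I" if \<mu>: "\<mu> \<in> Mon n1 n2 (Suc d) (Suc d)" for \<mu>
    proof (cases "Suc d < D")
      case True
      then have "single \<mu> 1 \<in> F (Suc d)" using FI0 \<mu> by blast
      then have "single \<mu> 1 \<in> cv.span (F (Suc d))" by (rule cv.span_base)
      moreover have "single \<mu> 1 - single \<mu> 1 \<in> I" using pidealD(1)[OF idl] by simp
      ultimately show ?thesis by blast
    next
      case False
      then have "single \<mu> 1 \<in> pgen (w ` {..<c + m})"
        using pgen_bidegree_ge[OF D(2), of "Suc d"] \<mu> by simp
      then obtain g where g: "single \<mu> 1 = (\<Sum>k<c + m. g k * w k)" "\<And>k. bihom n1 n2 d d (g k)"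
        using bihom_pgen[where q = w and c = "c + m", OF _ bihom_single[OF \<mu>]] w by blast
      \<comment> \<open>The first c forms are zero modulo I; for the others the coefficient has
        smaller bidegree and is covered by induction.\<close>
      have "\<exists>s\<in>cv.span (F (Suc d)). g k * w k - s \<in> I" if k: "k \<in> {..<c + m}" for k
      proof (cases "k < c")
        case True
        then have "g k * w k - 0 \<in> I" unfolding I_def by (auto intro: pidealD(3)[OF pideal_pgen] pgen_superset)
        then show ?thesis using cv.span_zero by blast
      next
        case False
        then obtain l where l: "k = c + l" "l < m" using k that[of "k - c"] by auto
        obtain s where s: "s \<in> cv.span (F d)" "g k - s \<in> I" using Suc.IH[OF g(2)] by blast
        have "r l * s \<in> cv.span ((*) (r l) ` F d)" by (rule span_mult_image[OF s(1)])
        moreover have "(*) (r l) ` F d \<subseteq> F (Suc d)" using rF[OF l(2)] by blast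
        ultimately have "r l * s \<in> cv.span (F (Suc d))" using cv.span_mono by blast
        moreover have "g k * w k - r l * s \<in> I"
          using pidealD(3)[OF idl s(2), of "r l"] l by (simp add: r_def algebra_simps)
        ultimately show ?thesis by blast
      qed
      then show ?thesis unfolding g(1) by (rule span_mod_closed(1)[OF idl])
    qed
    then have "\<exists>s\<in>cv.span (F (Suc d)). (\<Sum>\<mu>\<in>keys f. Cst (lookup f \<mu>) * single \<mu> 1) - s \<in> I"
      using Suc.prems by (intro span_mod_closed[OF idl]) (auto simp: bihom_def)
    then show ?case using sum_singles[of f] by (simp add: Cst_def mult_single)
  qed
  show ?thesis
    unfolding I_def[symmetric] using finF cardF main[OF bihom_single] by (intro exI[of _ K] allI) blast
qed

text \<open>In each block all exponents but the last range freely over 0, ..., u, and the last one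
  fills up the degree.\<close>

lemma card_Mon_ge: "(u + 1) ^ (a + b) \<le> card (Mon (Suc a) (Suc b) ((a + b) * u) ((a + b) * u))"
proof -
  define n where "n = Suc a + Suc b"
  define d where "d = (a + b) * u"
  define A where "A = {..<a} \<union> {Suc a..<Suc a + b}"
  have A: "finite A" "card A = a + b"
  proof -
    have "{..<a} \<inter> {Suc a..<Suc a + b} = {}" by auto
    then show "card A = a + b" unfolding A_def by (subst card_Un_disjoint) auto
  qed (simp add: A_def)
  define \<Phi> where "\<Phi> = (\<lambda>\<phi>. exps {..<n} (\<lambda>i. if i \<in> A then \<phi> i
     else if i = a then d - (\<Sum>i<a. \<phi> i) else d - (\<Sum>j<b. \<phi> (Suc a + j))))"
  have lk: "lookup (\<Phi> \<phi>) i = (if i < n then if i \<in> A then \<phi> i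
     else if i = a then d - (\<Sum>i<a. \<phi> i) else d - (\<Sum>j<b. \<phi> (Suc a + j)) else 0)" for \<phi> i
    by (simp add: \<Phi>_def lookup_exps)
  have An: "i < n" if "i \<in> A" for i using that by (auto simp: A_def n_def)
  have "inj_on \<Phi> (PiE A (\<lambda>_. {..u}))"
  proof (rule inj_onI)
    fix \<phi> \<psi> assume *: "\<phi> \<in> PiE A (\<lambda>_. {..u})" "\<psi> \<in> PiE A (\<lambda>_. {..u})" "\<Phi> \<phi> = \<Phi> \<psi>"
    have "\<phi> i = \<psi> i" if "i \<in> A" for i
      using lk[of \<phi> i] lk[of \<psi> i] *(3) that An[OF that] by simp
    then show "\<phi> = \<psi>" using *(1,2) by (rule PiE_ext[rotated 2])
  qed
  moreover have "\<Phi> ` PiE A (\<lambda>_. {..u}) \<subseteq> Mon (Suc a) (Suc b) d d"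
  proof (rule image_subsetI)
    fix \<phi> assume \<phi>: "\<phi> \<in> PiE A (\<lambda>_. {..u})"
    have u: "\<phi> i \<le> u" if "i \<in> A" for i using \<phi> that by auto
    have "(\<Sum>i<a. \<phi> i) \<le> a * u" using sum_bounded_above[of "{..<a}" \<phi> u] u by (simp add: A_def)
    then have 1: "(\<Sum>i<a. \<phi> i) \<le> d" by (simp add: d_def algebra_simps)
    have "(\<Sum>j<b. \<phi> (Suc a + j)) \<le> b * u"
      using sum_bounded_above[of "{..<b}" "\<lambda>j. \<phi> (Suc a + j)" u] u by (simp add: A_def)
    then have 2: "(\<Sum>j<b. \<phi> (Suc a + j)) \<le> d" by (simp add: d_def algebra_simps)
    have "(\<Sum>i<a. lookup (\<Phi> \<phi>) i) = (\<Sum>i<a. \<phi> i)"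
      by (intro sum.cong refl) (auto simp: lk A_def n_def)
    moreover have "lookup (\<Phi> \<phi>) a = d - (\<Sum>i<a. \<phi> i)" by (auto simp: lk A_def n_def)
    ultimately have "(\<Sum>i<Suc a. lookup (\<Phi> \<phi>) i) = d" using 1 by simp
    moreover have "(\<Sum>j<b. lookup (\<Phi> \<phi>) (Suc a + j)) = (\<Sum>j<b. \<phi> (Suc a + j))"
      by (intro sum.cong refl) (auto simp: lk A_def n_def)
    moreover have "lookup (\<Phi> \<phi>) (Suc a + b) = d - (\<Sum>j<b. \<phi> (Suc a + j))" by (auto simp: lk A_def n_def)
    ultimately have "(\<Sum>i<Suc a. lookup (\<Phi> \<phi>) i) = d" "(\<Sum>j<Suc b. lookup (\<Phi> \<phi>) (Suc a + j)) = d"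
      using 2 by simp_all
    moreover have "keys (\<Phi> \<phi>) \<subseteq> {..<Suc a + Suc b}"
      by (auto simp: in_keys_iff lk n_def split: if_splits)
    ultimately show "\<Phi> \<phi> \<in> Mon (Suc a) (Suc b) d d" by (simp add: Mon_def)
  qed
  ultimately have "card (PiE A (\<lambda>_. {..u})) \<le> card (Mon (Suc a) (Suc b) d d)"
    by (rule card_inj_on_le) simp
  then show ?thesis using A by (simp add: card_PiE d_def)
qed

text \<open>With only trivial zeros the c forms generate all large diagonal bidegrees, so the
  polynomials of bidegree (d, d) would have dimension O(d^(c - 1)). Their dimension is at least of
  order d^(n1 + n2 - 2), and c \<le> n1 + n2 - 2.\<close>

theorem bilinear_nontrivial_zero:
  assumes c: "c + 2 \<le> n1 + n2" and n: "1 \<le> n1" "1 \<le> n2"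
  obtains x where "\<exists>i<n1. x i \<noteq> 0" "\<exists>j<n2. x (n1 + j) \<noteq> 0" "\<And>k. k < c \<Longrightarrow> ev x (bil n1 n2 (b k)) = 0"
proof -
  obtain a' b' where ab: "n1 = Suc a'" "n2 = Suc b'"
    using n by (metis Suc_le_D One_nat_def)
  define q where "q = (\<lambda>k. bil n1 n2 (b k))"
  have "\<exists>x. (\<forall>k<c. ev x (q k) = 0) \<and> (\<exists>i<n1. x i \<noteq> 0) \<and> (\<exists>j<n2. x (n1 + j) \<noteq> 0)"
  proof (rule ccontr)
    assume no: "\<not> ?thesis"
    obtain D where D: "D \<ge> 1" "\<forall>m\<in>Mon n1 n2 D D. single m 1 \<in> pgen (q ` {..<c})"
      using no_zeros_imp_pgen[of c q n1 n2] no by blast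
    have "\<exists>K. \<forall>d. \<exists>F. finite F \<and> card F * (d + 1) \<le> K * (d + 1) ^ c \<and>
        (\<forall>\<mu>\<in>Mon n1 n2 d d. \<exists>s\<in>cv.span F. single \<mu> 1 - s \<in> pgen (q ` {..<0}))"
    proof (rule diagonal_growth)
      show "bihom n1 n2 1 1 (q k)" for k unfolding q_def by (rule bihom_bil)
    qed (use D in simp_all)
    then obtain K where K: "\<And>d. \<exists>F. finite F \<and> card F * (d + 1) \<le> K * (d + 1) ^ c \<and>
        (\<forall>\<mu>\<in>Mon n1 n2 d d. \<exists>s\<in>cv.span F. single \<mu> 1 - s \<in> pgen {})"
      unfolding lessThan_0 image_empty by blast
    have pg: "pgen {} = {0}"
      using pgen_minimal[of "{0}" "{}"] pgen.zero by (auto simp: pideal_def)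
    define e where "e = a' + b'"
    \<comment> \<open>Makes K * ((e + 1) * (u + 1))^e equal to u * (u + 1)^e; the comparison of
      dimensions then forces d + 1 \<le> u although d = e * u.\<close>
    define u where "u = K * (e + 1) ^ e"
    define d where "d = e * u"
    obtain F where F: "finite F" "card F * (d + 1) \<le> K * (d + 1) ^ c"
        "\<forall>\<mu>\<in>Mon n1 n2 d d. \<exists>s\<in>cv.span F. single \<mu> 1 - s \<in> {0}"
      using K[of d] unfolding pg by blast
    have sp: "single \<mu> 1 \<in> cv.span F" if "\<mu> \<in> Mon n1 n2 d d" for \<mu>
      using F(3) that by auto
    show False
    proof (cases "card F < card (Mon n1 n2 d d)")
      case True
      have "\<forall>\<mu>. \<exists>t. \<mu> \<in> Mon n1 n2 d d \<longrightarrow> single \<mu> 1 = (\<Sum>\<phi>\<in>F. Cst (t \<phi>) * \<phi>)"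
        using sp cv.span_finite[OF F(1)] by (auto simp: image_iff)
      from choice[OF this] obtain t
        where t: "\<And>\<mu>. \<mu> \<in> Mon n1 n2 d d \<Longrightarrow> single \<mu> 1 = (\<Sum>\<phi>\<in>F. Cst (t \<mu> \<phi>) * \<phi>)"
        by blast
      obtain z where z: "\<exists>\<mu>\<in>Mon n1 n2 d d. z \<mu> \<noteq> 0" "\<forall>\<phi>\<in>F. (\<Sum>\<mu>\<in>Mon n1 n2 d d. t \<mu> \<phi> * z \<mu>) = 0"
        using underdetermined[OF F(1) finite_Mon True, of "\<lambda>\<phi> \<mu>. t \<mu> \<phi>"] by blast
      have "(\<Sum>\<mu>\<in>Mon n1 n2 d d. single \<mu> (z \<mu>)) = (\<Sum>\<mu>\<in>Mon n1 n2 d d. Cst (z \<mu>) * (\<Sum>\<phi>\<in>F. Cst (t \<mu> \<phi>) * \<phi>))"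
        by (intro sum.cong refl) (simp add: t[symmetric], simp add: Cst_def mult_single)
      also have "\<dots> = (\<Sum>\<phi>\<in>F. Cst (\<Sum>\<mu>\<in>Mon n1 n2 d d. t \<mu> \<phi> * z \<mu>) * \<phi>)"
        unfolding sum_distrib_left sum_distrib_right Cst.hom_sum
        by (subst sum.swap) (simp add: Cst.hom_mult mult_ac)
      also have "\<dots> = 0" using z(2) by simp
      finally have zero: "(\<Sum>\<mu>\<in>Mon n1 n2 d d. single \<mu> (z \<mu>)) = 0" .
      have "z \<mu> = 0" if "\<mu> \<in> Mon n1 n2 d d" for \<mu>
      proof -
        have "lookup (\<Sum>\<mu>\<in>Mon n1 n2 d d. single \<mu> (z \<mu>)) \<mu> = (\<Sum>l\<in>Mon n1 n2 d d. if l = \<mu> then z \<mu> else 0)"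
          by (auto simp: lookup_sum lookup_single when_def intro!: sum.cong)
        then show ?thesis using zero that by simp
      qed
      then show False using z(1) by blast
    next
      case False
      then have "(u + 1) ^ e \<le> card F"
        using card_Mon_ge[of u a' b'] by (simp add: ab e_def d_def)
      then have "(u + 1) ^ e * (d + 1) \<le> K * (d + 1) ^ c"
        using F(2) by (meson le_trans mult_le_mono1)
      also have "\<dots> \<le> K * ((e + 1) * (u + 1)) ^ e"
      proof (intro mult_le_mono2)
        have "(d + 1) ^ c \<le> (d + 1) ^ e"
          using c by (intro power_increasing) (auto simp: ab e_def)
        also have "\<dots> \<le> ((e + 1) * (u + 1)) ^ e"
          by (intro power_mono) (auto simp: d_def)
        finally show "(d + 1) ^ c \<le> ((e + 1) * (u + 1)) ^ e" .
      qed
      also have "\<dots> = u * (u + 1) ^ e"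
        unfolding power_mult_distrib by (simp only: u_def mult.assoc)
      finally have "(u + 1) ^ e * (d + 1) \<le> (u + 1) ^ e * u" by (simp only: mult.commute)
      then have "d + 1 \<le> u" by (rule mult_left_le_imp_le) simp
      moreover have "u \<le> d" if "e \<noteq> 0" using that by (simp add: d_def)
      \<comment> \<open>What is left is e = 0, hence c = 0, where the all-ones vector solves the
        empty system.\<close>
      ultimately have "c = 0" using c by (cases "e = 0") (auto simp: ab e_def)
      then have "(\<forall>k<c. ev (\<lambda>_. 1) (q k) = 0) \<and> (\<exists>i<n1. (1::complex) \<noteq> 0) \<and> (\<exists>j<n2. (1::complex) \<noteq> 0)"
        using n by (auto intro!: exI[of _ 0])
      then show False using no by blast
    qed
  qed
  then show ?thesis using that unfolding q_def by blast
qed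

section \<open>Growth of the coordinate rings\<close>

text \<open>The diagonal part of the bigraded ring modulo I has dimension O(d^(m - 1)). Both sides
  carry a factor d + 1, so that m = 0 makes sense: then the part vanishes for large d.\<close>

definition dgrowth :: "nat \<Rightarrow> nat \<Rightarrow> cpoly set \<Rightarrow> nat \<Rightarrow> bool" where
  "dgrowth n1 n2 I m \<longleftrightarrow> (\<exists>K. \<forall>d. \<exists>F. finite F \<and> card F * (d + 1) \<le> K * (d + 1) ^ m \<and>
    (\<forall>\<mu>\<in>Mon n1 n2 d d. \<exists>s\<in>cv.span F. single \<mu> 1 - s \<in> I))"

lemma sum_singles_superset:
  assumes "finite A" "keys f \<subseteq> A"
  shows "f = (\<Sum>m\<in>A. single m (lookup f m))"
proof -
  have "(\<Sum>m\<in>A. single m (lookup f m)) = (\<Sum>m\<in>keys f. single m (lookup f m))"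
    by (rule sum.mono_neutral_right[OF assms]) (auto simp: in_keys_iff)
  then show ?thesis using sum_singles[of f] by simp
qed

text \<open>Coordinates with respect to F, chosen on monomials and extended linearly, detect
  membership in I: where all of them vanish, \<open>f\<close> is congruent to 0.\<close>

lemma dgrowth_functionals:
  assumes I: "pideal I" and F: "finite F" "\<forall>\<mu>\<in>Mon n1 n2 d d. \<exists>s\<in>cv.span F. single \<mu> 1 - s \<in> I"
  shows "\<exists>L. finite L \<and> card L \<le> card F \<and> (\<forall>l\<in>L. clin l) \<and>
    (\<forall>f. bihom n1 n2 d d f \<longrightarrow> (\<forall>l\<in>L. l f = 0) \<longrightarrow> f \<in> I)"
proof -
  have "\<forall>\<mu>. \<exists>t. \<mu> \<in> Mon n1 n2 d d \<longrightarrow> single \<mu> 1 - (\<Sum>\<phi>\<in>F. Cst (t \<phi>) * \<phi>) \<in> I"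
    using F(2) cv.span_finite[OF F(1)] by (auto simp: image_iff)
  from choice[OF this] obtain t
    where t: "\<And>\<mu>. \<mu> \<in> Mon n1 n2 d d \<Longrightarrow> single \<mu> 1 - (\<Sum>\<phi>\<in>F. Cst (t \<mu> \<phi>) * \<phi>) \<in> I"
    by blast
  define l where "l = (\<lambda>\<phi> f. \<Sum>\<mu>\<in>Mon n1 n2 d d. lookup f \<mu> * t \<mu> \<phi>)"
  have "clin (l \<phi>)" for \<phi>
    by (simp add: clin_def l_def lookup_add sum.distrib distrib_right sum_distrib_left mult.assoc)
  moreover have "f \<in> I" if f: "bihom n1 n2 d d f" and lf: "\<forall>l'\<in>l ` F. l' f = 0" for f
  proof -
    let ?M = "Mon n1 n2 d d"
    have "f = (\<Sum>\<mu>\<in>?M. single \<mu> (lookup f \<mu>))"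
      using f by (intro sum_singles_superset) (auto simp: bihom_def)
    also have "\<dots> = (\<Sum>\<mu>\<in>?M. Cst (lookup f \<mu>) * single \<mu> 1)"
      by (simp add: Cst_def mult_single)
    also have "\<dots> = (\<Sum>\<mu>\<in>?M. Cst (lookup f \<mu>) * (single \<mu> 1 - (\<Sum>\<phi>\<in>F. Cst (t \<mu> \<phi>) * \<phi>)))
        + (\<Sum>\<mu>\<in>?M. Cst (lookup f \<mu>) * (\<Sum>\<phi>\<in>F. Cst (t \<mu> \<phi>) * \<phi>))"
      by (simp add: sum.distrib[symmetric] algebra_simps)
    also have "(\<Sum>\<mu>\<in>?M. Cst (lookup f \<mu>) * (\<Sum>\<phi>\<in>F. Cst (t \<mu> \<phi>) * \<phi>)) = (\<Sum>\<phi>\<in>F. Cst (l \<phi> f) * \<phi>)"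
      unfolding l_def sum_distrib_left sum_distrib_right Cst.hom_sum
      by (subst sum.swap) (simp add: Cst.hom_mult mult_ac)
    also have "\<dots> = 0" using lf by simp
    also have "(\<Sum>\<mu>\<in>?M. Cst (lookup f \<mu>) * (single \<mu> 1 - (\<Sum>\<phi>\<in>F. Cst (t \<mu> \<phi>) * \<phi>))) + 0 \<in> I"
      unfolding add_0_right by (intro pideal_sum[OF I] pidealD(3)[OF I] t)
    finally show ?thesis .
  qed
  ultimately show ?thesis using F(1) card_image_le[OF F(1), of l] by (intro exI[of _ "l ` F"]) auto
qed

lemma dgrowthE:
  assumes "dgrowth n1 n2 I m" "pideal I"
  shows "\<exists>K L. \<forall>d. finite (L d) \<and> card (L d) * (d + 1) \<le> K * (d + 1) ^ m \<and> (\<forall>l\<in>L d. clin l) \<and>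
    (\<forall>f. bihom n1 n2 d d f \<longrightarrow> (\<forall>l\<in>L d. l f = 0) \<longrightarrow> f \<in> I)"
proof -
  obtain K where K: "\<And>d. \<exists>F. finite F \<and> card F * (d + 1) \<le> K * (d + 1) ^ m \<and>
    (\<forall>\<mu>\<in>Mon n1 n2 d d. \<exists>s\<in>cv.span F. single \<mu> 1 - s \<in> I)"
    using assms(1) unfolding dgrowth_def by blast
  have "\<exists>L. finite L \<and> card L * (d + 1) \<le> K * (d + 1) ^ m \<and> (\<forall>l\<in>L. clin l) \<and>
    (\<forall>f. bihom n1 n2 d d f \<longrightarrow> (\<forall>l\<in>L. l f = 0) \<longrightarrow> f \<in> I)" for d
  proof -
    obtain F where F: "finite F" "card F * (d + 1) \<le> K * (d + 1) ^ m"
      "\<forall>\<mu>\<in>Mon n1 n2 d d. \<exists>s\<in>cv.span F. single \<mu> 1 - s \<in> I"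
      using K[of d] by blast
    obtain L where L: "finite L" "card L \<le> card F" "\<forall>l\<in>L. clin l"
      "\<forall>f. bihom n1 n2 d d f \<longrightarrow> (\<forall>l\<in>L. l f = 0) \<longrightarrow> f \<in> I"
      using dgrowth_functionals[OF assms(2) F(1,3)] by blast
    have "card L * (d + 1) \<le> K * (d + 1) ^ m"
      using L(2) F(2) by (meson le_trans mult_le_mono1)
    then show ?thesis using L by blast
  qed
  then have "\<forall>d. \<exists>L. finite L \<and> card L * (d + 1) \<le> K * (d + 1) ^ m \<and> (\<forall>l\<in>L. clin l) \<and>
    (\<forall>f. bihom n1 n2 d d f \<longrightarrow> (\<forall>l\<in>L. l f = 0) \<longrightarrow> f \<in> I)" by blast
  from choice[OF this] show ?thesis by blast
qed

lemma keys_exps_le: "in_vars n f \<Longrightarrow> tdeg_le D f \<Longrightarrow> keys f \<subseteq> exps_le n D"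
  by (auto simp: exps_le_def in_vars_def tdeg_le_def)

lemma monev_single: "monev x (single i k) = x i ^ k"
  by (cases "k = 0") (auto simp: monev_def)

lemma clin_compose:
  assumes "clin l" "\<And>f g. T (f + g) = T f + T g" "\<And>c f. T (Cst c * f) = Cst c * T f"
  shows "clin (\<lambda>f. l (T f))"
  using assms by (simp add: clin_def)

lemma power_mult_single: "Var i ^ k * single m c = single (single i k + m) c"
  by (simp add: Var_power mult_single)

text \<open>A form of degree d in the first block, multiplied by the d-th power of a second-block
  coordinate that is nonzero at the point, has bidegree (d, d) and is controlled by the functionals.
  Summing O(d^(m - 1)) over d \<le> D gives O(D^m).\<close>

lemma sep_projection:
  assumes g: "dgrowth n1 n2 I m" "pideal I" and m: "1 \<le> m"
    and W: "\<And>z. z \<in> W \<Longrightarrow> \<exists>x. (\<forall>g\<in>I. ev x g = 0) \<and> (\<forall>i<n1. x i = z $ i) \<and> (\<exists>j<n2. x (n1 + j) \<noteq> 0)"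
  shows "sep n1 W m"
proof -
  from dgrowthE[OF g] obtain K L where KL: "\<forall>d. finite (L d) \<and> card (L d) * (d + 1) \<le> K * (d + 1) ^ m \<and>
      (\<forall>l\<in>L d. clin l) \<and> (\<forall>f. bihom n1 n2 d d f \<longrightarrow> (\<forall>l\<in>L d. l f = 0) \<longrightarrow> f \<in> I)"
    by (elim exE)
  have L: "finite (L d)" "card (L d) * (d + 1) \<le> K * (d + 1) ^ m" "l \<in> L d \<Longrightarrow> clin l"
    "bihom n1 n2 d d f \<Longrightarrow> (\<And>l. l \<in> L d \<Longrightarrow> l f = 0) \<Longrightarrow> f \<in> I" for d l f
    using KL[THEN spec, of d] by auto
  obtain m' where m': "m = Suc m'" using m by (cases m) auto
  define H where "H = (\<lambda>d f. \<Sum>\<mu>\<in>exps_eq n1 d. single \<mu> (lookup f \<mu>) :: cpoly)"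
  have H_add: "H d (f + g) = H d f + H d g" for d f g
    by (simp add: H_def lookup_add single_add sum.distrib)
  have H_Cst: "H d (Cst c * f) = Cst c * H d f" for d c f
    by (simp add: H_def sum_distrib_left) (simp add: Cst_def mult_single)
  define \<Lambda> where "\<Lambda> = (\<lambda>d j l f. l (Var (n1 + j) ^ d * H d f) :: complex)"
  have "\<exists>L'. finite L' \<and> card L' \<le> (n2 * K) * (D + 1) ^ m \<and> (\<forall>l\<in>L'. clin l) \<and>
     (\<forall>f. in_vars n1 f \<longrightarrow> tdeg_le D f \<longrightarrow> (\<forall>l\<in>L'. l f = 0) \<longrightarrow> (\<forall>z\<in>W. peval f z = 0))" for D
  proof -
    define L' where "L' = (\<Union>d\<le>D. \<Union>j<n2. \<Lambda> d j ` L d)"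
    have fin: "finite L'" by (auto simp: L'_def L(1))
    have cL: "card (L d) \<le> K * (D + 1) ^ m'" if "d \<le> D" for d
    proof -
      have "card (L d) * (d + 1) \<le> (K * (d + 1) ^ m') * (d + 1)"
        using L(2)[of d] by (simp only: m' power_Suc2 mult.assoc)
      then have "card (L d) \<le> K * (d + 1) ^ m'" by (rule mult_right_le_imp_le) simp
      also have "\<dots> \<le> K * (D + 1) ^ m'" using that by (simp add: power_mono)
      finally show ?thesis .
    qed
    have "card L' \<le> (\<Sum>d\<le>D. card (\<Union>j<n2. \<Lambda> d j ` L d))"
      unfolding L'_def by (rule card_UN_le) simp
    also have "\<dots> \<le> (\<Sum>d\<le>D. \<Sum>j<n2. card (\<Lambda> d j ` L d))"
      by (intro sum_mono card_UN_le) simp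
    also have "\<dots> \<le> (\<Sum>d\<le>D. \<Sum>j<n2. K * (D + 1) ^ m')"
      by (intro sum_mono order.trans[OF card_image_le[OF L(1)] cL]) simp
    also have "\<dots> = (D + 1) * (n2 * (K * (D + 1) ^ m'))" by simp
    also have "\<dots> = (n2 * K) * (D + 1) ^ m" by (simp only: m' power_Suc mult_ac)
    finally have card: "card L' \<le> (n2 * K) * (D + 1) ^ m" .
    have "clin (\<Lambda> d j l)" if "l \<in> L d" for d j l
      unfolding \<Lambda>_def
      by (rule clin_compose[OF L(3)[OF that]]) (simp_all add: H_add H_Cst ring_distribs mult.left_commute)
    then have lin: "clin l" if "l \<in> L'" for l
      using that unfolding L'_def by blast
    have van: "peval f z = 0" if f: "in_vars n1 f" "tdeg_le D f" and lf: "\<forall>l\<in>L'. l f = 0" and z: "z \<in> W" for f z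
    proof -
      obtain x j where x: "\<forall>g\<in>I. ev x g = 0" "\<forall>i<n1. x i = z $ i" "j < n2" "x (n1 + j) \<noteq> 0"
        using W[OF z] by blast
      have "ev x (H d f) = 0" if d: "d \<le> D" for d
      proof -
        have "Var (n1 + j) ^ d * H d f = (\<Sum>\<mu>\<in>exps_eq n1 d. single (single (n1 + j) d + \<mu>) (lookup f \<mu>))"
          by (simp add: H_def sum_distrib_left power_mult_single)
        moreover have "bihom n1 n2 d d (single (single (n1 + j) d + \<mu>) (lookup f \<mu>))" if "\<mu> \<in> exps_eq n1 d" for \<mu>
        proof (rule bihom_single)
          have k: "keys \<mu> \<subseteq> {..<n1}" "mdeg \<mu> = d" using that by (auto simp: exps_eq_def)
          then have "(\<Sum>i<n1. lookup \<mu> i) = d" using mdeg_superset[of "{..<n1}" \<mu>] by simp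
          moreover have "lookup \<mu> (n1 + i) = 0" for i
            using k(1) by (metis add_lessD1 in_keys_iff lessThan_iff less_irrefl subsetD)
          ultimately show "single (n1 + j) d + \<mu> \<in> Mon n1 n2 d d"
            using k(1) x(3)
            by (auto simp: Mon_def keys_nat_add lookup_add lookup_single when_def sum.distrib split: if_splits)
        qed
        ultimately have "bihom n1 n2 d d (Var (n1 + j) ^ d * H d f)"
          by (simp add: bihom_sum)
        moreover have "l (Var (n1 + j) ^ d * H d f) = 0" if "l \<in> L d" for l
          using lf that d x(3) unfolding L'_def \<Lambda>_def by force
        ultimately have "Var (n1 + j) ^ d * H d f \<in> I" by (rule L(4))
        then have "ev x (Var (n1 + j) ^ d * H d f) = 0" using x(1) by blast
        then show ?thesis using x(4) by (simp add: ev.hom_mult ev.hom_power)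
      qed
      moreover have "f = (\<Sum>d\<le>D. H d f)"
      proof -
        have "f = (\<Sum>\<mu>\<in>exps_le n1 D. single \<mu> (lookup f \<mu>))"
          by (rule sum_singles_superset[OF finite_exps_le keys_exps_le[OF f]])
        also have "\<dots> = (\<Sum>d\<le>D. \<Sum>\<mu> | \<mu> \<in> exps_le n1 D \<and> mdeg \<mu> = d. single \<mu> (lookup f \<mu>))"
          by (rule sum.group[symmetric, OF finite_exps_le]) (auto simp: exps_le_def)
        also have "\<dots> = (\<Sum>d\<le>D. H d f)"
          unfolding H_def by (intro sum.cong refl) (auto simp: exps_le_def exps_eq_def)
        finally show ?thesis .
      qed
      ultimately have "ev x f = 0" by (metis (no_types, lifting) atMost_iff ev.hom_sum sum.neutral)
      moreover have "ev x f = peval f z"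
        unfolding peval_ev by (rule evg_cong[OF f(1)]) (use x(2) in simp)
      ultimately show ?thesis by simp
    qed
    show ?thesis using fin card lin van by blast
  qed
  then show ?thesis unfolding sep_def by blast
qed

text \<open>The bound \<open>n2 - 1\<close> accounts for the points whose first block vanishes.\<close>

lemma sep_chart:
  assumes g: "dgrowth n1 n2 I m" "pideal I" and i: "i < n2"
    and W: "\<And>z. z \<in> W \<Longrightarrow> (\<forall>g\<in>I. ev (($) z) g = 0) \<and> z $ (n1 + i) = 1"
  shows "sep (n1 + n2) W (max m (n2 - 1))"
proof -
  from dgrowthE[OF g] obtain K L where KL: "\<forall>d. finite (L d) \<and> card (L d) * (d + 1) \<le> K * (d + 1) ^ m \<and>
      (\<forall>l\<in>L d. clin l) \<and> (\<forall>f. bihom n1 n2 d d f \<longrightarrow> (\<forall>l\<in>L d. l f = 0) \<longrightarrow> f \<in> I)"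
    by (elim exE)
  have L: "finite (L d)" "card (L d) * (d + 1) \<le> K * (d + 1) ^ m" "l \<in> L d \<Longrightarrow> clin l"
    "bihom n1 n2 d d f \<Longrightarrow> (\<And>l. l \<in> L d \<Longrightarrow> l f = 0) \<Longrightarrow> f \<in> I" for d l f
    using KL[THEN spec, of d] by auto
  define d1 where "d1 = (\<lambda>\<mu> :: nat \<Rightarrow>\<^sub>0 nat. \<Sum>k<n1. lookup \<mu> k)"
  define d2 where "d2 = (\<lambda>\<mu> :: nat \<Rightarrow>\<^sub>0 nat. \<Sum>j<n2. lookup \<mu> (n1 + j))"
  define S where "S = (\<lambda>D d. {\<mu> \<in> exps_le (n1 + n2) D. d1 \<mu> = d})"
  have mdeg12: "mdeg \<mu> = d1 \<mu> + d2 \<mu>" if "keys \<mu> \<subseteq> {..<n1 + n2}" for \<mu>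
    using mdeg_superset[OF _ that] by (simp add: sum_lessThan_add d1_def d2_def)
  \<comment> \<open>On the chart the coordinate n1 + i is 1, so every monomial can be filled up to
    second degree D without changing its values.\<close>
  define H where "H = (\<lambda>D d f. \<Sum>\<mu>\<in>S D d. single (\<mu> + single (n1 + i) (D - d2 \<mu>)) (lookup f \<mu>) :: cpoly)"
  have H_add: "H D d (f + g) = H D d f + H D d g" for D d f g
    by (simp add: H_def lookup_add single_add sum.distrib)
  have H_Cst: "H D d (Cst c * f) = Cst c * H D d f" for D d c f
    by (simp add: H_def sum_distrib_left) (simp add: Cst_def mult_single)
  define \<Lambda> where "\<Lambda> = (\<lambda>D d k l f. l (Var k ^ (D - d) * H D d f) :: complex)"
  define A where "A = {n1..<n1 + n2} - {n1 + i}"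
  \<comment> \<open>For points with vanishing first block: monomials of the second block, grouped by
    the exponents of all coordinates except n1 + i.\<close>
  define \<Theta> :: "nat \<Rightarrow> (nat \<Rightarrow> nat) \<Rightarrow> cpoly \<Rightarrow> complex" where "\<Theta> = (\<lambda>D \<nu> f. \<Sum>\<mu> | \<mu> \<in> S D 0 \<and> restrict (lookup \<mu>) A = \<nu>. lookup f \<mu>)"
  have "\<exists>L'. finite L' \<and> card L' \<le> (n1 * K + 1) * (D + 1) ^ max m (n2 - 1) \<and> (\<forall>l\<in>L'. clin l) \<and>
     (\<forall>f. in_vars (n1 + n2) f \<longrightarrow> tdeg_le D f \<longrightarrow> (\<forall>l\<in>L'. l f = 0) \<longrightarrow> (\<forall>z\<in>W. peval f z = 0))" for D
  proof -
    define LA where "LA = (\<Union>d\<le>D. \<Union>k<n1. \<Lambda> D d k ` L D)"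
    define P where "P = PiE A (\<lambda>_. {..D})"
    define LB where "LB = \<Theta> D ` P"
    have finA: "finite A" and cardA: "card A = n2 - 1" using i by (auto simp: A_def)
    have finP: "finite P" and cardP: "card P = (D + 1) ^ (n2 - 1)"
      using finA cardA by (auto simp: P_def finite_PiE card_PiE)
    have finL: "finite (LA \<union> LB)" using finP by (auto simp: LA_def LB_def L(1))
    have "card LA \<le> (\<Sum>d\<le>D. card (\<Union>k<n1. \<Lambda> D d k ` L D))"
      unfolding LA_def by (rule card_UN_le) simp
    also have "\<dots> \<le> (\<Sum>d\<le>D. \<Sum>k<n1. card (\<Lambda> D d k ` L D))"
      by (intro sum_mono card_UN_le) simp
    also have "\<dots> \<le> (\<Sum>d\<le>D. \<Sum>k<n1. card (L D))"
      by (intro sum_mono card_image_le[OF L(1)])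
    also have "\<dots> = n1 * (card (L D) * (D + 1))" by (simp add: mult_ac)
    also have "\<dots> \<le> n1 * (K * (D + 1) ^ m)" by (rule mult_le_mono2[OF L(2)])
    also have "\<dots> \<le> n1 * (K * (D + 1) ^ max m (n2 - 1))"
      by (intro mult_le_mono2 power_increasing) auto
    finally have "card LA \<le> n1 * (K * (D + 1) ^ max m (n2 - 1))" .
    moreover have "card LB \<le> (D + 1) ^ max m (n2 - 1)"
    proof -
      have "card LB \<le> (D + 1) ^ (n2 - 1)"
        using card_image_le[OF finP, of "\<Theta> D"] by (simp add: LB_def cardP)
      also have "\<dots> \<le> (D + 1) ^ max m (n2 - 1)" by (intro power_increasing) auto
      finally show ?thesis .
    qed
    ultimately have card: "card (LA \<union> LB) \<le> (n1 * K + 1) * (D + 1) ^ max m (n2 - 1)"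
      using card_Un_le[of LA LB] by (simp add: algebra_simps)
    have "clin (\<Lambda> D d k l)" if "l \<in> L D" for d k l
      unfolding \<Lambda>_def
      by (rule clin_compose[OF L(3)[OF that]]) (simp_all add: H_add H_Cst ring_distribs mult.left_commute)
    then have "clin l" if "l \<in> LA" for l
      using that unfolding LA_def by blast
    moreover have "clin l" if "l \<in> LB" for l
      using that unfolding LB_def \<Theta>_def
      by (auto simp: clin_def lookup_add sum.distrib sum_distrib_left)
    ultimately have lin: "clin l" if "l \<in> LA \<union> LB" for l using that by blast
    have van: "peval f z = 0"
      if f: "in_vars (n1 + n2) f" "tdeg_le D f" and lf: "\<forall>l\<in>LA \<union> LB. l f = 0" and zW: "z \<in> W" for f z
    proof -
      define x where "x = (($) z)"
      have x: "\<forall>g\<in>I. ev x g = 0" "x (n1 + i) = 1" using W[OF zW] by (auto simp: x_def)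
      have fS: "f = (\<Sum>\<mu>\<in>exps_le (n1 + n2) D. single \<mu> (lookup f \<mu>))"
        by (rule sum_singles_superset[OF finite_exps_le keys_exps_le[OF f]])
      show ?thesis
      proof (cases "\<exists>k<n1. x k \<noteq> 0")
        case True
        then obtain k where k: "k < n1" "x k \<noteq> 0" by blast
        \<comment> \<open>A power of the nonzero coordinate k fills up the first degree, so that the
          form has bidegree (D, D).\<close>
        have "ev x (H D d f) = 0" if d: "d \<le> D" for d
        proof -
          have "Var k ^ (D - d) * H D d f
              = (\<Sum>\<mu>\<in>S D d. single (single k (D - d) + (\<mu> + single (n1 + i) (D - d2 \<mu>))) (lookup f \<mu>))"
            by (simp add: H_def sum_distrib_left power_mult_single)
          moreover have "bihom n1 n2 D D (single (single k (D - d) + (\<mu> + single (n1 + i) (D - d2 \<mu>))) (lookup f \<mu>))"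
            if \<mu>: "\<mu> \<in> S D d" for \<mu>
          proof (rule bihom_single)
            have \<mu>': "keys \<mu> \<subseteq> {..<n1 + n2}" "d1 \<mu> = d" "mdeg \<mu> \<le> D" using \<mu> by (auto simp: S_def exps_le_def)
            have "\<mu> \<in> Mon n1 n2 d (d2 \<mu>)" using \<mu>' by (simp add: Mon_def d1_def d2_def)
            moreover have "single k (D - d) \<in> Mon n1 n2 (D - d) 0"
              using k(1) by (auto simp: Mon_def lookup_single when_def)
            moreover have "single (n1 + i) (D - d2 \<mu>) \<in> Mon n1 n2 0 (D - d2 \<mu>)"
              using i by (auto simp: Mon_def lookup_single when_def)
            ultimately have "single k (D - d) + (\<mu> + single (n1 + i) (D - d2 \<mu>))
                \<in> Mon n1 n2 ((D - d) + (d + 0)) (0 + (d2 \<mu> + (D - d2 \<mu>)))"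
              by (intro Mon_add)
            moreover have "d2 \<mu> \<le> D" using mdeg12[OF \<mu>'(1)] \<mu>'(3) by simp
            ultimately show "single k (D - d) + (\<mu> + single (n1 + i) (D - d2 \<mu>)) \<in> Mon n1 n2 D D"
              using d by simp
          qed
          ultimately have "bihom n1 n2 D D (Var k ^ (D - d) * H D d f)"
            by (simp add: bihom_sum)
          moreover have "l (Var k ^ (D - d) * H D d f) = 0" if "l \<in> L D" for l
          proof -
            have "\<Lambda> D d k l \<in> LA" using that d k(1) unfolding LA_def by blast
            then show ?thesis using lf by (auto simp: \<Lambda>_def)
          qed
          ultimately have "Var k ^ (D - d) * H D d f \<in> I" by (rule L(4))
          then have "ev x (Var k ^ (D - d) * H D d f) = 0" using x(1) by blast
          then show ?thesis using k(2) by (simp add: ev.hom_mult ev.hom_power)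
        qed
        moreover have "ev x f = (\<Sum>d\<le>D. ev x (H D d f))"
        proof -
          have "monev x (single (n1 + i) e) = 1" for e
            by (simp add: monev_def x(2))
          then have "ev x (H D d f) = (\<Sum>\<mu>\<in>S D d. lookup f \<mu> * monev x \<mu>)" for d
            by (simp add: H_def ev.hom_sum ev_single monev_add)
          moreover have "(\<Sum>\<mu>\<in>exps_le (n1 + n2) D. lookup f \<mu> * monev x \<mu>)
              = (\<Sum>d\<le>D. \<Sum>\<mu> | \<mu> \<in> exps_le (n1 + n2) D \<and> d1 \<mu> = d. lookup f \<mu> * monev x \<mu>)"
          proof (rule sum.group[symmetric, OF finite_exps_le])
            show "d1 ` exps_le (n1 + n2) D \<subseteq> {..D}"
              using mdeg12 by (fastforce simp: exps_le_def)
          qed auto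
          moreover have "ev x f = (\<Sum>\<mu>\<in>exps_le (n1 + n2) D. lookup f \<mu> * monev x \<mu>)"
            by (subst fS) (simp add: ev.hom_sum ev_single)
          ultimately show ?thesis by (simp add: S_def)
        qed
        ultimately have "ev x f = 0" by simp
        then show ?thesis by (simp add: peval_ev x_def)
      next
        case False
        have finS: "finite (S D 0)" by (simp add: S_def)
        have zero: "monev x \<mu> = 0" if "\<mu> \<in> exps_le (n1 + n2) D - S D 0" for \<mu>
        proof -
          have "d1 \<mu> \<noteq> 0" using that by (auto simp: S_def)
          then obtain k where "k < n1" "lookup \<mu> k \<noteq> 0" by (auto simp: d1_def)
          then show ?thesis using False by (auto simp: monev_def in_keys_iff intro!: bexI[of _ k])
        qed
        have mon: "monev x \<mu> = (\<Prod>a\<in>A. x a ^ restrict (lookup \<mu>) A a)" if \<mu>: "\<mu> \<in> S D 0" for \<mu>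
        proof -
          have z0: "lookup \<mu> k = 0" if "k < n1" for k using \<mu> that by (simp add: S_def d1_def)
          have "k \<in> insert (n1 + i) A" if k: "k \<in> keys \<mu>" for k
          proof -
            have "k < n1 + n2" using \<mu> k unfolding S_def exps_le_def by blast
            moreover have "\<not> k < n1" using z0[of k] k unfolding in_keys_iff by blast
            ultimately show ?thesis by (auto simp: A_def)
          qed
          then have "keys \<mu> \<subseteq> insert (n1 + i) A" by blast
          then have "monev x \<mu> = (\<Prod>a\<in>insert (n1 + i) A. x a ^ lookup \<mu> a)"
            using finA by (intro monev_superset) auto
          also have "\<dots> = (\<Prod>a\<in>A. x a ^ lookup \<mu> a)"
            using finA by (subst prod.insert) (auto simp: A_def x(2))
          finally show ?thesis by simp
        qed
        have "ev x f = (\<Sum>\<mu>\<in>exps_le (n1 + n2) D. lookup f \<mu> * monev x \<mu>)"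
          by (subst fS) (simp add: ev.hom_sum ev_single)
        also have "\<dots> = (\<Sum>\<mu>\<in>S D 0. lookup f \<mu> * monev x \<mu>)"
          using zero by (intro sum.mono_neutral_right) (auto simp: S_def)
        also have "\<dots> = (\<Sum>\<nu>\<in>P. \<Sum>\<mu> | \<mu> \<in> S D 0 \<and> restrict (lookup \<mu>) A = \<nu>. lookup f \<mu> * monev x \<mu>)"
        proof (rule sum.group[symmetric, OF finS finP])
          show "(\<lambda>\<mu>. restrict (lookup \<mu>) A) ` S D 0 \<subseteq> P"
          proof (rule image_subsetI)
            fix \<mu> assume "\<mu> \<in> S D 0"
            then have "lookup \<mu> k \<le> D" for k
              using lookup_le_mdeg[of \<mu> k] by (auto simp: S_def exps_le_def)
            then show "restrict (lookup \<mu>) A \<in> P" unfolding P_def restrict_PiE_iff by blast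
          qed
        qed
        also have "\<dots> = (\<Sum>\<nu>\<in>P. \<Theta> D \<nu> f * (\<Prod>a\<in>A. x a ^ \<nu> a))"
          unfolding \<Theta>_def sum_distrib_right by (intro sum.cong refl) (auto simp: mon)
        also have "\<dots> = 0" using lf by (intro sum.neutral) (auto simp: LB_def)
        finally show ?thesis by (simp add: peval_ev x_def)
      qed
    qed
    show ?thesis using finL card lin van by blast
  qed
  then show ?thesis unfolding sep_def by blast
qed

section \<open>Generic trilinear forms\<close>

definition coef :: "nat \<Rightarrow> nat \<Rightarrow> complex vec \<Rightarrow> nat \<Rightarrow> nat \<Rightarrow> nat \<Rightarrow> complex" where
  "coef t N a i j k = a $ ((i * (t + 1) + j) * N + k)"

text \<open>The j-th entry of s M(x), with the block x of size N before the block s of size t: the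
  equations of the Tjurina transform, see \<open>tjurina_equations_eq\<close>.\<close>

definition qY :: "nat \<Rightarrow> nat \<Rightarrow> complex vec \<Rightarrow> nat \<Rightarrow> cpoly" where
  "qY t N a j = bil N t (\<lambda>k i. coef t N a i j k)"

text \<open>The k-th entry of y B(s), with the block s before the block y; its zeros with y \<noteq>
  0 project onto the cone over the locus where B(s) drops rank.\<close>

definition qV :: "nat \<Rightarrow> nat \<Rightarrow> complex vec \<Rightarrow> nat \<Rightarrow> cpoly" where
  "qV t N a k = bil t (t + 1) (\<lambda>i j. coef t N a i j k)"

lemma coef_index:
  fixes i j k t N :: nat
  assumes "i < t" "j < t + 1" "k < N"
  shows "(i * (t + 1) + j) * N + k < t * (t + 1) * N"
proof -
  have "i * (t + 1) + j + 1 \<le> t * (t + 1)"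
    using assms(1,2) mult_le_mono1[of "i + 1" t "t + 1"] by simp
  then have "(i * (t + 1) + j + 1) * N \<le> t * (t + 1) * N" by (rule mult_le_mono1)
  then show ?thesis using assms(3) by (simp add: algebra_simps)
qed

text \<open>A tensor of zeros and ones. A relation such as i + j = k makes the bilinear forms
  coefficients of a product of two univariate polynomials.\<close>

definition special :: "nat \<Rightarrow> nat \<Rightarrow> (nat \<Rightarrow> nat \<Rightarrow> nat \<Rightarrow> bool) \<Rightarrow> complex vec" where
  "special t N R = vec (t * (t + 1) * N)
     (\<lambda>p. if R (p div N div (t + 1)) (p div N mod (t + 1)) (p mod N) then 1 else 0)"

lemma coef_special:
  assumes "i < t" "j < t + 1" "k < N"
  shows "coef t N (special t N R) i j k = (if R i j k then 1 else 0)"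
proof -
  have "((i * (t + 1) + j) * N + k) div N = i * (t + 1) + j" "((i * (t + 1) + j) * N + k) mod N = k"
    using assms(3) by auto
  moreover have "(i * (t + 1) + j) div (t + 1) = i" "(i * (t + 1) + j) mod (t + 1) = j"
    using assms(2) div_mult_self3[of "t + 1" j i] by (auto simp del: mult_Suc_right)
  ultimately show ?thesis
    using coef_index[OF assms] by (simp add: coef_def special_def del: mult_Suc_right)
qed

text \<open>The product of two nonzero univariate polynomials is nonzero (\<open>\<rho>\<close> possibly reverses the
  order of the coefficients of the second one).\<close>

lemma convolution_nonzero:
  fixes x y :: "nat \<Rightarrow> complex"
  assumes \<rho>: "inj_on \<rho> {..<n2}" "\<And>i. i < n2 \<Longrightarrow> \<rho> i < n2"
    and zero: "\<And>m. m < n1 + n2 - 1 \<Longrightarrow> (\<Sum>k<n1. \<Sum>i<n2. (if k + \<rho> i = m then 1 else 0) * x k * y i) = 0"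
  shows "(\<forall>k<n1. x k = 0) \<or> (\<forall>i<n2. y i = 0)"
proof (rule ccontr)
  assume "\<not> ?thesis"
  then have ex: "\<exists>k. k < n1 \<and> x k \<noteq> 0" "\<exists>i. i < n2 \<and> y i \<noteq> 0" by auto
  \<comment> \<open>The lowest nonzero coefficients of the two factors are taken; their product is
    the only contribution to the lowest coefficient of the product.\<close>
  obtain k0 where k0: "k0 < n1" "x k0 \<noteq> 0" "\<And>k. k < n1 \<Longrightarrow> x k \<noteq> 0 \<Longrightarrow> k0 \<le> k"
    using ex_has_least_nat[of "\<lambda>k. k < n1 \<and> x k \<noteq> 0" _ "\<lambda>k. k"] ex(1) by blast
  obtain i0 where i0: "i0 < n2" "y i0 \<noteq> 0" "\<And>i. i < n2 \<Longrightarrow> y i \<noteq> 0 \<Longrightarrow> \<rho> i0 \<le> \<rho> i"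
    using ex_has_least_nat[of "\<lambda>i. i < n2 \<and> y i \<noteq> 0" _ \<rho>] ex(2) by blast
  have summand: "(if k + \<rho> i = k0 + \<rho> i0 then 1 else 0) * x k * y i = (if k = k0 then if i = i0 then x k0 * y i0 else 0 else 0)"
    if "k < n1" "i < n2" for k i
  proof (cases "x k = 0 \<or> y i = 0")
    case True
    then show ?thesis using k0(2) i0(2) by auto
  next
    case False
    then have "k0 \<le> k" "\<rho> i0 \<le> \<rho> i" using k0(3) i0(3) that by auto
    then have "k + \<rho> i = k0 + \<rho> i0 \<longleftrightarrow> k = k0 \<and> \<rho> i = \<rho> i0" by auto
    moreover have "\<rho> i = \<rho> i0 \<longleftrightarrow> i = i0" using \<rho>(1) that i0(1) by (auto simp: inj_on_def)
    ultimately show ?thesis by simp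
  qed
  have "(\<Sum>k<n1. \<Sum>i<n2. (if k + \<rho> i = k0 + \<rho> i0 then 1 else 0) * x k * y i)
      = (\<Sum>k<n1. \<Sum>i<n2. if k = k0 then if i = i0 then x k0 * y i0 else 0 else 0)"
    by (intro sum.cong refl summand) auto
  also have "\<dots> = (\<Sum>k<n1. if k = k0 then \<Sum>i<n2. if i = i0 then x k0 * y i0 else 0 else 0)"
    by (intro sum.cong refl) auto
  also have "\<dots> = x k0 * y i0" using k0(1) i0(1) by simp
  finally have "x k0 * y i0 = 0"
    using zero[of "k0 + \<rho> i0"] k0(1) \<rho>(2)[OF i0(1)] by simp
  then show False using k0(2) i0(2) by simp
qed

text \<open>The first c forms are the ones of interest; the m others complete them to a system
  without nontrivial zeros and may be constant in the parameter. The determinant of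
  \<open>pgen_open\<close> serves as h: generating a whole bidegree (D, D) both bounds the growth
  and excludes nontrivial zeros of the full system.\<close>

lemma generic_growth:
  fixes \<beta> :: "nat \<Rightarrow> nat \<Rightarrow> nat \<Rightarrow> cpoly" and Q :: "complex vec \<Rightarrow> nat \<Rightarrow> cpoly"
  assumes \<beta>: "\<And>k i j. k < c + m \<Longrightarrow> i < n1 \<Longrightarrow> j < n2 \<Longrightarrow> in_vars A (\<beta> k i j)"
    and Q: "\<And>a k. Q a k = bil n1 n2 (\<lambda>i j. peval (\<beta> k i j) a)"
    and nz: "\<And>x. (\<And>k. k < c + m \<Longrightarrow> ev x (Q a0 k) = 0) \<Longrightarrow> (\<forall>i<n1. x i = 0) \<or> (\<forall>j<n2. x (n1 + j) = 0)"
  shows "\<exists>h. in_vars A h \<and> peval h a0 \<noteq> 0 \<and>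
    (\<forall>a. peval h a \<noteq> 0 \<longrightarrow> dgrowth n1 n2 (pgen (Q a ` {..<c})) m \<and>
      (\<forall>x. (\<forall>k<c + m. ev x (Q a k) = 0) \<longrightarrow> (\<forall>i<n1. x i = 0) \<or> (\<forall>j<n2. x (n1 + j) = 0)))"
proof -
  obtain D where D: "D \<ge> 1" "\<forall>\<mu>\<in>Mon n1 n2 D D. single \<mu> 1 \<in> pgen (Q a0 ` {..<c + m})"
    using no_zeros_imp_pgen[of "c + m" "Q a0" n1 n2] nz by blast
  obtain h where h: "in_vars A h" "peval h a0 \<noteq> 0"
    "\<And>a. peval h a \<noteq> 0 \<Longrightarrow> \<forall>\<mu>\<in>Mon n1 n2 D D. single \<mu> 1 \<in> pgen (Q a ` {..<c + m})"
    using pgen_open[where \<beta> = \<beta> and Q = Q, OF \<beta> Q D] by blast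
  have "dgrowth n1 n2 (pgen (Q a ` {..<c})) m" if "peval h a \<noteq> 0" for a
    unfolding dgrowth_def
    by (rule diagonal_growth[OF _ D(1) h(3)[OF that]]) (simp only: Q bihom_bil)
  moreover have "(\<forall>i<n1. x i = 0) \<or> (\<forall>j<n2. x (n1 + j) = 0)"
    if a: "peval h a \<noteq> 0" and x: "\<forall>k<c + m. ev x (Q a k) = 0" for a x
  proof (rule ccontr)
    assume "\<not> ?thesis"
    then obtain i j where ij: "i < n1" "x i \<noteq> 0" "j < n2" "x (n1 + j) \<noteq> 0" by auto
    have "single i D + single (n1 + j) D \<in> Mon n1 n2 D D"
      using ij by (auto simp: Mon_def keys_nat_add lookup_add lookup_single when_def sum.distrib)
    then have "single (single i D + single (n1 + j) D) 1 \<in> pgen (Q a ` {..<c + m})"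
      using h(3)[OF a] by blast
    then have "ev x (single (single i D + single (n1 + j) D) 1) = 0"
      by (rule ev_pgen) (use x in auto)
    then show False
      using ij by (simp add: ev_single monev_add monev_single)
  qed
  ultimately show ?thesis using h(1,2) by blast
qed

text \<open>A product of polynomials with t and t + 1 coefficients has 2t coefficients. The tensor i
  + j = k makes the form with index k the k-th of them; for N < 2t the remaining 2t - N are added as
  constant forms.\<close>

lemma generic_growth_V:
  "\<exists>h. in_vars (t * (t + 1) * N) h \<and> peval h (special t N (\<lambda>i j k. i + j = k)) \<noteq> 0 \<and>
    (\<forall>a. peval h a \<noteq> 0 \<longrightarrow> dgrowth t (t + 1) (pgen (qV t N a ` {..<N})) (2 * t - N) \<and>
      (2 * t \<le> N \<longrightarrow> (\<forall>x. (\<forall>k<N. ev x (qV t N a k) = 0) \<longrightarrow> (\<forall>i<t. x i = 0) \<or> (\<forall>j<t + 1. x (t + j) = 0))))"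
proof -
  define \<beta> where "\<beta> = (\<lambda>k i j. if k < N then Var ((i * (t + 1) + j) * N + k) else Cst (if i + j = k then 1 else 0))"
  define Q where "Q = (\<lambda>a k. bil t (t + 1) (\<lambda>i j. peval (\<beta> k i j) a))"
  have QV: "Q a k = qV t N a k" if "k < N" for a k
    using that by (simp add: Q_def qV_def coef_def \<beta>_def peval_ev)
  have "\<exists>h. in_vars (t * (t + 1) * N) h \<and> peval h (special t N (\<lambda>i j k. i + j = k)) \<noteq> 0 \<and>
    (\<forall>a. peval h a \<noteq> 0 \<longrightarrow> dgrowth t (t + 1) (pgen (Q a ` {..<N})) (2 * t - N) \<and>
      (\<forall>x. (\<forall>k<N + (2 * t - N). ev x (Q a k) = 0) \<longrightarrow> (\<forall>i<t. x i = 0) \<or> (\<forall>j<t + 1. x (t + j) = 0)))"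
    (is "\<exists>h. ?P h")
  proof (rule generic_growth)
    show "in_vars (t * (t + 1) * N) (\<beta> k i j)" if "i < t" "j < t + 1" for k i j
      using coef_index[OF that, of k N] by (auto simp: \<beta>_def)
    show "Q a k = bil t (t + 1) (\<lambda>i j. peval (\<beta> k i j) a)" for a k by (simp add: Q_def)
    fix x :: "nat \<Rightarrow> complex"
    assume x: "\<And>k. k < N + (2 * t - N) \<Longrightarrow> ev x (Q (special t N (\<lambda>i j k. i + j = k)) k) = 0"
    show "(\<forall>i<t. x i = 0) \<or> (\<forall>j<t + 1. x (t + j) = 0)"
    proof (rule convolution_nonzero[where \<rho> = "\<lambda>i. i"])
      fix m assume "m < t + (t + 1) - 1"
      then have "ev x (Q (special t N (\<lambda>i j k. i + j = k)) m) = 0" using x by simp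
      moreover have "ev x (Q (special t N (\<lambda>i j k. i + j = k)) m)
          = (\<Sum>i<t. \<Sum>j<t + 1. (if i + j = m then 1 else 0) * x i * x (t + j))"
        unfolding Q_def ev_bil
        using coef_special[of _ t _ m N "\<lambda>i j k. i + j = k"]
        by (intro sum.cong refl) (auto simp: \<beta>_def peval_ev coef_def)
      ultimately show "(\<Sum>i<t. \<Sum>j<t + 1. (if i + j = m then 1 else 0) * x i * x (t + j)) = 0" by simp
    qed auto
  qed
  then obtain h where h: "?P h" by blast
  have "Q a ` {..<N} = qV t N a ` {..<N}" for a using QV by auto
  then show ?thesis using h by (intro exI[of _ h]) (simp add: QV)
qed

text \<open>Reversing s turns i + j = k into k + (t - 1 - i) = j + t - 1, so that the t + 1 forms
  are the coefficients t - 1, ..., 2t - 1 of a product of polynomials with N and t coefficients. The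
  reversal allows the same tensor as in \<open>generic_growth_V\<close>: both conditions must hold
  at a common point.\<close>

lemma generic_growth_Y:
  assumes "1 \<le> t" "t + 1 \<le> N"
  shows "\<exists>h. in_vars (t * (t + 1) * N) h \<and> peval h (special t N (\<lambda>i j k. i + j = k)) \<noteq> 0 \<and>
    (\<forall>a. peval h a \<noteq> 0 \<longrightarrow> dgrowth N t (pgen (qY t N a ` {..<t + 1})) (N - 2))"
proof -
  \<comment> \<open>Numbers the N + t - 1 coefficients: first the t + 1 prescribed ones, then those
    below t - 1, then those from 2t on.\<close>
  define r where "r = (\<lambda>l. if l < t + 1 then l + t - 1 else if l - (t + 1) < t - 1 then l - (t + 1) else l)"
  define \<beta> where "\<beta> = (\<lambda>l k i. if l < t + 1 then Var ((i * (t + 1) + l) * N + k)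
      else Cst (if k + (t - 1 - i) = r l then 1 else 0))"
  define Q where "Q = (\<lambda>a l. bil N t (\<lambda>k i. peval (\<beta> l k i) a))"
  have QY: "Q a l = qY t N a l" if "l < t + 1" for a l
    using that by (simp add: Q_def qY_def coef_def \<beta>_def peval_ev)
  have "\<exists>h. in_vars (t * (t + 1) * N) h \<and> peval h (special t N (\<lambda>i j k. i + j = k)) \<noteq> 0 \<and>
    (\<forall>a. peval h a \<noteq> 0 \<longrightarrow> dgrowth N t (pgen (Q a ` {..<t + 1})) (N - 2) \<and>
      (\<forall>x. (\<forall>l<t + 1 + (N - 2). ev x (Q a l) = 0) \<longrightarrow> (\<forall>k<N. x k = 0) \<or> (\<forall>i<t. x (N + i) = 0)))"
  proof (rule generic_growth)
    show "in_vars (t * (t + 1) * N) (\<beta> l k i)" if "k < N" "i < t" for l k i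
      using coef_index[OF that(2) _ that(1), of l] by (auto simp: \<beta>_def)
    show "Q a l = bil N t (\<lambda>k i. peval (\<beta> l k i) a)" for a l by (simp add: Q_def)
    fix x :: "nat \<Rightarrow> complex"
    assume x: "\<And>l. l < t + 1 + (N - 2) \<Longrightarrow> ev x (Q (special t N (\<lambda>i j k. i + j = k)) l) = 0"
    show "(\<forall>k<N. x k = 0) \<or> (\<forall>i<t. x (N + i) = 0)"
    proof (rule convolution_nonzero[where \<rho> = "\<lambda>i. t - 1 - i"])
      fix m assume m: "m < N + t - 1"
      define l where "l = (if m < t - 1 then m + t + 1 else if m < 2 * t then m - (t - 1) else m)"
      have l: "l < t + 1 + (N - 2)" "r l = m" using m assms by (auto simp: l_def r_def)
      have \<beta>0: "peval (\<beta> l k i) (special t N (\<lambda>i j k. i + j = k)) = (if k + (t - 1 - i) = r l then 1 else 0)"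
        if "k < N" "i < t" for k i
        using coef_special[OF that(2) _ that(1), of l "\<lambda>i j k. i + j = k"] that
        by (auto simp: \<beta>_def peval_ev coef_def r_def)
      have "ev x (Q (special t N (\<lambda>i j k. i + j = k)) l)
          = (\<Sum>k<N. \<Sum>i<t. (if k + (t - 1 - i) = m then 1 else 0) * x k * x (N + i))"
        unfolding Q_def ev_bil using l(2) by (intro sum.cong refl) (simp add: \<beta>0)
      then show "(\<Sum>k<N. \<Sum>i<t. (if k + (t - 1 - i) = m then 1 else 0) * x k * x (N + i)) = 0"
        using x[OF l(1)] by simp
    qed (auto simp: inj_on_def)
  qed
  moreover have "Q a ` {..<t + 1} = qY t N a ` {..<t + 1}" for a using QY by auto
  ultimately show ?thesis by auto
qed

text \<open>For N \<le> t the tensor i + j = k would make the form j = t identically zero. With k +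
  i = j the forms are the coefficients 0, ..., t of the product, and N - 2 constant forms supply the
  rest.\<close>

lemma generic_growth_Y_small:
  assumes "2 \<le> N" "N \<le> t"
  shows "\<exists>h. in_vars (t * (t + 1) * N) h \<and> peval h (special t N (\<lambda>i j k. k + i = j)) \<noteq> 0 \<and>
    (\<forall>a. peval h a \<noteq> 0 \<longrightarrow> dgrowth N t (pgen (qY t N a ` {..<t + 1})) (N - 2))"
proof -
  define \<beta> where "\<beta> = (\<lambda>l k i. if l < t + 1 then Var ((i * (t + 1) + l) * N + k)
      else Cst (if k + i = l then 1 else 0))"
  define Q where "Q = (\<lambda>a l. bil N t (\<lambda>k i. peval (\<beta> l k i) a))"
  have QY: "Q a l = qY t N a l" if "l < t + 1" for a l
    using that by (simp add: Q_def qY_def coef_def \<beta>_def peval_ev)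
  have "\<exists>h. in_vars (t * (t + 1) * N) h \<and> peval h (special t N (\<lambda>i j k. k + i = j)) \<noteq> 0 \<and>
    (\<forall>a. peval h a \<noteq> 0 \<longrightarrow> dgrowth N t (pgen (Q a ` {..<t + 1})) (N - 2) \<and>
      (\<forall>x. (\<forall>l<t + 1 + (N - 2). ev x (Q a l) = 0) \<longrightarrow> (\<forall>k<N. x k = 0) \<or> (\<forall>i<t. x (N + i) = 0)))"
  proof (rule generic_growth)
    show "in_vars (t * (t + 1) * N) (\<beta> l k i)" if "k < N" "i < t" for l k i
      using coef_index[OF that(2) _ that(1), of l] by (auto simp: \<beta>_def)
    show "Q a l = bil N t (\<lambda>k i. peval (\<beta> l k i) a)" for a l by (simp add: Q_def)
    fix x :: "nat \<Rightarrow> complex"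
    assume x: "\<And>l. l < t + 1 + (N - 2) \<Longrightarrow> ev x (Q (special t N (\<lambda>i j k. k + i = j)) l) = 0"
    show "(\<forall>k<N. x k = 0) \<or> (\<forall>i<t. x (N + i) = 0)"
    proof (rule convolution_nonzero[where \<rho> = "\<lambda>i. i"])
      fix m assume m: "m < N + t - 1"
      have \<beta>0: "peval (\<beta> m k i) (special t N (\<lambda>i j k. k + i = j)) = (if k + i = m then 1 else 0)"
        if "k < N" "i < t" for k i
        using coef_special[OF that(2) _ that(1), of m "\<lambda>i j k. k + i = j"] that
        by (auto simp: \<beta>_def peval_ev coef_def)
      have "ev x (Q (special t N (\<lambda>i j k. k + i = j)) m)
          = (\<Sum>k<N. \<Sum>i<t. (if k + i = m then 1 else 0) * x k * x (N + i))"
        unfolding Q_def ev_bil by (intro sum.cong refl) (simp add: \<beta>0)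
      then show "(\<Sum>k<N. \<Sum>i<t. (if k + i = m then 1 else 0) * x k * x (N + i)) = 0"
        using x[of m] m assms by simp
    qed auto
  qed
  moreover have "Q a ` {..<t + 1} = qY t N a ` {..<t + 1}" for a using QY by auto
  ultimately show ?thesis by auto
qed

section \<open>Projective varieties and their cones\<close>

definition ray :: "complex vec \<Rightarrow> complex vec set" where
  "ray s = {c \<cdot>\<^sub>v s |c. c \<noteq> 0}"

lemma proj_space_eq: "proj_space n = ray ` {s \<in> carrier_vec n. s \<noteq> 0\<^sub>v n}"
  by (auto simp: proj_space_def ray_def)

lemma self_in_ray: "s \<in> ray s"
  unfolding ray_def by (auto intro!: exI[of _ 1])

lemma proj_spaceD:
  assumes "p \<in> proj_space n" "s \<in> p"
  shows "s \<in> carrier_vec n" "s \<noteq> 0\<^sub>v n" "p = ray s"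
proof -
  obtain r where r: "p = ray r" "r \<in> carrier_vec n" "r \<noteq> 0\<^sub>v n"
    using assms(1) by (auto simp: proj_space_eq)
  then obtain c where c: "s = c \<cdot>\<^sub>v r" "c \<noteq> 0" using assms(2) by (auto simp: ray_def)
  have r_eq: "r = (1 / c) \<cdot>\<^sub>v s" using c by (simp add: smult_smult_assoc)
  show "s \<in> carrier_vec n" using r c by simp
  show "s \<noteq> 0\<^sub>v n"
  proof
    assume "s = 0\<^sub>v n"
    then have "r = 0\<^sub>v n" unfolding r_eq by (intro eq_vecI) auto
    then show False using r(3) by simp
  qed
  have "x \<in> ray s" if x: "x \<in> ray r" for x
  proof -
    obtain d where d: "x = d \<cdot>\<^sub>v r" "d \<noteq> 0" using x by (auto simp: ray_def)
    then have "x = (d / c) \<cdot>\<^sub>v s" using c by (simp add: smult_smult_assoc)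
    then show ?thesis using d(2) c(2) unfolding ray_def by (auto intro!: exI[of _ "d / c"])
  qed
  moreover have "x \<in> ray r" if x: "x \<in> ray s" for x
  proof -
    obtain d where d: "x = d \<cdot>\<^sub>v s" "d \<noteq> 0" using x by (auto simp: ray_def)
    then have "x = (d * c) \<cdot>\<^sub>v r" using c by (simp add: smult_smult_assoc)
    then show ?thesis using d(2) c(2) unfolding ray_def by (auto intro!: exI[of _ "d * c"])
  qed
  ultimately show "p = ray s" using r(1) by blast
qed

lemma ray_in_proj_space: "s \<in> carrier_vec n \<Longrightarrow> s \<noteq> 0\<^sub>v n \<Longrightarrow> ray s \<in> proj_space n"
  by (simp add: proj_space_eq)

lemma monev_scale: "monev (\<lambda>i. c * x i) m = c ^ mdeg m * monev x m" for c :: complex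
  by (simp add: monev_def mdeg_def power_mult_distrib prod.distrib power_sum)

lemma homogeneous_in_vars: "homogeneous n d f \<Longrightarrow> in_vars n f"
  by (simp add: homogeneous_def)

lemma homogeneous_mdeg: "homogeneous n d f \<Longrightarrow> m \<in> keys f \<Longrightarrow> mdeg m = d"
  by (simp add: homogeneous_def mdeg_def)

lemma peval_scale:
  assumes "homogeneous n d f" "s \<in> carrier_vec n"
  shows "peval f (c \<cdot>\<^sub>v s) = c ^ d * peval f s"
proof -
  have "peval f (c \<cdot>\<^sub>v s) = ev (\<lambda>i. c * s $ i) f"
    unfolding peval_ev by (rule evg_cong[OF homogeneous_in_vars[OF assms(1)]]) (use assms(2) in simp)
  also have "\<dots> = (\<Sum>m\<in>keys f. c ^ d * (lookup f m * monev (($) s) m))"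
    unfolding evg_def by (intro sum.cong refl) (simp add: monev_scale homogeneous_mdeg[OF assms(1)])
  also have "\<dots> = c ^ d * peval f s"
    by (simp add: peval_ev evg_def sum_distrib_left)
  finally show ?thesis .
qed

lemma ray_in_proj_zero_locus:
  assumes S: "\<And>f. f \<in> S \<Longrightarrow> \<exists>d. homogeneous n d f" and s: "s \<in> carrier_vec n" "s \<noteq> 0\<^sub>v n"
  shows "ray s \<in> proj_zero_locus n S \<longleftrightarrow> (\<forall>f\<in>S. peval f s = 0)"
proof
  assume "ray s \<in> proj_zero_locus n S"
  then show "\<forall>f\<in>S. peval f s = 0" using self_in_ray[of s] by (auto simp: proj_zero_locus_def)
next
  assume z: "\<forall>f\<in>S. peval f s = 0"
  have "peval f x = 0" if f: "f \<in> S" and x: "x \<in> ray s" for f x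
  proof -
    obtain c where "x = c \<cdot>\<^sub>v s" using x by (auto simp: ray_def)
    then show ?thesis using S[OF f] z f peval_scale[OF _ s(1)] by fastforce
  qed
  then show "ray s \<in> proj_zero_locus n S"
    using ray_in_proj_space[OF s] by (auto simp: proj_zero_locus_def)
qed

lemma proj_closed_subset: "Z \<in> proj_closed n \<Longrightarrow> Z \<subseteq> proj_space n"
  by (auto simp: proj_closed_def proj_zero_locus_def)

lemma proj_closedI: "(\<And>f. f \<in> S \<Longrightarrow> \<exists>d. homogeneous n d f) \<Longrightarrow> proj_zero_locus n S \<in> proj_closed n"
  unfolding proj_closed_def by blast

lemma proj_closed_Int:
  assumes "A \<in> proj_closed n" "B \<in> proj_closed n"
  shows "A \<inter> B \<in> proj_closed n"
proof -
  obtain S T where S: "A = proj_zero_locus n S" "\<forall>f\<in>S. \<exists>d. homogeneous n d f"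
    and T: "B = proj_zero_locus n T" "\<forall>f\<in>T. \<exists>d. homogeneous n d f"
    using assms by (auto simp: proj_closed_def)
  have "A \<inter> B = proj_zero_locus n (S \<union> T)"
    unfolding S(1) T(1) proj_zero_locus_def by blast
  then show ?thesis using S(2) T(2) proj_closedI[of "S \<union> T" n] by auto
qed

lemma homogeneous_add: "homogeneous n d f \<Longrightarrow> homogeneous n d g \<Longrightarrow> homogeneous n d (f + g)"
  unfolding homogeneous_def using keys_add[of f g] in_vars_add by blast

lemma homogeneous_0: "homogeneous n d 0"
  by (simp add: homogeneous_def)

lemma homogeneous_sum: "(\<And>a. a \<in> A \<Longrightarrow> homogeneous n d (g a)) \<Longrightarrow> homogeneous n d (sum g A)"
  by (induction A rule: infinite_finite_induct) (auto intro: homogeneous_add homogeneous_0)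

lemma homogeneous_single: "\<mu> \<in> exps_eq n d \<Longrightarrow> homogeneous n d (single \<mu> c)"
  by (cases "c = 0") (auto simp: homogeneous_def in_vars_def exps_eq_def mdeg_def)

lemma homogeneous_mult: "homogeneous n d f \<Longrightarrow> homogeneous n e g \<Longrightarrow> homogeneous n (d + e) (f * g)"
  unfolding homogeneous_def mdeg_def[symmetric]
  by (auto simp: in_vars_mult mdeg_add elim!: keys_mult_cpoly)

lemma homogeneous_Cst_Var: "i < n \<Longrightarrow> homogeneous n 1 (Cst c * Var i)"
  by (cases "c = 0") (auto simp: homogeneous_def in_vars_def Cst_def Var_def mult_single)

lemma proj_closed_Un:
  assumes "A \<in> proj_closed n" "B \<in> proj_closed n"
  shows "A \<union> B \<in> proj_closed n"
proof -
  obtain S T where S: "A = proj_zero_locus n S" "\<And>f. f \<in> S \<Longrightarrow> \<exists>d. homogeneous n d f"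
    and T: "B = proj_zero_locus n T" "\<And>f. f \<in> T \<Longrightarrow> \<exists>d. homogeneous n d f"
    using assms by (auto simp: proj_closed_def)
  define ST where "ST = {f * g |f g. f \<in> S \<and> g \<in> T}"
  have hom: "\<exists>d. homogeneous n d h" if "h \<in> ST" for h
    using that S(2) T(2) homogeneous_mult unfolding ST_def by blast
  have "p \<in> A \<union> B \<longleftrightarrow> p \<in> proj_zero_locus n ST" for p
  proof (cases "p \<in> proj_space n")
    case True
    then obtain s where s: "s \<in> carrier_vec n" "s \<noteq> 0\<^sub>v n" "p = ray s" by (auto simp: proj_space_eq)
    have "(\<forall>h\<in>ST. peval h s = 0) \<longleftrightarrow> (\<forall>f\<in>S. \<forall>g\<in>T. peval f s * peval g s = 0)"
      unfolding ST_def by (auto simp: peval_ev ev.hom_mult; metis ev.hom_mult mult_eq_0_iff)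
    also have "\<dots> \<longleftrightarrow> (\<forall>f\<in>S. peval f s = 0) \<or> (\<forall>g\<in>T. peval g s = 0)" by auto
    finally show ?thesis
      unfolding S(1) T(1) Un_iff s(3)
      using ray_in_proj_zero_locus[OF S(2) s(1,2)] ray_in_proj_zero_locus[OF T(2) s(1,2)]
        ray_in_proj_zero_locus[OF hom s(1,2)] by simp
  qed (auto simp: S(1) T(1) proj_zero_locus_def)
  then have "A \<union> B = proj_zero_locus n ST" by blast
  then show ?thesis using proj_closedI[OF hom] by simp
qed

lemma proj_closed_empty: "{} \<in> proj_closed n"
proof -
  have "proj_zero_locus n {1} = {}"
    unfolding proj_zero_locus_def proj_space_eq using self_in_ray by (auto simp: peval_ev)
  moreover have "homogeneous n 0 1" by (simp add: homogeneous_def in_vars_def)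
  ultimately show ?thesis using proj_closedI[of "{1}" n] by auto
qed

lemma proj_closed_Union: "finite \<W> \<Longrightarrow> \<W> \<subseteq> proj_closed n \<Longrightarrow> \<Union>\<W> \<in> proj_closed n"
  by (induction \<W> rule: finite_induct) (auto intro: proj_closed_empty proj_closed_Un)

section \<open>Affine cones over projective sets\<close>

definition cone :: "nat \<Rightarrow> complex vec set set \<Rightarrow> complex vec set" where
  "cone n Z = {s \<in> carrier_vec n. s = 0\<^sub>v n \<or> ray s \<in> Z}"

definition hcomp :: "nat \<Rightarrow> nat \<Rightarrow> cpoly \<Rightarrow> cpoly" where
  "hcomp n d f = (\<Sum>\<mu>\<in>exps_eq n d. single \<mu> (lookup f \<mu>))"

lemma homogeneous_hcomp: "homogeneous n d (hcomp n d f)"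
  unfolding hcomp_def by (intro homogeneous_sum homogeneous_single)

lemma sum_hcomp:
  assumes "in_vars n f" "tdeg_le D f"
  shows "f = (\<Sum>d\<le>D. hcomp n d f)"
proof -
  have "f = (\<Sum>\<mu>\<in>exps_le n D. single \<mu> (lookup f \<mu>))"
    by (rule sum_singles_superset[OF finite_exps_le keys_exps_le[OF assms]])
  also have "\<dots> = (\<Sum>d\<le>D. \<Sum>\<mu> | \<mu> \<in> exps_le n D \<and> mdeg \<mu> = d. single \<mu> (lookup f \<mu>))"
    by (rule sum.group[symmetric, OF finite_exps_le]) (auto simp: exps_le_def)
  also have "\<dots> = (\<Sum>d\<le>D. hcomp n d f)"
    unfolding hcomp_def by (intro sum.cong refl) (auto simp: exps_le_def exps_eq_def)
  finally show ?thesis .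
qed

lemma hcomp_eq_0:
  assumes "tdeg_le D f" "D < d"
  shows "hcomp n d f = 0"
  unfolding hcomp_def
proof (rule sum.neutral, rule ballI)
  fix \<mu> assume "\<mu> \<in> exps_eq n d"
  then have "\<mu> \<notin> keys f" using assms by (auto simp: exps_eq_def tdeg_le_def)
  then show "single \<mu> (lookup f \<mu>) = 0" by (simp add: in_keys_iff)
qed

text \<open>On a line through the origin the homogeneous components of \<open>f\<close> become the
  coefficients of a univariate polynomial, so vanishing on the line means vanishing of all
  components.\<close>

lemma line_poly:
  assumes f: "in_vars n f" and s: "s \<in> carrier_vec n"
  shows "\<exists>P. (\<forall>c. poly P c = peval f (c \<cdot>\<^sub>v s)) \<and> (\<forall>d. coeff P d = peval (hcomp n d f) s)"
proof -
  obtain D where D: "tdeg_le D f" using tdeg_le_ex by blast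
  define P where "P = (\<Sum>d\<le>D. monom (peval (hcomp n d f) s) d)"
  have "poly P c = peval f (c \<cdot>\<^sub>v s)" for c
  proof -
    have "peval f (c \<cdot>\<^sub>v s) = (\<Sum>d\<le>D. peval (hcomp n d f) (c \<cdot>\<^sub>v s))"
      by (subst sum_hcomp[OF f D]) (simp add: peval_ev ev.hom_sum)
    also have "\<dots> = (\<Sum>d\<le>D. c ^ d * peval (hcomp n d f) s)"
      by (simp add: peval_scale[OF homogeneous_hcomp s])
    finally show ?thesis by (simp add: P_def poly_sum poly_monom mult.commute)
  qed
  moreover have "coeff P d = peval (hcomp n d f) s" for d
    using hcomp_eq_0[OF D, of d n] by (auto simp: P_def coeff_sum not_le peval_ev ev.hom_zero)
  ultimately show ?thesis by blast
qed

text \<open>Nonemptiness excludes nonzero constants from S, so that the origin satisfies the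
  equations.\<close>

lemma cone_zero_locus:
  assumes S: "\<And>f. f \<in> S \<Longrightarrow> \<exists>d. homogeneous n d f" and ne: "proj_zero_locus n S \<noteq> {}"
  shows "cone n (proj_zero_locus n S) = zero_locus n S"
proof -
  obtain p where p: "p \<in> proj_zero_locus n S" using ne by blast
  then obtain r where r: "r \<in> carrier_vec n" "r \<noteq> 0\<^sub>v n" "p = ray r"
    by (auto simp: proj_zero_locus_def proj_space_eq)
  have "peval f (0\<^sub>v n) = 0" if f: "f \<in> S" for f
  proof -
    obtain d where d: "homogeneous n d f" using S[OF f] by blast
    have "peval f r = 0" using p f self_in_ray[of r] r(3) by (auto simp: proj_zero_locus_def)
    then have "peval f (0 \<cdot>\<^sub>v r) = 0" using peval_scale[OF d r(1), of 0] by simp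
    moreover have "0 \<cdot>\<^sub>v r = 0\<^sub>v n" using r(1) by auto
    ultimately show ?thesis by simp
  qed
  then show ?thesis
    using ray_in_proj_zero_locus[of S n, OF S] by (auto simp: cone_def zero_locus_def)
qed

text \<open>If A and B cover the cone, each of its lines lies in one of them, since univariate
  polynomials have no zero divisors. The lines lying in A form a projective closed set, cut out by
  the homogeneous components of the equations of A, and irreducibility of Z decides.\<close>

lemma irreducible_cone:
  assumes Z: "irreducible_closed (proj_closed n) Z"
  shows "irreducible_closed (affine_closed n) (cone n Z)"
proof -
  have Zc: "Z \<in> proj_closed n" "Z \<noteq> {}" using Z by (auto simp: irreducible_closed_def)
  obtain S where S: "Z = proj_zero_locus n S" "\<And>f. f \<in> S \<Longrightarrow> \<exists>d. homogeneous n d f"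
    using Zc(1) by (auto simp: proj_closed_def)
  have cz: "cone n Z = zero_locus n S" using cone_zero_locus[of S n] S Zc(2) by simp
  obtain r where r: "r \<in> carrier_vec n" "r \<noteq> 0\<^sub>v n" "ray r \<in> Z"
    using Zc proj_closed_subset[OF Zc(1)] by (auto simp: proj_space_eq)
  show ?thesis
    unfolding irreducible_closed_def
  proof (intro conjI ballI impI)
    show "cone n Z \<in> affine_closed n"
      unfolding cz using S(2) homogeneous_in_vars by (intro zero_locus_closed) blast
    have "0\<^sub>v n \<in> cone n Z" by (simp add: cone_def)
    then show "cone n Z \<noteq> {}" by blast
    fix A B assume AB: "A \<in> affine_closed n" "B \<in> affine_closed n" "cone n Z \<subseteq> A \<union> B"
    define hs where "hs = (\<lambda>S. {hcomp n d f |d f. f \<in> S})"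
    have hs_hom: "\<exists>d. homogeneous n d f" if "f \<in> hs T" for f T
      using that homogeneous_hcomp by (auto simp: hs_def)
    have line: "(\<forall>c. c \<cdot>\<^sub>v s \<in> zero_locus n T) \<longleftrightarrow> ray s \<in> proj_zero_locus n (hs T)"
      if T: "\<forall>f\<in>T. in_vars n f" and s: "s \<in> carrier_vec n" "s \<noteq> 0\<^sub>v n" for T s
    proof -
      have "(\<forall>c. peval f (c \<cdot>\<^sub>v s) = 0) \<longleftrightarrow> (\<forall>d. peval (hcomp n d f) s = 0)" if f: "f \<in> T" for f
      proof -
        obtain P where P: "\<forall>c. poly P c = peval f (c \<cdot>\<^sub>v s)" "\<forall>d. coeff P d = peval (hcomp n d f) s"
          using line_poly[OF T[rule_format, OF f] s(1)] by blast
        have "(\<forall>c. poly P c = 0) \<longleftrightarrow> P = 0" by (simp add: poly_all_0_iff_0)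
        also have "\<dots> \<longleftrightarrow> (\<forall>d. coeff P d = 0)" by (auto simp: poly_eq_iff)
        finally show ?thesis using P by simp
      qed
      then have "(\<forall>f\<in>T. \<forall>c. peval f (c \<cdot>\<^sub>v s) = 0) \<longleftrightarrow> (\<forall>f\<in>T. \<forall>d. peval (hcomp n d f) s = 0)"
        by (intro ball_cong) auto
      also have "\<dots> \<longleftrightarrow> (\<forall>f\<in>hs T. peval f s = 0)" by (auto simp: hs_def)
      also have "\<dots> \<longleftrightarrow> ray s \<in> proj_zero_locus n (hs T)"
        using ray_in_proj_zero_locus[OF hs_hom[of _ T] s] by simp
      finally show ?thesis using s(1) by (auto simp: zero_locus_def)
    qed
    obtain SA SB where SA: "A = zero_locus n SA" "\<forall>f\<in>SA. in_vars n f"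
      and SB: "B = zero_locus n SB" "\<forall>f\<in>SB. in_vars n f"
      using AB by (auto simp: affine_closed_def)
    define A' B' where "A' = proj_zero_locus n (hs SA)" and "B' = proj_zero_locus n (hs SB)"
    have "Z \<subseteq> A' \<union> B'"
    proof
      fix p assume p: "p \<in> Z"
      then obtain s where s: "s \<in> carrier_vec n" "s \<noteq> 0\<^sub>v n" "p = ray s"
        using proj_closed_subset[OF Zc(1)] by (auto simp: proj_space_eq)
      have on: "c \<cdot>\<^sub>v s \<in> A \<union> B" for c
      proof -
        have "peval f (c \<cdot>\<^sub>v s) = 0" if f: "f \<in> S" for f
        proof -
          obtain d where "homogeneous n d f" using S(2)[OF f] by blast
          moreover have "peval f s = 0" using p f self_in_ray[of s] s(3) S(1) by (auto simp: proj_zero_locus_def)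
          ultimately show ?thesis using peval_scale[OF _ s(1)] by simp
        qed
        then have "c \<cdot>\<^sub>v s \<in> cone n Z" using s(1) by (simp add: cz zero_locus_def)
        then show ?thesis using AB(3) by blast
      qed
      have "(\<forall>c. c \<cdot>\<^sub>v s \<in> A) \<or> (\<forall>c. c \<cdot>\<^sub>v s \<in> B)"
      proof (rule ccontr)
        assume "\<not> ?thesis"
        then obtain c d where "c \<cdot>\<^sub>v s \<notin> A" "d \<cdot>\<^sub>v s \<notin> B" by blast
        then obtain f g where fg: "f \<in> SA" "peval f (c \<cdot>\<^sub>v s) \<noteq> 0" "g \<in> SB" "peval g (d \<cdot>\<^sub>v s) \<noteq> 0"
          using SA(1) SB(1) s(1) by (auto simp: zero_locus_def)
        obtain P where P: "\<forall>c. poly P c = peval f (c \<cdot>\<^sub>v s)"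
          using line_poly[OF SA(2)[rule_format, OF fg(1)] s(1)] by blast
        obtain Q where Q: "\<forall>c. poly Q c = peval g (c \<cdot>\<^sub>v s)"
          using line_poly[OF SB(2)[rule_format, OF fg(3)] s(1)] by blast
        have "P \<noteq> 0" "Q \<noteq> 0" using P[rule_format, of c] Q[rule_format, of d] fg by auto
        then have "P * Q \<noteq> 0" by simp
        then obtain e where "poly (P * Q) e \<noteq> 0" using poly_all_0_iff_0 by blast
        then have "peval f (e \<cdot>\<^sub>v s) \<noteq> 0" "peval g (e \<cdot>\<^sub>v s) \<noteq> 0" using P Q by auto
        then show False using on[of e] SA(1) SB(1) fg by (auto simp: zero_locus_def)
      qed
      then show "p \<in> A' \<union> B'"
        unfolding A'_def B'_def s(3) using line[OF SA(2) s(1,2)] line[OF SB(2) s(1,2)] SA(1) SB(1) by blast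
    qed
    moreover have "A' \<in> proj_closed n" "B' \<in> proj_closed n"
      unfolding A'_def B'_def by (intro proj_closedI hs_hom; assumption)+
    ultimately have "Z \<subseteq> A' \<or> Z \<subseteq> B'" using Z unfolding irreducible_closed_def by blast
    moreover have "cone n Z \<subseteq> zero_locus n T" if T: "\<forall>f\<in>T. in_vars n f" and ZT: "Z \<subseteq> proj_zero_locus n (hs T)" for T
    proof
      fix s assume s: "s \<in> cone n Z"
      show "s \<in> zero_locus n T"
      proof (cases "s = 0\<^sub>v n")
        case True
        have "0 \<cdot>\<^sub>v r \<in> zero_locus n T" using line[OF T r(1,2)] r(3) ZT by blast
        moreover have "0 \<cdot>\<^sub>v r = 0\<^sub>v n" using r(1) by auto
        ultimately show ?thesis using True by simp
      next
        case False
        then have s': "s \<in> carrier_vec n" "ray s \<in> Z" using s by (auto simp: cone_def)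
        have "1 \<cdot>\<^sub>v s \<in> zero_locus n T" using line[OF T s'(1) False] s'(2) ZT by blast
        then show ?thesis by simp
      qed
    qed
    ultimately show "cone n Z \<subseteq> A \<or> cone n Z \<subseteq> B"
      unfolding SA(1) SB(1) A'_def B'_def using SA(2) SB(2) by blast
  qed
qed

lemma irreducible_origin: "irreducible_closed (affine_closed n) {0\<^sub>v n}"
proof -
  have "{0\<^sub>v n} = zero_locus n (Var ` {..<n})"
    by (auto simp: zero_locus_def peval_ev intro: eq_vecI)
  moreover have "zero_locus n (Var ` {..<n}) \<in> affine_closed n"
    by (rule zero_locus_closed) auto
  ultimately have "{0\<^sub>v n} \<in> affine_closed n" by simp
  then show ?thesis unfolding irreducible_closed_def by blast
qed

text \<open>The origin is added below the cones, which makes the affine chain one step longer;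
  affine bounds thus become projective ones.\<close>

lemma cone_chain:
  assumes "irreducible_chain (proj_closed n) d Z" "Z d \<subseteq> V"
  shows "\<exists>Z'. irreducible_chain (affine_closed n) (Suc d) Z' \<and> Z' (Suc d) \<subseteq> cone n V"
proof -
  define Z' where "Z' = (\<lambda>i. if i = 0 then {0\<^sub>v n} else cone n (Z (i - 1)))"
  have irr: "irreducible_closed (proj_closed n) (Z i)" if "i \<le> d" for i
    using assms(1) that by (simp add: irreducible_chain_def)
  have point: "\<exists>s. s \<in> carrier_vec n \<and> s \<noteq> 0\<^sub>v n \<and> p = ray s" if "p \<in> Z i" "i \<le> d" for p i
    using proj_closed_subset[of "Z i" n] irr[OF that(2)] that(1)
    by (auto simp: irreducible_closed_def proj_space_eq)
  have "irreducible_closed (affine_closed n) (Z' i)" if "i \<le> Suc d" for i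
    using that irreducible_origin irreducible_cone[OF irr[of "i - 1"]] by (auto simp: Z'_def)
  moreover have "Z' i \<subset> Z' (Suc i)" if i: "i < Suc d" for i
  proof (cases i)
    case 0
    have "Z 0 \<noteq> {}" using irr[of 0] by (simp add: irreducible_closed_def)
    then obtain s where "s \<in> carrier_vec n" "s \<noteq> 0\<^sub>v n" "ray s \<in> Z 0" using point[of _ 0] by blast
    then show ?thesis by (auto simp: 0 Z'_def cone_def)
  next
    case (Suc j)
    then have "Z j \<subset> Z (Suc j)" using assms(1) i by (simp add: irreducible_chain_def)
    moreover from this obtain p where p: "p \<in> Z (Suc j)" "p \<notin> Z j" by blast
    moreover obtain s where "s \<in> carrier_vec n" "s \<noteq> 0\<^sub>v n" "p = ray s"
      using point[OF p(1)] i Suc by auto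
    ultimately show ?thesis by (auto simp: Suc Z'_def cone_def)
  qed
  moreover have "Z' (Suc d) \<subseteq> cone n V" using assms(2) by (auto simp: Z'_def cone_def)
  ultimately show ?thesis unfolding irreducible_chain_def by blast
qed


section \<open>Irreducible components and linear sections\<close>

text \<open>Points are extended by zeros, so that the variables beyond n belong to the ideal and
  \<open>pideal_acc\<close> applies.\<close>

definition vanishing :: "nat \<Rightarrow> complex vec set set \<Rightarrow> cpoly set" where
  "vanishing n Z = {f. \<forall>s\<in>carrier_vec n. s \<noteq> 0\<^sub>v n \<longrightarrow> ray s \<in> Z \<longrightarrow> ev (\<lambda>i. if i < n then s $ i else 0) f = 0}"

lemma pideal_vanishing: "pideal (vanishing n Z)"
  by (auto simp: pideal_def vanishing_def ev.hom_add ev.hom_mult)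

lemma vanishing_strict:
  assumes "Z \<in> proj_closed n" "Z' \<in> proj_closed n" "Z \<subset> Z'"
  shows "vanishing n Z' \<subset> vanishing n Z"
proof -
  obtain S where S: "Z = proj_zero_locus n S" "\<And>f. f \<in> S \<Longrightarrow> \<exists>d. homogeneous n d f"
    using assms(1) by (auto simp: proj_closed_def)
  obtain p where p: "p \<in> Z'" "p \<notin> Z" using assms(3) by blast
  obtain s where s: "s \<in> carrier_vec n" "s \<noteq> 0\<^sub>v n" "p = ray s"
    using p(1) proj_closed_subset[OF assms(2)] by (auto simp: proj_space_eq)
  have eq: "ev (\<lambda>i. if i < n then r $ i else 0) f = peval f r" if "f \<in> S" for f r
    unfolding peval_ev using S(2)[OF that] homogeneous_in_vars by (auto intro!: evg_cong[of n])
  obtain f where f: "f \<in> S" "peval f s \<noteq> 0"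
    using p(2) s S ray_in_proj_zero_locus[of S n s, OF S(2)] by blast
  have "f \<in> vanishing n Z"
    using ray_in_proj_zero_locus[of S n, OF S(2)] f(1) S(1) eq[OF f(1)] by (auto simp: vanishing_def)
  moreover have "f \<notin> vanishing n Z'"
    using f eq[OF f(1)] s p(1) by (auto simp: vanishing_def)
  moreover have "vanishing n Z' \<subseteq> vanishing n Z"
    using assms(3) by (auto simp: vanishing_def)
  ultimately show ?thesis by blast
qed

text \<open>Noetherian induction: a closed set that is no finite union of irreducible ones splits
  into two smaller closed sets, one of which is again bad, and the vanishing ideals would ascend
  forever.\<close>

lemma irreducible_components:
  assumes "V \<in> proj_closed n"
  shows "\<exists>\<W>. finite \<W> \<and> (\<forall>W\<in>\<W>. irreducible_closed (proj_closed n) W) \<and> V = \<Union>\<W>"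
proof (rule ccontr)
  define good where "good = (\<lambda>V. \<exists>\<W>. finite \<W> \<and> (\<forall>W\<in>\<W>. irreducible_closed (proj_closed n) W) \<and> V = \<Union>\<W>)"
  assume "\<not> ?thesis"
  then have bad: "\<not> good V" by (simp add: good_def)
  have step: "\<exists>V'. V' \<in> proj_closed n \<and> \<not> good V' \<and> V' \<subset> V" if V: "V \<in> proj_closed n" "\<not> good V" for V
  proof -
    have "V \<noteq> {}" using V(2) unfolding good_def by (metis Union_empty empty_iff finite.emptyI)
    moreover have "\<not> irreducible_closed (proj_closed n) V"
    proof
      assume "irreducible_closed (proj_closed n) V"
      then have "good V" unfolding good_def by (intro exI[of _ "{V}"]) simp
      then show False using V(2) by blast
    qed
    ultimately obtain A B where AB: "A \<in> proj_closed n" "B \<in> proj_closed n" "V \<subseteq> A \<union> B" "\<not> V \<subseteq> A" "\<not> V \<subseteq> B"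
      using V(1) by (auto simp: irreducible_closed_def)
    have "\<not> good (V \<inter> A) \<or> \<not> good (V \<inter> B)"
    proof (rule ccontr)
      assume "\<not> ?thesis"
      then obtain \<W> \<W>' where W: "finite \<W>" "\<forall>W\<in>\<W>. irreducible_closed (proj_closed n) W" "V \<inter> A = \<Union>\<W>"
        "finite \<W>'" "\<forall>W\<in>\<W>'. irreducible_closed (proj_closed n) W" "V \<inter> B = \<Union>\<W>'"
        unfolding good_def by blast
      have "V = (V \<inter> A) \<union> (V \<inter> B)" using AB(3) by blast
      then have "V = \<Union>(\<W> \<union> \<W>')" unfolding W(3,6) Union_Un_distrib .
      then have "good V" unfolding good_def using W by (intro exI[of _ "\<W> \<union> \<W>'"]) auto
      then show False using V(2) by blast
    qed
    then show ?thesis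
      using proj_closed_Int[OF V(1) AB(1)] proj_closed_Int[OF V(1) AB(2)] AB(4,5) by blast
  qed
  then have "\<forall>V. \<exists>V'. V \<in> proj_closed n \<and> \<not> good V \<longrightarrow> V' \<in> proj_closed n \<and> \<not> good V' \<and> V' \<subset> V" by blast
  from choice[OF this] obtain nxt where
    nxt: "\<And>V. V \<in> proj_closed n \<Longrightarrow> \<not> good V \<Longrightarrow> nxt V \<in> proj_closed n \<and> \<not> good (nxt V) \<and> nxt V \<subset> V"
    by blast
  define s where "s = (\<lambda>i::nat. (nxt ^^ i) V)"
  have s: "s i \<in> proj_closed n \<and> \<not> good (s i)" for i
    by (induction i) (use assms bad nxt in \<open>auto simp: s_def\<close>)
  have "s (Suc i) \<subset> s i" for i
    using nxt[of "s i"] s[of i] by (simp add: s_def)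
  then have "vanishing n (s i) \<subset> vanishing n (s (Suc i))" for i
    using vanishing_strict s by blast
  moreover have "Var k \<in> vanishing n Z" if "k \<ge> n" for k Z
    using that by (auto simp: vanishing_def)
  ultimately show False using pideal_acc[of "\<lambda>i. vanishing n (s i)" n] pideal_vanishing by blast
qed

text \<open>The coefficient vectors (1, c, c^2, ...) lie on the moment curve, so the form evaluates
  at c the polynomial with coefficients s. A point lies on finitely many of these hyperplanes, and
  sections by them are described by roots.\<close>

definition hyperplane :: "nat \<Rightarrow> complex \<Rightarrow> cpoly" where
  "hyperplane n c = (\<Sum>i<n. Cst (c ^ i) * Var i)"

lemma homogeneous_hyperplane: "homogeneous n 1 (hyperplane n c)"
  unfolding hyperplane_def by (intro homogeneous_sum homogeneous_Cst_Var) auto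

lemma peval_hyperplane: "peval (hyperplane n c) s = (\<Sum>i<n. c ^ i * s $ i)"
  by (simp add: hyperplane_def peval_ev ev.hom_sum ev.hom_mult)

lemma avoiding_hyperplane:
  assumes "finite X" "\<And>s. s \<in> X \<Longrightarrow> s \<in> carrier_vec n \<and> s \<noteq> 0\<^sub>v n"
  shows "\<exists>c. \<forall>s\<in>X. peval (hyperplane n c) s \<noteq> 0"
proof -
  define P where "P = (\<lambda>s :: complex vec. \<Sum>i<n. monom (s $ i) i)"
  have "P s \<noteq> 0" if "s \<in> X" for s
  proof
    assume "P s = 0"
    then have c0: "coeff (P s) i = 0" for i by simp
    have "s $ i = 0" if "i < n" for i using that c0[of i] by (simp add: P_def coeff_sum)
    then have "s = 0\<^sub>v n" using assms(2)[OF \<open>s \<in> X\<close>] by (intro eq_vecI) auto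
    then show False using assms(2)[OF \<open>s \<in> X\<close>] by simp
  qed
  then have "(\<Prod>s\<in>X. P s) \<noteq> 0" using assms(1) by simp
  then obtain c where "poly (\<Prod>s\<in>X. P s) c \<noteq> 0" using poly_all_0_iff_0 by blast
  then have "\<forall>s\<in>X. poly (P s) c \<noteq> 0" using assms(1) by (simp add: poly_prod)
  moreover have "poly (P s) c = peval (hyperplane n c) s" for s
    by (simp add: P_def poly_sum poly_monom peval_hyperplane mult.commute)
  ultimately show ?thesis by auto
qed

text \<open>A hyperplane that contains no component of V is chosen. The chain in the section ends
  strictly inside some component W, so W lengthens it by one. All sections are assumed nonempty
  because this hyperplane depends on V.\<close>

theorem chain_of_linear_sections:
  assumes "V \<in> proj_closed n"
    and "\<And>cs. V \<inter> proj_zero_locus n ((\<lambda>l. hyperplane n (cs l)) ` {..<e}) \<noteq> {}"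
  shows "\<exists>Z. irreducible_chain (proj_closed n) e Z \<and> Z e \<subseteq> V"
  using assms
proof (induction e arbitrary: V)
  case 0
  obtain \<W> where W: "finite \<W>" "\<forall>W\<in>\<W>. irreducible_closed (proj_closed n) W" "V = \<Union>\<W>"
    using irreducible_components[OF 0(1)] by blast
  have "V \<noteq> {}" using 0(2) by auto
  then obtain W where "W \<in> \<W>" using W(3) by blast
  then show ?case
    using W by (intro exI[of _ "\<lambda>_. W"]) (auto simp: irreducible_chain_def)
next
  case (Suc e)
  obtain \<W> where W: "finite \<W>" "\<forall>W\<in>\<W>. irreducible_closed (proj_closed n) W" "V = \<Union>\<W>"
    using irreducible_components[OF Suc.prems(1)] by blast
  have "\<exists>s. s \<in> carrier_vec n \<and> s \<noteq> 0\<^sub>v n \<and> ray s \<in> W" if "W \<in> \<W>" for W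
  proof -
    have "W \<in> proj_closed n" "W \<noteq> {}" using W(2) that by (auto simp: irreducible_closed_def)
    then show ?thesis using proj_closed_subset[of W n] by (auto simp: proj_space_eq)
  qed
  then have "\<forall>W. \<exists>s. W \<in> \<W> \<longrightarrow> s \<in> carrier_vec n \<and> s \<noteq> 0\<^sub>v n \<and> ray s \<in> W" by blast
  from choice[OF this] obtain pt
    where pt: "\<And>W. W \<in> \<W> \<Longrightarrow> pt W \<in> carrier_vec n \<and> pt W \<noteq> 0\<^sub>v n \<and> ray (pt W) \<in> W" by blast
  have "finite (pt ` \<W>)" using W(1) by simp
  moreover have "s \<in> carrier_vec n \<and> s \<noteq> 0\<^sub>v n" if "s \<in> pt ` \<W>" for s using that pt by auto
  ultimately have "\<exists>c. \<forall>s\<in>pt ` \<W>. peval (hyperplane n c) s \<noteq> 0" by (rule avoiding_hyperplane)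
  then obtain c where c: "\<forall>s\<in>pt ` \<W>. peval (hyperplane n c) s \<noteq> 0" by blast
  define H where "H = proj_zero_locus n {hyperplane n c}"
  have hom: "\<exists>d. homogeneous n d f" if "f \<in> {hyperplane n c}" for f
    using that homogeneous_hyperplane by blast
  have Hc: "H \<in> proj_closed n" unfolding H_def by (rule proj_closedI[OF hom])
  have notH: "ray (pt W) \<notin> H" if "W \<in> \<W>" for W
    using ray_in_proj_zero_locus[OF hom, where s = "pt W"] pt[OF that] c that by (auto simp: H_def)
  have "V \<inter> H \<inter> proj_zero_locus n ((\<lambda>l. hyperplane n (cs l)) ` {..<e}) \<noteq> {}" for cs
  proof -
    let ?S = "(\<lambda>l. hyperplane n (cs l)) ` {..<e}"
    have 1: "V \<inter> proj_zero_locus n ((\<lambda>l. hyperplane n ((cs(e := c)) l)) ` {..<Suc e}) \<noteq> {}"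
      by (rule Suc.prems(2))
    have 2: "(\<lambda>l. hyperplane n ((cs(e := c)) l)) ` {..<Suc e} = insert (hyperplane n c) ?S"
      unfolding lessThan_Suc by auto
    have 3: "proj_zero_locus n (insert (hyperplane n c) ?S) = H \<inter> proj_zero_locus n ?S"
      unfolding H_def proj_zero_locus_def by blast
    show ?thesis using 1 unfolding 2 3 by (simp add: Int_assoc)
  qed
  then obtain Z where Z: "irreducible_chain (proj_closed n) e Z" "Z e \<subseteq> V \<inter> H"
    using Suc.IH[OF proj_closed_Int[OF Suc.prems(1) Hc]] by blast
  have irr: "irreducible_closed (proj_closed n) (Z e)" using Z(1) by (simp add: irreducible_chain_def)
  have in_comp: "\<exists>W\<in>\<W>'. Y \<subseteq> W"
    if Y: "irreducible_closed (proj_closed n) Y" and "finite \<W>'" "\<W>' \<subseteq> \<W>" "Y \<subseteq> \<Union>\<W>'" for Y \<W>'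
    using that(2-4)
  proof (induction \<W>' rule: finite_induct)
    case empty
    then show ?case using Y by (auto simp: irreducible_closed_def)
  next
    case (insert W \<W>')
    have "W \<in> proj_closed n" "\<Union>\<W>' \<in> proj_closed n"
      using W(2) insert by (auto simp: irreducible_closed_def intro!: proj_closed_Union)
    moreover have "Y \<subseteq> W \<union> \<Union>\<W>'" using insert.prems by auto
    ultimately have "Y \<subseteq> W \<or> Y \<subseteq> \<Union>\<W>'"
      using Y unfolding irreducible_closed_def by blast
    then show ?case using insert by auto
  qed
  obtain W where W': "W \<in> \<W>" "Z e \<subseteq> W"
    using in_comp[OF irr W(1) subset_refl] Z(2) W(3) by blast
  have "Z e \<noteq> W" using notH[OF W'(1)] pt[OF W'(1)] Z(2) by blast
  then have "Z e \<subset> W" using W'(2) by blast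
  then show ?case
    using Z(1) W W'(1)
    by (intro exI[of _ "\<lambda>i. if i \<le> e then Z i else W"])
      (auto simp: irreducible_chain_def le_Suc_eq less_Suc_eq)
qed

section \<open>Linear algebra\<close>

text \<open>Independent sets in X stay independent in the whole space, so their sizes are bounded
  and a maximal one is a finite basis.\<close>

lemma (in vectorspace) subspace_fin_dim:
  assumes X: "VectorSpace.subspace K X V" and fd: "fin_dim"
  shows "vectorspace.fin_dim K (vs X)"
proof -
  interpret X: vectorspace K "vs X" by (rule subspace_is_vs[OF X])
  have XV: "X \<subseteq> carrier V" using X by (auto simp: VectorSpace.subspace_def submodule_def)
  have sm: "submodule K X V" using X by (simp add: VectorSpace.subspace_def)
  have li: "finite A \<and> card A \<le> dim" if "A \<subseteq> X" "X.lin_indpt A" for A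
  proof -
    have "lin_indpt A"
      using that span_li_not_depend(2)[OF that(1) sm] by simp
    then show ?thesis using li_le_dim[OF fd, of A] that(1) XV by blast
  qed
  have "\<exists>A. finite A \<and> maximal A (\<lambda>S. S \<subseteq> carrier (vs X) \<and> X.lin_indpt S)"
  proof (rule maximal_exists[where N = dim and B = "{}"])
    show "\<And>A. A \<subseteq> carrier (vs X) \<and> X.lin_indpt A \<Longrightarrow> finite A \<and> card A \<le> dim" using li by simp
    show "{} \<subseteq> carrier (vs X) \<and> X.lin_indpt {}" by (auto simp: X.lin_dep_def)
  qed
  then obtain A where A: "finite A" "maximal A (\<lambda>S. S \<subseteq> carrier (vs X) \<and> X.lin_indpt S)" by blast
  then have "X.basis A" by (intro X.max_li_is_basis) auto
  then show ?thesis using A(1) unfolding X.fin_dim_def X.basis_def by auto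
qed

abbreviation subdim :: "nat \<Rightarrow> complex vec set \<Rightarrow> nat" where
  "subdim n T \<equiv> vectorspace.dim (class_ring :: complex ring) (module_vec TYPE(complex) n \<lparr>carrier := T\<rparr>)"

lemma subspace_vecI:
  assumes "T \<subseteq> carrier_vec n" "0\<^sub>v n \<in> T" "\<And>u v. u \<in> T \<Longrightarrow> v \<in> T \<Longrightarrow> u + v \<in> T" "\<And>c v. v \<in> T \<Longrightarrow> c \<cdot>\<^sub>v v \<in> T"
  shows "VectorSpace.subspace (class_ring :: complex ring) T (module_vec TYPE(complex) n)"
proof -
  interpret vec_space "TYPE(complex)" n .
  show ?thesis
    unfolding VectorSpace.subspace_def submodule_def using assms vec_vs vec_module
    by (auto simp: module_vec_simps class_ring_simps)
qed

lemma mat_linear_map: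
  assumes "B \<in> carrier_mat c n"
  shows "linear_map (class_ring :: complex ring) (module_vec TYPE(complex) n) (module_vec TYPE(complex) c) ((*\<^sub>v) B)"
proof -
  have "(*\<^sub>v) B \<in> LinearCombinations.module_hom (class_ring :: complex ring) (module_vec TYPE(complex) n) (module_vec TYPE(complex) c)"
    using assms
    by (auto simp: LinearCombinations.module_hom_def module_vec_simps class_ring_simps mult_add_distrib_mat_vec mult_mat_vec)
  then show ?thesis
    unfolding linear_map_def mod_hom_def mod_hom_axioms_def using vec_vs vec_module by auto
qed

lemma kernel_rank_nullity:
  assumes B: "B \<in> carrier_mat c n"
  shows "VectorSpace.subspace class_ring {v \<in> carrier_vec n. B *\<^sub>v v = 0\<^sub>v c} (module_vec TYPE(complex) n)"
    "subdim n {v \<in> carrier_vec n. B *\<^sub>v v = 0\<^sub>v c} + c \<ge> n"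
    "(\<And>w. w \<in> carrier_vec c \<Longrightarrow> \<exists>v\<in>carrier_vec n. B *\<^sub>v v = w) \<Longrightarrow>
      subdim n {v \<in> carrier_vec n. B *\<^sub>v v = 0\<^sub>v c} + c = n"
proof -
  interpret N: vec_space "TYPE(complex)" n .
  interpret C: vec_space "TYPE(complex)" c .
  interpret L: linear_map "class_ring :: complex ring" "module_vec TYPE(complex) n" "module_vec TYPE(complex) c" "(*\<^sub>v) B"
    by (rule mat_linear_map[OF B])
  have ker: "L.ker = {v \<in> carrier_vec n. B *\<^sub>v v = 0\<^sub>v c}"
    by (simp add: L.ker_def module_vec_simps)
  have im: "L.im = (*\<^sub>v) B ` carrier_vec n"
    by (simp add: L.im_def module_vec_simps)
  show "VectorSpace.subspace class_ring {v \<in> carrier_vec n. B *\<^sub>v v = 0\<^sub>v c} (module_vec TYPE(complex) n)"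
    using L.kerT_is_subspace by (simp add: ker)
  have rn: "subdim c ((*\<^sub>v) B ` carrier_vec n) + subdim n {v \<in> carrier_vec n. B *\<^sub>v v = 0\<^sub>v c} = n"
    using L.rank_nullity[OF N.fin_dim] by (simp add: ker im N.dim_is_n)
  have sub: "VectorSpace.subspace class_ring ((*\<^sub>v) B ` carrier_vec n) (module_vec TYPE(complex) c)"
    using L.imT_is_subspace by (simp add: im)
  have "subdim c ((*\<^sub>v) B ` carrier_vec n) \<le> c"
    using C.subspace_dim[OF sub C.fin_dim C.subspace_fin_dim[OF sub C.fin_dim]] by (simp add: C.dim_is_n)
  then show "subdim n {v \<in> carrier_vec n. B *\<^sub>v v = 0\<^sub>v c} + c \<ge> n" using rn by simp
  assume surj: "\<And>w. w \<in> carrier_vec c \<Longrightarrow> \<exists>v\<in>carrier_vec n. B *\<^sub>v v = w"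
  have "(*\<^sub>v) B ` carrier_vec n = carrier_vec c"
    using surj B by (auto simp: image_iff)
  then have "subdim c ((*\<^sub>v) B ` carrier_vec n) = c"
    using C.dim_is_n by (simp add: module_vec_def)
  then show "subdim n {v \<in> carrier_vec n. B *\<^sub>v v = 0\<^sub>v c} + c = n" using rn by simp
qed

lemma subdim_ge:
  assumes B: "B \<in> carrier_mat c n" and T: "VectorSpace.subspace class_ring T (module_vec TYPE(complex) n)"
    and sub: "{v \<in> carrier_vec n. B *\<^sub>v v = 0\<^sub>v c} \<subseteq> T"
  shows "n \<le> subdim n T + c"
proof -
  interpret N: vec_space "TYPE(complex)" n .
  let ?W = "{v \<in> carrier_vec n. B *\<^sub>v v = 0\<^sub>v c}"
  note W = kernel_rank_nullity[OF B]
  interpret T: vectorspace class_ring "module_vec TYPE(complex) n \<lparr>carrier := T\<rparr>"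
    by (rule N.subspace_is_vs[OF T])
  have "subdim n ?W \<le> subdim n T"
    using T.subspace_dim[OF N.nested_subspaces[OF T W(1) sub]]
      N.subspace_fin_dim[OF T N.fin_dim] N.subspace_fin_dim[OF W(1) N.fin_dim] by simp
  then show ?thesis using W(2) by simp
qed


section \<open>Determinants and minors\<close>

lemma det_zero_left:
  assumes M: "M \<in> carrier_mat r r"
  shows "det M = 0 \<longleftrightarrow> (\<exists>y::nat \<Rightarrow> complex. (\<exists>j<r. y j \<noteq> 0) \<and> (\<forall>l<r. (\<Sum>j<r. y j * M $$ (j, l)) = 0))"
proof -
  have T: "transpose_mat M \<in> carrier_mat r r" using M by simp
  have mv: "(transpose_mat M *\<^sub>v v) $ l = (\<Sum>j<r. v $ j * M $$ (j, l))" if "v \<in> carrier_vec r" "l < r" for v l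
    using M that by (auto simp: scalar_prod_def atLeast0LessThan mult.commute intro!: sum.cong)
  have "det M = 0 \<longleftrightarrow> (\<exists>v. v \<in> carrier_vec r \<and> v \<noteq> 0\<^sub>v r \<and> transpose_mat M *\<^sub>v v = 0\<^sub>v r)"
    using det_0_iff_vec_prod_zero_field[OF T] det_transpose[OF M] by simp
  also have "\<dots> \<longleftrightarrow> (\<exists>y::nat \<Rightarrow> complex. (\<exists>j<r. y j \<noteq> 0) \<and> (\<forall>l<r. (\<Sum>j<r. y j * M $$ (j, l)) = 0))"
  proof
    assume "\<exists>v. v \<in> carrier_vec r \<and> v \<noteq> 0\<^sub>v r \<and> transpose_mat M *\<^sub>v v = 0\<^sub>v r"
    then obtain v where v: "v \<in> carrier_vec r" "v \<noteq> 0\<^sub>v r" "transpose_mat M *\<^sub>v v = 0\<^sub>v r" by blast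
    have "\<exists>j<r. v $ j \<noteq> 0" using v(1,2) by (metis carrier_vecD eq_vecI index_zero_vec(1,2))
    then show "\<exists>y::nat \<Rightarrow> complex. (\<exists>j<r. y j \<noteq> 0) \<and> (\<forall>l<r. (\<Sum>j<r. y j * M $$ (j, l)) = 0)"
      using mv[OF v(1)] v(3) by (intro exI[of _ "($) v"]) auto
  next
    assume "\<exists>y::nat \<Rightarrow> complex. (\<exists>j<r. y j \<noteq> 0) \<and> (\<forall>l<r. (\<Sum>j<r. y j * M $$ (j, l)) = 0)"
    then obtain y :: "nat \<Rightarrow> complex" where y: "\<exists>j<r. y j \<noteq> 0" "\<forall>l<r. (\<Sum>j<r. y j * M $$ (j, l)) = 0" by blast
    have "vec r y \<noteq> 0\<^sub>v r" using y(1) by (metis index_vec index_zero_vec(1))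
    moreover have "transpose_mat M *\<^sub>v vec r y = 0\<^sub>v r"
    proof (rule eq_vecI)
      fix l assume "l < dim_vec (0\<^sub>v r :: complex vec)"
      then have "l < r" by simp
      then show "(transpose_mat M *\<^sub>v vec r y) $ l = 0\<^sub>v r $ l"
        using mv[of "vec r y" l] y(2) by simp
    qed (use M in simp)
    ultimately show "\<exists>v. v \<in> carrier_vec r \<and> v \<noteq> 0\<^sub>v r \<and> transpose_mat M *\<^sub>v v = 0\<^sub>v r"
      by (intro exI[of _ "vec r y"]) simp
  qed
  finally show ?thesis .
qed

lemma det_mat_zero_left:
  fixes f :: "nat \<Rightarrow> nat \<Rightarrow> complex"
  shows "det (mat r r (\<lambda>(i, l). f i l)) = 0 \<longleftrightarrow> (\<exists>y. (\<exists>j<r. y j \<noteq> 0) \<and> (\<forall>l<r. (\<Sum>j<r. y j * f j l) = 0))"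
proof -
  have eq: "(\<Sum>j<r. y j * mat r r (\<lambda>(i, l). f i l) $$ (j, l)) = (\<Sum>j<r. y j * f j l)"
    if "l < r" for y :: "nat \<Rightarrow> complex" and l
    by (intro sum.cong refl) (use that in auto)
  show ?thesis
    unfolding det_zero_left[OF mat_carrier] by (intro iff_exI conj_cong refl) (simp add: eq)
qed

lemma det_replace_row:
  fixes f :: "nat \<Rightarrow> nat \<Rightarrow> 'a :: comm_ring_1"
  assumes "i0 < r"
  shows "det (mat r r (\<lambda>(i, l). if i = i0 then \<rho> l else f i l))
    = (\<Sum>l<r. \<rho> l * cofactor (mat r r (\<lambda>(i, l). f i l)) i0 l)"
proof -
  let ?A = "mat r r (\<lambda>(i, l). if i = i0 then \<rho> l else f i l)"
  have "mat_delete ?A i0 l = mat_delete (mat r r (\<lambda>(i, l). f i l)) i0 l" for l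
    using assms by (intro eq_matI) (auto simp: mat_delete_def)
  then have "cofactor ?A i0 l = cofactor (mat r r (\<lambda>(i, l). f i l)) i0 l" for l
    by (simp add: cofactor_def)
  then show ?thesis
    using laplace_expansion_row[of ?A r i0] assms by simp
qed

lemma det_combine_rows:
  fixes f :: "nat \<Rightarrow> nat \<Rightarrow> 'a :: comm_ring_1"
  assumes i0: "i0 < r"
  shows "det (mat r r (\<lambda>(i, l). if i = i0 then \<Sum>k<r. s k * f k l else f i l)) = s i0 * det (mat r r (\<lambda>(i, l). f i l))"
proof -
  have row: "det (mat r r (\<lambda>(i, l). if i = i0 then f k l else f i l)) = (if k = i0 then det (mat r r (\<lambda>(i, l). f i l)) else 0)"
    if k: "k < r" for k
  proof (cases "k = i0")
    case True
    then show ?thesis by (auto intro!: arg_cong[of _ _ det] eq_matI)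
  next
    case False
    have "det (mat r r (\<lambda>(i, l). if i = i0 then f k l else f i l)) = 0"
      by (rule det_identical_rows[of _ r i0 k]) (use False k i0 in \<open>auto intro!: eq_vecI\<close>)
    then show ?thesis using False by simp
  qed
  have "det (mat r r (\<lambda>(i, l). if i = i0 then \<Sum>k<r. s k * f k l else f i l))
      = (\<Sum>k<r. s k * det (mat r r (\<lambda>(i, l). if i = i0 then f k l else f i l)))"
    unfolding det_replace_row[OF i0] sum_distrib_left sum_distrib_right
    by (subst sum.swap) (simp add: mult.assoc)
  also have "\<dots> = (\<Sum>k<r. if k = i0 then s i0 * det (mat r r (\<lambda>(i, l). f i l)) else 0)"
    by (intro sum.cong refl) (simp add: row)
  also have "\<dots> = s i0 * det (mat r r (\<lambda>(i, l). f i l))" using i0 by simp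
  finally show ?thesis .
qed

text \<open>A nonsingular selection for r rows is extended by a column k. The new determinant
  combines the entries of column k with cofactors that do not depend on k, and the last cofactor is
  the old determinant; if it vanished for all k, the cofactors would be a row relation.\<close>

lemma nonzero_minor_columns:
  fixes A :: "nat \<Rightarrow> nat \<Rightarrow> complex"
  assumes "\<And>y. (\<forall>k<n. (\<Sum>j<r. y j * A j k) = 0) \<Longrightarrow> \<forall>j<r. y j = 0"
  shows "\<exists>\<sigma>. (\<forall>l<r. \<sigma> l < n) \<and> det (mat r r (\<lambda>(i, l). A i (\<sigma> l))) \<noteq> 0"
  using assms
proof (induction r)
  case 0
  show ?case by (simp add: det_dim_zero)
next
  case (Suc r)
  have "\<forall>j<r. y j = 0" if y: "\<forall>k<n. (\<Sum>j<r. y j * A j k) = 0" for y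
  proof -
    have "\<forall>k<n. (\<Sum>j<Suc r. (y(r := 0)) j * A j k) = 0" using y by simp
    then have "\<forall>j<Suc r. (y(r := 0)) j = 0" by (rule Suc.prems)
    then show ?thesis by (metis fun_upd_apply less_Suc_eq less_irrefl)
  qed
  then obtain \<sigma> where \<sigma>: "\<forall>l<r. \<sigma> l < n" "det (mat r r (\<lambda>(i, l). A i (\<sigma> l))) \<noteq> 0"
    using Suc.IH by blast
  define M where "M = (\<lambda>k. mat (Suc r) (Suc r) (\<lambda>(i, l). A i ((\<sigma>(r := k)) l)))"
  define y where "y = (\<lambda>i. cofactor (M 0) i r)"
  have md: "mat_delete (M k) i r = mat_delete (M 0) i r" if "i < Suc r" for k i
    using that by (intro eq_matI) (auto simp: mat_delete_def M_def)
  have cof: "cofactor (M k) i r = y i" if "i < Suc r" for k i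
    unfolding cofactor_def y_def md[OF that, of k] ..
  have exp: "det (M k) = (\<Sum>i<Suc r. y i * A i k)" for k
  proof -
    have "det (M k) = (\<Sum>i<Suc r. M k $$ (i, r) * cofactor (M k) i r)"
      by (rule laplace_expansion_column) (auto simp: M_def)
    also have "\<dots> = (\<Sum>i<Suc r. y i * A i k)"
      by (intro sum.cong refl) (simp add: cof, simp add: M_def mult.commute)
    finally show ?thesis .
  qed
  have "mat_delete (M 0) r r = mat r r (\<lambda>(i, l). A i (\<sigma> l))"
    by (intro eq_matI) (auto simp: mat_delete_def M_def)
  then have "y r \<noteq> 0" using \<sigma>(2) by (simp add: y_def cofactor_def)
  then have "\<not> (\<forall>k<n. (\<Sum>j<Suc r. y j * A j k) = 0)" using Suc.prems[of y] by blast
  then obtain k where k: "k < n" "det (M k) \<noteq> 0" using exp by metis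
  then show ?case
    using \<sigma>(1) unfolding M_def by (intro exI[of _ "\<sigma>(r := k)"]) auto
qed

text \<open>A selection of columns with nonzero determinant is injective; its image J, enumerated
  increasingly by \<open>pick\<close>, lists the same columns.\<close>

lemma minors_zero_iff:
  fixes A :: "nat \<Rightarrow> nat \<Rightarrow> complex"
  shows "(\<forall>J. J \<subseteq> {..<n} \<and> card J = r \<longrightarrow> det (mat r r (\<lambda>(i, l). A i (pick J l))) = 0) \<longleftrightarrow>
    (\<exists>y. (\<exists>j<r. y j \<noteq> 0) \<and> (\<forall>k<n. (\<Sum>j<r. y j * A j k) = 0))"
proof
  assume "\<exists>y. (\<exists>j<r. y j \<noteq> 0) \<and> (\<forall>k<n. (\<Sum>j<r. y j * A j k) = 0)"
  then obtain y where y: "\<exists>j<r. y j \<noteq> 0" "\<forall>k<n. (\<Sum>j<r. y j * A j k) = 0" by blast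
  show "\<forall>J. J \<subseteq> {..<n} \<and> card J = r \<longrightarrow> det (mat r r (\<lambda>(i, l). A i (pick J l))) = 0"
  proof (intro allI impI)
    fix J assume J: "J \<subseteq> {..<n} \<and> card J = r"
    have "pick J l < n" if "l < r" for l using pick_in_set_le[of l J] J that by auto
    then show "det (mat r r (\<lambda>(i, l). A i (pick J l))) = 0"
      using y unfolding det_mat_zero_left by blast
  qed
next
  assume z: "\<forall>J. J \<subseteq> {..<n} \<and> card J = r \<longrightarrow> det (mat r r (\<lambda>(i, l). A i (pick J l))) = 0"
  show "\<exists>y. (\<exists>j<r. y j \<noteq> 0) \<and> (\<forall>k<n. (\<Sum>j<r. y j * A j k) = 0)"
  proof (rule ccontr)
    assume "\<not> ?thesis"
    then have "\<exists>\<sigma>. (\<forall>l<r. \<sigma> l < n) \<and> det (mat r r (\<lambda>(i, l). A i (\<sigma> l))) \<noteq> 0"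
      by (intro nonzero_minor_columns) blast
    then obtain \<sigma> where \<sigma>: "\<forall>l<r. \<sigma> l < n" "det (mat r r (\<lambda>(i, l). A i (\<sigma> l))) \<noteq> 0" by blast
    have "inj_on \<sigma> {..<r}"
    proof (rule inj_onI, rule ccontr)
      fix l m assume lm: "l \<in> {..<r}" "m \<in> {..<r}" "\<sigma> l = \<sigma> m" "l \<noteq> m"
      have "det (mat r r (\<lambda>(i, l). A i (\<sigma> l))) = 0"
        by (rule det_identical_columns[of _ r l m]) (use lm in \<open>auto intro!: eq_vecI\<close>)
      then show False using \<sigma>(2) by blast
    qed
    define J where "J = \<sigma> ` {..<r}"
    have J: "J \<subseteq> {..<n}" "card J = r"
      using \<sigma>(1) \<open>inj_on \<sigma> {..<r}\<close> by (auto simp: J_def card_image)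
    then have "det (mat r r (\<lambda>(i, l). A i (pick J l))) = 0" using z by blast
    then have "\<exists>y. (\<exists>j<r. y j \<noteq> 0) \<and> (\<forall>l<r. (\<Sum>j<r. y j * A j (pick J l)) = 0)"
      unfolding det_mat_zero_left .
    then obtain y where y: "\<exists>j<r. y j \<noteq> 0" "\<forall>l<r. (\<Sum>j<r. y j * A j (pick J l)) = 0" by blast
    have "(\<Sum>j<r. y j * A j (\<sigma> l)) = 0" if "l < r" for l
    proof -
      have "\<sigma> l \<in> J" using that by (simp add: J_def)
      then have "pick J (card {a \<in> J. a < \<sigma> l}) = \<sigma> l" by (rule pick_card_in_set)
      moreover have "card {a \<in> J. a < \<sigma> l} < r"
      proof -
        have "{a \<in> J. a < \<sigma> l} \<subset> J" using \<open>\<sigma> l \<in> J\<close> by auto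
        then show ?thesis using psubset_card_mono[of J] J finite_subset[OF J(1)] by auto
      qed
      ultimately show ?thesis using y(2) by metis
    qed
    then have "det (mat r r (\<lambda>(i, l). A i (\<sigma> l))) = 0"
      using y(1) unfolding det_mat_zero_left by blast
    then show False using \<sigma>(2) by blast
  qed
qed

lemma minors_full_rows:
  assumes F: "F \<in> carrier_mat r n"
  shows "minors r F = {det (mat r r (\<lambda>(i, l). F $$ (i, pick J l))) |J. J \<subseteq> {..<n} \<and> card J = r}"
proof -
  have sub: "submatrix F {..<r} J = mat r r (\<lambda>(i, l). F $$ (i, pick J l))" if J: "J \<subseteq> {..<n}" "card J = r" for J
  proof -
    have "{j. j < n \<and> j \<in> J} = J" using J(1) by auto
    moreover have "pick {..<r} i = i" if "i < r" for i
    proof -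
      have "pick UNIV i = pick {a. a < r \<and> a \<in> UNIV} i" by (rule pick_reduce_set) (use that in simp)
      then show ?thesis by (simp add: pick_UNIV lessThan_def)
    qed
    ultimately show ?thesis
      using F J(2) by (intro eq_matI) (auto simp: submatrix_def lessThan_def)
  qed
  have iff: "I \<subseteq> {..<r} \<and> J \<subseteq> {..<n} \<and> card I = r \<and> card J = r \<longleftrightarrow> I = {..<r} \<and> J \<subseteq> {..<n} \<and> card J = r"
    for I J :: "nat set"
    using card_subset_eq[of "{..<r}" I] by auto
  have "minors r F = {det (submatrix F {..<r} J) |J. J \<subseteq> {..<n} \<and> card J = r}"
    using F unfolding minors_def by (simp add: iff)
  also have "\<dots> = {det (mat r r (\<lambda>(i, l). F $$ (i, pick J l))) |J. J \<subseteq> {..<n} \<and> card J = r}"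
    by (rule Collect_cong) (metis sub)
  finally show ?thesis .
qed

lemma hom_det_mat:
  assumes "comm_ring_hom \<phi>"
  shows "\<phi> (det (mat r r f)) = det (mat r r (\<lambda>p. \<phi> (f p)))"
proof -
  interpret comm_ring_hom \<phi> by (rule assms)
  have "map_mat \<phi> (mat r r f) = mat r r (\<lambda>p. \<phi> (f p))" by (intro eq_matI) auto
  then show ?thesis using hom_det[of "mat r r f"] by simp
qed

lemma minors_vanish_iff:
  assumes F: "F \<in> carrier_mat r n"
  shows "(\<forall>f\<in>minors r F. peval f x = 0) \<longleftrightarrow>
    (\<exists>y. (\<exists>j<r. y j \<noteq> 0) \<and> (\<forall>k<n. (\<Sum>j<r. y j * peval (F $$ (j, k)) x) = 0))"
proof -
  have "peval (det (mat r r (\<lambda>(i, l). F $$ (i, pick J l)))) x = det (mat r r (\<lambda>(i, l). peval (F $$ (i, pick J l)) x))" for J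
    unfolding peval_ev by (subst hom_det_mat[OF ev.comm_ring_hom_axioms]) (simp add: case_prod_unfold)
  moreover have "(\<forall>f\<in>minors r F. peval f x = 0) \<longleftrightarrow>
      (\<forall>J. J \<subseteq> {..<n} \<and> card J = r \<longrightarrow> peval (det (mat r r (\<lambda>(i, l). F $$ (i, pick J l)))) x = 0)"
    unfolding minors_full_rows[OF F] by blast
  ultimately show ?thesis
    by (simp only: minors_zero_iff[where A = "\<lambda>j k. peval (F $$ (j, k)) x", symmetric])
qed

text \<open>A nonsingular square block of columns is inverted by its adjugate, and the unknowns
  outside the block are set to 0.\<close>

lemma linear_system_surjective:
  fixes B :: "nat \<Rightarrow> nat \<Rightarrow> complex"
  assumes "\<And>y. (\<forall>k<n. (\<Sum>j<c. y j * B j k) = 0) \<Longrightarrow> \<forall>j<c. y j = 0"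
  shows "\<exists>v\<in>carrier_vec n. \<forall>j<c. (\<Sum>k<n. B j k * v $ k) = w j"
proof -
  obtain \<sigma> where \<sigma>: "\<forall>l<c. \<sigma> l < n" "det (mat c c (\<lambda>(i, l). B i (\<sigma> l))) \<noteq> 0"
    using nonzero_minor_columns[where n = n and r = c and A = B] assms by blast
  define C where "C = mat c c (\<lambda>(i, l). B i (\<sigma> l))"
  have C: "C \<in> carrier_mat c c" by (simp add: C_def)
  define u where "u = (1 / det C) \<cdot>\<^sub>v (adj_mat C *\<^sub>v vec c w)"
  have u: "u \<in> carrier_vec c" using adj_mat(1)[OF C] by (simp add: u_def)
  have "C *\<^sub>v u = (1 / det C) \<cdot>\<^sub>v (C *\<^sub>v (adj_mat C *\<^sub>v vec c w))"
    unfolding u_def using C adj_mat(1)[OF C] by (intro mult_mat_vec[of _ c c]) auto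
  also have "C *\<^sub>v (adj_mat C *\<^sub>v vec c w) = (C * adj_mat C) *\<^sub>v vec c w"
    using C adj_mat(1)[OF C] by (intro assoc_mult_mat_vec[symmetric, of _ c c _ c]) auto
  also have "\<dots> = det C \<cdot>\<^sub>v vec c w"
  proof (rule eq_vecI)
    fix i assume "i < dim_vec (det C \<cdot>\<^sub>v vec c w)"
    then have i: "i < c" by simp
    have "((det C \<cdot>\<^sub>m 1\<^sub>m c) *\<^sub>v vec c w) $ i = (\<Sum>j<c. det C * (if j = i then 1 else 0) * w j)"
      using i by (auto simp: scalar_prod_def atLeast0LessThan intro!: sum.cong)
    also have "\<dots> = (\<Sum>j<c. if j = i then det C * w i else 0)"
      by (intro sum.cong) auto
    finally show "(C * adj_mat C *\<^sub>v vec c w) $ i = (det C \<cdot>\<^sub>v vec c w) $ i"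
      unfolding adj_mat(2)[OF C] using i by simp
  qed (use C in simp)
  also have "(1 / det C) \<cdot>\<^sub>v (det C \<cdot>\<^sub>v vec c w) = vec c w"
    using \<sigma>(2) by (simp add: smult_smult_assoc C_def)
  finally have Cu: "C *\<^sub>v u = vec c w" .
  define v where "v = vec n (\<lambda>k. \<Sum>l<c. if \<sigma> l = k then u $ l else 0)"
  have "(\<Sum>k<n. B j k * v $ k) = w j" if j: "j < c" for j
  proof -
    have "(\<Sum>k<n. B j k * v $ k) = (\<Sum>l<c. \<Sum>k<n. if k = \<sigma> l then B j (\<sigma> l) * u $ l else 0)"
      unfolding v_def by (subst sum.swap) (auto simp: sum_distrib_left intro!: sum.cong)
    also have "\<dots> = (\<Sum>l<c. B j (\<sigma> l) * u $ l)" using \<sigma>(1) by simp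
    also have "\<dots> = (C *\<^sub>v u) $ j"
      using j u by (auto simp: C_def scalar_prod_def atLeast0LessThan)
    finally show ?thesis using Cu j by simp
  qed
  then show ?thesis by (intro bexI[of _ v]) (auto simp: v_def)
qed

lemma mat_mult_vec_eq_iff:
  assumes "v \<in> carrier_vec n"
  shows "mat c n (\<lambda>(j, k). B j k) *\<^sub>v v = vec c w \<longleftrightarrow> (\<forall>j<c. (\<Sum>k<n. B j k * v $ k) = (w j :: complex))"
proof -
  have "(mat c n (\<lambda>(j, k). B j k) *\<^sub>v v) $ j = (\<Sum>k<n. B j k * v $ k)" if "j < c" for j
    using that assms by (simp add: scalar_prod_def atLeast0LessThan)
  then show ?thesis by (auto simp: vec_eq_iff)
qed

lemma linear_solutions_eq:
  "{v \<in> carrier_vec n. mat c n (\<lambda>(j, k). B j k) *\<^sub>v v = 0\<^sub>v c} = {v \<in> carrier_vec n. \<forall>j<c. (\<Sum>k<n. B j k * v $ k) = (0 :: complex)}"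
  using mat_mult_vec_eq_iff[where B = B and w = "\<lambda>_. 0"] by (auto simp: zero_vec_def)

lemma subdim_solutions:
  fixes B :: "nat \<Rightarrow> nat \<Rightarrow> complex"
  assumes "\<And>y. (\<forall>k<n. (\<Sum>j<c. y j * B j k) = 0) \<Longrightarrow> \<forall>j<c. y j = 0"
  shows "subdim n {v \<in> carrier_vec n. \<forall>j<c. (\<Sum>k<n. B j k * v $ k) = 0} + c = n"
  unfolding linear_solutions_eq[symmetric]
proof (rule kernel_rank_nullity(3))
  fix w :: "complex vec" assume w: "w \<in> carrier_vec c"
  obtain v where v: "v \<in> carrier_vec n" "\<forall>j<c. (\<Sum>k<n. B j k * v $ k) = w $ j"
    using linear_system_surjective[where n = n and c = c and B = B and w = "($) w"] assms by blast
  have "vec c (($) w) = w" using w by auto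
  then show "\<exists>v\<in>carrier_vec n. mat c n (\<lambda>(j, k). B j k) *\<^sub>v v = w"
    using mat_mult_vec_eq_iff[OF v(1), where c = c and B = B and w = "($) w"] v by auto
qed simp

lemma subdim_ge_solutions:
  fixes B :: "nat \<Rightarrow> nat \<Rightarrow> complex"
  assumes T: "VectorSpace.subspace class_ring T (module_vec TYPE(complex) n)"
    and "{v \<in> carrier_vec n. \<forall>j<c. (\<Sum>k<n. B j k * v $ k) = 0} \<subseteq> T"
  shows "n \<le> subdim n T + c"
  using assms(2) unfolding linear_solutions_eq[symmetric] by (intro subdim_ge[OF _ T]) auto

section \<open>Tangent spaces\<close>

lemma pderivative_superset:
  assumes "finite A" "keys f \<subseteq> A"
  shows "pderivative k f = (\<Sum>m\<in>A. single (m - single k 1) (of_nat (lookup m k) * lookup f m))"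
  unfolding pderivative_def by (rule sum.mono_neutral_left[OF assms]) (auto simp: in_keys_iff)

lemma pderivative_add: "pderivative k (f + g) = pderivative k f + pderivative k g"
proof -
  have "finite (keys f \<union> keys g)" by simp
  moreover have "keys (f + g) \<subseteq> keys f \<union> keys g" by (rule keys_add)
  ultimately show ?thesis
    by (simp add: pderivative_superset[of "keys f \<union> keys g"] lookup_add single_add ring_distribs sum.distrib)
qed

lemma pderivative_0: "pderivative k 0 = 0"
  by (simp add: pderivative_def)

lemma pderivative_sum: "pderivative k (sum g A) = (\<Sum>a\<in>A. pderivative k (g a))"
  by (induction A rule: infinite_finite_induct) (auto simp: pderivative_add pderivative_0)

lemma pderivative_single: "pderivative k (single m c) = single (m - single k 1) (of_nat (lookup m k) * c)"
  by (cases "c = 0") (auto simp: pderivative_def)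

lemma pderivative_single_mult:
  "pderivative k (single m c * single l d) = pderivative k (single m c) * single l d + single m c * pderivative k (single l d)"
proof -
  have 1: "single (m + l - single k 1) (of_nat (lookup m k) * (c * d)) = single (m - single k 1) (of_nat (lookup m k) * c) * single l d"
    for m l :: "nat \<Rightarrow>\<^sub>0 nat" and c d :: complex
  proof (cases "lookup m k = 0")
    case False
    then have "m + l - single k 1 = (m - single k 1) + l"
      by (intro poly_mapping_eqI) (auto simp: lookup_add lookup_minus lookup_single when_def)
    then show ?thesis by (simp add: mult_single mult.assoc)
  qed simp
  have "pderivative k (single m c * single l d)
      = single (m + l - single k 1) (of_nat (lookup m k) * (c * d)) + single (l + m - single k 1) (of_nat (lookup l k) * (d * c))"
    by (simp add: mult_single pderivative_single lookup_add single_add[symmetric] ring_distribs add.commute[of l m] mult.commute[of d c])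
  then show ?thesis
    unfolding 1 by (simp add: pderivative_single mult.commute)
qed

lemma pderivative_mult: "pderivative k (f * g) = pderivative k f * g + f * pderivative k g"
proof -
  let ?s = "\<lambda>f m. single m (lookup f m) :: cpoly"
  have "pderivative k ((\<Sum>m\<in>keys f. ?s f m) * (\<Sum>l\<in>keys g. ?s g l))
      = (\<Sum>m\<in>keys f. \<Sum>l\<in>keys g. pderivative k (?s f m) * ?s g l + ?s f m * pderivative k (?s g l))"
    unfolding sum_product pderivative_sum pderivative_single_mult ..
  also have "\<dots> = pderivative k (\<Sum>m\<in>keys f. ?s f m) * (\<Sum>l\<in>keys g. ?s g l)
      + (\<Sum>m\<in>keys f. ?s f m) * pderivative k (\<Sum>l\<in>keys g. ?s g l)"
    by (simp add: sum.distrib sum_product pderivative_sum)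
  finally show ?thesis unfolding sum_singles[symmetric] .
qed

text \<open>The derivative at p in the direction v, as one operation on polynomials: tangent spaces
  are then common kernels of a derivation.\<close>

definition dd :: "nat \<Rightarrow> complex vec \<Rightarrow> complex vec \<Rightarrow> cpoly \<Rightarrow> complex" where
  "dd n p v f = (\<Sum>k<n. peval (pderivative k f) p * v $ k)"

lemma tangent_space_dd: "tangent_space n S p = {v \<in> carrier_vec n. \<forall>f\<in>S. dd n p v f = 0}"
  by (simp add: tangent_space_def dd_def)

lemma dd_add: "dd n p v (f + g) = dd n p v f + dd n p v g"
  by (simp add: dd_def pderivative_add peval_ev ev.hom_add ring_distribs sum.distrib)

lemma dd_mult: "dd n p v (f * g) = peval f p * dd n p v g + peval g p * dd n p v f"
  by (simp add: dd_def pderivative_mult peval_ev ev.hom_add ev.hom_mult ring_distribs sum.distrib sum_distrib_left algebra_simps)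

lemma dd_Cst: "dd n p v (Cst c) = 0"
  by (simp add: dd_def Cst_def pderivative_single peval_ev)

lemma dd_0: "dd n p v 0 = 0"
  by (simp add: dd_def pderivative_0 peval_ev)

lemma dd_sum: "dd n p v (sum g A) = (\<Sum>a\<in>A. dd n p v (g a))"
  by (induction A rule: infinite_finite_induct) (auto simp: dd_add dd_0)

lemma dd_Var: "dd n p v (Var i) = (if i < n then v $ i else 0)"
proof -
  have "pderivative k (Var i) = (if k = i then 1 else 0)" for k
    by (auto simp: Var_def pderivative_single lookup_single when_def)
  then have "dd n p v (Var i) = (\<Sum>k<n. if k = i then v $ i else 0)"
    unfolding dd_def by (intro sum.cong refl) (auto simp: peval_ev)
  then show ?thesis by simp
qed

lemma subspace_tangent_space: "VectorSpace.subspace class_ring (tangent_space n S p) (module_vec TYPE(complex) n)"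
proof (rule subspace_vecI)
  have "dd n p (u + v) f = dd n p u f + dd n p v f" if "u \<in> carrier_vec n" "v \<in> carrier_vec n" for u v f
    using that by (simp add: dd_def ring_distribs sum.distrib)
  then show "u + v \<in> tangent_space n S p" if "u \<in> tangent_space n S p" "v \<in> tangent_space n S p" for u v
    using that by (simp add: tangent_space_dd)
  have "dd n p (c \<cdot>\<^sub>v v) f = c * dd n p v f" if "v \<in> carrier_vec n" for c v f
    using that by (simp add: dd_def sum_distrib_left mult.left_commute)
  then show "c \<cdot>\<^sub>v v \<in> tangent_space n S p" if "v \<in> tangent_space n S p" for c v
    using that by (simp add: tangent_space_dd)
qed (auto simp: tangent_space_dd dd_def)

text \<open>The restriction to a line through \<open>p\<close>, as a univariate polynomial; its linear coefficient is
  the directional derivative.\<close>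

definition along :: "nat \<Rightarrow> complex vec \<Rightarrow> complex vec \<Rightarrow> cpoly \<Rightarrow> complex poly" where
  "along n p v = evg (\<lambda>c. [:c:]) (\<lambda>i. [:p $ i, if i < n then v $ i else 0:])"

lemma const_poly_hom: "comm_ring_hom (\<lambda>c::complex. [:c:])"
  by unfold_locales (auto simp: one_pCons)

lemma along_hom: "comm_ring_hom (along n p v)"
  unfolding along_def by (rule evg_hom[OF const_poly_hom])

interpretation along: comm_ring_hom "along n p v" for n p v
  by (rule along_hom)

lemma along_Cst: "along n p v (Cst c) = [:c:]" and along_Var: "along n p v (Var i) = [:p $ i, if i < n then v $ i else 0:]"
  unfolding along_def by (simp_all add: evg_Cst[OF const_poly_hom] evg_Var[OF const_poly_hom])

lemma coeff_along: "coeff (along n p v f) 0 = peval f p \<and> coeff (along n p v f) 1 = dd n p v f"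
proof (induction f rule: cpoly_induct)
  case (mult f g)
  then show ?case
    by (simp add: along.hom_mult coeff_mult dd_mult peval_ev ev.hom_mult)
qed (auto simp: along_Cst along_Var along.hom_add dd_Cst dd_Var dd_add peval_ev ev.hom_add)

section \<open>Jacobians of the minors and of the Tjurina equations\<close>

definition mx :: "nat \<Rightarrow> nat \<Rightarrow> complex vec \<Rightarrow> complex vec \<Rightarrow> nat \<Rightarrow> nat \<Rightarrow> complex" where
  "mx t N a x i j = (\<Sum>k<N. coef t N a i j k * x $ k)"

text \<open>The entry (j, k) of B(s); \<open>sx_mx_swap\<close> is the identity s M(x) = B(s)
  x.\<close>

definition sx :: "nat \<Rightarrow> nat \<Rightarrow> complex vec \<Rightarrow> (nat \<Rightarrow> complex) \<Rightarrow> nat \<Rightarrow> nat \<Rightarrow> complex" where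
  "sx t N a s j k = (\<Sum>i<t. coef t N a i j k * s i)"

lemma linear_matrix_carrier: "linear_matrix t N a \<in> carrier_mat t (t + 1)"
  by (simp add: linear_matrix_def)

lemma linear_matrix_entry:
  "i < t \<Longrightarrow> j < t + 1 \<Longrightarrow> linear_matrix t N a $$ (i, j) = (\<Sum>k<N. Cst (coef t N a i j k) * Var k)"
  by (simp add: linear_matrix_def coef_def)

lemma peval_linear_matrix:
  "i < t \<Longrightarrow> j < t + 1 \<Longrightarrow> peval (linear_matrix t N a $$ (i, j)) x = mx t N a x i j"
  by (simp add: linear_matrix_entry peval_ev ev.hom_sum ev.hom_mult mx_def)

lemma along_linear_matrix:
  "i < t \<Longrightarrow> j < t + 1 \<Longrightarrow> along N p v (linear_matrix t N a $$ (i, j)) = [:mx t N a p i j, mx t N a v i j:]"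
proof -
  assume ij: "i < t" "j < t + 1"
  have "(\<Sum>k\<in>A. [:f k, g k:]) = [:\<Sum>k\<in>A. f k, \<Sum>k\<in>A. g k:]" for A and f g :: "nat \<Rightarrow> complex"
    by (induction A rule: infinite_finite_induct) auto
  then show ?thesis
    using ij by (simp add: linear_matrix_entry along.hom_sum along.hom_mult along_Cst along_Var mx_def mult.commute)
qed

lemma zero_locus_minors_iff:
  "x \<in> zero_locus N (minors t (linear_matrix t N a)) \<longleftrightarrow> x \<in> carrier_vec N \<and>
    (\<exists>s. (\<exists>i<t. s i \<noteq> 0) \<and> (\<forall>j<t + 1. (\<Sum>i<t. s i * mx t N a x i j) = 0))"
proof -
  have "(\<Sum>i<t. s i * peval (linear_matrix t N a $$ (i, j)) x) = (\<Sum>i<t. s i * mx t N a x i j)" if "j < t + 1" for s j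
    using that by (intro sum.cong refl) (simp add: peval_linear_matrix)
  then show ?thesis
    unfolding zero_locus_def using minors_vanish_iff[OF linear_matrix_carrier, of t N a x] by simp
qed

lemma sx_mx_swap:
  "(\<Sum>i<t. s i * mx t N a x i j) = (\<Sum>k<N. sx t N a s j k * x $ k)"
  unfolding mx_def sx_def sum_distrib_left sum_distrib_right
  by (subst sum.swap) (simp add: mult_ac)

text \<open>If the Jacobian of the Tjurina transform drops rank over \<open>p\<close>, the differentials of the minors
  are all proportional. To see this, replace the row \<open>i0\<close> of the matrix by the combination of rows
  that vanishes at \<open>p\<close>.\<close>

lemma tangent_minors_large:
  assumes p: "p \<in> carrier_vec N" and i0: "i0 < t" "s i0 = 1" and j0: "j0 < t + 1" "y j0 \<noteq> 0"
    and sM: "\<And>j. j < t + 1 \<Longrightarrow> (\<Sum>i<t. s i * mx t N a p i j) = 0"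
    and My: "\<And>i. i < t \<Longrightarrow> (\<Sum>j<t + 1. mx t N a p i j * y j) = 0"
    and yB: "\<And>k. k < N \<Longrightarrow> (\<Sum>j<t + 1. y j * sx t N a s j k) = 0"
  shows "N \<le> tangent_dim N (minors t (linear_matrix t N a)) p + 1"
proof -
  define r where "r = (\<lambda>v j. \<Sum>i<t. s i * mx t N a v i j)"
  define M' where "M' = (\<lambda>v i j. if i = i0 then r v j else mx t N a p i j)"
  have der: "dd N p v (det (mat t t (\<lambda>(i, l). linear_matrix t N a $$ (i, pick J l)))) = det (mat t t (\<lambda>(i, l). M' v i (pick J l)))"
    if J: "J \<subseteq> {..<t + 1}" "card J = t" for J v
  proof -
    have pJ: "pick J l < t + 1" if "l < t" for l using pick_in_set_le[of l J] J that by auto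
    define P where "P = (\<lambda>i l. [:mx t N a p i (pick J l), mx t N a v i (pick J l):])"
    let ?A = "mat t t (\<lambda>(i, l). if i = i0 then [:r v (pick J l):] else P i l)"
    have al: "along N p v (det (mat t t (\<lambda>(i, l). linear_matrix t N a $$ (i, pick J l)))) = det (mat t t (\<lambda>(i, l). P i l))"
      unfolding hom_det_mat[OF along_hom]
      by (intro arg_cong[of _ _ det] eq_matI) (simp_all add: P_def along_linear_matrix pJ[unfolded Suc_eq_plus1[symmetric]])
    \<comment> \<open>At p the combination of the rows with coefficients s vanishes, so on the line
      it is divisible by the parameter.\<close>
    have comb: "(\<Sum>k<t. [:s k:] * P k l) = [:0, 1:] * [:r v (pick J l):]" if "l < t" for l
    proof -
      have "(\<Sum>k\<in>A. [:s k:] * P k l) = [:\<Sum>k\<in>A. s k * mx t N a p k (pick J l), \<Sum>k\<in>A. s k * mx t N a v k (pick J l):]" for A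
        by (induction A rule: infinite_finite_induct) (auto simp: P_def)
      then show ?thesis using sM[OF pJ[OF that]] by (simp add: r_def)
    qed
    have "det (mat t t (\<lambda>(i, l). P i l)) = [:s i0:] * det (mat t t (\<lambda>(i, l). P i l))"
      using i0(2) by (simp add: one_pCons[symmetric])
    also have "\<dots> = det (mat t t (\<lambda>(i, l). if i = i0 then \<Sum>k<t. [:s k:] * P k l else P i l))"
      by (rule det_combine_rows[OF i0(1), symmetric])
    also have "\<dots> = (\<Sum>l<t. (\<Sum>k<t. [:s k:] * P k l) * cofactor (mat t t (\<lambda>(i, l). P i l)) i0 l)"
      by (rule det_replace_row[OF i0(1)])
    also have "\<dots> = [:0, 1:] * (\<Sum>l<t. [:r v (pick J l):] * cofactor (mat t t (\<lambda>(i, l). P i l)) i0 l)"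
      unfolding sum_distrib_left by (intro sum.cong refl) (simp only: comb lessThan_iff mult.assoc)
    also have "(\<Sum>l<t. [:r v (pick J l):] * cofactor (mat t t (\<lambda>(i, l). P i l)) i0 l) = det ?A"
      by (rule det_replace_row[OF i0(1), symmetric])
    \<comment> \<open>After division by the parameter, the derivative of the minor is the
      determinant with row i0 replaced and all other rows taken at p.\<close>
    finally have "coeff (det (mat t t (\<lambda>(i, l). P i l))) 1 = coeff (det ?A) 0"
      by simp
    also have "\<dots> = det (mat t t (\<lambda>(i, l). M' v i (pick J l)))"
    proof -
      have h: "comm_ring_hom (\<lambda>q::complex poly. coeff q 0)"
        by unfold_locales (auto simp: coeff_mult)
      show ?thesis
        unfolding hom_det_mat[OF h]
        by (intro arg_cong[of _ _ det] eq_matI) (auto simp: M'_def P_def)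
    qed
    finally show ?thesis using coeff_along[of N p v] al by metis
  qed
  \<comment> \<open>The minor that omits a column with y j0 \<noteq> 0; its differential \<psi>
    controls all the others.\<close>
  define J0 where "J0 = {..<t + 1} - {j0}"
  have J0: "J0 \<subseteq> {..<t + 1}" "card J0 = t" using j0(1) by (auto simp: J0_def)
  define C where "C = cofactor (mat t t (\<lambda>(i, l). mx t N a p i (pick J0 l))) i0"
  define \<psi> where "\<psi> = (\<lambda>k. \<Sum>l<t. C l * sx t N a s (pick J0 l) k)"
  have r_sx: "r v j = (\<Sum>k<N. sx t N a s j k * v $ k)" for v j
    unfolding r_def by (rule sx_mx_swap)
  have D0: "det (mat t t (\<lambda>(i, l). M' v i (pick J0 l))) = (\<Sum>k<N. \<psi> k * v $ k)" for v
  proof -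
    have "det (mat t t (\<lambda>(i, l). M' v i (pick J0 l))) = (\<Sum>l<t. r v (pick J0 l) * C l)"
      unfolding M'_def C_def by (rule det_replace_row[OF i0(1)])
    also have "\<dots> = (\<Sum>k<N. \<psi> k * v $ k)"
      unfolding r_sx \<psi>_def sum_distrib_right by (subst sum.swap) (simp add: mult_ac)
    finally show ?thesis .
  qed
  have "v \<in> tangent_space N (minors t (linear_matrix t N a)) p"
    if v: "v \<in> carrier_vec N" "(\<Sum>k<N. \<psi> k * v $ k) = 0" for v
  proof -
    \<comment> \<open>On the kernel of \<psi> some w kills the columns of \<open>M' v\<close> in J0.
      The column relation y makes w kill column j0 as well, and then every maximal minor of
      \<open>M' v\<close> vanishes.\<close>
    have "det (mat t t (\<lambda>(i, l). M' v i (pick J0 l))) = 0"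
      unfolding D0 by (rule v(2))
    then obtain w where w: "\<exists>i<t. w i \<noteq> 0" "\<forall>l<t. (\<Sum>i<t. w i * M' v i (pick J0 l)) = 0"
      unfolding det_mat_zero_left by blast
    have row: "(\<Sum>j<t + 1. M' v i j * y j) = 0" if "i < t" for i
    proof (cases "i = i0")
      case True
      have "(\<Sum>j<t + 1. r v j * y j) = (\<Sum>k<N. (\<Sum>j<t + 1. y j * sx t N a s j k) * v $ k)"
        unfolding r_sx sum_distrib_right by (subst sum.swap) (simp add: mult_ac)
      then show ?thesis using yB True by (simp add: M'_def)
    next
      case False
      then show ?thesis using My[OF that] by (simp add: M'_def)
    qed
    have wJ: "(\<Sum>i<t. w i * M' v i j) = 0" if "j \<in> J0" for j
    proof -
      have "pick J0 (card {a \<in> J0. a < j}) = j" by (rule pick_card_in_set[OF that])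
      moreover have "card {a \<in> J0. a < j} < t"
      proof -
        have "{a \<in> J0. a < j} \<subset> J0" using that by auto
        then show ?thesis using psubset_card_mono[of J0] J0 finite_subset[OF J0(1)] by auto
      qed
      ultimately show ?thesis using w(2) by metis
    qed
    have "0 = (\<Sum>i<t. w i * (\<Sum>j<t + 1. M' v i j * y j))" using row by simp
    also have "\<dots> = (\<Sum>j<t + 1. (\<Sum>i<t. w i * M' v i j) * y j)"
      unfolding sum_distrib_left sum_distrib_right by (subst sum.swap) (simp add: mult.assoc)
    also have "\<dots> = (\<Sum>i<t. w i * M' v i j0) * y j0 + (\<Sum>j\<in>J0. (\<Sum>i<t. w i * M' v i j) * y j)"
      unfolding J0_def by (rule sum.remove) (use j0 in auto)
    also have "\<dots> = (\<Sum>i<t. w i * M' v i j0) * y j0" using wJ by simp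
    finally have "(\<Sum>i<t. w i * M' v i j0) = 0" using j0(2) by simp
    then have wall: "(\<Sum>i<t. w i * M' v i j) = 0" if "j < t + 1" for j
      using wJ[of j] that by (cases "j = j0") (auto simp: J0_def)
    have "dd N p v f = 0" if f: "f \<in> minors t (linear_matrix t N a)" for f
    proof -
      obtain J where J: "J \<subseteq> {..<t + 1}" "card J = t"
        and f': "f = det (mat t t (\<lambda>(i, l). linear_matrix t N a $$ (i, pick J l)))"
        using f unfolding minors_full_rows[OF linear_matrix_carrier] by blast
      have "pick J l < t + 1" if "l < t" for l using pick_in_set_le[of l J] J that by auto
      then have "\<forall>l<t. (\<Sum>i<t. w i * M' v i (pick J l)) = 0" using wall by blast
      then have "det (mat t t (\<lambda>(i, l). M' v i (pick J l))) = 0"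
        unfolding det_mat_zero_left using w(1) by blast
      then show ?thesis unfolding f' der[OF J] .
    qed
    then show ?thesis using v(1) by (simp add: tangent_space_dd)
  qed
  then have "{v \<in> carrier_vec N. \<forall>j<(1::nat). (\<Sum>k<N. \<psi> k * v $ k) = 0} \<subseteq> tangent_space N (minors t (linear_matrix t N a)) p"
    by auto
  then show ?thesis
    unfolding tangent_dim_def by (rule subdim_ge_solutions[OF subspace_tangent_space, where c = 1 and B = "\<lambda>_. \<psi>"])
qed

lemma tjurina_equations_eq:
  "tjurina_equations N t (linear_matrix t N a) = qY t N a ` {..<t + 1}"
proof -
  have "(\<Sum>i<t. Var (N + i) * linear_matrix t N a $$ (i, j)) = qY t N a j" if "j < t + 1" for j
  proof -
    have "(\<Sum>i<t. Var (N + i) * linear_matrix t N a $$ (i, j))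
        = (\<Sum>i<t. \<Sum>k<N. Cst (coef t N a i j k) * (Var k * Var (N + i)))"
      using that by (intro sum.cong refl) (simp add: linear_matrix_entry sum_distrib_left mult_ac)
    also have "\<dots> = qY t N a j" unfolding qY_def bil_def by (rule sum.swap)
    finally show ?thesis .
  qed
  then have "(\<lambda>j. \<Sum>i<t. Var (N + i) * linear_matrix t N a $$ (i, j)) ` {..<t + 1} = qY t N a ` {..<t + 1}"
    by (intro image_cong refl) simp
  then show ?thesis unfolding tjurina_equations_def by (simp add: image_def Bex_def conj_commute)
qed

lemma in_vars_qY: "in_vars (N + t) (qY t N a j)"
  unfolding qY_def bil_def by (intro in_vars_sum in_vars_mult) auto

lemma ev_qY: "ev x (qY t N a j) = (\<Sum>k<N. sx t N a (\<lambda>i. x (N + i)) j k * x k)"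
  unfolding qY_def ev_bil sx_def by (intro sum.cong refl) (simp add: sum_distrib_right sum_distrib_left mult_ac)

text \<open>Rows 0, ..., t are the differentials of the equations, first in the directions of x,
  then in those of s; row t + 1 belongs to the normalization s_i = 1.\<close>

definition jac :: "nat \<Rightarrow> nat \<Rightarrow> complex vec \<Rightarrow> nat \<Rightarrow> complex vec \<Rightarrow> nat \<Rightarrow> nat \<Rightarrow> complex" where
  "jac t N a i z j k = (if j = t + 1 then (if k = N + i then 1 else 0)
     else if k < N then sx t N a (\<lambda>i. z $ (N + i)) j k else mx t N a z (k - N) j)"

lemma dd_qY:
  assumes "j < t + 1"
  shows "dd (N + t) z v (qY t N a j) = (\<Sum>k<N + t. jac t N a i z j k * v $ k)"
proof -
  have "dd (N + t) z v (qY t N a j)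
      = (\<Sum>k<N. \<Sum>i<t. coef t N a i j k * (z $ k * v $ (N + i) + z $ (N + i) * v $ k))"
    by (simp add: qY_def bil_def dd_sum dd_mult dd_Cst dd_Var peval_ev)
  also have "\<dots> = (\<Sum>k<N. \<Sum>i<t. coef t N a i j k * z $ k * v $ (N + i)) + (\<Sum>k<N. \<Sum>i<t. coef t N a i j k * z $ (N + i) * v $ k)"
    by (simp add: ring_distribs sum.distrib mult.assoc)
  also have "(\<Sum>k<N. \<Sum>i<t. coef t N a i j k * z $ (N + i) * v $ k) = (\<Sum>k<N. jac t N a i z j k * v $ k)"
    using assms by (intro sum.cong refl) (simp add: jac_def sx_def sum_distrib_right)
  also have "(\<Sum>k<N. \<Sum>i<t. coef t N a i j k * z $ k * v $ (N + i)) = (\<Sum>l<t. jac t N a i z j (N + l) * v $ (N + l))"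
    using assms by (subst sum.swap, intro sum.cong refl) (simp add: jac_def mx_def sum_distrib_right)
  finally show ?thesis by (simp add: sum_lessThan_add)
qed

lemma tangent_space_chart:
  assumes "i < t"
  shows "tangent_space (N + t) (tjurina_chart N t (linear_matrix t N a) i) z
    = {v \<in> carrier_vec (N + t). \<forall>j<t + 2. (\<Sum>k<N + t. jac t N a i z j k * v $ k) = 0}"
proof -
  have "dd (N + t) z v (Var (N + i) - 1) = (\<Sum>k<N + t. jac t N a i z (t + 1) k * v $ k)" for v
  proof -
    have eq: "Var (N + i) - 1 = Var (N + i) + Cst (- 1)" by (simp add: Cst.hom_uminus)
    have "dd (N + t) z v (Var (N + i) - 1) = v $ (N + i)"
      unfolding eq using assms by (simp add: dd_add dd_Var dd_Cst)
    also have "\<dots> = (\<Sum>k<N + t. if k = N + i then v $ (N + i) else 0)" using assms by simp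
    also have "\<dots> = (\<Sum>k<N + t. jac t N a i z (t + 1) k * v $ k)"
      by (intro sum.cong refl) (auto simp: jac_def)
    finally show ?thesis .
  qed
  moreover have "(\<forall>j<t + 2. P j) \<longleftrightarrow> P (t + 1) \<and> (\<forall>j<t + 1. P j)" for P
    by (auto simp: less_Suc_eq)
  ultimately show ?thesis
    unfolding tangent_space_dd tjurina_chart_def tjurina_equations_eq by (auto simp: dd_qY[where i = i])
qed

text \<open>A left relation of the Jacobian is trivial: pairing its s-part with s gives s M(x) y = 0
  by the equations, so the coefficient of the normalization vanishes, and the remaining y is
  excluded by \<open>nodeg\<close>.\<close>

lemma tangent_dim_chart_full:
  assumes i: "i < t" "z $ (N + i) = 1"
    and z: "\<And>j. j < t + 1 \<Longrightarrow> (\<Sum>l<t. z $ (N + l) * mx t N a z l j) = 0"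
    and nodeg: "\<And>y. (\<forall>k<N. (\<Sum>j<t + 1. y j * sx t N a (\<lambda>i. z $ (N + i)) j k) = 0) \<Longrightarrow>
      (\<forall>l<t. (\<Sum>j<t + 1. mx t N a z l j * y j) = 0) \<Longrightarrow> \<forall>j<t + 1. y j = 0"
  shows "tangent_dim (N + t) (tjurina_chart N t (linear_matrix t N a) i) z + (t + 2) = N + t"
  unfolding tangent_dim_def tangent_space_chart[OF i(1)]
proof (rule subdim_solutions)
  fix y assume y: "\<forall>k<N + t. (\<Sum>j<t + 2. y j * jac t N a i z j k) = 0"
  have split: "(\<Sum>j<t + 2. y j * jac t N a i z j k) = (\<Sum>j<t + 1. y j * jac t N a i z j k) + y (t + 1) * jac t N a i z (t + 1) k" for k
    by simp
  have 1: "(\<Sum>j<t + 1. y j * sx t N a (\<lambda>i. z $ (N + i)) j k) = 0" if "k < N" for k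
  proof -
    have "(\<Sum>j<t + 1. y j * jac t N a i z j k) = (\<Sum>j<t + 1. y j * sx t N a (\<lambda>i. z $ (N + i)) j k)"
      by (intro sum.cong refl) (use that in \<open>auto simp: jac_def\<close>)
    moreover have "jac t N a i z (t + 1) k = 0" using that by (simp add: jac_def)
    ultimately show ?thesis using y[rule_format, of k] that unfolding split by simp
  qed
  have 2: "(\<Sum>j<t + 1. mx t N a z l j * y j) + (if l = i then y (t + 1) else 0) = 0" if "l < t" for l
  proof -
    have "(\<Sum>j<t + 1. y j * jac t N a i z j (N + l)) = (\<Sum>j<t + 1. mx t N a z l j * y j)"
      by (intro sum.cong refl) (auto simp: jac_def)
    moreover have "y (t + 1) * jac t N a i z (t + 1) (N + l) = (if l = i then y (t + 1) else 0)" by (simp add: jac_def)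
    ultimately show ?thesis using y[rule_format, of "N + l"] that unfolding split by (simp del: sum.lessThan_Suc)
  qed
  have "(\<Sum>l<t. z $ (N + l) * (if l = i then y (t + 1) else 0)) = y (t + 1)"
  proof -
    have "(\<Sum>l<t. z $ (N + l) * (if l = i then y (t + 1) else 0)) = (\<Sum>l<t. if l = i then y (t + 1) else 0)"
      by (intro sum.cong refl) (auto simp: i(2))
    then show ?thesis using i(1) by simp
  qed
  moreover have "(\<Sum>l<t. z $ (N + l) * (\<Sum>j<t + 1. mx t N a z l j * y j)) = 0"
  proof -
    have "(\<Sum>l<t. z $ (N + l) * (\<Sum>j<t + 1. mx t N a z l j * y j)) = (\<Sum>j<t + 1. (\<Sum>l<t. z $ (N + l) * mx t N a z l j) * y j)"
      unfolding sum_distrib_left sum_distrib_right by (subst sum.swap) (simp add: mult.assoc)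
    then show ?thesis using z by simp
  qed
  moreover have "(\<Sum>l<t. z $ (N + l) * ((\<Sum>j<t + 1. mx t N a z l j * y j) + (if l = i then y (t + 1) else 0))) = 0"
    using 2 by simp
  ultimately have y0: "y (t + 1) = 0" by (simp add: ring_distribs sum.distrib)
  have "(\<Sum>j<t + 1. mx t N a z l j * y j) = 0" if "l < t" for l
    using 2[OF that] unfolding y0 by simp
  then have "\<forall>j<t + 1. y j = 0" using nodeg[of y] 1 by blast
  then show "\<forall>j<t + 2. y j = 0" using y0 by (auto simp: less_Suc_eq)
qed

text \<open>At the points of the zero section one equation is redundant if the linear forms have a left
  kernel, and the zero section and a line in the fibre are tangent.\<close>

lemma tangent_dim_chart_degenerate:
  assumes i: "i < t" and z: "\<And>k. k < N \<Longrightarrow> z $ k = 0"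
    and y: "j0 < t + 1" "y j0 \<noteq> 0" "\<And>k. k < N \<Longrightarrow> (\<Sum>j<t + 1. y j * sx t N a (\<lambda>i. z $ (N + i)) j k) = 0"
  shows "N \<le> tangent_dim (N + t) (tjurina_chart N t (linear_matrix t N a) i) z + 1"
proof -
  have mx0: "mx t N a z l j = 0" for l j using z by (simp add: mx_def)
  have rel: "(\<Sum>j<t + 1. y j * jac t N a i z j k) = 0" if "k < N + t" for k
  proof (cases "k < N")
    case True
    have "(\<Sum>j<t + 1. y j * jac t N a i z j k) = (\<Sum>j<t + 1. y j * sx t N a (\<lambda>i. z $ (N + i)) j k)"
      by (intro sum.cong refl) (use True in \<open>auto simp: jac_def\<close>)
    then show ?thesis using y(3)[OF True] by simp
  qed (simp add: jac_def mx0)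
  \<comment> \<open>Enumerates the t + 1 rows other than the redundant row j0.\<close>
  define e where "e = (\<lambda>j. if j < j0 then j else j + 1)"
  have "v \<in> tangent_space (N + t) (tjurina_chart N t (linear_matrix t N a) i) z"
    if v: "v \<in> carrier_vec (N + t)" "\<forall>j<t + 1. (\<Sum>k<N + t. jac t N a i z (e j) k * v $ k) = 0" for v
  proof -
    define F where "F = (\<lambda>j. \<Sum>k<N + t. jac t N a i z j k * v $ k)"
    have other: "F j = 0" if "j < t + 2" "j \<noteq> j0" for j
    proof (cases "j < j0")
      case True
      then show ?thesis using v(2)[rule_format, of j] y(1) by (simp add: F_def e_def)
    next
      case False
      then have "e (j - 1) = j" "j - 1 < t + 1" using that by (auto simp: e_def)
      then show ?thesis using v(2)[rule_format, of "j - 1"] by (simp add: F_def)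
    qed
    have "(\<Sum>j<t + 1. y j * F j) = (\<Sum>k<N + t. (\<Sum>j<t + 1. y j * jac t N a i z j k) * v $ k)"
      unfolding F_def sum_distrib_left sum_distrib_right by (subst sum.swap) (simp add: mult.assoc)
    also have "\<dots> = 0" using rel by simp
    finally have "y j0 * F j0 + (\<Sum>j\<in>{..<t + 1} - {j0}. y j * F j) = 0"
      using y(1) by (subst (asm) sum.remove[of _ j0]) auto
    moreover have "(\<Sum>j\<in>{..<t + 1} - {j0}. y j * F j) = 0"
      using other by (intro sum.neutral) auto
    ultimately have "F j0 = 0" using y(2) by simp
    then have "\<forall>j<t + 2. F j = 0" using other by metis
    then show ?thesis using v(1) unfolding tangent_space_chart[OF i] F_def by blast
  qed
  then have sub: "{v \<in> carrier_vec (N + t). \<forall>j<t + 1. (\<Sum>k<N + t. jac t N a i z (e j) k * v $ k) = 0}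
      \<subseteq> tangent_space (N + t) (tjurina_chart N t (linear_matrix t N a) i) z" by blast
  have "N + t \<le> tangent_dim (N + t) (tjurina_chart N t (linear_matrix t N a) i) z + (t + 1)"
    unfolding tangent_dim_def by (rule subdim_ge_solutions[OF subspace_tangent_space sub])
  then show ?thesis by simp
qed

lemma tangent_dim_chart_fibre:
  assumes i: "i < t" and z: "\<And>k. k < N \<Longrightarrow> z $ k = 0"
    and u: "k0 < N" "u k0 \<noteq> 0" "\<And>j. j < t + 1 \<Longrightarrow> (\<Sum>k<N. sx t N a (\<lambda>i. z $ (N + i)) j k * u k) = 0"
  shows "t \<le> tangent_dim (N + t) (tjurina_chart N t (linear_matrix t N a) i) z"
proof -
  have mx0: "mx t N a z l j = 0" for l j using z by (simp add: mx_def)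
  \<comment> \<open>N equations with a solution space of dimension t: row k0 makes the i-th
    s-coordinate zero, and the other rows make the x-part proportional to u.\<close>
  define B where "B = (\<lambda>j k. if j = k0 then (if k = N + i then 1 else 0)
    else (if k = j then u k0 else 0) - (if k = k0 then u j else 0))"
  have "v \<in> tangent_space (N + t) (tjurina_chart N t (linear_matrix t N a) i) z"
    if v: "v \<in> carrier_vec (N + t)" "\<forall>j<N. (\<Sum>k<N + t. B j k * v $ k) = 0" for v
  proof -
    have vi: "v $ (N + i) = 0"
    proof -
      have "(\<Sum>k<N + t. B k0 k * v $ k) = (\<Sum>k<N + t. if k = N + i then v $ (N + i) else 0)"
        by (intro sum.cong refl) (auto simp: B_def)
      then show ?thesis using v(2) u(1) i by simp
    qed
    have vj: "v $ j = (v $ k0 / u k0) * u j" if j: "j < N" for j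
    proof (cases "j = k0")
      case False
      have "(\<Sum>k<N + t. B j k * v $ k) = (\<Sum>k<N + t. (if k = j then u k0 * v $ j else 0) - (if k = k0 then u j * v $ k0 else 0))"
        using False by (intro sum.cong refl) (auto simp: B_def algebra_simps)
      also have "\<dots> = u k0 * v $ j - u j * v $ k0"
        using j u(1) by (simp add: sum_subtractf)
      finally show ?thesis using v(2) j u(2) by (simp add: field_simps)
    qed (use u(2) in simp)
    have "(\<Sum>k<N + t. jac t N a i z j k * v $ k) = 0" if j: "j < t + 2" for j
    proof (cases "j = t + 1")
      case True
      have "(\<Sum>k<N + t. jac t N a i z j k * v $ k) = (\<Sum>k<N + t. if k = N + i then v $ (N + i) else 0)"
        by (intro sum.cong refl) (auto simp: jac_def True)
      then show ?thesis using vi i by simp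
    next
      case False
      have "(\<Sum>k<N + t. jac t N a i z j k * v $ k) = (\<Sum>k<N. sx t N a (\<lambda>i. z $ (N + i)) j k * v $ k)"
        using False by (simp add: sum_lessThan_add jac_def mx0)
      also have "\<dots> = (\<Sum>k<N. (v $ k0 / u k0) * (sx t N a (\<lambda>i. z $ (N + i)) j k * u k))"
        by (intro sum.cong refl) (simp add: vj)
      also have "\<dots> = (v $ k0 / u k0) * (\<Sum>k<N. sx t N a (\<lambda>i. z $ (N + i)) j k * u k)"
        by (rule sum_distrib_left[symmetric])
      also have "\<dots> = 0" using u(3)[of j] j False by simp
      finally show ?thesis .
    qed
    then show ?thesis using v(1) unfolding tangent_space_chart[OF i] by blast
  qed
  then have sub: "{v \<in> carrier_vec (N + t). \<forall>j<N. (\<Sum>k<N + t. B j k * v $ k) = 0}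
      \<subseteq> tangent_space (N + t) (tjurina_chart N t (linear_matrix t N a) i) z" by blast
  have "N + t \<le> tangent_dim (N + t) (tjurina_chart N t (linear_matrix t N a) i) z + N"
    unfolding tangent_dim_def by (rule subdim_ge_solutions[OF subspace_tangent_space sub])
  then show ?thesis by simp
qed

section \<open>Singularities of the Tjurina transform\<close>

lemma irreducible_chain_mono:
  assumes "irreducible_chain \<C> d Z" "i \<le> j" "j \<le> d"
  shows "Z i \<subseteq> Z j"
  using assms(2,3)
proof (induction j rule: dec_induct)
  case (step j)
  then show ?case using assms(1) unfolding irreducible_chain_def by (metis Suc_le_eq less_imp_le psubset_imp_subset order_trans)
qed simp

lemma has_local_dim_le_sep:
  assumes "has_local_dim (affine_closed n) V p d" "sep n V m"
  shows "d \<le> m"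
proof (rule ccontr)
  assume "\<not> d \<le> m"
  then have md: "Suc m \<le> d" by simp
  obtain Z where Z: "irreducible_chain (affine_closed n) d Z" "Z d \<subseteq> V"
    using assms(1) unfolding has_local_dim_def by blast
  have "irreducible_chain (affine_closed n) (Suc m) Z"
    using Z(1) md unfolding irreducible_chain_def by simp
  moreover have "Z (Suc m) \<subseteq> V" using irreducible_chain_mono[OF Z(1) md] Z(2) by blast
  ultimately show False using no_chain_if_sep[OF assms(2)] by blast
qed

lemma ev_qV: "ev x (qV t N a k) = (\<Sum>j<t + 1. x (t + j) * sx t N a x j k)"
proof -
  have "ev x (qV t N a k) = (\<Sum>i<t. \<Sum>j<t + 1. coef t N a i j k * x i * x (t + j))"
    unfolding qV_def by (rule ev_bil)
  also have "\<dots> = (\<Sum>j<t + 1. x (t + j) * sx t N a x j k)"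
    unfolding sx_def sum_distrib_left by (subst sum.swap) (simp only: mult_ac)
  finally show ?thesis .
qed

lemma sx_cong: "(\<And>i. i < t \<Longrightarrow> s i = s' i) \<Longrightarrow> sx t N a s j k = sx t N a s' j k"
  unfolding sx_def by (intro sum.cong refl) simp

lemma mx_cong: "(\<And>k. k < N \<Longrightarrow> x $ k = x' $ k) \<Longrightarrow> mx t N a x i j = mx t N a x' i j"
  unfolding mx_def by (intro sum.cong refl) simp

text \<open>X is the image of Y under the projection to x, so \<open>sep_projection\<close>
  transfers the growth bound of the bilinear system.\<close>

lemma sep_minors:
  assumes "dgrowth N t (pgen (qY t N a ` {..<t + 1})) m" "1 \<le> m"
  shows "sep N (zero_locus N (minors t (linear_matrix t N a))) m"
proof (rule sep_projection[OF assms(1) pideal_pgen assms(2)])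
  fix z assume "z \<in> zero_locus N (minors t (linear_matrix t N a))"
  then obtain s where s: "\<exists>i<t. s i \<noteq> 0" "\<forall>j<t + 1. (\<Sum>i<t. s i * mx t N a z i j) = 0"
    unfolding zero_locus_minors_iff by blast
  define x where "x = (\<lambda>k. if k < N then z $ k else s (k - N))"
  have "ev x (qY t N a j) = 0" if "j < t + 1" for j
  proof -
    have "ev x (qY t N a j) = (\<Sum>k<N. sx t N a s j k * z $ k)"
      unfolding ev_qY by (intro sum.cong refl arg_cong2[of _ _ _ _ "(*)"] sx_cong) (auto simp: x_def)
    also have "\<dots> = (\<Sum>i<t. s i * mx t N a z i j)" by (rule sx_mx_swap[symmetric])
    finally show ?thesis using s(2) that by simp
  qed
  then have "\<forall>g\<in>pgen (qY t N a ` {..<t + 1}). ev x g = 0"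
    using ev_pgen[of _ "qY t N a ` {..<t + 1}" x] by blast
  moreover have "\<forall>i<N. x i = z $ i" by (simp add: x_def)
  moreover have "\<exists>j<t. x (N + j) \<noteq> 0" using s(1) by (simp add: x_def)
  ultimately show "\<exists>x. (\<forall>g\<in>pgen (qY t N a ` {..<t + 1}). ev x g = 0) \<and> (\<forall>i<N. x i = z $ i) \<and> (\<exists>j<t. x (N + j) \<noteq> 0)"
    by blast
qed

lemma chart_zero_locus_iff:
  "z \<in> zero_locus (N + t) (tjurina_chart N t (linear_matrix t N a) i) \<longleftrightarrow>
    z \<in> carrier_vec (N + t) \<and> z $ (N + i) = 1 \<and> (\<forall>j<t + 1. (\<Sum>l<t. z $ (N + l) * mx t N a z l j) = 0)"
proof -
  have "peval (qY t N a j) z = (\<Sum>l<t. z $ (N + l) * mx t N a z l j)" for j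
    unfolding peval_ev ev_qY by (rule sx_mx_swap[symmetric])
  moreover have "peval (Var (N + i) - 1) z = 0 \<longleftrightarrow> z $ (N + i) = 1"
    by (simp add: peval_ev ev.hom_minus)
  ultimately show ?thesis
    unfolding zero_locus_def tjurina_chart_def tjurina_equations_eq by auto
qed

lemma sep_tjurina_chart:
  assumes "dgrowth N t (pgen (qY t N a ` {..<t + 1})) m" "i < t"
  shows "sep (N + t) (zero_locus (N + t) (tjurina_chart N t (linear_matrix t N a) i)) (max m (t - 1))"
proof (rule sep_chart[OF assms(1) pideal_pgen assms(2)])
  fix z assume z: "z \<in> zero_locus (N + t) (tjurina_chart N t (linear_matrix t N a) i)"
  then have "ev (($) z) (qY t N a j) = 0" if "j < t + 1" for j
    using that unfolding zero_locus_def tjurina_chart_def tjurina_equations_eq peval_ev by blast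
  then have "\<forall>g\<in>pgen (qY t N a ` {..<t + 1}). ev (($) z) g = 0"
    using ev_pgen[of _ "qY t N a ` {..<t + 1}" "($) z"] by blast
  then show "(\<forall>g\<in>pgen (qY t N a ` {..<t + 1}). ev (($) z) g = 0) \<and> z $ (N + i) = 1"
    using z unfolding chart_zero_locus_iff by blast
qed

text \<open>Three numbers agree: Krull bounds the local dimension below by (N + t) - (t + 2) = N -
  2, growth bounds it above by the same, and a Jacobian of full rank gives the tangent space this
  dimension.\<close>

lemma smooth_at_chart:
  assumes t: "1 \<le> t" "t + 1 \<le> N" and i: "i < t"
    and g: "dgrowth N t (pgen (qY t N a ` {..<t + 1})) (N - 2)"
    and z: "z \<in> zero_locus (N + t) (tjurina_chart N t (linear_matrix t N a) i)"
    and nodeg: "\<And>y. (\<forall>k<N. (\<Sum>j<t + 1. y j * sx t N a (\<lambda>i. z $ (N + i)) j k) = 0) \<Longrightarrow>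
      (\<forall>l<t. (\<Sum>j<t + 1. mx t N a z l j * y j) = 0) \<Longrightarrow> \<forall>j<t + 1. y j = 0"
  shows "smooth_at (N + t) (tjurina_chart N t (linear_matrix t N a) i) z"
proof -
  let ?S = "tjurina_chart N t (linear_matrix t N a) i"
  have z': "z \<in> carrier_vec (N + t)" "z $ (N + i) = 1" "\<And>j. j < t + 1 \<Longrightarrow> (\<Sum>l<t. z $ (N + l) * mx t N a z l j) = 0"
    using z unfolding chart_zero_locus_iff by auto
  have td: "tangent_dim (N + t) ?S z = N - 2"
    using tangent_dim_chart_full[of i t z N a, OF i z'(2,3) nodeg] t by simp
  define f where "f = (\<lambda>l. if l < t + 1 then qY t N a l else Var (N + i) - 1)"
  have S: "?S = f ` {..<t + 2}"
  proof -
    have "f ` {..<t + 2} = insert (f (t + 1)) (f ` {..<t + 1})"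
      by (simp add: lessThan_Suc)
    moreover have "f ` {..<t + 1} = qY t N a ` {..<t + 1}" by (intro image_cong refl) (simp add: f_def)
    ultimately show ?thesis unfolding tjurina_chart_def tjurina_equations_eq by (simp add: f_def)
  qed
  have "\<exists>Z. irreducible_chain (affine_closed (N + t)) (N + t - (t + 2)) Z \<and> z \<in> Z 0 \<and>
      Z (N + t - (t + 2)) \<subseteq> zero_locus (N + t) (f ` {..<t + 2})"
  proof (rule maximal_powers.krull_chain[OF z'(1)])
    show "in_vars (N + t) (f l)" for l
      using i by (auto simp: f_def in_vars_qY intro!: in_vars_minus)
    show "peval (f l) z = 0" if "l < t + 2" for l
      using z that unfolding S zero_locus_def by blast
  qed (use t in simp)
  moreover have "N + t - (t + 2) = N - 2" by simp
  \<comment> \<open>The zero section has dimension t - 1, which does not exceed N - 2.\<close>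
  moreover have "sep (N + t) (zero_locus (N + t) ?S) (N - 2)"
    using sep_tjurina_chart[OF g i] max_absorb1[of "t - 1" "N - 2"] t(2) by simp
  ultimately have "has_local_dim (affine_closed (N + t)) (zero_locus (N + t) ?S) z (N - 2)"
    unfolding has_local_dim_def S[symmetric] using no_chain_if_sep by metis
  then show ?thesis unfolding smooth_at_def td using z by blast
qed

lemma not_smooth_at_chart:
  assumes g: "dgrowth N t (pgen (qY t N a ` {..<t + 1})) m" and i: "i < t"
    and large: "max m (t - 1) < tangent_dim (N + t) (tjurina_chart N t (linear_matrix t N a) i) z"
  shows "\<not> smooth_at (N + t) (tjurina_chart N t (linear_matrix t N a) i) z"
  using has_local_dim_le_sep[OF _ sep_tjurina_chart[OF g i]] large unfolding smooth_at_def by fastforce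

section \<open>Points of the transform and of its charts\<close>

lemma transform_chart_point:
  assumes "(x, p) \<in> tjurina_transform N t (linear_matrix t N a)" "s \<in> p" "i < t" "s $ i = 1"
  shows "x @\<^sub>v s \<in> zero_locus (N + t) (tjurina_chart N t (linear_matrix t N a) i)"
proof -
  have xs: "x \<in> carrier_vec N" "s \<in> carrier_vec t"
    using assms(1,2) proj_spaceD(1) by (auto simp: tjurina_transform_def)
  have "peval f (x @\<^sub>v s) = 0" if "f \<in> tjurina_equations N t (linear_matrix t N a)" for f
    using assms(1,2) that by (auto simp: tjurina_transform_def)
  moreover have "peval (Var (N + i) - 1) (x @\<^sub>v s) = 0"
    using xs assms(3,4) by (simp add: peval_ev ev.hom_minus)
  ultimately show ?thesis
    using xs by (auto simp: zero_locus_def tjurina_chart_def)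
qed

lemma zero_section_point:
  assumes p: "p \<in> proj_space t"
  shows "(0\<^sub>v N, p) \<in> tjurina_transform N t (linear_matrix t N a)"
proof -
  have "peval (qY t N a j) (0\<^sub>v N @\<^sub>v s) = 0" if "s \<in> p" for j s
    unfolding peval_ev ev_qY using proj_spaceD(1)[OF p that] by (intro sum.neutral) auto
  then show ?thesis
    using p unfolding tjurina_transform_def tjurina_equations_eq by auto
qed

lemma normalized_representative:
  assumes "p \<in> proj_space t"
  obtains s i where "s \<in> p" "i < t" "s $ i = 1" "s \<in> carrier_vec t"
proof -
  obtain r where r: "r \<in> carrier_vec t" "r \<noteq> 0\<^sub>v t" "p = ray r"
    using assms by (auto simp: proj_space_eq)
  obtain i where i: "i < t" "r $ i \<noteq> 0" using r(1,2) by (metis carrier_vecD eq_vecI index_zero_vec(1,2))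
  have "(1 / r $ i) \<cdot>\<^sub>v r \<in> ray r" unfolding ray_def using i(2) by (auto intro!: exI[of _ "1 / r $ i"])
  then show ?thesis using that[of "(1 / r $ i) \<cdot>\<^sub>v r" i] i r by simp
qed

text \<open>The matrix of linear forms in \<open>s\<close> obtained by writing the equations of the transform as a
  linear system in \<open>x\<close>.\<close>

definition section_matrix :: "nat \<Rightarrow> nat \<Rightarrow> complex vec \<Rightarrow> cpoly mat" where
  "section_matrix t N a = mat (t + 1) N (\<lambda>(j, k). \<Sum>i<t. Cst (coef t N a i j k) * Var i)"

definition section_locus :: "nat \<Rightarrow> nat \<Rightarrow> complex vec \<Rightarrow> complex vec set set" where
  "section_locus t N a = proj_zero_locus t (minors (t + 1) (section_matrix t N a))"

lemma section_matrix_carrier: "section_matrix t N a \<in> carrier_mat (t + 1) N"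
  by (simp add: section_matrix_def)

lemma section_matrix_homogeneous:
  "j < t + 1 \<Longrightarrow> k < N \<Longrightarrow> homogeneous t 1 (section_matrix t N a $$ (j, k))"
  by (simp add: section_matrix_def del: One_nat_def) (intro homogeneous_sum homogeneous_Cst_Var, simp)

lemma homogeneous_prod:
  "finite A \<Longrightarrow> (\<And>x. x \<in> A \<Longrightarrow> homogeneous n 1 (g x)) \<Longrightarrow> homogeneous n (card A) (prod g A)"
proof (induction A rule: finite_induct)
  case empty
  then show ?case by (simp add: homogeneous_def in_vars_def)
next
  case (insert x A)
  then have "homogeneous n (1 + card A) (g x * prod g A)" by (intro homogeneous_mult) auto
  then show ?case using insert by simp
qed

lemma homogeneous_det:
  assumes A: "A \<in> carrier_mat r r" "\<And>i j. i < r \<Longrightarrow> j < r \<Longrightarrow> homogeneous n 1 (A $$ (i, j))"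
  shows "homogeneous n r (det A)"
  unfolding det_def'[OF A(1)]
proof (rule homogeneous_sum)
  fix p assume "p \<in> {p. p permutes {0..<r}}"
  then have "homogeneous n (card {0..<r}) (\<Prod>i = 0..<r. A $$ (i, p i))"
    by (intro homogeneous_prod A(2)) (auto simp: permutes_in_image)
  moreover have "homogeneous n d (- f)" if "homogeneous n d f" for d f
    using that in_vars_uminus[of n f] by (simp add: homogeneous_def in_keys_iff)
  ultimately show "homogeneous n r (signof p * (\<Prod>i = 0..<r. A $$ (i, p i)))"
    by (cases "sign p = 1") (auto simp: sign_def)
qed

lemma section_minors_homogeneous:
  assumes "f \<in> minors (t + 1) (section_matrix t N a)"
  shows "\<exists>d. homogeneous t d f"
proof -
  obtain J where J: "J \<subseteq> {..<N}" "card J = t + 1"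
    and f: "f = det (mat (t + 1) (t + 1) (\<lambda>(i, l). section_matrix t N a $$ (i, pick J l)))"
    using assms unfolding minors_full_rows[OF section_matrix_carrier] by blast
  have "\<And>l. l < t + 1 \<Longrightarrow> pick J l < N" using pick_in_set_le[of _ J] J by (metis lessThan_iff subsetD)
  then have "homogeneous t (t + 1) f"
    unfolding f
  proof (intro homogeneous_det)
    fix i l assume *: "i < t + 1" "l < t + 1"
    then show "homogeneous t 1 (mat (t + 1) (t + 1) (\<lambda>(i, l). section_matrix t N a $$ (i, pick J l)) $$ (i, l))"
      using section_matrix_homogeneous[OF *(1) \<open>\<And>l. l < t + 1 \<Longrightarrow> pick J l < N\<close>[OF *(2)]] by (simp del: One_nat_def)
  qed simp
  then show ?thesis by blast
qed

lemma section_locus_iff: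
  assumes "p \<in> proj_space t" "s \<in> p"
  shows "p \<in> section_locus t N a \<longleftrightarrow>
    (\<exists>y. (\<exists>j<t + 1. y j \<noteq> 0) \<and> (\<forall>k<N. (\<Sum>j<t + 1. y j * sx t N a (($) s) j k) = 0))"
proof -
  note s = proj_spaceD[OF assms]
  have "peval (section_matrix t N a $$ (j, k)) s = sx t N a (($) s) j k" if "j < t + 1" "k < N" for j k
    using that by (simp add: section_matrix_def sx_def peval_ev ev.hom_sum ev.hom_mult)
  then have eq: "(\<Sum>j<t + 1. y j * peval (section_matrix t N a $$ (j, k)) s) = (\<Sum>j<t + 1. y j * sx t N a (($) s) j k)"
    if "k < N" for y k
    using that by (intro sum.cong refl) simp
  have "p \<in> section_locus t N a \<longleftrightarrow> (\<forall>f\<in>minors (t + 1) (section_matrix t N a). peval f s = 0)"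
    unfolding section_locus_def s(3) by (rule ray_in_proj_zero_locus[OF section_minors_homogeneous s(1,2)])
  also have "\<dots> \<longleftrightarrow> (\<exists>y. (\<exists>j<t + 1. y j \<noteq> 0) \<and> (\<forall>k<N. (\<Sum>j<t + 1. y j * sx t N a (($) s) j k) = 0))"
    unfolding minors_vanish_iff[OF section_matrix_carrier] by (intro iff_exI conj_cong refl all_cong1 imp_cong) (simp only: eq)
  finally show ?thesis .
qed

lemma section_locus_closed: "section_locus t N a \<in> proj_closed t"
  unfolding section_locus_def by (rule proj_closedI[OF section_minors_homogeneous])

text \<open>The cone is the projection to s of the solutions of y B(s) = 0 with y \<noteq> 0; over
  the origin any y will do.\<close>

lemma sep_section_cone:
  assumes "dgrowth t (t + 1) (pgen (qV t N a ` {..<N})) m" "1 \<le> m"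
  shows "sep t (cone t (section_locus t N a)) m"
proof (rule sep_projection[OF assms(1) pideal_pgen assms(2)])
  fix z assume z: "z \<in> cone t (section_locus t N a)"
  have "\<exists>y. (\<exists>j<t + 1. y j \<noteq> 0) \<and> (\<forall>k<N. (\<Sum>j<t + 1. y j * sx t N a (($) z) j k) = 0)"
  proof (cases "z = 0\<^sub>v t")
    case True
    then have "sx t N a (($) z) j k = 0" for j k by (simp add: sx_def)
    then show ?thesis by (intro exI[of _ "\<lambda>_. 1"]) auto
  next
    case False
    then have "z \<in> carrier_vec t" "ray z \<in> section_locus t N a" using z by (auto simp: cone_def)
    then show ?thesis
      using section_locus_iff[OF ray_in_proj_space[OF _ False] self_in_ray] by blast
  qed
  then obtain y where y: "\<exists>j<t + 1. y j \<noteq> 0" "\<forall>k<N. (\<Sum>j<t + 1. y j * sx t N a (($) z) j k) = 0" by blast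
  define x where "x = (\<lambda>k. if k < t then z $ k else y (k - t))"
  have "ev x (qV t N a k) = 0" if "k < N" for k
  proof -
    have "ev x (qV t N a k) = (\<Sum>j<t + 1. y j * sx t N a (($) z) j k)"
      unfolding ev_qV by (intro sum.cong refl arg_cong2[of _ _ _ _ "(*)"] sx_cong) (auto simp: x_def)
    then show ?thesis using y(2) that by simp
  qed
  then have "\<forall>g\<in>pgen (qV t N a ` {..<N}). ev x g = 0"
    using ev_pgen[of _ "qV t N a ` {..<N}" x] by blast
  moreover have "\<forall>i<t. x i = z $ i" by (simp add: x_def)
  moreover have "\<exists>j<t + 1. x (t + j) \<noteq> 0" using y(1) by (simp add: x_def)
  ultimately show "\<exists>x. (\<forall>g\<in>pgen (qV t N a ` {..<N}). ev x g = 0) \<and> (\<forall>i<t. x i = z $ i) \<and> (\<exists>j<t + 1. x (t + j) \<noteq> 0)"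
    by blast
qed

text \<open>The points of the linear section by the hyperplanes \<open>hyperplane t c\<close> are the coefficient
  vectors of the polynomials with the roots \<open>c\<close>.\<close>

lemma section_locus_linear_section:
  assumes "t + 1 \<le> N" "N < 2 * t"
  shows "section_locus t N a \<inter> proj_zero_locus t ((\<lambda>l. hyperplane t (cs l)) ` {..<2 * t - N - 1}) \<noteq> {}"
proof -
  define e where "e = 2 * t - N - 1"
  \<comment> \<open>The multiples of \<omega> among the polynomials of degree below t form a space
    of dimension n1.\<close>
  define n1 where "n1 = t - e"
  have n1: "n1 + e = t" "n1 + t = N + 1" "1 \<le> n1" using assms by (auto simp: e_def n1_def)
  define \<omega> where "\<omega> = (\<Prod>l<e. [:- cs l, 1:])"
  have deg\<omega>: "degree \<omega> \<le> e" unfolding \<omega>_def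
    using degree_prod_sum_le[of "{..<e}" "\<lambda>l. [:- cs l, 1:]"] by simp
  have \<omega>0: "\<omega> \<noteq> 0" by (simp add: \<omega>_def)
  \<comment> \<open>The system y B(s) = 0 for s = \<tau> \<omega>, written as bilinear forms in the
    coefficients of \<tau> and in y.\<close>
  define b where "b = (\<lambda>k p j. \<Sum>i<t. coef t N a i j k * coeff (monom 1 p * \<omega>) i)"
  \<comment> \<open>Here N is exactly the largest number of equations for which a nontrivial zero is
    guaranteed.\<close>
  have c: "N + 2 \<le> n1 + (t + 1)" using n1 by simp
  obtain x where x: "\<exists>i<n1. x i \<noteq> 0" "\<exists>j<t + 1. x (n1 + j) \<noteq> 0" "\<And>k. k < N \<Longrightarrow> ev x (bil n1 (t + 1) (b k)) = 0"
    using bilinear_nontrivial_zero[OF c n1(3), of b] by auto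
  define \<tau> where "\<tau> = (\<Sum>p<n1. monom (x p) p)"
  define s where "s = vec t (\<lambda>i. coeff (\<tau> * \<omega>) i)"
  define y where "y = (\<lambda>j. x (n1 + j))"
  have "coeff \<tau> i = (if i < n1 then x i else 0)" for i by (simp add: \<tau>_def coeff_sum)
  then have "\<tau> \<noteq> 0" using x(1) by (metis coeff_0)
  have "degree \<tau> < n1"
    unfolding \<tau>_def using n1(3) by (intro degree_sum_less) (auto intro: le_less_trans[OF degree_monom_le])
  then have deg: "degree (\<tau> * \<omega>) < t"
    using degree_mult_le[of \<tau> \<omega>] deg\<omega> n1(1) by simp
  have "s \<noteq> 0\<^sub>v t"
  proof
    assume "s = 0\<^sub>v t"
    then have "coeff (\<tau> * \<omega>) i = 0" if "i < t" for i using that by (metis s_def index_vec index_zero_vec(1))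
    then have "\<tau> * \<omega> = 0" using deg by (metis leading_coeff_0_iff)
    then show False using \<open>\<tau> \<noteq> 0\<close> \<omega>0 by simp
  qed
  then have s: "s \<in> carrier_vec t" "s \<noteq> 0\<^sub>v t" by (auto simp: s_def)
  have coeff_s: "coeff (\<tau> * \<omega>) i = (\<Sum>p<n1. x p * coeff (monom 1 p * \<omega>) i)" for i
  proof -
    have "\<tau> * \<omega> = (\<Sum>p<n1. smult (x p) (monom 1 p * \<omega>))"
      unfolding \<tau>_def sum_distrib_right by (intro sum.cong refl) (simp add: smult_monom mult_smult_left[symmetric])
    then show ?thesis by (simp add: coeff_sum)
  qed
  have "(\<Sum>j<t + 1. y j * sx t N a (($) s) j k) = 0" if "k < N" for k
  proof -
    have "sx t N a (($) s) j k = (\<Sum>p<n1. b k p j * x p)" for j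
    proof -
      have "sx t N a (($) s) j k = (\<Sum>i<t. \<Sum>p<n1. coef t N a i j k * (x p * coeff (monom 1 p * \<omega>) i))"
        unfolding sx_def by (intro sum.cong refl) (simp add: s_def coeff_s sum_distrib_left)
      also have "\<dots> = (\<Sum>p<n1. b k p j * x p)"
        unfolding b_def sum_distrib_right by (subst sum.swap) (simp add: mult_ac)
      finally show ?thesis .
    qed
    then have "(\<Sum>j<t + 1. y j * sx t N a (($) s) j k) = (\<Sum>j<t + 1. \<Sum>p<n1. b k p j * x p * x (n1 + j))"
      by (simp only: y_def sum_distrib_left mult_ac)
    also have "\<dots> = ev x (bil n1 (t + 1) (b k))" unfolding ev_bil by (rule sum.swap)
    finally show ?thesis using x(3)[OF that] by simp
  qed
  moreover have "\<exists>j<t + 1. y j \<noteq> 0" using x(2) by (simp add: y_def)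
  ultimately have "ray s \<in> section_locus t N a"
    using section_locus_iff[OF ray_in_proj_space[OF s] self_in_ray] by blast
  moreover have "ray s \<in> proj_zero_locus t ((\<lambda>l. hyperplane t (cs l)) ` {..<e})"
  proof -
    have "peval (hyperplane t (cs l)) s = 0" if "l < e" for l
    proof -
      have "poly \<omega> (cs l) = 0" using that by (auto simp: \<omega>_def poly_prod)
      then have "poly (\<tau> * \<omega>) (cs l) = 0" by simp
      moreover have "poly (\<tau> * \<omega>) (cs l) = (\<Sum>i<t. coeff (\<tau> * \<omega>) i * cs l ^ i)"
        unfolding poly_altdef using deg by (intro sum.mono_neutral_left) (auto simp: coeff_eq_0)
      ultimately have "(\<Sum>i<t. cs l ^ i * coeff (\<tau> * \<omega>) i) = 0" by (simp only: mult.commute[of "cs l ^ _"])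
      then show ?thesis by (simp add: peval_hyperplane s_def)
    qed
    then show ?thesis
      using homogeneous_hyperplane by (subst ray_in_proj_zero_locus[OF _ s]) auto
  qed
  ultimately show ?thesis unfolding e_def by blast
qed

text \<open>A chain comes from linear sections; the upper bound comes from the cone, whose dimension
  is larger by one, hence the growth exponent 2t - N.\<close>

lemma has_dim_section_locus:
  assumes N: "t + 1 \<le> N" "N < 2 * t"
    and g: "dgrowth t (t + 1) (pgen (qV t N a ` {..<N})) (2 * t - N)"
  shows "has_dim (proj_closed t) (section_locus t N a) (2 * t - N - 1)"
  unfolding has_dim_def
proof
  show "\<exists>Z. irreducible_chain (proj_closed t) (2 * t - N - 1) Z \<and> Z (2 * t - N - 1) \<subseteq> section_locus t N a"
    by (rule chain_of_linear_sections[OF section_locus_closed section_locus_linear_section[OF N]])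
  have sep: "sep t (cone t (section_locus t N a)) (2 * t - N)"
    using sep_section_cone[OF g] N by simp
  have eq: "Suc (Suc (2 * t - N - 1)) = Suc (2 * t - N)" using N by simp
  show "\<not> (\<exists>Z. irreducible_chain (proj_closed t) (Suc (2 * t - N - 1)) Z \<and> Z (Suc (2 * t - N - 1)) \<subseteq> section_locus t N a)"
    using cone_chain no_chain_if_sep[OF sep] unfolding eq[symmetric] by blast
qed

text \<open>A left kernel of B(s) raises the dimension of the tangent space at (0, s) to at least N
  - 1, while the local dimension is at most N - 2.\<close>

lemma singular_on_section_locus:
  assumes N: "t + 1 \<le> N" and g: "dgrowth N t (pgen (qY t N a ` {..<t + 1})) (N - 2)"
    and p: "p \<in> section_locus t N a"
  shows "(0\<^sub>v N, p) \<in> tjurina_singular_locus N t (linear_matrix t N a)"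
proof -
  have ps: "p \<in> proj_space t" using p proj_closed_subset[OF section_locus_closed] by blast
  obtain s i where s: "s \<in> p" "i < t" "s $ i = 1" "s \<in> carrier_vec t"
    using normalized_representative[OF ps] by blast
  obtain y j0 where y: "j0 < t + 1" "y j0 \<noteq> 0" "\<forall>k<N. (\<Sum>j<t + 1. y j * sx t N a (($) s) j k) = 0"
    using p section_locus_iff[OF ps s(1)] by blast
  have sx: "sx t N a (\<lambda>i. (0\<^sub>v N @\<^sub>v s) $ (N + i)) j k = sx t N a (($) s) j k" for j k
    by (rule sx_cong) (use s(4) in simp)
  have "N \<le> tangent_dim (N + t) (tjurina_chart N t (linear_matrix t N a) i) (0\<^sub>v N @\<^sub>v s) + 1"
    by (rule tangent_dim_chart_degenerate[where y = y and ?j0.0 = j0, OF s(2) _ y(1,2)]) (use s(4) y(3) in \<open>simp_all add: sx\<close>)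
  then have "max (N - 2) (t - 1) < tangent_dim (N + t) (tjurina_chart N t (linear_matrix t N a) i) (0\<^sub>v N @\<^sub>v s)"
    using N s(2) by simp
  then have "\<not> smooth_at (N + t) (tjurina_chart N t (linear_matrix t N a) i) (0\<^sub>v N @\<^sub>v s)"
    by (rule not_smooth_at_chart[OF g s(2)])
  then show ?thesis
    unfolding tjurina_singular_locus_def tjurina_smooth_at_def using zero_section_point[OF ps] s by auto
qed

text \<open>The entries are linear, so degeneracy at x is inherited by its multiples, and x may be
  moved into the neighbourhood where X is smooth. There the tangent space has dimension at most N -
  2, whereas a nonzero y forces at least N - 1.\<close>

lemma ICMC2_no_degeneracy:
  assumes I: "ICMC2 N t (linear_matrix t N a)" and N: "3 \<le> N"
    and g: "dgrowth N t (pgen (qY t N a ` {..<t + 1})) (N - 2)"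
    and x: "x \<in> carrier_vec N" "x \<noteq> 0\<^sub>v N" and i: "i < t" "s i = 1"
    and sM: "\<And>j. j < t + 1 \<Longrightarrow> (\<Sum>l<t. s l * mx t N a x l j) = 0"
    and yB: "\<forall>k<N. (\<Sum>j<t + 1. y j * sx t N a s j k) = 0"
    and My: "\<forall>l<t. (\<Sum>j<t + 1. mx t N a x l j * y j) = 0"
  shows "\<forall>j<t + 1. y j = 0"
proof (rule ccontr)
  assume "\<not> ?thesis"
  then obtain j0 where j0: "j0 < t + 1" "y j0 \<noteq> 0" by blast
  let ?M = "minors t (linear_matrix t N a)"
  obtain \<epsilon> where \<epsilon>: "\<epsilon> > 0" "\<And>x. x \<in> zero_locus N ?M \<Longrightarrow> x \<noteq> 0\<^sub>v N \<Longrightarrow> (\<forall>k<N. cmod (x $ k) < \<epsilon>) \<Longrightarrow> smooth_at N ?M x"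
    using I unfolding ICMC2_def by blast
  \<comment> \<open>Exceeds every coordinate of x in absolute value, so scaling by \<epsilon> / B
    brings x into the neighbourhood; the summand 1 keeps B positive.\<close>
  define B where "B = (\<Sum>k<N. cmod (x $ k)) + 1"
  define r where "r = \<epsilon> / B"
  define c where "c = complex_of_real r"
  have B: "B > 0" unfolding B_def by (intro add_nonneg_pos sum_nonneg) auto
  then have r: "r > 0" using \<epsilon>(1) by (simp add: r_def)
  then have c0: "c \<noteq> 0" by (simp add: c_def)
  define x' where "x' = c \<cdot>\<^sub>v x"
  have x': "x' \<in> carrier_vec N" using x(1) by (simp add: x'_def)
  have mx': "mx t N a x' l j = c * mx t N a x l j" for l j
    using x(1) by (simp add: mx_def x'_def sum_distrib_left mult_ac)
  have nz: "x' \<noteq> 0\<^sub>v N"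
  proof
    assume "x' = 0\<^sub>v N"
    have "x = 0\<^sub>v N"
    proof (rule eq_vecI)
      fix k assume "k < dim_vec (0\<^sub>v N :: complex vec)"
      then have "k < N" by simp
      then have "c * x $ k = 0" using \<open>x' = 0\<^sub>v N\<close> x(1) by (metis x'_def carrier_vecD index_smult_vec(1) index_zero_vec(1))
      then show "x $ k = 0\<^sub>v N $ k" using c0 \<open>k < N\<close> by simp
    qed (use x(1) in simp)
    then show False using x(2) by blast
  qed
  have sM': "(\<Sum>l<t. s l * mx t N a x' l j) = 0" if "j < t + 1" for j
  proof -
    have "(\<Sum>l<t. s l * mx t N a x' l j) = c * (\<Sum>l<t. s l * mx t N a x l j)"
      by (simp add: mx' sum_distrib_left mult_ac)
    then show ?thesis using sM[OF that] by simp
  qed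
  have My': "(\<Sum>j<t + 1. mx t N a x' l j * y j) = 0" if "l < t" for l
  proof -
    have "(\<Sum>j<t + 1. mx t N a x' l j * y j) = c * (\<Sum>j<t + 1. mx t N a x l j * y j)"
      unfolding mx' sum_distrib_left by (simp only: mult.assoc)
    then show ?thesis using My that by simp
  qed
  have "x' \<in> zero_locus N ?M"
    unfolding zero_locus_minors_iff using x' sM' i by (intro conjI exI[of _ s]) auto
  moreover have "cmod (x' $ k) < \<epsilon>" if k: "k < N" for k
  proof -
    have "cmod (x $ k) \<le> (\<Sum>k<N. cmod (x $ k))" by (rule member_le_sum) (use k in auto)
    then have "cmod (x $ k) < B" by (simp add: B_def)
    then have "r * cmod (x $ k) < r * B" using r by simp
    then show ?thesis using k x(1) B r using \<epsilon>(1) by (simp add: x'_def c_def norm_mult norm_divide r_def)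
  qed
  ultimately have "smooth_at N ?M x'" using \<epsilon>(2) nz by blast
  then have "tangent_dim N ?M x' \<le> N - 2"
    using has_local_dim_le_sep[OF _ sep_minors[OF g]] N unfolding smooth_at_def by auto
  moreover have "N \<le> tangent_dim N ?M x' + 1"
    by (rule tangent_minors_large[where s = s and y = y, OF x' i j0 sM' My']) (use yB in auto)
  ultimately show False using N by simp
qed

text \<open>A point that is not smooth has a nonzero y at which the Jacobian degenerates; for x
  \<noteq> 0 this contradicts ICMC2, and in any case y is a left kernel of B(s).\<close>

lemma singular_locus_eq:
  assumes N: "t + 1 \<le> N" "N < 2 * t" and g: "dgrowth N t (pgen (qY t N a ` {..<t + 1})) (N - 2)"
    and I: "ICMC2 N t (linear_matrix t N a)"
  shows "tjurina_singular_locus N t (linear_matrix t N a) = {0\<^sub>v N} \<times> section_locus t N a"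
proof (intro equalityI subsetI)
  fix q :: "complex vec \<times> complex vec set" assume "q \<in> {0\<^sub>v N} \<times> section_locus t N a"
  then show "q \<in> tjurina_singular_locus N t (linear_matrix t N a)"
    using singular_on_section_locus[OF N(1) g] by auto
next
  fix q assume q: "q \<in> tjurina_singular_locus N t (linear_matrix t N a)"
  obtain x p where qp: "q = (x, p)" by (cases q)
  have Y: "(x, p) \<in> tjurina_transform N t (linear_matrix t N a)"
    using q by (simp add: tjurina_singular_locus_def qp)
  obtain i s where s: "i < t" "s \<in> p" "s $ i = 1"
    and ns: "\<not> smooth_at (N + t) (tjurina_chart N t (linear_matrix t N a) i) (x @\<^sub>v s)"
    using q by (auto simp: tjurina_singular_locus_def qp tjurina_smooth_at_def)
  have ps: "p \<in> proj_space t" "x \<in> carrier_vec N" using Y by (auto simp: tjurina_transform_def)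
  have sc: "s \<in> carrier_vec t" using proj_spaceD(1)[OF ps(1) s(2)] .
  define z where "z = x @\<^sub>v s"
  have zx: "z $ k = x $ k" if "k < N" for k using that ps(2) sc by (simp add: z_def)
  have zs: "z $ (N + l) = s $ l" if "l < t" for l using that ps(2) sc by (simp add: z_def)
  have zl: "z \<in> zero_locus (N + t) (tjurina_chart N t (linear_matrix t N a) i)"
    unfolding z_def by (rule transform_chart_point[OF Y s(2,1,3)])
  have sx: "sx t N a (\<lambda>i. z $ (N + i)) j k = sx t N a (($) s) j k" for j k
    by (rule sx_cong) (rule zs)
  have mx: "mx t N a z l j = mx t N a x l j" for l j by (rule mx_cong) (rule zx)
  have t1: "1 \<le> t" using s(1) by simp
  obtain y where y: "\<forall>k<N. (\<Sum>j<t + 1. y j * sx t N a (($) s) j k) = 0"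
      "\<forall>l<t. (\<Sum>j<t + 1. mx t N a x l j * y j) = 0" "\<exists>j<t + 1. y j \<noteq> 0"
    using smooth_at_chart[OF t1 N(1) s(1) g zl] ns unfolding z_def[symmetric] sx mx by blast
  have "x = 0\<^sub>v N"
  proof (rule ccontr)
    assume x0: "x \<noteq> 0\<^sub>v N"
    have sM: "(\<Sum>l<t. s $ l * mx t N a x l j) = 0" if "j < t + 1" for j
    proof -
      have "(\<Sum>l<t. z $ (N + l) * mx t N a z l j) = 0" using zl that unfolding chart_zero_locus_iff by blast
      moreover have "(\<Sum>l<t. z $ (N + l) * mx t N a z l j) = (\<Sum>l<t. s $ l * mx t N a x l j)"
        by (intro sum.cong refl) (simp add: zs mx)
      ultimately show ?thesis by simp
    qed
    \<comment> \<open>From t + 1 \<le> N < 2t follows t \<ge> 2; the growth exponent N - 2 is then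
      positive, as \<open>sep_minors\<close> requires.\<close>
    have "3 \<le> N" using N by simp
    then have "\<forall>j<t + 1. y j = 0"
      using ICMC2_no_degeneracy[OF I _ g ps(2) x0 s(1), of "($) s" y] s(3) sM y(1,2) by blast
    then show False using y(3) by blast
  qed
  moreover have "p \<in> section_locus t N a"
    using section_locus_iff[OF ps(1) s(2)] y(1,3) by blast
  ultimately show "q \<in> {0\<^sub>v N} \<times> section_locus t N a" by (simp add: qp)
qed

text \<open>For every s \<noteq> 0 the matrix B(s) has no left kernel, so the Jacobian degenerates
  nowhere on Y.\<close>

lemma tjurina_smooth_large:
  assumes t: "1 \<le> t" and N: "2 * t \<le> N" and g: "dgrowth N t (pgen (qY t N a ` {..<t + 1})) (N - 2)"
    and nz: "\<And>x. (\<forall>k<N. ev x (qV t N a k) = 0) \<Longrightarrow> (\<forall>i<t. x i = 0) \<or> (\<forall>j<t + 1. x (t + j) = 0)"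
  shows "tjurina_smooth N t (linear_matrix t N a)"
  unfolding tjurina_smooth_def
proof
  fix q assume q: "q \<in> tjurina_transform N t (linear_matrix t N a)"
  obtain x p where qp: "q = (x, p)" by (cases q)
  have "smooth_at (N + t) (tjurina_chart N t (linear_matrix t N a) i) (x @\<^sub>v s)"
    if s: "i < t" "s \<in> p" "s $ i = 1" for i s
  proof (rule smooth_at_chart[OF t _ s(1) g])
    have ps: "p \<in> proj_space t" "x \<in> carrier_vec N" using q by (auto simp: tjurina_transform_def qp)
    have sc: "s \<in> carrier_vec t" using proj_spaceD(1)[OF ps(1) s(2)] .
    show "t + 1 \<le> N" using t N by simp
    show "x @\<^sub>v s \<in> zero_locus (N + t) (tjurina_chart N t (linear_matrix t N a) i)"
      using transform_chart_point[OF _ s(2,1,3)] q qp by blast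
    fix y assume y: "\<forall>k<N. (\<Sum>j<t + 1. y j * sx t N a (\<lambda>i. (x @\<^sub>v s) $ (N + i)) j k) = 0"
    define w where "w = (\<lambda>k. if k < t then s $ k else y (k - t))"
    have "ev w (qV t N a k) = 0" if "k < N" for k
    proof -
      have "ev w (qV t N a k) = (\<Sum>j<t + 1. y j * sx t N a (\<lambda>i. (x @\<^sub>v s) $ (N + i)) j k)"
        unfolding ev_qV using ps(2) sc
        by (intro sum.cong refl arg_cong2[of _ _ _ _ "(*)"] sx_cong) (auto simp: w_def)
      then show ?thesis using y that by simp
    qed
    then have "(\<forall>i<t. w i = 0) \<or> (\<forall>j<t + 1. w (t + j) = 0)" using nz by blast
    moreover have "w i = 1" using s by (simp add: w_def)
    ultimately show "\<forall>j<t + 1. y j = 0" using s(1) by (auto simp: w_def)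
  qed
  then show "tjurina_smooth_at N t (linear_matrix t N a) q"
    unfolding qp tjurina_smooth_at_def by auto
qed

text \<open>The system s M(x) = 0 has a zero with x and s both nonzero. At (0, s) the direction x is
  tangent in addition to the zero section, so the tangent space has dimension at least t, while the
  local dimension is at most t - 1.\<close>

lemma not_tjurina_smooth_small:
  assumes N: "3 \<le> N" "N \<le> t" and g: "dgrowth N t (pgen (qY t N a ` {..<t + 1})) (N - 2)"
  shows "\<not> tjurina_smooth N t (linear_matrix t N a)"
proof -
  have c: "t + 1 + 2 \<le> N + t" "1 \<le> N" "1 \<le> t" using N by auto
  obtain x where x: "\<exists>k<N. x k \<noteq> 0" "\<exists>i<t. x (N + i) \<noteq> 0" "\<And>j. j < t + 1 \<Longrightarrow> ev x (qY t N a j) = 0"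
    using bilinear_nontrivial_zero[OF c, of "\<lambda>j k i. coef t N a i j k"] unfolding qY_def by blast
  obtain k0 i where ki: "k0 < N" "x k0 \<noteq> 0" "i < t" "x (N + i) \<noteq> 0" using x(1,2) by blast
  define s where "s = vec t (\<lambda>l. x (N + l) / x (N + i))"
  have s: "s \<in> carrier_vec t" "s $ i = 1" using ki by (auto simp: s_def)
  have "s \<noteq> 0\<^sub>v t" using s(2) ki(3) by auto
  then have ps: "ray s \<in> proj_space t" using s(1) by (rule ray_in_proj_space[rotated])
  have sx: "sx t N a (\<lambda>i. (0\<^sub>v N @\<^sub>v s) $ (N + i)) j k = sx t N a (\<lambda>l. x (N + l)) j k / x (N + i)" for j k
  proof -
    have "sx t N a (\<lambda>i. (0\<^sub>v N @\<^sub>v s) $ (N + i)) j k = (\<Sum>l<t. coef t N a l j k * x (N + l) / x (N + i))"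
      unfolding sx_def by (intro sum.cong refl) (use s(1) in \<open>simp add: s_def\<close>)
    then show ?thesis by (simp add: sx_def sum_divide_distrib)
  qed
  have "t \<le> tangent_dim (N + t) (tjurina_chart N t (linear_matrix t N a) i) (0\<^sub>v N @\<^sub>v s)"
  proof (rule tangent_dim_chart_fibre[where u = x and ?k0.0 = k0, OF ki(3) _ ki(1,2)])
    show "(0\<^sub>v N @\<^sub>v s) $ k = 0" if "k < N" for k using that s(1) by simp
    show "(\<Sum>k<N. sx t N a (\<lambda>i. (0\<^sub>v N @\<^sub>v s) $ (N + i)) j k * x k) = 0" if "j < t + 1" for j
    proof -
      have "(\<Sum>k<N. sx t N a (\<lambda>i. (0\<^sub>v N @\<^sub>v s) $ (N + i)) j k * x k) = (\<Sum>k<N. sx t N a (\<lambda>l. x (N + l)) j k * x k) / x (N + i)"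
        unfolding sx by (simp add: sum_divide_distrib)
      then show ?thesis using x(3)[OF that] by (simp add: ev_qY)
    qed
  qed
  then have "max (N - 2) (t - 1) < tangent_dim (N + t) (tjurina_chart N t (linear_matrix t N a) i) (0\<^sub>v N @\<^sub>v s)"
    using N by simp
  then have "\<not> smooth_at (N + t) (tjurina_chart N t (linear_matrix t N a) i) (0\<^sub>v N @\<^sub>v s)"
    by (rule not_smooth_at_chart[OF g ki(3)])
  then have "\<not> tjurina_smooth_at N t (linear_matrix t N a) (0\<^sub>v N, ray s)"
    unfolding tjurina_smooth_at_def using ki(3) s(2) self_in_ray by auto
  then show ?thesis
    unfolding tjurina_smooth_def using zero_section_point[OF ps] by blast
qed

text \<open>For N < 2t the rank locus has a dimension, hence it is nonempty, and its points are
  singular; this is the failure of smoothness in the range t + 1 \<le> N.\<close>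

lemma generic_conclusion:
  assumes t: "1 \<le> t" and N: "t + 1 \<le> N"
    and gY: "dgrowth N t (pgen (qY t N a ` {..<t + 1})) (N - 2)"
    and gV: "dgrowth t (t + 1) (pgen (qV t N a ` {..<N})) (2 * t - N)"
    and nz: "2 * t \<le> N \<Longrightarrow> \<forall>x. (\<forall>k<N. ev x (qV t N a k) = 0) \<longrightarrow> (\<forall>i<t. x i = 0) \<or> (\<forall>j<t + 1. x (t + j) = 0)"
    and I: "ICMC2 N t (linear_matrix t N a)"
  shows "tjurina_smooth N t (linear_matrix t N a) \<longleftrightarrow> 2 * t \<le> N"
    and "N < 2 * t \<Longrightarrow> \<exists>V. tjurina_singular_locus N t (linear_matrix t N a) = {0\<^sub>v N} \<times> V \<and>
             determinantal_variety t (t + 1) N (t + 1) V \<and> has_dim (proj_closed t) V (2 * t - N - 1)"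
proof -
  have dim: "has_dim (proj_closed t) (section_locus t N a) (2 * t - N - 1)" if "N < 2 * t"
    by (rule has_dim_section_locus[OF N that gV])
  have "\<not> tjurina_smooth N t (linear_matrix t N a)" if lt: "N < 2 * t"
  proof -
    obtain Z where "irreducible_chain (proj_closed t) (2 * t - N - 1) Z" "Z (2 * t - N - 1) \<subseteq> section_locus t N a"
      using dim[OF lt] unfolding has_dim_def by blast
    then have "section_locus t N a \<noteq> {}" by (auto simp: irreducible_chain_def irreducible_closed_def)
    then obtain p where "p \<in> section_locus t N a" by blast
    then have "(0\<^sub>v N, p) \<in> tjurina_singular_locus N t (linear_matrix t N a)"
      by (rule singular_on_section_locus[OF N gY])
    then show ?thesis by (auto simp: tjurina_smooth_def tjurina_singular_locus_def)
  qed
  moreover have "tjurina_smooth N t (linear_matrix t N a)" if "2 * t \<le> N"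
    using tjurina_smooth_large[OF t that gY] nz[OF that] by blast
  ultimately show "tjurina_smooth N t (linear_matrix t N a) \<longleftrightarrow> 2 * t \<le> N" by (metis not_less)
  assume lt: "N < 2 * t"
  have "determinantal_variety t (t + 1) N (t + 1) (section_locus t N a)"
    unfolding determinantal_variety_def
  proof (intro conjI bexI exI allI impI)
    show "homogeneous t 1 (section_matrix t N a $$ (i, j))" if "i < t + 1" "j < N" for i j
      using that by (rule section_matrix_homogeneous)
    show "section_locus t N a = proj_zero_locus t (minors (t + 1) (section_matrix t N a))"
      by (rule section_locus_def)
    show "has_dim (proj_closed t) (section_locus t N a) (2 * t - N - 1)" by (rule dim[OF lt])
    \<comment> \<open>The codimension is 1 * (N - t), and (t - 1) - (N - t) = 2t - N - 1.\<close>
    show "2 * t - N - 1 + (t + 1 - (t + 1) + 1) * (N - (t + 1) + 1) + 1 = t" using lt N by simp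
  qed (rule section_matrix_carrier)
  then show "\<exists>V. tjurina_singular_locus N t (linear_matrix t N a) = {0\<^sub>v N} \<times> V \<and>
             determinantal_variety t (t + 1) N (t + 1) V \<and> has_dim (proj_closed t) V (2 * t - N - 1)"
    using singular_locus_eq[OF N lt gY I] dim[OF lt] by blast
qed

section \<open>The open set of coefficients\<close>

lemma zariski_open_nonvanishing:
  assumes "in_vars n h"
  shows "zariski_open n {a \<in> carrier_vec n. peval h a \<noteq> 0}"
proof -
  have "{a \<in> carrier_vec n. peval h a \<noteq> 0} = carrier_vec n - zero_locus n {h}"
    by (auto simp: zero_locus_def)
  moreover have "zero_locus n {h} \<in> affine_closed n" by (rule zero_locus_closed) (simp add: assms)
  ultimately show ?thesis unfolding zariski_open_def by blast
qed

lemma special_carrier: "special t N R \<in> carrier_vec (t * (t + 1) * N)"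
  by (simp add: special_def)

text \<open>The equivalence is stated outside N = 2, t \<ge> 2 because it fails there: generically M
  then drops rank only at the origin, and Y is the zero section, smooth of dimension t - 1 although
  N < 2t.\<close>

theorem lemma4p1:
  fixes t N :: nat
  assumes "t \<ge> 1"
  shows "\<exists>U. zariski_open (t * (t + 1) * N) U \<and> U \<noteq> {} \<and>
    (\<forall>a\<in>U. ICMC2 N t (linear_matrix t N a) \<longrightarrow>
      (N \<noteq> 2 \<or> t = 1 \<longrightarrow> (tjurina_smooth N t (linear_matrix t N a) \<longleftrightarrow> N \<ge> 2 * t)) \<and>
      (t + 1 \<le> N \<and> N < 2 * t \<longrightarrow>
        (\<exists>V. tjurina_singular_locus N t (linear_matrix t N a) = {0\<^sub>v N} \<times> V \<and>
             determinantal_variety t (t + 1) N (t + 1) V \<and>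
             has_dim (proj_closed t) V (2 * t - N - 1))))"
proof -
  define A where "A = t * (t + 1) * N"
  \<comment> \<open>For N \<le> t the zero section has dimension t - 1, above the expected N - 2, so
    this range is treated apart.\<close>
  consider "t + 1 \<le> N" | "3 \<le> N" "N \<le> t" | "N = 2" "2 \<le> t" | "N < 2"
    using assms by linarith
  then have "\<exists>h. in_vars A h \<and> (\<exists>a\<in>carrier_vec A. peval h a \<noteq> 0) \<and>
    (\<forall>a\<in>carrier_vec A. peval h a \<noteq> 0 \<longrightarrow> ICMC2 N t (linear_matrix t N a) \<longrightarrow>
      (N \<noteq> 2 \<or> t = 1 \<longrightarrow> (tjurina_smooth N t (linear_matrix t N a) \<longleftrightarrow> N \<ge> 2 * t)) \<and>
      (t + 1 \<le> N \<and> N < 2 * t \<longrightarrow>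
        (\<exists>V. tjurina_singular_locus N t (linear_matrix t N a) = {0\<^sub>v N} \<times> V \<and>
             determinantal_variety t (t + 1) N (t + 1) V \<and>
             has_dim (proj_closed t) V (2 * t - N - 1))))"
  proof cases
    case 1
    obtain hV where hV: "in_vars A hV" "peval hV (special t N (\<lambda>i j k. i + j = k)) \<noteq> 0"
      "\<forall>a. peval hV a \<noteq> 0 \<longrightarrow> dgrowth t (t + 1) (pgen (qV t N a ` {..<N})) (2 * t - N) \<and>
        (2 * t \<le> N \<longrightarrow> (\<forall>x. (\<forall>k<N. ev x (qV t N a k) = 0) \<longrightarrow> (\<forall>i<t. x i = 0) \<or> (\<forall>j<t + 1. x (t + j) = 0)))"
      using generic_growth_V[of t N] unfolding A_def by blast
    obtain hY where hY: "in_vars A hY" "peval hY (special t N (\<lambda>i j k. i + j = k)) \<noteq> 0"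
      "\<forall>a. peval hY a \<noteq> 0 \<longrightarrow> dgrowth N t (pgen (qY t N a ` {..<t + 1})) (N - 2)"
      using generic_growth_Y[OF assms 1] unfolding A_def by blast
    have prod: "peval (hV * hY) a \<noteq> 0 \<longleftrightarrow> peval hV a \<noteq> 0 \<and> peval hY a \<noteq> 0" for a
      by (simp add: peval_ev ev.hom_mult)
    show ?thesis
    proof (intro exI[of _ "hV * hY"] conjI ballI impI)
      show "in_vars A (hV * hY)" using hV(1) hY(1) by (rule in_vars_mult)
      \<comment> \<open>Both factors are nonzero at the same special tensor, hence so is their
        product.\<close>
      show "\<exists>a\<in>carrier_vec A. peval (hV * hY) a \<noteq> 0"
        using hV(2) hY(2) special_carrier prod unfolding A_def by blast
      fix a assume a: "peval (hV * hY) a \<noteq> 0" and I: "ICMC2 N t (linear_matrix t N a)"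
      have gY: "dgrowth N t (pgen (qY t N a ` {..<t + 1})) (N - 2)"
        and gV: "dgrowth t (t + 1) (pgen (qV t N a ` {..<N})) (2 * t - N)"
        and nz: "2 * t \<le> N \<Longrightarrow> \<forall>x. (\<forall>k<N. ev x (qV t N a k) = 0) \<longrightarrow> (\<forall>i<t. x i = 0) \<or> (\<forall>j<t + 1. x (t + j) = 0)"
        using a prod hV(3) hY(3) by blast+
      note concl = generic_conclusion[OF assms 1 gY gV nz I]
      show "tjurina_smooth N t (linear_matrix t N a) \<longleftrightarrow> N \<ge> 2 * t" by (rule concl(1))
      assume lt: "t + 1 \<le> N \<and> N < 2 * t"
      show "\<exists>V. tjurina_singular_locus N t (linear_matrix t N a) = {0\<^sub>v N} \<times> V \<and>
             determinantal_variety t (t + 1) N (t + 1) V \<and> has_dim (proj_closed t) V (2 * t - N - 1)"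
        by (rule concl(2)[OF _ conjunct2[OF lt]])
    qed
  next
    case 2
    then have N2: "2 \<le> N" by simp
    obtain h where h: "in_vars A h" "peval h (special t N (\<lambda>i j k. k + i = j)) \<noteq> 0"
      "\<forall>a. peval h a \<noteq> 0 \<longrightarrow> dgrowth N t (pgen (qY t N a ` {..<t + 1})) (N - 2)"
      using generic_growth_Y_small[OF N2 2(2)] unfolding A_def by blast
    have "\<exists>a\<in>carrier_vec A. peval h a \<noteq> 0" using h(2) special_carrier unfolding A_def by blast
    moreover have "\<not> tjurina_smooth N t (linear_matrix t N a)" if "peval h a \<noteq> 0" for a
      using not_tjurina_smooth_small[OF 2] h(3) that by blast
    moreover have "\<not> 2 * t \<le> N" "\<not> t + 1 \<le> N" using 2 by auto
    ultimately show ?thesis using h(1) by (intro exI[of _ h]) blast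
  next
    case 3
    \<comment> \<open>Both claims are vacuous for N = 2 and t \<ge> 2, so the whole space serves as
      the open set.\<close>
    have "\<exists>a\<in>carrier_vec A. peval 1 a \<noteq> 0" by (intro bexI[of _ "0\<^sub>v A"]) (auto simp: peval_ev)
    then show ?thesis using 3 by (intro exI[of _ 1]) auto
  next
    case 4
    \<comment> \<open>Codimension 2 is impossible in fewer than two variables.\<close>
    have "\<not> ICMC2 N t M" for M using 4 by (auto simp: ICMC2_def)
    moreover have "\<exists>a\<in>carrier_vec A. peval 1 a \<noteq> 0" by (intro bexI[of _ "0\<^sub>v A"]) (auto simp: peval_ev)
    ultimately show ?thesis by (intro exI[of _ 1]) auto
  qed
  then obtain h where h: "in_vars A h" "\<exists>a\<in>carrier_vec A. peval h a \<noteq> 0"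
    "\<forall>a\<in>carrier_vec A. peval h a \<noteq> 0 \<longrightarrow> ICMC2 N t (linear_matrix t N a) \<longrightarrow>
      (N \<noteq> 2 \<or> t = 1 \<longrightarrow> (tjurina_smooth N t (linear_matrix t N a) \<longleftrightarrow> N \<ge> 2 * t)) \<and>
      (t + 1 \<le> N \<and> N < 2 * t \<longrightarrow>
        (\<exists>V. tjurina_singular_locus N t (linear_matrix t N a) = {0\<^sub>v N} \<times> V \<and>
             determinantal_variety t (t + 1) N (t + 1) V \<and>
             has_dim (proj_closed t) V (2 * t - N - 1)))"
    by blast
  show ?thesis
    using zariski_open_nonvanishing[OF h(1)] h(2,3) unfolding A_def
    by (intro exI[of _ "{a \<in> carrier_vec (t * (t + 1) * N). peval h a \<noteq> 0}"]) blast
qed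

end
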